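(* Let $M$ be a closed oriented Riemannian surface, $N=\Gamma\backslash\mathbb H^m$ a closed oriented hyperbolic manifold, $p>2$, $1/p+1/q=1$, and let $u\in W^{1,p}(M,N)$ satisfy the $J_p$-Euler–Lagrange equations. Let $Z=*S_{p-1}(du)=*Q(du)^{p-2}du$, a 1-form with values in $E$. For sections $\xi$ of $E$ let $$J_q(\xi)=\int_M\mathrm{Tr}\,Q\bigl(Z+(d\xi)_u\bigr)^q*1 .$$ Then the minimum of $J_q$ over all sections $\xi$ of $E$ with $\xi=\xi_u$ is attained at $\xi=0$. Furthermore, in the weak sense, $$D_u*Q(Z)^{q-2}Z=0 .$$
   Context: For a linear map $A$ of inner product spaces, $Q(A)=(AA^T)^{1/2}$; $Q(A)^{r-1}A$ ($r>0$) is defined through the singular value decomposition: if $A=\sum_js_jB_j\otimes b_j$ then $Q(A)^{r-1}A=\sum_js_j^rB_j\otimes b_j$. The $J_p$-Euler–Lagrange equations of $J_p(u)=\int_M\mathrm{Tr}\,Q(du)^p*1$ are $D_u^*Q(du)^{p-2}du=0$ weakly, i.e. $\int_M(Q(du)^{p-2}du;D_u\xi)^\sharp*1=0$ for all $W^{1,p}$ sections $\xi$ of $u^{-1}(TN)$, $D_u$ being the pullback of the Levi-Civita connection. $\mathbb R^{m,1}$ carries $(X,Y)^\sharp=\sum_{i\le m}X_iY_i-X_{m+1}Y_{m+1}$, and $\mathbb H^m=\{(X,X)^\sharp=-1,X_{m+1}\ge1\}$ with the induced metric. With $\rho:\pi_1(M)\to\Gamma\subset SO^+(m,1)$ induced by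 $u$, $E=\tilde M\times_\rho\mathbb R^{m,1}$ is a flat bundle with flat connection $d$; $u$ is identified with the section of $E$ given by its equivariant lift to $\mathbb H^m$, and $u^{-1}(TN)\subset E$. For $\xi$ with values in $E$, $\xi_u=\xi+(\xi,u)^\sharp u$ is the projection to $u^{-1}(TN)$, where $(\cdot,\cdot)^\sharp$ is positive definite. For $\xi=\xi_u$, $D_u\xi=(d\xi)_u$. Sections $\xi=\xi_u$ are taken of class $W^{1,p}$. For a 1-form $A$ with values in $u^{-1}(TN)$, $Q(A)$ is computed with the metrics of $M$ and $u^{-1}(TN)$. $*$ is the Hodge star on forms on $M$, and $D_u$ acts on $u^{-1}(TN)$-valued 1-forms as the exterior covariant derivative. *)

theory Defs
  imports "HOL-Analysis.Analysis"
begin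

section \<open>Smooth functions and weak derivatives on open subsets of Euclidean space\<close>

primrec C_k_on ::
  "nat \<Rightarrow> 'a::real_normed_vector set \<Rightarrow> ('a \<Rightarrow> 'b::real_normed_vector) \<Rightarrow> bool" where
  "C_k_on 0 V f \<longleftrightarrow> continuous_on V f"
| "C_k_on (Suc k) V f \<longleftrightarrow>
     (\<forall>x\<in>V. f differentiable (at x)) \<and>
     (\<forall>e. C_k_on k V (\<lambda>x. frechet_derivative f (at x) e))"

definition smooth_on ::
  "'a::real_normed_vector set \<Rightarrow> ('a \<Rightarrow> 'b::real_normed_vector) \<Rightarrow> bool" where
  "smooth_on V f \<longleftrightarrow> (\<forall>k. C_k_on k V f)"

definition test_function :: "(real^2) set \<Rightarrow> (real^2 \<Rightarrow> real) \<Rightarrow> bool" where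
  "test_function W \<phi> \<longleftrightarrow> smooth_on UNIV \<phi> \<and> (\<exists>K\<subseteq>W. compact K \<and> (\<forall>v. v \<notin> K \<longrightarrow> \<phi> v = 0))"

definition Lp_loc_on :: "real \<Rightarrow> (real^2) set \<Rightarrow> (real^2 \<Rightarrow> 'e::euclidean_space) \<Rightarrow> bool" where
  "Lp_loc_on p W f \<longleftrightarrow>
     (\<forall>K\<subseteq>W. compact K \<longrightarrow> set_integrable lebesgue K (\<lambda>v. norm (f v) powr p))"

definition weak_deriv_on ::
  "(real^2) set \<Rightarrow> (real^2 \<Rightarrow> 'e::euclidean_space) \<Rightarrow> (real^2 \<Rightarrow> real^2 \<Rightarrow> 'e) \<Rightarrow> bool" where
  "weak_deriv_on W f F \<longleftrightarrow>
     (\<forall>K\<subseteq>W. compact K \<longrightarrow>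
        set_integrable lebesgue K f \<and> (\<forall>e. set_integrable lebesgue K (\<lambda>v. F v e))) \<and>
     (\<forall>\<phi> e. test_function W \<phi> \<longrightarrow>
        (LINT v:W|lebesgue. \<phi> v *\<^sub>R F v e)
        = - (LINT v:W|lebesgue. frechet_derivative \<phi> (at v) e *\<^sub>R f v))"


section \<open>Linear algebra: Q(A), its powers and its trace\<close>

text \<open>An inner product space is a pair of a subspace F of a real vector space and a form h that is
  an inner product on F.\<close>

definition inner_product_on ::
  "'v::real_vector set \<Rightarrow> ('v \<Rightarrow> 'v \<Rightarrow> real) \<Rightarrow> bool" where
  "inner_product_on F h \<longleftrightarrow> subspace F \<and> bilinear h \<and>
     (\<forall>x\<in>F. \<forall>y\<in>F. h x y = h y x) \<and> (\<forall>x\<in>F. x \<noteq> 0 \<longrightarrow> h x x > 0)"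

definition orthonormal_basis ::
  "('v::real_vector \<Rightarrow> 'v \<Rightarrow> real) \<Rightarrow> 'v set \<Rightarrow> 'v set \<Rightarrow> bool" where
  "orthonormal_basis h F B \<longleftrightarrow> finite B \<and> span B = F \<and>
     (\<forall>a\<in>B. \<forall>b\<in>B. h a b = (if a = b then 1 else 0))"

definition adj ::
  "('u \<Rightarrow> 'u \<Rightarrow> real) \<Rightarrow> ('v \<Rightarrow> 'v \<Rightarrow> real) \<Rightarrow> ('u \<Rightarrow> 'v) \<Rightarrow> 'v \<Rightarrow> 'u" where
  "adj g h A Y = (THE v. \<forall>w. g v w = h Y (A w))"

text \<open>Spectral definition of the power S^a of a positive semidefinite self-adjoint operator S of
  (F,h): h b (S b) is the eigenvalue of S at the unit eigenvector b.\<close>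

definition psd_powr ::
  "('v::real_vector \<Rightarrow> 'v \<Rightarrow> real) \<Rightarrow> 'v set \<Rightarrow> ('v \<Rightarrow> 'v) \<Rightarrow> real \<Rightarrow> 'v \<Rightarrow> 'v" where
  "psd_powr h F S a Y =
     (let B = (SOME B. orthonormal_basis h F B \<and> (\<forall>b\<in>B. \<exists>c. S b = c *\<^sub>R b))
      in \<Sum>b\<in>B. ((h b (S b)) powr a * h b Y) *\<^sub>R b)"

definition Tr_on ::
  "('v::real_vector \<Rightarrow> 'v \<Rightarrow> real) \<Rightarrow> 'v set \<Rightarrow> ('v \<Rightarrow> 'v) \<Rightarrow> real" where
  "Tr_on h F T = (let B = (SOME B. orthonormal_basis h F B) in \<Sum>b\<in>B. h b (T b))"

definition Q_op ::
  "('u \<Rightarrow> 'u \<Rightarrow> real) \<Rightarrow> ('v::real_vector \<Rightarrow> 'v \<Rightarrow> real) \<Rightarrow> 'v set \<Rightarrow> ('u \<Rightarrow> 'v) \<Rightarrow> 'v \<Rightarrow> 'v" where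
  "Q_op g h F A = psd_powr h F (A \<circ> adj g h A) (1/2)"

definition is_svd ::
  "('u \<Rightarrow> 'u \<Rightarrow> real) \<Rightarrow> ('v::real_vector \<Rightarrow> 'v \<Rightarrow> real) \<Rightarrow> 'v set \<Rightarrow> ('u \<Rightarrow> 'v) \<Rightarrow>
   nat \<Rightarrow> (nat \<Rightarrow> real) \<Rightarrow> (nat \<Rightarrow> 'v) \<Rightarrow> (nat \<Rightarrow> 'u) \<Rightarrow> bool" where
  "is_svd g h F A n s B b \<longleftrightarrow>
     (\<forall>j<n. s j \<ge> 0 \<and> B j \<in> F) \<and>
     (\<forall>i<n. \<forall>j<n. h (B i) (B j) = (if i = j then 1 else 0) \<and>
                  g (b i) (b j) = (if i = j then 1 else 0)) \<and>
     (\<forall>v. A v = (\<Sum>j<n. (s j * g (b j) v) *\<^sub>R B j))"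

text \<open>\<open>Qpow g h F r A\<close> is \<open>Q(A)\<close> to the power \<open>r - 1\<close>, composed with \<open>A\<close>, for \<open>r > 0\<close>.\<close>

definition Qpow ::
  "('u \<Rightarrow> 'u \<Rightarrow> real) \<Rightarrow> ('v::real_vector \<Rightarrow> 'v \<Rightarrow> real) \<Rightarrow> 'v set \<Rightarrow> real \<Rightarrow> ('u \<Rightarrow> 'v) \<Rightarrow> 'u \<Rightarrow> 'v" where
  "Qpow g h F r A = (THE C. \<exists>n s B b. is_svd g h F A n s B b \<and>
     (\<forall>v. C v = (\<Sum>j<n. (s j powr r * g (b j) v) *\<^sub>R B j)))"


section \<open>Closed oriented Riemannian surfaces and their universal coverings\<close>

text \<open>A chart is given by a local parametrization: a pair \<open>(V, \<psi>)\<close> of an open set of the plane and a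
  homeomorphism \<open>\<psi>\<close> of \<open>V\<close> onto an open subset of the surface. The tangent space at a point \<open>x\<close> is
  the plane, identified by means of the preferred chart \<open>chart_at S x\<close>; thus \<open>metric S x\<close> is an
  inner product on the plane, and a 1-form assigns to each point a linear map on the plane.
  The universal covering \<open>uproj S\<close> from \<open>ucov S\<close> to \<open>pts S\<close> is a local diffeomorphism, so tangent
  spaces of \<open>ucov S\<close> are identified with those of \<open>pts S\<close>.\<close>

record ('a, 'b) surface =
  pts :: "'a set"
  charts :: "((real^2) set \<times> (real^2 \<Rightarrow> 'a)) set"
  metric :: "'a \<Rightarrow> real^2 \<Rightarrow> real^2 \<Rightarrow> real"
  area :: "'a measure"
  ucov :: "'b set"
  uproj :: "'b \<Rightarrow> 'a"

definition coord :: "(real^2) set \<times> (real^2 \<Rightarrow> 'a) \<Rightarrow> 'a \<Rightarrow> real^2" where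
  "coord c = the_inv_into (fst c) (snd c)"

definition oriented_smooth_atlas ::
  "'a::topological_space set \<Rightarrow> ((real^2) set \<times> (real^2 \<Rightarrow> 'a)) set \<Rightarrow> bool" where
  "oriented_smooth_atlas M \<A> \<longleftrightarrow>
     (\<forall>(V, \<psi>)\<in>\<A>. open V \<and> openin (top_of_set M) (\<psi> ` V) \<and>
        (\<exists>\<theta>. homeomorphism V (\<psi> ` V) \<psi> \<theta>)) \<and>
     (\<Union>(V, \<psi>)\<in>\<A>. \<psi> ` V) = M \<and>
     (\<forall>c\<in>\<A>. \<forall>d\<in>\<A>.
        let D = fst c \<inter> snd c -` (snd d ` fst d); t = coord d \<circ> snd c
        in smooth_on D t \<and> (\<forall>v\<in>D. det (matrix (frechet_derivative t (at v))) > 0))"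

definition chart_at ::
  "('a, 'b) surface \<Rightarrow> 'a \<Rightarrow> (real^2) set \<times> (real^2 \<Rightarrow> 'a)" where
  "chart_at S x = (SOME c. c \<in> charts S \<and> x \<in> snd c ` fst c)"

text \<open>The differential of the parametrization of the chart \<open>c\<close> at \<open>v\<close>, as a map into the tangent
  space at \<open>snd c v\<close>.\<close>

definition dpar ::
  "('a, 'b) surface \<Rightarrow> (real^2) set \<times> (real^2 \<Rightarrow> 'a) \<Rightarrow> real^2 \<Rightarrow> real^2 \<Rightarrow> real^2" where
  "dpar S c v = frechet_derivative (coord (chart_at S (snd c v)) \<circ> snd c) (at v)"

definition metric_coeff ::
  "('a, 'b) surface \<Rightarrow> (real^2) set \<times> (real^2 \<Rightarrow> 'a) \<Rightarrow> real^2 \<Rightarrow> real^2 \<Rightarrow> real^2 \<Rightarrow> real" where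
  "metric_coeff S c a b v = metric S (snd c v) (dpar S c v a) (dpar S c v b)"

definition riemannian_metric :: "('a, 'b) surface \<Rightarrow> bool" where
  "riemannian_metric S \<longleftrightarrow>
     (\<forall>x\<in>pts S. inner_product_on UNIV (metric S x)) \<and>
     (\<forall>c\<in>charts S. \<forall>a b. smooth_on (fst c) (metric_coeff S c a b))"

definition area_density ::
  "('a, 'b) surface \<Rightarrow> (real^2) set \<times> (real^2 \<Rightarrow> 'a) \<Rightarrow> real^2 \<Rightarrow> real" where
  "area_density S c v =
     (let e1 = axis 1 1; e2 = axis 2 1
      in sqrt (metric_coeff S c e1 e1 v * metric_coeff S c e2 e2 v - (metric_coeff S c e1 e2 v)\<^sup>2))"

text \<open>The (completed) Riemannian area measure, uniquely determined by the following conditions.\<close>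

definition riemannian_area :: "('a, 'b) surface \<Rightarrow> bool" where
  "riemannian_area S \<longleftrightarrow>
     space (area S) = pts S \<and>
     sets (area S) = {A. A \<subseteq> pts S \<and> (\<forall>(V, \<psi>)\<in>charts S. V \<inter> \<psi> -` A \<in> sets lebesgue)} \<and>
     (\<forall>c\<in>charts S. \<forall>A\<in>sets (area S). A \<subseteq> snd c ` fst c \<longrightarrow>
        emeasure (area S) A =
          (\<integral>\<^sup>+ v. ennreal (area_density S c v) * indicator (fst c \<inter> snd c -` A) v \<partial>lebesgue))"

definition deck :: "('a::topological_space, 'b::topological_space) surface \<Rightarrow> ('b \<Rightarrow> 'b) set" where
  "deck S = {\<tau>. (\<exists>\<tau>'. homeomorphism (ucov S) (ucov S) \<tau> \<tau>') \<and>
                 (\<forall>y\<in>ucov S. uproj S (\<tau> y) = uproj S y)}"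

text \<open>The fundamental group acts on the universal covering by deck transformations. Transitivity on
  the fibres is automatic for a simply connected covering of a manifold; it is recorded because it
  expresses that the surface is the quotient of its universal covering by this action.\<close>

definition universal_covering ::
  "('a::topological_space, 'b::topological_space) surface \<Rightarrow> bool" where
  "universal_covering S \<longleftrightarrow>
     covering_space (ucov S) (uproj S) (pts S) \<and> simply_connected (ucov S) \<and>
     (\<forall>y\<in>ucov S. \<forall>z\<in>ucov S. uproj S y = uproj S z \<longrightarrow> (\<exists>\<tau>\<in>deck S. \<tau> y = z))"

definition closed_oriented_riemannian_surface ::
  "('a::t2_space, 'b::topological_space) surface \<Rightarrow> bool" where
  "closed_oriented_riemannian_surface S \<longleftrightarrow>
     pts S \<noteq> {} \<and> compact (pts S) \<and> connected (pts S) \<and>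
     oriented_smooth_atlas (pts S) (charts S) \<and> riemannian_metric S \<and> riemannian_area S \<and>
     universal_covering S"

text \<open>The integral over the surface of a deck-invariant function on the universal covering.\<close>

definition surface_integral :: "('a, 'b) surface \<Rightarrow> ('b \<Rightarrow> real) \<Rightarrow> real" where
  "surface_integral S f =
     (LINT x|area S. f (SOME y. y \<in> ucov S \<and> uproj S y = x))"


section \<open>Hyperbolic space and closed hyperbolic manifolds\<close>

text \<open>The index \<open>None\<close> is the last coordinate, and the indices \<open>Some i\<close> are the first m ones, where
  m is the cardinality of \<open>'m\<close>.\<close>

type_synonym 'm mink = "real ^ ('m option)"

definition lor :: "'m::finite mink \<Rightarrow> 'm mink \<Rightarrow> real" where
  "lor X Y = (\<Sum>i\<in>UNIV. X $ Some i * Y $ Some i) - X $ None * Y $ None"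

definition hyp :: "'m::finite mink set" where
  "hyp = {X. lor X X = -1 \<and> X $ None \<ge> 1}"

definition SO_plus :: "(real ^ ('m::finite option) ^ ('m option)) set" where
  "SO_plus = {A. (\<forall>X Y. lor (A *v X) (A *v Y) = lor X Y) \<and> det A = 1 \<and> A $ None $ None > 0}"

definition orbit ::
  "(real ^ ('m::finite option) ^ ('m option)) set \<Rightarrow> 'm mink \<Rightarrow> 'm mink set" where
  "orbit \<Gamma> X = (\<lambda>A. A *v X) ` \<Gamma>"

definition hyp_quotient ::
  "(real ^ ('m::finite option) ^ ('m option)) set \<Rightarrow> 'm mink set set" where
  "hyp_quotient \<Gamma> = orbit \<Gamma> ` hyp"

text \<open>\<open>\<Gamma>\<close> is a subgroup acting freely, properly discontinuously and cocompactly on hyperbolic space,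
  i.e. the quotient is a closed oriented hyperbolic manifold.\<close>

definition closed_hyperbolic_group ::
  "(real ^ ('m::finite option) ^ ('m option)) set \<Rightarrow> bool" where
  "closed_hyperbolic_group \<Gamma> \<longleftrightarrow>
     \<Gamma> \<subseteq> SO_plus \<and> mat 1 \<in> \<Gamma> \<and>
     (\<forall>A\<in>\<Gamma>. \<forall>B\<in>\<Gamma>. A ** B \<in> \<Gamma>) \<and> (\<forall>A\<in>\<Gamma>. matrix_inv A \<in> \<Gamma>) \<and>
     (\<forall>A\<in>\<Gamma>. \<forall>X\<in>hyp. A *v X = X \<longrightarrow> A = mat 1) \<and>
     (\<forall>K\<subseteq>hyp. compact K \<longrightarrow> finite {A\<in>\<Gamma>. (\<lambda>X. A *v X) ` K \<inter> K \<noteq> {}}) \<and>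
     (\<exists>K\<subseteq>hyp. compact K \<and> hyp = (\<Union>A\<in>\<Gamma>. (\<lambda>X. A *v X) ` K))"


section \<open>The flat bundle E, its sections and the flat connection\<close>

text \<open>A representation assigns a matrix to each deck transformation. Sections of E are equivariant
  maps from the universal covering to Minkowski space, and 1-forms with values in E are equivariant
  1-forms on the universal covering (type \<open>'b \<Rightarrow> real^2 \<Rightarrow> 'm mink\<close>).\<close>

definition equivariant_lift ::
  "('a::topological_space, 'b::topological_space) surface \<Rightarrow>
   (real ^ ('m::finite option) ^ ('m option)) set \<Rightarrow>
   ('a \<Rightarrow> 'm mink set) \<Rightarrow> (('b \<Rightarrow> 'b) \<Rightarrow> real ^ ('m option) ^ ('m option)) \<Rightarrow> ('b \<Rightarrow> 'm mink) \<Rightarrow> bool"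
  where
  "equivariant_lift S \<Gamma> u \<rho> w \<longleftrightarrow>
     continuous_on (ucov S) w \<and>
     (\<forall>y\<in>ucov S. w y \<in> hyp \<and> u (uproj S y) = orbit \<Gamma> (w y)) \<and>
     (\<forall>\<tau>\<in>deck S. \<rho> \<tau> \<in> \<Gamma> \<and> (\<forall>y\<in>ucov S. w (\<tau> y) = \<rho> \<tau> *v w y))"

definition E_section ::
  "('a::topological_space, 'b::topological_space) surface \<Rightarrow>
   (('b \<Rightarrow> 'b) \<Rightarrow> real ^ ('m::finite option) ^ ('m option)) \<Rightarrow> ('b \<Rightarrow> 'm mink) \<Rightarrow> bool" where
  "E_section S \<rho> \<xi> \<longleftrightarrow> (\<forall>\<tau>\<in>deck S. \<forall>y\<in>ucov S. \<xi> (\<tau> y) = \<rho> \<tau> *v \<xi> y)"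

definition E_form ::
  "('a::topological_space, 'b::topological_space) surface \<Rightarrow>
   (('b \<Rightarrow> 'b) \<Rightarrow> real ^ ('m::finite option) ^ ('m option)) \<Rightarrow> ('b \<Rightarrow> real^2 \<Rightarrow> 'm mink) \<Rightarrow> bool" where
  "E_form S \<rho> \<omega> \<longleftrightarrow>
     (\<forall>y\<in>ucov S. linear (\<omega> y)) \<and>
     (\<forall>\<tau>\<in>deck S. \<forall>y\<in>ucov S. \<forall>v. \<omega> (\<tau> y) v = \<rho> \<tau> *v \<omega> y v)"

text \<open>A chart of the universal covering: a continuous lift \<open>\<sigma>\<close> of the chart \<open>c\<close> over the open set
  \<open>W\<close>.\<close>

definition lifted_chart ::
  "('a, 'b::topological_space) surface \<Rightarrow> (real^2) set \<times> (real^2 \<Rightarrow> 'a) \<Rightarrow>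
   (real^2) set \<Rightarrow> (real^2 \<Rightarrow> 'b) \<Rightarrow> bool" where
  "lifted_chart S c W \<sigma> \<longleftrightarrow>
     c \<in> charts S \<and> open W \<and> W \<subseteq> fst c \<and> continuous_on W \<sigma> \<and> \<sigma> ` W \<subseteq> ucov S \<and>
     (\<forall>v\<in>W. uproj S (\<sigma> v) = snd c v)"

definition weak_differential ::
  "('a::topological_space, 'b::topological_space) surface \<Rightarrow>
   (('b \<Rightarrow> 'b) \<Rightarrow> real ^ ('m::finite option) ^ ('m option)) \<Rightarrow>
   ('b \<Rightarrow> 'm mink) \<Rightarrow> ('b \<Rightarrow> real^2 \<Rightarrow> 'm mink) \<Rightarrow> bool" where
  "weak_differential S \<rho> \<xi> \<omega> \<longleftrightarrow> E_form S \<rho> \<omega> \<and>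
     (\<forall>c W \<sigma>. lifted_chart S c W \<sigma> \<longrightarrow>
        weak_deriv_on W (\<lambda>v. \<xi> (\<sigma> v)) (\<lambda>v e. \<omega> (\<sigma> v) (dpar S c v e)))"

text \<open>The flat connection d on sections of E; the weak differential is determined up to null sets.\<close>

definition flat_d ::
  "('a::topological_space, 'b::topological_space) surface \<Rightarrow>
   (('b \<Rightarrow> 'b) \<Rightarrow> real ^ ('m::finite option) ^ ('m option)) \<Rightarrow>
   ('b \<Rightarrow> 'm mink) \<Rightarrow> 'b \<Rightarrow> real^2 \<Rightarrow> 'm mink" where
  "flat_d S \<rho> \<xi> = (SOME \<omega>. weak_differential S \<rho> \<xi> \<omega>)"

text \<open>As the surface is compact, being locally of class \<open>W\<close>(1,p) in all charts of the universal
  covering is the same as being globally so on the surface. For the same reason the choice of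
  fibre norm on E is immaterial.\<close>

definition W1p_section ::
  "real \<Rightarrow> ('a::topological_space, 'b::topological_space) surface \<Rightarrow>
   (('b \<Rightarrow> 'b) \<Rightarrow> real ^ ('m::finite option) ^ ('m option)) \<Rightarrow> ('b \<Rightarrow> 'm mink) \<Rightarrow> bool" where
  "W1p_section p S \<rho> \<xi> \<longleftrightarrow> E_section S \<rho> \<xi> \<and>
     (\<exists>\<omega>. weak_differential S \<rho> \<xi> \<omega> \<and>
        (\<forall>c W \<sigma>. lifted_chart S c W \<sigma> \<longrightarrow>
           Lp_loc_on p W (\<lambda>v. \<xi> (\<sigma> v)) \<and>
           (\<forall>e. Lp_loc_on p W (\<lambda>v. \<omega> (\<sigma> v) (dpar S c v e)))))"

text \<open>Maps of class \<open>W\<close>(1,p) for p > 2, represented by their continuous representatives. Since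
  hyperbolic space is a Riemannian submanifold of Minkowski space and covers the quotient by local
  isometries, such a map is of class \<open>W\<close>(1,p) iff its lift to hyperbolic space is.\<close>

definition W1p_map ::
  "real \<Rightarrow> ('a::topological_space, 'b::topological_space) surface \<Rightarrow>
   (real ^ ('m::finite option) ^ ('m option)) set \<Rightarrow> ('a \<Rightarrow> 'm mink set) \<Rightarrow> bool" where
  "W1p_map p S \<Gamma> u \<longleftrightarrow> u ` pts S \<subseteq> hyp_quotient \<Gamma> \<and>
     (\<exists>\<rho> w. equivariant_lift S \<Gamma> u \<rho> w \<and> W1p_section p S \<rho> w)"


section \<open>The pulled back tangent bundle and the functionals\<close>

text \<open>From here on, \<open>w\<close> is the section of E given by the equivariant lift of u.\<close>

definition tan_space :: "'m::finite mink \<Rightarrow> 'm mink set" where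
  "tan_space X = {Y. lor Y X = 0}"

definition tan_proj :: "'m::finite mink \<Rightarrow> 'm mink \<Rightarrow> 'm mink" where
  "tan_proj X Y = Y + lor Y X *\<^sub>R X"

definition W1p_tangent_sections ::
  "real \<Rightarrow> ('a::topological_space, 'b::topological_space) surface \<Rightarrow>
   (('b \<Rightarrow> 'b) \<Rightarrow> real ^ ('m::finite option) ^ ('m option)) \<Rightarrow>
   ('b \<Rightarrow> 'm mink) \<Rightarrow> ('b \<Rightarrow> 'm mink) set" where
  "W1p_tangent_sections p S \<rho> w =
     {\<xi>. W1p_section p S \<rho> \<xi> \<and> (\<forall>y\<in>ucov S. \<xi> y = tan_proj (w y) (\<xi> y))}"

definition D_pull ::
  "('a::topological_space, 'b::topological_space) surface \<Rightarrow>
   (('b \<Rightarrow> 'b) \<Rightarrow> real ^ ('m::finite option) ^ ('m option)) \<Rightarrow>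
   ('b \<Rightarrow> 'm mink) \<Rightarrow> ('b \<Rightarrow> 'm mink) \<Rightarrow> 'b \<Rightarrow> real^2 \<Rightarrow> 'm mink" where
  "D_pull S \<rho> w \<xi> y v = tan_proj (w y) (flat_d S \<rho> \<xi> y v)"

definition oriented_frame :: "(real^2 \<Rightarrow> real^2 \<Rightarrow> real) \<Rightarrow> (real^2) \<times> (real^2) \<Rightarrow> bool" where
  "oriented_frame g = (\<lambda>(e1, e2). g e1 e1 = 1 \<and> g e2 e2 = 1 \<and> g e1 e2 = 0 \<and>
      e1 $ 1 * e2 $ 2 - e1 $ 2 * e2 $ 1 > 0)"

definition frame :: "(real^2 \<Rightarrow> real^2 \<Rightarrow> real) \<Rightarrow> (real^2) \<times> (real^2)" where
  "frame g = (SOME e. oriented_frame g e)"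

text \<open>The Hodge star sends the first element of the coframe dual to an oriented orthonormal frame to
  the second one, and the second one to minus the first one.\<close>

definition hodge ::
  "(real^2 \<Rightarrow> real^2 \<Rightarrow> real) \<Rightarrow> (real^2 \<Rightarrow> 'e::real_vector) \<Rightarrow> real^2 \<Rightarrow> 'e" where
  "hodge g A v = (let (e1, e2) = frame g in g e2 v *\<^sub>R A e1 - g e1 v *\<^sub>R A e2)"

definition form_inner ::
  "(real^2 \<Rightarrow> real^2 \<Rightarrow> real) \<Rightarrow> (real^2 \<Rightarrow> 'm::finite mink) \<Rightarrow> (real^2 \<Rightarrow> 'm mink) \<Rightarrow> real" where
  "form_inner g A B = (let (e1, e2) = frame g in lor (A e1) (B e1) + lor (A e2) (B e2))"

text \<open>The coefficient, with respect to the area form, of the wedge product of two vector valued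
  1-forms contracted with the Minkowski form.\<close>

definition form_wedge ::
  "(real^2 \<Rightarrow> real^2 \<Rightarrow> real) \<Rightarrow> (real^2 \<Rightarrow> 'm::finite mink) \<Rightarrow> (real^2 \<Rightarrow> 'm mink) \<Rightarrow> real" where
  "form_wedge g A B = (let (e1, e2) = frame g in lor (A e1) (B e2) - lor (A e2) (B e1))"

definition star ::
  "('a, 'b) surface \<Rightarrow> ('b \<Rightarrow> real^2 \<Rightarrow> 'm::finite mink) \<Rightarrow> 'b \<Rightarrow> real^2 \<Rightarrow> 'm mink" where
  "star S A y = hodge (metric S (uproj S y)) (A y)"

text \<open>For 1-forms with values in the pulled back tangent bundle: \<open>S_form S w r A\<close> is \<open>Q(A)\<close> to the
  power \<open>r - 1\<close> composed with \<open>A\<close>, and \<open>Tr_Q S w r A\<close> is the trace of \<open>Q(A)\<close> to the power \<open>r\<close>.\<close>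

definition S_form ::
  "('a, 'b) surface \<Rightarrow> ('b \<Rightarrow> 'm::finite mink) \<Rightarrow> real \<Rightarrow>
   ('b \<Rightarrow> real^2 \<Rightarrow> 'm mink) \<Rightarrow> 'b \<Rightarrow> real^2 \<Rightarrow> 'm mink" where
  "S_form S w r A y = Qpow (metric S (uproj S y)) lor (tan_space (w y)) r (A y)"

definition Tr_Q ::
  "('a, 'b) surface \<Rightarrow> ('b \<Rightarrow> 'm::finite mink) \<Rightarrow> real \<Rightarrow>
   ('b \<Rightarrow> real^2 \<Rightarrow> 'm mink) \<Rightarrow> 'b \<Rightarrow> real" where
  "Tr_Q S w r A y =
     (let F = tan_space (w y)
      in Tr_on lor F (psd_powr lor F (Q_op (metric S (uproj S y)) lor F (A y)) r))"

definition Jp_Euler_Lagrange ::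
  "real \<Rightarrow> ('a::topological_space, 'b::topological_space) surface \<Rightarrow>
   (('b \<Rightarrow> 'b) \<Rightarrow> real ^ ('m::finite option) ^ ('m option)) \<Rightarrow> ('b \<Rightarrow> 'm mink) \<Rightarrow> bool" where
  "Jp_Euler_Lagrange p S \<rho> w \<longleftrightarrow>
     (\<forall>\<xi>\<in>W1p_tangent_sections p S \<rho> w.
        surface_integral S (\<lambda>y. form_inner (metric S (uproj S y))
           (S_form S w (p - 1) (flat_d S \<rho> w) y) (D_pull S \<rho> w \<xi> y)) = 0)"

definition Z_form ::
  "real \<Rightarrow> ('a::topological_space, 'b::topological_space) surface \<Rightarrow>
   (('b \<Rightarrow> 'b) \<Rightarrow> real ^ ('m::finite option) ^ ('m option)) \<Rightarrow>
   ('b \<Rightarrow> 'm mink) \<Rightarrow> 'b \<Rightarrow> real^2 \<Rightarrow> 'm mink" where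
  "Z_form p S \<rho> w = star S (S_form S w (p - 1) (flat_d S \<rho> w))"

definition J_dual ::
  "real \<Rightarrow> ('a::topological_space, 'b::topological_space) surface \<Rightarrow>
   (('b \<Rightarrow> 'b) \<Rightarrow> real ^ ('m::finite option) ^ ('m option)) \<Rightarrow> ('b \<Rightarrow> 'm mink) \<Rightarrow>
   ('b \<Rightarrow> real^2 \<Rightarrow> 'm mink) \<Rightarrow> ('b \<Rightarrow> 'm mink) \<Rightarrow> real" where
  "J_dual q S \<rho> w Z \<xi> =
     surface_integral S (Tr_Q S w q (\<lambda>y v. Z y v + tan_proj (w y) (flat_d S \<rho> \<xi> y v)))"

text \<open>The weak form of the vanishing of the exterior covariant derivative of a 1-form \<open>\<alpha>\<close> with values
  in the pulled back tangent bundle: by Stokes, integrating \<open>D_u \<alpha>\<close> against a section \<open>\<xi>\<close> gives minus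
  the integral of the wedge product of \<open>D_u \<xi>\<close> and \<open>\<alpha>\<close>. The test sections are those of the
  Euler-Lagrange equations.\<close>

definition weakly_D_closed ::
  "real \<Rightarrow> ('a::topological_space, 'b::topological_space) surface \<Rightarrow>
   (('b \<Rightarrow> 'b) \<Rightarrow> real ^ ('m::finite option) ^ ('m option)) \<Rightarrow> ('b \<Rightarrow> 'm mink) \<Rightarrow>
   ('b \<Rightarrow> real^2 \<Rightarrow> 'm mink) \<Rightarrow> bool" where
  "weakly_D_closed p S \<rho> w \<alpha> \<longleftrightarrow>
     (\<forall>\<xi>\<in>W1p_tangent_sections p S \<rho> w.
        surface_integral S (\<lambda>y. form_wedge (metric S (uproj S y)) (D_pull S \<rho> w \<xi> y) (\<alpha> y)) = 0)"

end

theory Submission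
  imports Defs "HOL-Computational_Algebra.Polynomial"
begin

text \<open>
  In dimension two the star is an isometry with \<open>** = -1\<close>, and \<open>(p - 1) (q - 1) = 1\<close>, so
  \<open>*S\<^sub>q\<^sub>-\<^sub>1(Z) = **du = -du\<close>. Hence both claims only involve the integral of \<open>du \<and> D\<^sub>u\<xi>\<close>, which
  is the integral of \<open>dw \<and> d\<xi>\<close> because the lift \<open>w\<close> has tangential differential, and this vanishes by the Stokes
  theorem on the flat bundle. The functional \<open>A \<mapsto> Tr Q(A)\<^sup>q\<close> is convex, with subgradient \<open>q S\<^sub>q\<^sub>-\<^sub>1(Z)\<close>
  at \<open>Z\<close>; integrating the subgradient inequality yields the minimality of \<open>\<xi> = 0\<close>.
\<close>

subsection \<open>A smooth bump function\<close>

text \<open>The obstacle is regularity: the sections are only of class W^{1,p}, so the exactness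
  behind the Stokes theorem has no pointwise meaning. It is recovered by mollifying the lift times a
  cutoff; the mollified differentials only need to converge weakly in L^2, because they are paired
  with one fixed differential. As p > 2, all differentials are locally square integrable. That dw is
  tangential is the weakly differentiated relation (w, w) = -1 and holds almost everywhere only; the
  minimality argument therefore works with the projection of dw, tangential at every point. The
  subgradient inequality is not drawn from convexity: it comes from Young's inequality for pairs of
  singular values, weighted by a doubly substochastic matrix. Two matters of measure shape the rest.
  Energies must be shown finite, since a nonintegrable function has integral 0 by convention; and
  singular frames are chosen without any measurability, so measurability rests on closed formulas in
  the trace and determinant of a Gram matrix. Finally, W^{1,p} regularity is given for some lift of
  u, and has to be carried over to \<open>w\<close>.\<close>

definition exp_inv :: "real poly \<Rightarrow> real \<Rightarrow> real" where
  "exp_inv P t = (if t \<le> 0 then 0 else poly P (1 / t) * exp (- (1 / t)))"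

lemma tendsto_poly_exp_neg: "((\<lambda>s::real. poly P s * exp (- s)) \<longlongrightarrow> 0) at_top"
proof -
  have *: "((\<lambda>s::real. s ^ n * exp (- s)) \<longlongrightarrow> 0) at_top" for n
    using tendsto_power_div_exp_0[of n] by (simp add: exp_minus field_simps)
  have "((\<lambda>s::real. \<Sum>i\<le>degree P. coeff P i * (s ^ i * exp (- s))) \<longlongrightarrow> (\<Sum>i\<le>degree P. coeff P i * 0)) at_top"
    by (intro tendsto_sum tendsto_mult_left *)
  then show ?thesis
    by (simp add: poly_altdef sum_distrib_right mult.assoc)
qed

text \<open>Under s = 1/t the right-hand limit is that of a polynomial times exp(-s) at infinity; on
  the left the function is zero.\<close>

lemma tendsto_exp_inv_0: "(exp_inv P \<longlongrightarrow> 0) (at 0)"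
proof -
  have "((\<lambda>t::real. poly P (inverse t) * exp (- (inverse t))) \<longlongrightarrow> 0) (at_right 0)"
    using tendsto_poly_exp_neg[of P] filterlim_inverse_at_top_right by (rule filterlim_compose)
  then have "(exp_inv P \<longlongrightarrow> 0) (at_right 0)"
    by (rule Lim_transform_eventually)
      (auto simp: exp_inv_def eventually_at_right_less eventually_at_filter inverse_eq_divide)
  moreover have "(exp_inv P \<longlongrightarrow> 0) (at_left 0)"
    by (rule Lim_transform_eventually[OF tendsto_const])
      (auto simp: exp_inv_def eventually_at_filter)
  ultimately show ?thesis
    using filterlim_split_at by blast
qed

text \<open>The derivative of P(1/t) exp(-1/t) is t^-2 (P - P')(1/t) exp(-1/t), and the factor t^-2
  is the monomial X^2 evaluated at 1/t. The polynomial factor is carried along precisely so that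
  differentiation stays inside the family.\<close>

definition dexp_poly :: "real poly \<Rightarrow> real poly" where
  "dexp_poly P = [:0, 0, 1:] * (P - pderiv P)"

lemma has_real_derivative_exp_inv:
  "(exp_inv P has_real_derivative exp_inv (dexp_poly P) t) (at t)"
proof (cases t "0::real" rule: linorder_cases)
  case less
  have "((\<lambda>_. 0) has_real_derivative 0) (at t)" by simp
  then have "(exp_inv P has_real_derivative 0) (at t)"
    by (rule has_field_derivative_transform_within_open[of _ _ _ "{..<0}"])
      (use less in \<open>auto simp: exp_inv_def\<close>)
  then show ?thesis using less by (simp add: exp_inv_def)
next
  case equal
  \<comment> \<open>The difference quotient at 0 absorbs the factor 1/h into the polynomial, so it
    is again a member of the family, whose limit at 0 is already known.\<close>
  have "(\<lambda>h. (exp_inv P (0 + h) - exp_inv P 0) / h) = exp_inv ([:0, 1:] * P)"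
    by (auto simp: exp_inv_def fun_eq_iff)
  then have "(exp_inv P has_real_derivative 0) (at 0)"
    unfolding DERIV_def using tendsto_exp_inv_0 by simp
  then show ?thesis using equal by (simp add: exp_inv_def)
next
  case greater
  have "((\<lambda>t. poly P (1 / t) * exp (- (1 / t))) has_real_derivative
      exp_inv (dexp_poly P) t) (at t)"
    using greater
    by (auto intro!: derivative_eq_intros
        simp: exp_inv_def dexp_poly_def field_simps power2_eq_square)
  then show ?thesis
    by (rule has_field_derivative_transform_within_open[of _ _ _ "{0<..}"])
      (use greater in \<open>auto simp: exp_inv_def\<close>)
qed

text \<open>Membership in a set stable under directional derivatives gives differentiability of
  every order, by induction on the order. Both the bump functions and the convolutions below are
  shown smooth through such a set.\<close>

lemma smooth_on_UNIV_coinduct: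
  assumes "f \<in> F"
    and step: "\<And>f. f \<in> F \<Longrightarrow>
      \<exists>f'. (\<forall>x. (f has_derivative f' x) (at x)) \<and> (\<forall>e. (\<lambda>x. f' x e) \<in> F)"
  shows "smooth_on UNIV f"
proof -
  have "C_k_on k UNIV f" if "f \<in> F" for k f
    using that
  proof (induction k arbitrary: f)
    case 0
    then obtain f' where "\<And>x. (f has_derivative f' x) (at x)" using step by blast
    then show ?case
      by (auto intro!: continuous_at_imp_continuous_on has_derivative_continuous)
  next
    case (Suc k)
    then obtain f' where f': "\<And>x. (f has_derivative f' x) (at x)" "\<And>e. (\<lambda>x. f' x e) \<in> F"
      using step by blast
    have "frechet_derivative f (at x) = f' x" for x
      using frechet_derivative_at[OF f'(1)] by simp
    then show ?case using Suc.IH[OF f'(2)] f'(1) by (auto simp: differentiable_def)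
  qed
  with \<open>f \<in> F\<close> show ?thesis by (simp add: smooth_on_def)
qed

lemma smooth_on_UNIV_has_derivative:
  assumes "smooth_on UNIV f"
  shows "(f has_derivative frechet_derivative f (at x)) (at x)"
proof -
  have "C_k_on (Suc 0) UNIV f" using assms unfolding smooth_on_def by blast
  then show ?thesis using frechet_derivative_works by auto
qed

lemma smooth_on_UNIV_frechet_derivative:
  "smooth_on UNIV f \<Longrightarrow> smooth_on UNIV (\<lambda>x. frechet_derivative f (at x) e)"
  unfolding smooth_on_def by (metis C_k_on.simps(2))

lemma smooth_on_imp_continuous_on: "smooth_on V f \<Longrightarrow> continuous_on V f"
  unfolding smooth_on_def by (metis C_k_on.simps(1))

text \<open>An algebra that contains the radial bumps and, because the chain rule produces the
  factor x . e, the linear functions as well; so it is stable under directional derivatives.\<close>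

inductive_set bump_algebra :: "real \<Rightarrow> ('a::euclidean_space \<Rightarrow> real) set" for r where
  bump: "(\<lambda>v. exp_inv P (r\<^sup>2 - v \<bullet> v)) \<in> bump_algebra r"
| inner: "(\<lambda>v. v \<bullet> e) \<in> bump_algebra r"
| const: "(\<lambda>v. c) \<in> bump_algebra r"
| add: "f \<in> bump_algebra r \<Longrightarrow> g \<in> bump_algebra r \<Longrightarrow> (\<lambda>v. f v + g v) \<in> bump_algebra r"
| mult: "f \<in> bump_algebra r \<Longrightarrow> g \<in> bump_algebra r \<Longrightarrow> (\<lambda>v. f v * g v) \<in> bump_algebra r"

lemma has_derivative_bump:
  "((\<lambda>v::'a::euclidean_space. exp_inv P (r\<^sup>2 - v \<bullet> v)) has_derivative
     (\<lambda>e. exp_inv (dexp_poly P) (r\<^sup>2 - x \<bullet> x) * ((- 2) * (x \<bullet> e)))) (at x)"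
proof -
  have "((\<lambda>v. r\<^sup>2 - v \<bullet> v) has_derivative (\<lambda>e. (- 2) * (x \<bullet> e))) (at x)"
    by (auto intro!: derivative_eq_intros simp: inner_commute algebra_simps)
  moreover have "(exp_inv P has_derivative (*) (exp_inv (dexp_poly P) (r\<^sup>2 - x \<bullet> x))) (at (r\<^sup>2 - x \<bullet> x))"
    using has_real_derivative_exp_inv by (simp add: has_field_derivative_def)
  ultimately show ?thesis
    using diff_chain_at by (fastforce simp: o_def)
qed

lemma smooth_bump_algebra: "f \<in> bump_algebra r \<Longrightarrow> smooth_on UNIV f"
proof (rule smooth_on_UNIV_coinduct)
  fix f :: "'a \<Rightarrow> real" assume "f \<in> bump_algebra r"
  then show "\<exists>f'. (\<forall>x. (f has_derivative f' x) (at x)) \<and> (\<forall>e. (\<lambda>x. f' x e) \<in> bump_algebra r)"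
  proof induction
    case (bump P)
    show ?case
      by (rule exI[of _ "\<lambda>x e. exp_inv (dexp_poly P) (r\<^sup>2 - x \<bullet> x) * ((- 2) * (x \<bullet> e))"])
        (intro conjI allI has_derivative_bump bump_algebra.intros)
  next
    case (inner e)
    show ?case
      by (rule exI[of _ "\<lambda>x h. h \<bullet> e"])
        (auto intro!: derivative_eq_intros bump_algebra.intros)
  next
    case (const c)
    show ?case
      by (rule exI[of _ "\<lambda>x h. 0"]) (auto intro!: bump_algebra.intros)
  next
    case (add f g)
    then obtain f' g' where
      "\<And>x. (f has_derivative f' x) (at x)" "\<And>e. (\<lambda>x. f' x e) \<in> bump_algebra r"
      "\<And>x. (g has_derivative g' x) (at x)" "\<And>e. (\<lambda>x. g' x e) \<in> bump_algebra r" by blast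
    then show ?case
      by (intro exI[of _ "\<lambda>x h. f' x h + g' x h"])
        (auto intro!: derivative_intros bump_algebra.intros)
  next
    case (mult f g)
    then obtain f' g' where
      "\<And>x. (f has_derivative f' x) (at x)" "\<And>e. (\<lambda>x. f' x e) \<in> bump_algebra r"
      "\<And>x. (g has_derivative g' x) (at x)" "\<And>e. (\<lambda>x. g' x e) \<in> bump_algebra r" by blast
    with mult show ?case
      by (intro exI[of _ "\<lambda>x h. f x * g' x h + f' x h * g x"])
        (auto intro!: derivative_intros bump_algebra.intros)
  qed
qed

text \<open>The bump of radius 1/(n+1), divided by its own integral; one normalising constant per
  radius avoids a change of variables by scaling.\<close>

definition mollifier :: "nat \<Rightarrow> real^2 \<Rightarrow> real" where
  "mollifier n v = exp_inv 1 ((1 / real (Suc n))\<^sup>2 - v \<bullet> v) /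
     (LINT v|lborel. exp_inv 1 ((1 / real (Suc n))\<^sup>2 - v \<bullet> (v::real^2)))"

lemma exp_inv_bump_eq_0_iff: 
  "r > 0 \<Longrightarrow> exp_inv 1 (r\<^sup>2 - v \<bullet> v) = 0 \<longleftrightarrow> norm (v::'a::euclidean_space) \<ge> r"
  by (auto simp: exp_inv_def dot_square_norm power2_le_iff_abs_le)

lemma smooth_mollifier: "smooth_on UNIV (mollifier n)"
proof -
  have "mollifier n = (\<lambda>v. exp_inv 1 ((1 / real (Suc n))\<^sup>2 - v \<bullet> v) * (1 /
     (LINT v|lborel. exp_inv 1 ((1 / real (Suc n))\<^sup>2 - v \<bullet> (v::real^2)))))"
    by (auto simp: mollifier_def)
  also have "\<dots> \<in> bump_algebra (1 / real (Suc n))"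
    by (intro bump_algebra.intros)
  finally show ?thesis by (rule smooth_bump_algebra)
qed

lemma mollifier_eq_0: "norm v \<ge> 1 / real (Suc n) \<Longrightarrow> mollifier n v = 0"
  using exp_inv_bump_eq_0_iff[of "1 / real (Suc n)" v] by (simp add: mollifier_def)

lemma continuous_compact_support_integrable:
  fixes f :: "'a::euclidean_space \<Rightarrow> 'b::euclidean_space"
  assumes "continuous_on UNIV f" "compact K" "\<And>x. x \<notin> K \<Longrightarrow> f x = 0"
  shows "integrable lborel f"
proof -
  have "set_integrable lborel K f"
    unfolding set_integrable_def
    using borel_integrable_compact[OF assms(2) continuous_on_subset[OF assms(1)]] by simp
  moreover have "(\<lambda>x. indicator K x *\<^sub>R f x) = f"
    using assms(3) by (auto simp: indicator_def fun_eq_iff)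
  ultimately show ?thesis by (simp add: set_integrable_def)
qed

lemma continuous_bump: "continuous_on UNIV (\<lambda>v. exp_inv P (r\<^sup>2 - v \<bullet> (v::'a::euclidean_space)))"
  using smooth_bump_algebra[OF bump_algebra.bump] by (rule smooth_on_imp_continuous_on)

lemma exp_inv_1_nonneg: "exp_inv 1 t \<ge> 0"
  by (simp add: exp_inv_def)

lemma integrable_bump: 
  "r > 0 \<Longrightarrow> integrable lborel (\<lambda>v::'a::euclidean_space. exp_inv 1 (r\<^sup>2 - v \<bullet> v))"
  by (rule continuous_compact_support_integrable[OF continuous_bump compact_cball[of 0 r]])
    (auto simp: exp_inv_bump_eq_0_iff)

text \<open>A nonnegative function with integral zero vanishes almost everywhere, whereas the bump
  is nonzero on a nonempty open ball.\<close>

lemma integral_bump_pos: 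
  assumes "r > 0" shows "(LINT v|lborel. exp_inv 1 (r\<^sup>2 - v \<bullet> (v::'a::euclidean_space))) > 0"
proof -
  have "(LINT v|lborel. exp_inv 1 (r\<^sup>2 - v \<bullet> (v::'a))) \<noteq> 0"
  proof
    assume "(LINT v|lborel. exp_inv 1 (r\<^sup>2 - v \<bullet> (v::'a))) = 0"
    then have "AE v::'a in lborel. exp_inv 1 (r\<^sup>2 - v \<bullet> v) = 0"
      using integral_nonneg_eq_0_iff_AE[OF integrable_bump[OF assms, where ?'a='a]]
      by (simp add: exp_inv_1_nonneg)
    moreover have "exp_inv 1 (r\<^sup>2 - v \<bullet> v) \<noteq> 0" if "v \<in> ball 0 r" for v :: 'a
      using exp_inv_bump_eq_0_iff[OF assms, of v] that by auto
    ultimately have "AE v::'a in lborel. v \<notin> ball 0 r"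
      by (auto elim: eventually_mono)
    then have "emeasure lborel (ball (0::'a) r) = 0"
      by (subst (asm) AE_iff_measurable[of "ball 0 r"]) auto
    then have "negligible (ball (0::'a) r)"
      by (simp add: negligible_iff_null_sets null_sets_def)
    then have "ball (0::'a) r = {}"
      using open_not_negligible open_ball by blast
    with assms show False by simp
  qed
  moreover have "(LINT v|lborel. exp_inv 1 (r\<^sup>2 - v \<bullet> (v::'a))) \<ge> 0"
    by (simp add: exp_inv_1_nonneg)
  ultimately show ?thesis by linarith
qed

lemma mollifier_nonneg: "mollifier n v \<ge> 0"
  by (simp add: mollifier_def exp_inv_1_nonneg)

lemma integral_mollifier: "(LINT v|lborel. mollifier n v) = 1"
  using integral_bump_pos[of "1 / real (Suc n)", where ?'a="real^2"] by (simp add: mollifier_def)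

lemma mollifier_minus: "mollifier n (- v) = mollifier n v"
  by (simp add: mollifier_def)

lemma continuous_mollifier: "continuous_on UNIV (mollifier n)"
  by (rule smooth_on_imp_continuous_on[OF smooth_mollifier])

lemma frechet_derivative_mollifier:
  obtains c where "\<And>x e. frechet_derivative (mollifier n) (at x) e
      = c * (exp_inv (dexp_poly 1) ((1 / real (Suc n))\<^sup>2 - x \<bullet> x) * ((- 2) * (x \<bullet> e)))"
proof -
  define c where "c = 1 / (LINT v|lborel. exp_inv 1 ((1 / real (Suc n))\<^sup>2 - v \<bullet> (v::real^2)))"
  have m: "mollifier n = (\<lambda>v. c * exp_inv 1 ((1 / real (Suc n))\<^sup>2 - v \<bullet> v))"
    by (auto simp: mollifier_def c_def)
  have "(mollifier n has_derivative (\<lambda>e. c * (exp_inv (dexp_poly 1) ((1 / real (Suc n))\<^sup>2 - x \<bullet> x) * ((- 2) * (x \<bullet> e))))) (at x)" for x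
    unfolding m by (intro has_derivative_mult_right has_derivative_bump)
  from frechet_derivative_at[OF this, symmetric] show thesis by (intro that) auto
qed

text \<open>The mollifier is radial, so its second derivatives have an explicit expression, visibly
  symmetric in the two directions. The commutation of derivatives used for the Stokes formula is
  inherited from the kernel through this.\<close>

lemma mollifier_second_derivative_symmetric:
  "frechet_derivative (\<lambda>x. frechet_derivative (mollifier n) (at x) e) (at x) e' =
   frechet_derivative (\<lambda>x. frechet_derivative (mollifier n) (at x) e') (at x) e"
proof -
  obtain c where c: "\<And>x e. frechet_derivative (mollifier n) (at x) e
      = c * (exp_inv (dexp_poly 1) ((1 / real (Suc n))\<^sup>2 - x \<bullet> x) * ((- 2) * (x \<bullet> e)))"
    using frechet_derivative_mollifier by blast
  let ?Q = "dexp_poly 1" and ?r = "1 / real (Suc n)"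
  have "((\<lambda>x. c * (exp_inv ?Q (?r\<^sup>2 - x \<bullet> x) * ((- 2) * (x \<bullet> a)))) has_derivative
      (\<lambda>b. c * (exp_inv ?Q (?r\<^sup>2 - x \<bullet> x) * ((- 2) * (b \<bullet> a)) 
         + exp_inv (dexp_poly ?Q) (?r\<^sup>2 - x \<bullet> x) * ((- 2) * (x \<bullet> b)) * ((- 2) * (x \<bullet> a))))) (at x)" for a
    by (intro has_derivative_mult_right has_derivative_mult has_derivative_bump)
      (auto intro!: derivative_eq_intros)
  note * = frechet_derivative_at[OF this, symmetric]
  show ?thesis
    unfolding c * by (simp add: inner_commute algebra_simps)
qed

subsection \<open>Mollification\<close>

lemma test_function_has_derivative:
  "test_function W \<phi> \<Longrightarrow> (\<phi> has_derivative frechet_derivative \<phi> (at x)) (at x)"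
  unfolding test_function_def using smooth_on_UNIV_has_derivative by blast

lemma test_function_continuous: "test_function W \<phi> \<Longrightarrow> continuous_on UNIV \<phi>"
  unfolding test_function_def using smooth_on_imp_continuous_on by blast

lemma frechet_derivative_eq_0_off:
  assumes "closed K" "\<And>v. v \<notin> K \<Longrightarrow> f v = 0" "x \<notin> K"
  shows "frechet_derivative f (at x) = (\<lambda>_. 0)"
proof -
  have "((\<lambda>_. 0) has_derivative (\<lambda>_. 0)) (at x)" by simp
  then have "(f has_derivative (\<lambda>_. 0)) (at x)"
    by (rule has_derivative_transform_within_open[of _ _ _ _ "- K"])
      (use assms in auto)
  from frechet_derivative_at[OF this] show ?thesis by simp
qed

lemma test_function_frechet_derivative:
  assumes "test_function W \<phi>"
  shows "test_function W (\<lambda>x. frechet_derivative \<phi> (at x) e)"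
proof -
  obtain K where K: "K \<subseteq> W" "compact K" "\<And>v. v \<notin> K \<Longrightarrow> \<phi> v = 0" and s: "smooth_on UNIV \<phi>"
    using assms unfolding test_function_def by auto
  have "frechet_derivative \<phi> (at v) e = 0" if "v \<notin> K" for v
    using frechet_derivative_eq_0_off[OF compact_imp_closed[OF K(2)] K(3) that] by simp
  then show ?thesis
    unfolding test_function_def
    by (intro conjI smooth_on_UNIV_frechet_derivative[OF s] exI[of _ K] K allI impI)
qed

lemma bounded_continuous_compact_support:
  fixes f :: "'a::topological_space \<Rightarrow> real"
  assumes "continuous_on UNIV f" "compact K" "\<And>v. v \<notin> K \<Longrightarrow> f v = 0"
  obtains B where "B \<ge> 0" "\<And>x. \<bar>f x\<bar> \<le> B"
proof -
  have "bounded (f ` K)"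
    by (intro compact_imp_bounded compact_continuous_image continuous_on_subset[OF assms(1)] assms(2)) simp
  then obtain B where B: "\<And>x. x \<in> K \<Longrightarrow> \<bar>f x\<bar> \<le> B"
    by (auto simp: bounded_iff)
  have "\<bar>f x\<bar> \<le> max 0 B" for x
    using B[of x] assms(3)[of x] by (cases "x \<in> K") auto
  then show thesis by (intro that[of "max 0 B"]) auto
qed

lemma test_function_bounded:
  assumes "test_function W \<phi>" obtains B where "B \<ge> 0" "\<And>x. \<bar>\<phi> x\<bar> \<le> B"
  using assms bounded_continuous_compact_support[of \<phi>] test_function_continuous[OF assms]
  unfolding test_function_def by metis

lemma linear_bound_Basis:
  fixes f :: "'a::euclidean_space \<Rightarrow> real"
  assumes "linear f" "\<And>b. b \<in> Basis \<Longrightarrow> \<bar>f b\<bar> \<le> B b"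
  shows "\<bar>f h\<bar> \<le> (\<Sum>b\<in>Basis. B b) * norm h"
proof -
  have "f h = f (\<Sum>b\<in>Basis. (h \<bullet> b) *\<^sub>R b)" by (simp add: euclidean_representation)
  also have "\<dots> = (\<Sum>b\<in>Basis. (h \<bullet> b) * f b)"
    using assms(1) by (simp add: linear_sum linear_cmul)
  also have "\<bar>\<dots>\<bar> \<le> (\<Sum>b\<in>Basis. norm h * B b)"
    by (rule order_trans[OF sum_abs sum_mono])
      (auto simp: abs_mult intro!: mult_mono assms Basis_le_norm)
  finally show ?thesis by (simp add: sum_distrib_left mult.commute)
qed

lemma test_function_lipschitz:
  assumes "test_function W \<phi>"
  obtains L where "L \<ge> 0" "\<And>x h. \<bar>frechet_derivative \<phi> (at x) h\<bar> \<le> L * norm h"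
    "\<And>x y. \<bar>\<phi> x - \<phi> y\<bar> \<le> L * norm (x - y)"
proof -
  have "\<forall>b. \<exists>B\<ge>0. \<forall>x. \<bar>frechet_derivative \<phi> (at x) b\<bar> \<le> B"
    using test_function_bounded[OF test_function_frechet_derivative[OF assms]] by metis
  then obtain B where B: "\<And>b. B b \<ge> 0" "\<And>b x. \<bar>frechet_derivative \<phi> (at x) b\<bar> \<le> B b"
    by metis
  let ?L = "\<Sum>b\<in>Basis. B b"
  have 1: "\<bar>frechet_derivative \<phi> (at x) h\<bar> \<le> ?L * norm h" for x h
    using linear_bound_Basis[OF has_derivative_linear[OF test_function_has_derivative[OF assms]]] B
    by blast
  have "norm (\<phi> x - \<phi> y) \<le> ?L * norm (x - y)" for x y
    by (rule differentiable_bound[of UNIV _ "\<lambda>x. frechet_derivative \<phi> (at x)"])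
      (use test_function_has_derivative[OF assms] 1 in \<open>auto intro!: onorm_le\<close>)
  with 1 show thesis by (intro that[of ?L]) (auto intro!: sum_nonneg B)
qed

text \<open>The partial derivatives of a test function are test functions, hence Lipschitz; the
  first-order remainder is therefore quadratic with one constant for all base points.\<close>

lemma test_function_taylor:
  fixes \<phi> :: "real^2 \<Rightarrow> real"
  assumes "test_function W \<phi>"
  obtains L where "\<And>x h. \<bar>\<phi> (x + h) - \<phi> x - frechet_derivative \<phi> (at x) h\<bar> \<le> L * (norm h)\<^sup>2"
proof -
  have "\<forall>b. \<exists>L\<ge>0. \<forall>x y. \<bar>frechet_derivative \<phi> (at x) b - frechet_derivative \<phi> (at y) b\<bar> \<le> L * norm (x - y)"
    using test_function_lipschitz[OF test_function_frechet_derivative[OF assms]] by metis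
  then obtain L where L: "\<And>b. L b \<ge> 0"
    "\<And>b x y. \<bar>frechet_derivative \<phi> (at x) b - frechet_derivative \<phi> (at y) b\<bar> \<le> L b * norm (x - y)"
    by metis
  let ?L = "\<Sum>b\<in>Basis. L b"
  have 1: "\<bar>frechet_derivative \<phi> (at x) h - frechet_derivative \<phi> (at y) h\<bar> \<le> ?L * norm (x - y) * norm h" for x y h
    using linear_bound_Basis[of "\<lambda>h. frechet_derivative \<phi> (at x) h - frechet_derivative \<phi> (at y) h" 
        "\<lambda>b. L b * norm (x - y)" h]
      has_derivative_linear[OF test_function_has_derivative[OF assms]] L
    by (auto simp: linear_compose_sub sum_distrib_right)
  have "norm (\<phi> (x + h) - \<phi> x - frechet_derivative \<phi> (at x) ((x + h) - x)) \<le> norm ((x + h) - x) * (?L * norm h)" for x h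
  proof (rule differentiable_bound_linearization[where S = "cball x (norm h)"])
    show "x + t *\<^sub>R (x + h - x) \<in> cball x (norm h)" if "t \<in> {0..1}" for t
      using that by (simp add: dist_norm mult_left_le_one_le)
    show "(\<phi> has_derivative frechet_derivative \<phi> (at y)) (at y within cball x (norm h))" for y
      using test_function_has_derivative[OF assms] has_derivative_at_withinI by blast
    show "onorm (frechet_derivative \<phi> (at y) - frechet_derivative \<phi> (at x)) \<le> ?L * norm h"
      if "y \<in> cball x (norm h)" for y
    proof (rule onorm_le)
      fix v :: "real^2"
      have "?L * norm (y - x) * norm v \<le> ?L * norm h * norm v"
        using that L(1) by (intro mult_right_mono mult_left_mono)
          (auto simp: dist_norm norm_minus_commute intro!: sum_nonneg)
      then show "norm ((frechet_derivative \<phi> (at y) - frechet_derivative \<phi> (at x)) v) \<le> ?L * norm h * norm v"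
        using 1[of y v x] by simp
    qed
  qed simp
  then have "\<bar>\<phi> (x + h) - \<phi> x - frechet_derivative \<phi> (at x) h\<bar> \<le> ?L * (norm h)\<^sup>2" for x h
    by (simp add: power2_eq_square mult_ac)
  then show thesis by (rule that)
qed

section \<open>Convolution with a test function\<close>

definition conv :: "(real^2 \<Rightarrow> real) \<Rightarrow> (real^2 \<Rightarrow> real) \<Rightarrow> real^2 \<Rightarrow> real" where
  "conv v \<zeta> x = (LINT y|lebesgue. v y * \<zeta> (x - y))"

lemma integrable_mult_bounded:
  fixes f g :: "'a \<Rightarrow> real"
  assumes "integrable M f" "g \<in> borel_measurable M" "\<And>x. \<bar>g x\<bar> \<le> B"
  shows "integrable M (\<lambda>x. f x * g x)"
  by (rule Bochner_Integration.integrable_bound[of _ "\<lambda>x. B * f x"])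
    (use assms order_trans[OF abs_ge_zero assms(3)] in
      \<open>auto simp: abs_mult mult.commute[of _ "\<bar>g _\<bar>"] intro!: AE_I2 mult_right_mono\<close>)

lemma continuous_imp_measurable_lebesgue:
  fixes f :: "'a::euclidean_space \<Rightarrow> real"
  shows "continuous_on UNIV f \<Longrightarrow> f \<in> borel_measurable lebesgue"
  by (intro measurable_completion) (simp add: borel_measurable_continuous_onI)

lemma measurable_reflect_test:
  assumes "continuous_on UNIV (f :: real^2 \<Rightarrow> real)"
  shows "(\<lambda>y. f (x - y)) \<in> borel_measurable lebesgue"
  by (intro continuous_imp_measurable_lebesgue continuous_on_compose2[OF assms])
    (auto intro!: continuous_intros)

lemma integrable_conv:
  assumes "integrable lebesgue v" "test_function W \<zeta>"
  shows "integrable lebesgue (\<lambda>y. v y * \<zeta> (x - y))"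
proof -
  obtain B where "\<And>x. \<bar>\<zeta> x\<bar> \<le> B" using test_function_bounded[OF assms(2)] by blast
  then show ?thesis
    by (intro integrable_mult_bounded[OF assms(1)] measurable_reflect_test[OF test_function_continuous[OF assms(2)]])
qed

text \<open>The derivative falls on the kernel. The uniform quadratic remainder of the kernel bounds
  the error at h by a constant times |h|^2 times the L^1 norm of \<open>v\<close>.\<close>

lemma has_derivative_conv:
  assumes v: "integrable lebesgue v" and \<zeta>: "test_function W \<zeta>"
  shows "(conv v \<zeta> has_derivative (\<lambda>h. conv v (\<lambda>x. frechet_derivative \<zeta> (at x) h) x)) (at x)"
proof -
  let ?D = "\<lambda>h. conv v (\<lambda>x. frechet_derivative \<zeta> (at x) h) x"
  let ?d = "\<lambda>x. frechet_derivative \<zeta> (at x)"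
  note i = integrable_conv[OF v]
  note id = integrable_conv[OF v test_function_frechet_derivative[OF \<zeta>]]
  have lin: "linear (?d x)" for x
    using has_derivative_linear[OF test_function_has_derivative[OF \<zeta>]] .
  obtain L where L: "L \<ge> 0" "\<And>x h. \<bar>?d x h\<bar> \<le> L * norm h"
    "\<And>x y. \<bar>\<zeta> x - \<zeta> y\<bar> \<le> L * norm (x - y)"
    by (rule test_function_lipschitz[OF \<zeta>], rule that)
  obtain T where T: "\<And>x h. \<bar>\<zeta> (x + h) - \<zeta> x - ?d x h\<bar> \<le> T * (norm h)\<^sup>2"
    by (rule test_function_taylor[OF \<zeta>], rule that)
  let ?I = "LINT y|lebesgue. \<bar>v y\<bar>"
  have lin_D: "linear ?D"
  proof (rule linearI)
    fix h k
    have "?D (h + k) = (LINT y|lebesgue. v y * ?d (x - y) h + v y * ?d (x - y) k)"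
      unfolding conv_def by (simp add: linear_add[OF lin] distrib_left)
    also have "\<dots> = ?D h + ?D k"
      unfolding conv_def by (rule Bochner_Integration.integral_add[OF id id])
    finally show "?D (h + k) = ?D h + ?D k" .
  next
    fix c h
    have "?D (c *\<^sub>R h) = (LINT y|lebesgue. c * (v y * ?d (x - y) h))"
      unfolding conv_def by (simp add: linear_cmul[OF lin] mult.left_commute)
    also have "\<dots> = c *\<^sub>R ?D h" by (simp add: conv_def)
    finally show "?D (c *\<^sub>R h) = c *\<^sub>R ?D h" .
  qed
  then have bl: "bounded_linear ?D" by (rule linear_conv_bounded_linear[THEN iffD1])
  have est: "\<bar>conv v \<zeta> (x + h) - conv v \<zeta> x - ?D h\<bar> \<le> ?I * T * (norm h)\<^sup>2" for h
  proof -
    note ih = i[OF \<zeta>, of "x + h"] and ix = i[OF \<zeta>, of x] and idx = id[of x h]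
    have eq: "v y * \<zeta> (x + h - y) - v y * \<zeta> (x - y) - v y * ?d (x - y) h
        = v y * (\<zeta> ((x - y) + h) - \<zeta> (x - y) - ?d (x - y) h)" for y
      by (simp add: right_diff_distrib diff_add_eq)
    have "conv v \<zeta> (x + h) - conv v \<zeta> x - ?D h =
      (LINT y|lebesgue. v y * \<zeta> (x + h - y) - v y * \<zeta> (x - y) - v y * ?d (x - y) h)"
      unfolding conv_def Bochner_Integration.integral_diff[OF Bochner_Integration.integrable_diff[OF ih ix] idx]
        Bochner_Integration.integral_diff[OF ih ix] ..
    also have "\<dots> = (LINT y|lebesgue. v y * (\<zeta> ((x - y) + h) - \<zeta> (x - y) - ?d (x - y) h))"
      unfolding eq ..
    also have "\<bar>\<dots>\<bar> \<le> (LINT y|lebesgue. \<bar>v y\<bar> * (T * (norm h)\<^sup>2))"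
    proof (rule integral_abs_bound[THEN order_trans], rule Bochner_Integration.integral_mono)
      have "integrable lebesgue (\<lambda>y. v y * (\<zeta> ((x - y) + h) - \<zeta> (x - y) - ?d (x - y) h))"
        using Bochner_Integration.integrable_diff[OF Bochner_Integration.integrable_diff[OF ih ix] idx]
        unfolding eq .
      then show "integrable lebesgue (\<lambda>y. \<bar>v y * (\<zeta> ((x - y) + h) - \<zeta> (x - y) - ?d (x - y) h)\<bar>)"
        by (rule integrable_abs)
      show "integrable lebesgue (\<lambda>y. \<bar>v y\<bar> * (T * (norm h)\<^sup>2))"
        using v by simp
      show "\<bar>v y * (\<zeta> (x - y + h) - \<zeta> (x - y) - ?d (x - y) h)\<bar> \<le> \<bar>v y\<bar> * (T * (norm h)\<^sup>2)" for y
        using T[of "x - y" h] by (simp add: abs_mult mult_left_mono)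
    qed
    finally show ?thesis by simp
  qed
  show ?thesis
  proof (rule has_derivativeI[OF bl])
    have "((\<lambda>y. ?I * T * norm (y - x)) \<longlongrightarrow> ?I * T * norm (x - x)) (at x)"
      by (intro tendsto_intros)
    then have lim: "((\<lambda>y. ?I * T * norm (y - x)) \<longlongrightarrow> 0) (at x)" by simp
    show "((\<lambda>y. (conv v \<zeta> y - conv v \<zeta> x - ?D (y - x)) /\<^sub>R norm (y - x)) \<longlongrightarrow> 0) (at x)"
    proof (rule Lim_null_comparison[OF _ lim], rule always_eventually, rule allI)
      fix y
      show "norm ((conv v \<zeta> y - conv v \<zeta> x - ?D (y - x)) /\<^sub>R norm (y - x)) \<le> ?I * T * norm (y - x)"
        using est[of "y - x"]
        by (cases "y = x") (auto simp: abs_mult divide_simps power2_eq_square mult_ac)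
    qed
  qed
qed

lemma frechet_derivative_conv:
  assumes "integrable lebesgue v" "test_function W \<zeta>"
  shows "frechet_derivative (conv v \<zeta>) (at x) h = conv v (\<lambda>x. frechet_derivative \<zeta> (at x) h) x"
  using frechet_derivative_at[OF has_derivative_conv[OF assms], symmetric] by simp

text \<open>For fixed \<open>v\<close> the convolutions with test functions form a set stable under
  directional derivatives.\<close>

lemma smooth_conv:
  assumes v: "integrable lebesgue v" and "test_function W \<zeta>"
  shows "smooth_on UNIV (conv v \<zeta>)"
proof (rule smooth_on_UNIV_coinduct[where F = "conv v ` {\<zeta>. test_function W \<zeta>}"])
  show "conv v \<zeta> \<in> conv v ` {\<zeta>. test_function W \<zeta>}" using assms by blast
  show "\<exists>f'. (\<forall>x. (f has_derivative f' x) (at x)) \<and>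
          (\<forall>e. (\<lambda>x. f' x e) \<in> conv v ` {\<zeta>. test_function W \<zeta>})"
    if f: "f \<in> conv v ` {\<zeta>. test_function W \<zeta>}" for f
  proof -
    obtain \<zeta> where f: "f = conv v \<zeta>" and \<zeta>: "test_function W \<zeta>" using f by blast
    show ?thesis
      unfolding f
      by (rule exI[of _ "\<lambda>x h. conv v (\<lambda>x. frechet_derivative \<zeta> (at x) h) x"])
        (use has_derivative_conv[OF v \<zeta>] test_function_frechet_derivative[OF \<zeta>] in auto)
  qed
qed

lemma test_function_mollifier: "test_function UNIV (mollifier n)"
  unfolding test_function_def
  by (intro conjI smooth_mollifier exI[of _ "cball 0 (1 / real (Suc n))"])
    (auto intro: mollifier_eq_0)

lemma mollifier_le: "norm y > 1 / real (Suc n) \<Longrightarrow> mollifier n y = 0"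
  by (intro mollifier_eq_0) simp

text \<open>The closed neighbourhood written as a sum set: sums of compact sets are compact, and the
  support of a convolution lies in such a sum.\<close>

definition cthicken :: "real \<Rightarrow> 'a::euclidean_space set \<Rightarrow> 'a set" where
  "cthicken r K = {x + y | x y. x \<in> K \<and> y \<in> cball 0 r}"

lemma compact_cthicken: "compact K \<Longrightarrow> compact (cthicken r K)"
  unfolding cthicken_def by (intro compact_sums compact_cball)

lemma cthicken_mono: "r \<le> s \<Longrightarrow> cthicken r K \<subseteq> cthicken s K"
  unfolding cthicken_def by force

lemma subset_cthicken: "r \<ge> 0 \<Longrightarrow> K \<subseteq> cthicken r K"
  unfolding cthicken_def by force

lemma cthicken_subset_open:
  assumes "compact K" "open W" "K \<subseteq> W"
  obtains r where "r > 0" "cthicken r K \<subseteq> W"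
proof -
  obtain r where r: "r > 0" "(\<Union>x\<in>K. cball x r) \<subseteq> W"
    using compact_subset_open_imp_cball_epsilon_subset[OF assms] .
  have "cthicken r K \<subseteq> (\<Union>x\<in>K. cball x r)"
    by (auto simp: cthicken_def dist_norm)
  with r show thesis by (intro that[of r]) simp_all
qed

lemma conv_eq_0:
  assumes "\<And>y. y \<notin> K \<Longrightarrow> v y = 0" "\<And>y. norm y > r \<Longrightarrow> \<zeta> y = 0" "x \<notin> cthicken r K"
  shows "conv v \<zeta> x = 0"
proof -
  have "v y * \<zeta> (x - y) = 0" for y
  proof (cases "y \<in> K")
    case True
    have "\<not> norm (x - y) \<le> r"
    proof
      assume "norm (x - y) \<le> r"
      then have "x \<in> cthicken r K"
        unfolding cthicken_def using True
        by (intro CollectI exI[of _ y] exI[of _ "x - y"]) auto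
      with assms(3) show False by blast
    qed
    then have "norm (x - y) > r" by simp
    then show ?thesis by (simp add: assms(2))
  qed (simp add: assms(1))
  then show ?thesis unfolding conv_def by (simp only: Bochner_Integration.integral_zero)
qed

lemma test_function_conv_mollifier:
  assumes "integrable lebesgue v" "compact K" "\<And>y. y \<notin> K \<Longrightarrow> v y = 0"
    and "cthicken (1 / real (Suc n)) K \<subseteq> W"
  shows "test_function W (conv v (mollifier n))"
  unfolding test_function_def
  by (intro conjI smooth_conv[OF assms(1) test_function_mollifier] exI[of _ "cthicken (1 / real (Suc n)) K"]
      assms(4) compact_cthicken[OF assms(2)] allI impI conv_eq_0[OF assms(3) mollifier_le])

lemma integral_reflect_translate:
  fixes f :: "'a::euclidean_space \<Rightarrow> real"
  assumes "f \<in> borel_measurable borel"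
  shows "(LINT y|lborel. f (x - y)) = (LINT y|lborel. f y)"
proof -
  have "(lborel :: 'a measure) = distr lborel borel (\<lambda>y. x + (- 1) *\<^sub>R y)"
    using lborel_affine[of "- 1" x] by (simp add: density_1)
  then have "(LINT y|lborel. f y) = (LINT y|distr lborel borel (\<lambda>y. x + (- 1) *\<^sub>R y). f y)"
    by (rule arg_cong[where f = "\<lambda>M. integral\<^sup>L M f"])
  also have "\<dots> = (LINT y|lborel. f (x - y))"
    using assms by (subst integral_distr) auto
  finally show ?thesis by simp
qed

lemma integral_mollifier_reflect: "(LINT y|lebesgue. mollifier n (x - y)) = 1"
proof -
  have [measurable]: "mollifier n \<in> borel_measurable borel"
    by (simp add: borel_measurable_continuous_onI continuous_mollifier)
  have "(LINT y|lebesgue. mollifier n (x - y)) = (LINT y|lborel. mollifier n (x - y))"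
    by (rule integral_completion) measurable
  also have "\<dots> = 1" using integral_reflect_translate[of "mollifier n" x] integral_mollifier by simp
  finally show ?thesis .
qed

text \<open>A nonintegrable function would have integral 0 by convention, and the integral here is
  1.\<close>

lemma integrable_mollifier_reflect: "integrable lebesgue (\<lambda>y. mollifier n (x - y))"
  using integral_mollifier_reflect[of n x] not_integrable_integral_eq by fastforce

lemma continuous_compact_support_integrable_lebesgue:
  fixes f :: "'a::euclidean_space \<Rightarrow> real"
  assumes "continuous_on UNIV f" "compact K" "\<And>x. x \<notin> K \<Longrightarrow> f x = 0"
  shows "integrable lebesgue f"
  by (intro integrable_completion[THEN iffD2] continuous_compact_support_integrable[OF assms]
     borel_measurable_integrable)

text \<open>The mollifier is a probability density, so the difference is the average of
  \<open>v y - v x\<close>, and only points within the radius of the kernel contribute.\<close>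

lemma conv_mollifier_close:
  assumes v: "continuous_on UNIV v" "compact K" "\<And>y. y \<notin> K \<Longrightarrow> v y = 0"
    and near: "\<And>y. norm (x - y) \<le> 1 / real (Suc n) \<Longrightarrow> \<bar>v y - v x\<bar> \<le> e"
  shows "\<bar>conv v (mollifier n) x - v x\<bar> \<le> e"
proof -
  note iv = continuous_compact_support_integrable_lebesgue[OF v]
  note i1 = integrable_conv[OF iv test_function_mollifier[of n], of x]
  note i2 = integrable_mult_right[OF integrable_mollifier_reflect, of "v x" n x]
  have "conv v (mollifier n) x - v x = (LINT y|lebesgue. v y * mollifier n (x - y)) 
      - (LINT y|lebesgue. v x * mollifier n (x - y))"
    by (simp add: conv_def integral_mollifier_reflect)
  also have "\<dots> = (LINT y|lebesgue. (v y - v x) * mollifier n (x - y))"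
    using Bochner_Integration.integral_diff[OF i1 i2] by (simp add: left_diff_distrib)
  also have "\<bar>\<dots>\<bar> \<le> (LINT y|lebesgue. e * mollifier n (x - y))"
  proof (rule integral_abs_bound[THEN order_trans], rule Bochner_Integration.integral_mono)
    show "integrable lebesgue (\<lambda>y. \<bar>(v y - v x) * mollifier n (x - y)\<bar>)"
      using Bochner_Integration.integrable_diff[OF i1 i2] by (simp add: left_diff_distrib)
    show "integrable lebesgue (\<lambda>y. e * mollifier n (x - y))"
      by (intro integrable_mult_right integrable_mollifier_reflect)
    show "\<bar>(v y - v x) * mollifier n (x - y)\<bar> \<le> e * mollifier n (x - y)" for y
    proof (cases "norm (x - y) \<le> 1 / real (Suc n)")
      case True
      then show ?thesis using near[of y] mollifier_nonneg by (simp add: abs_mult mult_right_mono)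
    next
      case False
      then show ?thesis using mollifier_le[of n "x - y"] by simp
    qed
  qed
  also have "\<dots> = e" by (simp add: integral_mollifier_reflect)
  finally show ?thesis .
qed

text \<open>Two points closer than 1 either both lie in the compact thickening of radius 1, where
  the Heine-Cantor theorem applies, or both lie off \<open>K\<close>, where the values are
  zero.\<close>

lemma compact_support_uniformly_continuous:
  fixes f :: "'a::euclidean_space \<Rightarrow> real"
  assumes "continuous_on UNIV f" "compact K" "\<And>x. x \<notin> K \<Longrightarrow> f x = 0"
  shows "uniformly_continuous_on UNIV f"
proof -
  have "uniformly_continuous_on (cthicken 1 K) f"
    using compact_uniformly_continuous[OF continuous_on_subset[OF assms(1)] compact_cthicken[OF assms(2)]] by simp
  show ?thesis
    unfolding uniformly_continuous_on_def
  proof (intro allI impI)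
    fix e :: real assume "e > 0"
    then obtain d where d: "d > 0" "\<And>x y. x \<in> cthicken 1 K \<Longrightarrow> y \<in> cthicken 1 K \<Longrightarrow> dist y x < d \<Longrightarrow> dist (f y) (f x) < e"
      using \<open>uniformly_continuous_on (cthicken 1 K) f\<close> unfolding uniformly_continuous_on_def by metis
    have near: "y \<in> cthicken 1 K" if "x \<in> K" "dist y x < 1" for x y
      unfolding cthicken_def using that
      by (intro CollectI exI[of _ x] exI[of _ "y - x"]) (simp add: dist_norm norm_minus_commute)
    have "dist (f y) (f x) < e" if "dist y x < min d 1" for x y
    proof (cases "x \<in> K \<or> y \<in> K")
      case True
      then have "x \<in> cthicken 1 K" "y \<in> cthicken 1 K"
        using near[of x y] near[of y x] that subset_cthicken[of 1 K] by (auto simp: dist_commute)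
      then show ?thesis using d that by auto
    next
      case False
      then show ?thesis using assms(3) \<open>e > 0\<close> by simp
    qed
    then show "\<exists>d>0. \<forall>x\<in>UNIV. \<forall>x'\<in>UNIV. dist x' x < d \<longrightarrow> dist (f x') (f x) < e"
      using d(1) by (intro exI[of _ "min d 1"]) auto
  qed
qed

lemma conv_mollifier_uniform:
  assumes v: "continuous_on UNIV v" "compact K" "\<And>y. y \<notin> K \<Longrightarrow> v y = 0" and "e > 0"
  shows "\<forall>\<^sub>F n in sequentially. \<forall>x. \<bar>conv v (mollifier n) x - v x\<bar> \<le> e"
proof -
  obtain d where d: "d > 0" "\<And>x y. dist y x < d \<Longrightarrow> dist (v y) (v x) < e"
    using compact_support_uniformly_continuous[OF v] \<open>e > 0\<close>
    unfolding uniformly_continuous_on_def by (metis UNIV_I)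
  have "(\<lambda>n. 1 / real (Suc n)) \<longlonglongrightarrow> 0"
    using LIMSEQ_inverse_real_of_nat by (simp add: inverse_eq_divide)
  then have "\<forall>\<^sub>F n in sequentially. 1 / real (Suc n) < d"
    using order_tendstoD(2) \<open>d > 0\<close> by blast
  then show ?thesis
  proof eventually_elim
    case (elim n)
    show ?case
    proof
      fix x
      show "\<bar>conv v (mollifier n) x - v x\<bar> \<le> e"
      proof (rule conv_mollifier_close[OF v])
        show "\<bar>v y - v x\<bar> \<le> e" if "norm (x - y) \<le> 1 / real (Suc n)" for y
          using d(2)[of y x] that elim by (auto simp: dist_norm norm_minus_commute)
      qed
    qed
  qed
qed

subsection \<open>Weak convergence of mollifications\<close>

text \<open>Measurability is listed separately, since integrability of the square does not imply
  measurability of the function.\<close>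

definition sq_int :: "(real^2 \<Rightarrow> real) \<Rightarrow> bool" where
  "sq_int f \<longleftrightarrow> f \<in> borel_measurable lebesgue \<and> integrable lebesgue (\<lambda>x. (f x)\<^sup>2)"

lemma sq_int_measurable: "sq_int f \<Longrightarrow> f \<in> borel_measurable lebesgue"
  and sq_int_integrable: "sq_int f \<Longrightarrow> integrable lebesgue (\<lambda>x. (f x)\<^sup>2)"
  by (auto simp: sq_int_def)

text \<open>Expand the square of a|x| - |y|. The free weight \<open>a\<close> takes the place of the
  Cauchy-Schwarz inequality: either of the two squares can be given a small coefficient at the
  expense of the other.\<close>

lemma abs_mult_le_weighted_squares:
  fixes x y a :: real assumes "a > 0"
  shows "\<bar>x * y\<bar> \<le> a / 2 * x\<^sup>2 + 1 / (2 * a) * y\<^sup>2"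
proof -
  have "0 \<le> (a * \<bar>x\<bar> - \<bar>y\<bar>)\<^sup>2" by simp
  then have "2 * a * \<bar>x * y\<bar> \<le> a\<^sup>2 * x\<^sup>2 + y\<^sup>2"
    by (simp add: power2_diff power_mult_distrib abs_mult mult_ac)
  then have "\<bar>x * y\<bar> \<le> (a\<^sup>2 * x\<^sup>2 + y\<^sup>2) / (2 * a)"
    using assms by (simp add: pos_le_divide_eq mult_ac)
  also have "\<dots> = a / 2 * x\<^sup>2 + 1 / (2 * a) * y\<^sup>2"
    using assms by (simp add: add_divide_distrib power2_eq_square)
  finally show ?thesis .
qed

lemma sq_int_mult_integrable:
  assumes "sq_int f" "sq_int g" shows "integrable lebesgue (\<lambda>x. f x * g x)"
proof (rule Bochner_Integration.integrable_bound)
  show "integrable lebesgue (\<lambda>x. 1 / 2 * (f x)\<^sup>2 + 1 / 2 * (g x)\<^sup>2)"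
    using assms by (intro Bochner_Integration.integrable_add integrable_mult_right sq_int_integrable)
  show "(\<lambda>x. f x * g x) \<in> borel_measurable lebesgue"
    using assms by (intro borel_measurable_times sq_int_measurable)
  show "AE x in lebesgue. norm (f x * g x) \<le> norm (1 / 2 * (f x)\<^sup>2 + 1 / 2 * (g x)\<^sup>2)"
    using abs_mult_le_weighted_squares[of 1] by (intro AE_I2) (auto intro: order_trans)
qed

lemma sq_int_add:
  assumes "sq_int f" "sq_int g" shows "sq_int (\<lambda>x. f x + g x)"
  using assms sq_int_mult_integrable[OF assms]
  by (auto simp: sq_int_def power2_sum mult.assoc)

lemma sq_int_cmult: "sq_int f \<Longrightarrow> sq_int (\<lambda>x. c * f x)"
  by (auto simp: sq_int_def power_mult_distrib)

lemma sq_int_diff: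
  assumes "sq_int f" "sq_int g" shows "sq_int (\<lambda>x. f x - g x)"
  using sq_int_add[OF assms(1) sq_int_cmult[OF assms(2), of "- 1"]] by simp

lemma sq_int_bounded_mult:
  assumes "sq_int f" "g \<in> borel_measurable lebesgue" "\<And>x. \<bar>g x\<bar> \<le> B"
  shows "sq_int (\<lambda>x. g x * f x)"
proof -
  have "integrable lebesgue (\<lambda>x. (f x)\<^sup>2 * (g x)\<^sup>2)"
  proof (rule integrable_mult_bounded[where B = "B\<^sup>2"])
    show "\<bar>(g x)\<^sup>2\<bar> \<le> B\<^sup>2" for x
      using power_mono[OF assms(3)[of x], of 2] by simp
  qed (use assms in \<open>auto simp: sq_int_def\<close>)
  then show ?thesis
    using assms borel_measurable_times[OF assms(2) sq_int_measurable[OF assms(1)]]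
    by (simp add: sq_int_def power_mult_distrib mult.commute)
qed

lemma integrable_indicator_compact:
  fixes K :: "'a::euclidean_space set"
  assumes "compact K" shows "integrable lebesgue (indicator K :: 'a \<Rightarrow> real)"
  using lmeasurable_compact[OF assms] by (intro integrable_real_indicator) (auto simp: fmeasurable_def)

lemma bounded_compact_support_integrable:
  fixes f :: "real^2 \<Rightarrow> real"
  assumes "f \<in> borel_measurable lebesgue" "\<And>x. \<bar>f x\<bar> \<le> B" "compact K" "\<And>x. x \<notin> K \<Longrightarrow> f x = 0"
  shows "integrable lebesgue f"
proof (rule Bochner_Integration.integrable_bound[OF _ assms(1)])
  show "integrable lebesgue (\<lambda>x. B * indicator K x)"
    by (intro integrable_mult_right integrable_indicator_compact assms(3))
  show "AE x in lebesgue. norm (f x) \<le> norm (B * indicator K x)"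
  proof (rule AE_I2)
    fix x
    have "\<bar>f x\<bar> \<le> \<bar>B\<bar>" using assms(2)[of x] by linarith
    then show "norm (f x) \<le> norm (B * indicator K x)"
      using assms(4)[of x] by (simp add: indicator_def)
  qed
qed

lemma sq_int_bounded_compact_support:
  assumes "f \<in> borel_measurable lebesgue" "\<And>x. \<bar>f x\<bar> \<le> B" "compact K" "\<And>x. x \<notin> K \<Longrightarrow> f x = 0"
  shows "sq_int f"
  unfolding sq_int_def
proof
  show "integrable lebesgue (\<lambda>x. (f x)\<^sup>2)"
    by (rule bounded_compact_support_integrable[of _ "B\<^sup>2", OF _ _ assms(3)])
      (use assms in \<open>auto simp flip: abs_le_square_iff intro: order_trans[OF _ abs_ge_self]\<close>)
qed fact

lemma sq_int_continuous:
  assumes "continuous_on UNIV f" "compact K" "\<And>x. x \<notin> K \<Longrightarrow> f x = 0"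
  shows "sq_int f"
proof -
  obtain B where "B \<ge> 0" "\<And>x. \<bar>f x\<bar> \<le> B"
    using bounded_continuous_compact_support[OF assms(1,2)] assms(3) by metis
  then show ?thesis
    using sq_int_bounded_compact_support[OF continuous_imp_measurable_lebesgue[OF assms(1)] _ assms(2,3)]
    by blast
qed

lemma sq_int_imp_integrable:
  assumes "sq_int f" "compact K" "\<And>x. x \<notin> K \<Longrightarrow> f x = 0"
  shows "integrable lebesgue f"
proof -
  have "sq_int (indicator K :: real^2 \<Rightarrow> real)"
    using assms(2) borel_measurable_integrable[OF integrable_indicator_compact[OF assms(2)]]
    by (intro sq_int_bounded_compact_support[of _ 1 K]) (auto simp: indicator_def)
  from sq_int_mult_integrable[OF assms(1) this] show ?thesis
  proof (rule Bochner_Integration.integrable_cong[THEN iffD1, rotated 2])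
    show "f x * indicator K x = f x" for x using assms(3)[of x] by (auto simp: indicator_def)
  qed simp
qed

lemma continuous_conv:
  "integrable lebesgue v \<Longrightarrow> test_function W \<zeta> \<Longrightarrow> continuous_on UNIV (conv v \<zeta>)"
  by (intro smooth_on_imp_continuous_on smooth_conv)

lemma sq_int_conv_mollifier:
  assumes "sq_int v" "compact K" "\<And>x. x \<notin> K \<Longrightarrow> v x = 0"
  shows "sq_int (conv v (mollifier n))"
  by (rule sq_int_continuous[OF continuous_conv[OF sq_int_imp_integrable[OF assms] test_function_mollifier]
        compact_cthicken[OF assms(2)] conv_eq_0[OF assms(3) mollifier_le]])

lemma nn_integral_mollifier:
  "(\<integral>\<^sup>+ y. ennreal (mollifier n (x - y)) \<partial>lborel) = 1"
proof -
  have "(\<integral>\<^sup>+ y. ennreal (mollifier n (x - y)) \<partial>lborel) = (\<integral>\<^sup>+ y. ennreal (mollifier n (x - y)) \<partial>lebesgue)"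
    by (simp add: nn_integral_completion)
  also have "\<dots> = 1"
    using nn_integral_eq_integral[OF integrable_mollifier_reflect[of n x]]
    by (simp add: mollifier_nonneg integral_mollifier_reflect)
  finally show ?thesis .
qed

text \<open>Young's inequality with weight \<open>a\<close> turns the bilinear form into two squares, in each of which
  the mollifier integrates to 1.\<close>

lemma integral_conv_mollifier_bound:
  assumes f: "sq_int f" and k: "sq_int k" "compact K" "\<And>x. x \<notin> K \<Longrightarrow> k x = 0" and a: "a > 0"
  shows "\<bar>LINT x|lebesgue. f x * conv k (mollifier n) x\<bar>
      \<le> a / 2 * (LINT x|lebesgue. (f x)\<^sup>2) + 1 / (2 * a) * (LINT x|lebesgue. (k x)\<^sup>2)"
proof -
  let ?\<eta> = "mollifier n"
  have [measurable]: "?\<eta> \<in> borel_measurable borel"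
    by (simp add: borel_measurable_continuous_onI continuous_mollifier)
  \<comment> \<open>The order of integration is exchanged on \<open>lborel\<close>, so the Lebesgue
    measurable factors are replaced by Borel functions that agree with them almost
    everywhere.\<close>
  obtain f' where f'[measurable]: "f' \<in> borel_measurable lborel" "AE x in lborel. f x = f' x"
    using completion_ex_borel_measurable_real sq_int_measurable[OF f] by blast
  obtain k' where k'[measurable]: "k' \<in> borel_measurable lborel" "AE x in lborel. k x = k' x"
    using completion_ex_borel_measurable_real sq_int_measurable[OF k(1)] by blast
  have [measurable]: "f' \<in> borel_measurable borel" "k' \<in> borel_measurable borel" using f' k' by auto
  let ?c = "conv k ?\<eta>"
  have sc: "sq_int ?c" by (rule sq_int_conv_mollifier[OF k])
  have ck: "ennreal \<bar>?c x\<bar> \<le> (\<integral>\<^sup>+ y. ennreal (\<bar>k' y\<bar> * ?\<eta> (x - y)) \<partial>lborel)" for x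
  proof -
    have "ennreal \<bar>?c x\<bar> \<le> (\<integral>\<^sup>+ y. ennreal \<bar>k y * ?\<eta> (x - y)\<bar> \<partial>lebesgue)"
      unfolding conv_def
      using integral_norm_bound_ennreal[OF integrable_conv[OF sq_int_imp_integrable[OF k] test_function_mollifier[of n], of x]]
      by simp
    also have "\<dots> = (\<integral>\<^sup>+ y. ennreal (\<bar>k' y\<bar> * ?\<eta> (x - y)) \<partial>lebesgue)"
      by (rule nn_integral_cong_AE) (use AE_completion[OF k'(2)] in \<open>auto simp: abs_mult mollifier_nonneg\<close>)
    finally show ?thesis by (simp add: nn_integral_completion)
  qed
  have pt: "\<bar>f' x\<bar> * (\<bar>k' y\<bar> * ?\<eta> (x - y)) \<le> a / 2 * (f' x)\<^sup>2 * ?\<eta> (x - y) + 1 / (2 * a) * (k' y)\<^sup>2 * ?\<eta> (x - y)" for x y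
    using mult_right_mono[OF abs_mult_le_weighted_squares[OF a, of "f' x" "k' y"] mollifier_nonneg[of n "x - y"]]
    by (simp add: abs_mult algebra_simps)
  have int_f: "(\<integral>\<^sup>+ x. ennreal ((f' x)\<^sup>2) \<partial>lborel) = ennreal (LINT x|lebesgue. (f x)\<^sup>2)"
  proof -
    have "(\<integral>\<^sup>+ x. ennreal ((f' x)\<^sup>2) \<partial>lborel) = (\<integral>\<^sup>+ x. ennreal ((f x)\<^sup>2) \<partial>lebesgue)"
      unfolding nn_integral_completion[symmetric, of lborel "\<lambda>x. ennreal ((f' x)\<^sup>2)"]
      by (rule nn_integral_cong_AE) (use AE_completion[OF f'(2)] in auto)
    then show ?thesis using nn_integral_eq_integral[OF sq_int_integrable[OF f]] by simp
  qed
  have int_k: "(\<integral>\<^sup>+ x. ennreal ((k' x)\<^sup>2) \<partial>lborel) = ennreal (LINT x|lebesgue. (k x)\<^sup>2)"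
  proof -
    have "(\<integral>\<^sup>+ x. ennreal ((k' x)\<^sup>2) \<partial>lborel) = (\<integral>\<^sup>+ x. ennreal ((k x)\<^sup>2) \<partial>lebesgue)"
      unfolding nn_integral_completion[symmetric, of lborel "\<lambda>x. ennreal ((k' x)\<^sup>2)"]
      by (rule nn_integral_cong_AE) (use AE_completion[OF k'(2)] in auto)
    then show ?thesis using nn_integral_eq_integral[OF sq_int_integrable[OF k(1)]] by simp
  qed
  \<comment> \<open>By symmetry the mollifier also integrates to 1 in the first variable; this
    handles the square of \<open>k'\<close>.\<close>
  have m2: "(\<integral>\<^sup>+ x. ennreal (?\<eta> (x - y)) \<partial>lborel) = 1" for y
    using nn_integral_mollifier[of n y] mollifier_minus[of n "_ - y"] by simp
  have "ennreal \<bar>LINT x|lebesgue. f x * ?c x\<bar> \<le> (\<integral>\<^sup>+ x. ennreal \<bar>f x * ?c x\<bar> \<partial>lebesgue)"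
    using integral_norm_bound_ennreal[OF sq_int_mult_integrable[OF f sc]] by simp
  also have "\<dots> = (\<integral>\<^sup>+ x. ennreal \<bar>f' x\<bar> * ennreal \<bar>?c x\<bar> \<partial>lebesgue)"
    by (rule nn_integral_cong_AE) (use AE_completion[OF f'(2)] in \<open>auto simp: abs_mult ennreal_mult\<close>)
  also have "\<dots> = (\<integral>\<^sup>+ x. ennreal \<bar>f' x\<bar> * ennreal \<bar>?c x\<bar> \<partial>lborel)"
    by (rule nn_integral_completion)
  also have "\<dots> \<le> (\<integral>\<^sup>+ x. ennreal \<bar>f' x\<bar> * (\<integral>\<^sup>+ y. ennreal (\<bar>k' y\<bar> * ?\<eta> (x - y)) \<partial>lborel) \<partial>lborel)"
    by (intro nn_integral_mono mult_left_mono ck) simp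
  also have "\<dots> = (\<integral>\<^sup>+ x. (\<integral>\<^sup>+ y. ennreal (\<bar>f' x\<bar> * (\<bar>k' y\<bar> * ?\<eta> (x - y))) \<partial>lborel) \<partial>lborel)"
    by (subst nn_integral_cmult[symmetric]) (auto simp: ennreal_mult mollifier_nonneg)
  also have "\<dots> \<le> (\<integral>\<^sup>+ x. (\<integral>\<^sup>+ y. ennreal (a / 2 * (f' x)\<^sup>2) * ennreal (?\<eta> (x - y)) + 
       ennreal (1 / (2 * a) * (k' y)\<^sup>2) * ennreal (?\<eta> (x - y)) \<partial>lborel) \<partial>lborel)"
  proof (intro nn_integral_mono)
    fix x y
    have "ennreal (\<bar>f' x\<bar> * (\<bar>k' y\<bar> * ?\<eta> (x - y))) \<le> 
      ennreal (a / 2 * (f' x)\<^sup>2 * ?\<eta> (x - y) + 1 / (2 * a) * (k' y)\<^sup>2 * ?\<eta> (x - y))"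
      by (rule ennreal_leI[OF pt])
    also have "\<dots> = ennreal (a / 2 * (f' x)\<^sup>2) * ennreal (?\<eta> (x - y)) + 
       ennreal (1 / (2 * a) * (k' y)\<^sup>2) * ennreal (?\<eta> (x - y))"
      using a by (simp add: ennreal_mult[symmetric] ennreal_plus mollifier_nonneg)
    finally show "ennreal (\<bar>f' x\<bar> * (\<bar>k' y\<bar> * ?\<eta> (x - y))) \<le> \<dots>" .
  qed
  also have "\<dots> = (\<integral>\<^sup>+ x. (\<integral>\<^sup>+ y. ennreal (a / 2 * (f' x)\<^sup>2) * ennreal (?\<eta> (x - y)) \<partial>lborel) \<partial>lborel) +
     (\<integral>\<^sup>+ x. (\<integral>\<^sup>+ y. ennreal (1 / (2 * a) * (k' y)\<^sup>2) * ennreal (?\<eta> (x - y)) \<partial>lborel) \<partial>lborel)"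
    by (subst nn_integral_add, simp, simp)+ simp
  also have "(\<integral>\<^sup>+ x. (\<integral>\<^sup>+ y. ennreal (a / 2 * (f' x)\<^sup>2) * ennreal (?\<eta> (x - y)) \<partial>lborel) \<partial>lborel) 
      = (\<integral>\<^sup>+ x. ennreal (a / 2) * ennreal ((f' x)\<^sup>2) \<partial>lborel)"
    using a by (subst nn_integral_cmult) (auto simp: nn_integral_mollifier ennreal_mult[symmetric])
  also have "\<dots> = ennreal (a / 2 * (LINT x|lebesgue. (f x)\<^sup>2))"
    using a by (subst nn_integral_cmult) (auto simp: int_f ennreal_mult[symmetric])
  also have "(\<integral>\<^sup>+ x. (\<integral>\<^sup>+ y. ennreal (1 / (2 * a) * (k' y)\<^sup>2) * ennreal (?\<eta> (x - y)) \<partial>lborel) \<partial>lborel)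
     = (\<integral>\<^sup>+ y. (\<integral>\<^sup>+ x. ennreal (1 / (2 * a) * (k' y)\<^sup>2) * ennreal (?\<eta> (x - y)) \<partial>lborel) \<partial>lborel)"
    by (rule lborel_pair.Fubini') simp
  also have "\<dots> = (\<integral>\<^sup>+ y. ennreal (1 / (2 * a)) * ennreal ((k' y)\<^sup>2) \<partial>lborel)"
    using a by (subst nn_integral_cmult) (auto simp: m2 ennreal_mult[symmetric])
  also have "\<dots> = ennreal (1 / (2 * a) * (LINT x|lebesgue. (k x)\<^sup>2))"
    using a by (subst nn_integral_cmult) (auto simp: int_k ennreal_mult[symmetric])
  also have "ennreal (a / 2 * (LINT x|lebesgue. (f x)\<^sup>2)) + \<dots> = 
     ennreal (a / 2 * (LINT x|lebesgue. (f x)\<^sup>2) + 1 / (2 * a) * (LINT x|lebesgue. (k x)\<^sup>2))"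
    using a by (simp add: ennreal_plus)
  finally show ?thesis
    using a by (subst (asm) ennreal_le_iff) auto
qed

text \<open>A Lebesgue measurable function is an almost everywhere limit of continuous ones;
  clipping these to [-N, N] and multiplying by a cutoff keeps the bound and puts all supports into
  one compact subset of \<open>W\<close>.\<close>

lemma bounded_measurable_approx:
  fixes h :: "real^2 \<Rightarrow> real"
  assumes h: "h \<in> borel_measurable lebesgue" "\<And>x. \<bar>h x\<bar> \<le> N"
    and K: "compact K" "\<And>x. x \<notin> K \<Longrightarrow> h x = 0" and W: "open W" "K \<subseteq> W"
  shows "\<exists>K' g. compact K' \<and> K \<subseteq> K' \<and> K' \<subseteq> W \<and> (\<forall>n. continuous_on UNIV (g n)) \<and>
    (\<forall>n x. \<bar>g n x\<bar> \<le> N) \<and> (\<forall>n x. x \<notin> K' \<longrightarrow> g n x = 0) \<and>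
    (AE x in lebesgue. (\<lambda>n::nat. g n x) \<longlonglongrightarrow> h x)"
proof (cases "K = {}")
  case True
  then have h0: "h = (\<lambda>_. 0)" using K(2) by auto
  have "N \<ge> 0" using h(2)[of undefined] by linarith
  then show ?thesis
    unfolding h0 True by (intro exI[of _ "{}"] exI[of _ "\<lambda>_ _. 0"]) auto
next
  case False
  obtain r where r: "r > 0" "cthicken r K \<subseteq> W" by (rule cthicken_subset_open[OF K(1) W])
  \<comment> \<open>Piecewise linear in the distance to \<open>K\<close>: equal to 1 on
    \<open>K\<close>, and 0 from distance r on.\<close>
  define cut where "cut x = max 0 (1 - infdist x K / r)" for x
  have N: "N \<ge> 0" using h(2)[of undefined] by linarith
  have cutc: "continuous_on UNIV cut"
    unfolding cut_def by (intro continuous_intros) (use r in auto)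
  have cut1: "\<bar>cut x\<bar> \<le> 1" for x
    using r infdist_nonneg[of x K] by (auto simp: cut_def field_simps)
  have cutK: "cut x = 1" if "x \<in> K" for x using that by (simp add: cut_def)
  have cut0: "cut x = 0" if "x \<notin> cthicken r K" for x
  proof -
    obtain y where y: "y \<in> K" "infdist x K = dist x y"
      using infdist_attains_inf[OF compact_imp_closed[OF K(1)] False] by blast
    have "\<not> infdist x K < r"
    proof
      assume "infdist x K < r"
      then have "x = y + (x - y) \<and> y \<in> K \<and> x - y \<in> cball 0 r"
        using y by (simp add: dist_norm norm_minus_commute)
      then have "x \<in> cthicken r K" unfolding cthicken_def by blast
      with that show False by simp
    qed
    then show ?thesis using r(1) by (simp add: cut_def field_simps)
  qed
  have "h measurable_on UNIV"
    using h(1) lebesgue_measurable_imp_measurable_on[of h UNIV] by (simp add: lebesgue_on_UNIV_eq)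
  then obtain N0 g where g: "negligible N0" "\<And>n. continuous_on UNIV (g n)"
     "\<And>x. x \<notin> N0 \<Longrightarrow> (\<lambda>n. g n x) \<longlonglongrightarrow> h x"
    unfolding measurable_on_def by auto
  define g' where "g' n x = cut x * max (- N) (min N (g n x))" for n :: nat and x
  have lim: "(\<lambda>n. g' n x) \<longlonglongrightarrow> h x" if "x \<notin> N0" for x
  proof -
    have "(\<lambda>n. g' n x) \<longlonglongrightarrow> cut x * max (- N) (min N (h x))"
      unfolding g'_def by (intro tendsto_intros g(3) that)
    moreover have "max (- N) (min N (h x)) = h x" using h(2)[of x] by auto
    moreover have "cut x * h x = h x" using cutK[of x] K(2)[of x] by (cases "x \<in> K") auto
    ultimately show ?thesis by simp
  qed
  have b: "\<bar>g' n x\<bar> \<le> N" for n x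
  proof -
    have "\<bar>g' n x\<bar> \<le> 1 * N"
      unfolding g'_def abs_mult using cut1 N by (intro mult_mono) auto
    then show ?thesis by simp
  qed
  have "AE x in lebesgue. x \<notin> N0"
    using g(1) by (simp add: negligible_iff_null_sets AE_not_in)
  then have "AE x in lebesgue. (\<lambda>n. g' n x) \<longlonglongrightarrow> h x"
    by (rule AE_mp) (auto intro!: AE_I2 lim)
  moreover have "continuous_on UNIV (g' n)" for n
    unfolding g'_def by (intro continuous_intros cutc g(2))
  moreover have "g' n x = 0" if "x \<notin> cthicken r K" for n x
    using cut0[OF that] by (simp add: g'_def)
  ultimately show ?thesis
    using compact_cthicken[OF K(1)] r b subset_cthicken[of r K] by (intro exI[of _ "cthicken r K"] exI[of _ g']) auto
qed

text \<open>Clip \<open>h\<close> at height n, then approximate the clipped function by bounded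
  continuous ones; both steps converge in mean square by dominated convergence. The thresholds e/4
  absorb the factor 2 in (x + y)^2 \<le> 2 x^2 + 2 y^2.\<close>

lemma sq_int_continuous_approx:
  assumes h: "sq_int h" and K: "compact K" "\<And>x. x \<notin> K \<Longrightarrow> h x = 0" and e: "e > 0"
  shows "\<exists>k K'. continuous_on UNIV k \<and> compact K' \<and> (\<forall>x. x \<notin> K' \<longrightarrow> k x = 0) \<and>
     (LINT x|lebesgue. (h x - k x)\<^sup>2) < e"
proof -
  define t where "t n x = max (- real n) (min (real n) (h x))" for n x
  have tm: "t n \<in> borel_measurable lebesgue" for n
    unfolding t_def using sq_int_measurable[OF h] by measurable
  have tb: "\<bar>t n x\<bar> \<le> real n" for n x by (auto simp: t_def)
  have t0: "t n x = 0" if "x \<notin> K" for n x using K(2)[OF that] by (simp add: t_def)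
  have st: "sq_int (t n)" for n by (rule sq_int_bounded_compact_support[OF tm tb K(1) t0])
  have "(\<lambda>n. LINT x|lebesgue. (h x - t n x)\<^sup>2) \<longlonglongrightarrow> (LINT x|(lebesgue :: (real^2) measure). 0)"
  proof (rule integral_dominated_convergence[where w = "\<lambda>x. (h x)\<^sup>2" and f = "\<lambda>x. 0"])
    show "integrable lebesgue (\<lambda>x. (h x)\<^sup>2)" by (rule sq_int_integrable[OF h])
    show "(\<lambda>x. (h x - t n x)\<^sup>2) \<in> borel_measurable lebesgue" for n
      using sq_int_measurable[OF h] tm[of n] by measurable
    show "AE x in lebesgue. (\<lambda>n. (h x - t n x)\<^sup>2) \<longlonglongrightarrow> 0"
    proof (rule AE_I2)
      fix x
      obtain n0 :: nat where n0: "\<bar>h x\<bar> \<le> real n0" using real_arch_simple by blast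
      have "\<forall>\<^sub>F n in sequentially. (h x - t n x)\<^sup>2 = 0"
        using eventually_ge_at_top[of n0] by eventually_elim (use n0 in \<open>auto simp: t_def\<close>)
      then show "(\<lambda>n. (h x - t n x)\<^sup>2) \<longlonglongrightarrow> 0" by (rule tendsto_eventually)
    qed
    show "AE x in lebesgue. norm ((h x - t n x)\<^sup>2) \<le> (h x)\<^sup>2" for n
    proof (rule AE_I2)
      fix x
      have "\<bar>h x - t n x\<bar> \<le> \<bar>h x\<bar>" by (auto simp: t_def)
      then show "norm ((h x - t n x)\<^sup>2) \<le> (h x)\<^sup>2" by (simp add: abs_le_square_iff)
    qed
  qed simp
  then have "\<forall>\<^sub>F n in sequentially. (LINT x|lebesgue. (h x - t n x)\<^sup>2) < e / 4"
    using e by (intro order_tendstoD(2)) auto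
  then obtain n where n: "(LINT x|lebesgue. (h x - t n x)\<^sup>2) < e / 4"
    using eventually_happens trivial_limit_sequentially by blast
  obtain K' g where K': "compact K'" and g: "\<And>n. continuous_on UNIV (g n)" 
     "\<And>j x. \<bar>g j x\<bar> \<le> real n" "\<And>n x. x \<notin> K' \<Longrightarrow> g n x = 0" and
     glim: "AE x in lebesgue. (\<lambda>j::nat. g j x) \<longlonglongrightarrow> t n x"
    using bounded_measurable_approx[OF tm tb K(1) t0 open_UNIV subset_UNIV, of n] by blast
  have sg: "sq_int (g j)" for j by (rule sq_int_continuous[OF g(1) K' g(3)])
  have "(\<lambda>j. LINT x|lebesgue. (t n x - g j x)\<^sup>2) \<longlonglongrightarrow> (LINT x|(lebesgue :: (real^2) measure). 0)"
  proof (rule integral_dominated_convergence[where w = "\<lambda>x. (2 * real n)\<^sup>2 * indicator (K \<union> K') x" and f = "\<lambda>x. 0"])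
    show "integrable lebesgue (\<lambda>x. (2 * real n)\<^sup>2 * indicator (K \<union> K') x)"
      by (intro integrable_mult_right integrable_indicator_compact compact_Un K(1) K')
    show "(\<lambda>x. (t n x - g j x)\<^sup>2) \<in> borel_measurable lebesgue" for j
      using sq_int_measurable[OF sg[of j]] tm[of n] by measurable
    show "AE x in lebesgue. (\<lambda>j. (t n x - g j x)\<^sup>2) \<longlonglongrightarrow> 0"
      using glim
    proof eventually_elim
      case (elim x)
      have "(\<lambda>j. (t n x - g j x)\<^sup>2) \<longlonglongrightarrow> (t n x - t n x)\<^sup>2"
        by (intro tendsto_intros elim)
      then show ?case by simp
    qed
    show "AE x in lebesgue. norm ((t n x - g j x)\<^sup>2) \<le> (2 * real n)\<^sup>2 * indicator (K \<union> K') x" for j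
    proof (rule AE_I2)
      fix x
      show "norm ((t n x - g j x)\<^sup>2) \<le> (2 * real n)\<^sup>2 * indicator (K \<union> K') x"
      proof (cases "x \<in> K \<union> K'")
        case True
        have "\<bar>t n x - g j x\<bar> \<le> 2 * real n" using tb[of n x] g(2)[of j x] by linarith
        then have "(t n x - g j x)\<^sup>2 \<le> (2 * real n)\<^sup>2"
          using abs_le_square_iff[of "t n x - g j x" "2 * real n"] by simp
        then show ?thesis using True by simp
      next
        case False
        then show ?thesis using t0[of x n] g(3)[of x j] by simp
      qed
    qed
  qed simp
  then have "\<forall>\<^sub>F j in sequentially. (LINT x|lebesgue. (t n x - g j x)\<^sup>2) < e / 4"
    using e by (intro order_tendstoD(2)) auto
  then obtain j where j: "(LINT x|lebesgue. (t n x - g j x)\<^sup>2) < e / 4"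
    using eventually_happens trivial_limit_sequentially by blast
  have "(LINT x|lebesgue. (h x - g j x)\<^sup>2) \<le> 
     (LINT x|lebesgue. 2 * (h x - t n x)\<^sup>2 + 2 * (t n x - g j x)\<^sup>2)"
  proof (rule Bochner_Integration.integral_mono)
    show "integrable lebesgue (\<lambda>x. (h x - g j x)\<^sup>2)"
      by (rule sq_int_integrable[OF sq_int_diff[OF h sg]])
    show "integrable lebesgue (\<lambda>x. 2 * (h x - t n x)\<^sup>2 + 2 * (t n x - g j x)\<^sup>2)"
      by (intro Bochner_Integration.integrable_add integrable_mult_right sq_int_integrable sq_int_diff h st sg)
    fix x
    have "2 * (h x - t n x)\<^sup>2 + 2 * (t n x - g j x)\<^sup>2 - (h x - g j x)\<^sup>2 = (h x - 2 * t n x + g j x)\<^sup>2"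
      by (simp add: power2_eq_square algebra_simps)
    then show "(h x - g j x)\<^sup>2 \<le> 2 * (h x - t n x)\<^sup>2 + 2 * (t n x - g j x)\<^sup>2"
      by (smt (verit) zero_le_power2)
  qed
  also have "\<dots> = 2 * (LINT x|lebesgue. (h x - t n x)\<^sup>2) + 2 * (LINT x|lebesgue. (t n x - g j x)\<^sup>2)"
    by (subst Bochner_Integration.integral_add)
      (auto intro!: integrable_mult_right sq_int_integrable sq_int_diff h st sg)
  also have "\<dots> < e" using n j by simp
  finally show ?thesis using g(1,3) K' by blast
qed

text \<open>The limit is taken against a fixed factor \<open>f\<close>, so weak convergence
  suffices. Replace \<open>h\<close> by a continuous \<open>k\<close>: the remainder is controlled
  by the weighted bound uniformly in n, and the mollifications of \<open>k\<close> converge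
  uniformly.\<close>

lemma integral_conv_mollifier_tendsto:
  assumes f: "sq_int f" and h: "sq_int h" and K: "compact K" "\<And>x. x \<notin> K \<Longrightarrow> h x = 0"
  shows "(\<lambda>n. LINT x|lebesgue. f x * conv h (mollifier n) x) \<longlonglongrightarrow> (LINT x|lebesgue. f x * h x)"
proof (rule LIMSEQ_I)
  fix e :: real assume e: "e > 0"
  let ?C = "LINT x|lebesgue. (f x)\<^sup>2"
  have C: "?C \<ge> 0" by simp
  \<comment> \<open>With this weight the term of \<open>f\<close> is at most e/8, and the choice of
    \<open>k\<close> below makes the other term less than e/8.\<close>
  define a where "a = e / (4 * (?C + 1))"
  have a: "a > 0" using e C by (simp add: a_def add_nonneg_pos)
  obtain k K' where k: "continuous_on UNIV k" "compact K'" "\<And>x. x \<notin> K' \<Longrightarrow> k x = 0"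
    and hk: "(LINT x|lebesgue. (h x - k x)\<^sup>2) < a * e / 4"
    using sq_int_continuous_approx[OF h K, of "a * e / 4"] a e by auto
  have sk: "sq_int k" by (rule sq_int_continuous[OF k])
  have shk: "sq_int (\<lambda>x. h x - k x)" by (rule sq_int_diff[OF h sk])
  have small: "a / 2 * ?C + 1 / (2 * a) * (LINT x|lebesgue. (h x - k x)\<^sup>2) < e / 4"
  proof -
    have "a / 2 * ?C = e / 8 * (?C / (?C + 1))" by (simp add: a_def)
    also have "\<dots> \<le> e / 8 * 1"
      using C e by (intro mult_left_mono divide_le_eq_1[THEN iffD2] disjI1) linarith+
    finally have "a / 2 * ?C \<le> e / 8" by simp
    moreover have "1 / (2 * a) * (LINT x|lebesgue. (h x - k x)\<^sup>2) < 1 / (2 * a) * (a * e / 4)"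
      using hk a by (intro mult_strict_left_mono) auto
    ultimately have "a / 2 * ?C + 1 / (2 * a) * (LINT x|lebesgue. (h x - k x)\<^sup>2)
        < e / 8 + 1 / (2 * a) * (a * e / 4)"
      by (rule add_le_less_mono)
    also have "\<dots> = e / 4" using a by simp
    finally show ?thesis .
  qed
  have e1: "\<bar>LINT x|lebesgue. f x * conv (\<lambda>x. h x - k x) (mollifier n) x\<bar> < e / 4" for n
    using integral_conv_mollifier_bound[OF f shk compact_Un[OF K(1) k(2)] _ a, of n] K(2) k(3) small
    by fastforce
  have e2: "\<bar>LINT x|lebesgue. f x * (h x - k x)\<bar> < e / 4"
  proof -
    have "\<bar>LINT x|lebesgue. f x * (h x - k x)\<bar> \<le> (LINT x|lebesgue. a / 2 * (f x)\<^sup>2 + 1 / (2 * a) * (h x - k x)\<^sup>2)"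
    proof (rule integral_abs_bound[THEN order_trans], rule Bochner_Integration.integral_mono)
      show "integrable lebesgue (\<lambda>x. \<bar>f x * (h x - k x)\<bar>)"
        by (intro integrable_abs sq_int_mult_integrable f shk)
      show "integrable lebesgue (\<lambda>x. a / 2 * (f x)\<^sup>2 + 1 / (2 * a) * (h x - k x)\<^sup>2)"
        by (intro Bochner_Integration.integrable_add integrable_mult_right sq_int_integrable f shk)
    qed (rule abs_mult_le_weighted_squares[OF a])
    also have "\<dots> = a / 2 * ?C + 1 / (2 * a) * (LINT x|lebesgue. (h x - k x)\<^sup>2)"
      using sq_int_integrable[OF f] sq_int_integrable[OF shk] by simp
    finally show ?thesis using small by linarith
  qed
  let ?K = "cthicken 1 K'"
  have cK: "compact ?K" by (rule compact_cthicken[OF k(2)])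
  have "sq_int (indicator ?K :: real^2 \<Rightarrow> real)"
    using cK borel_measurable_integrable[OF integrable_indicator_compact[OF cK]]
    by (intro sq_int_bounded_compact_support[of _ 1 ?K]) (auto simp: indicator_def)
  from integrable_abs[OF sq_int_mult_integrable[OF f this]]
  have iK: "integrable lebesgue (\<lambda>x. \<bar>f x * indicator ?K x\<bar>)" .
  let ?I = "LINT x|lebesgue. \<bar>f x * indicator ?K x\<bar>"
  \<comment> \<open>Chosen so that a uniform error \<open>d\<close> on the thickened support costs
    at most e/4 against \<open>f\<close>.\<close>
  define d where "d = e / (4 * (?I + 1))"
  have I: "?I \<ge> 0" by simp
  have d: "d > 0" using e I by (simp add: d_def add_nonneg_pos)
  have "?I * d = e / 4 * (?I / (?I + 1))" by (simp add: d_def)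
  also have "\<dots> \<le> e / 4 * 1"
    using I e by (intro mult_left_mono divide_le_eq_1[THEN iffD2] disjI1) linarith+
  finally have dI: "?I * d \<le> e / 4" by simp
  have "\<forall>\<^sub>F n in sequentially. \<forall>x. \<bar>conv k (mollifier n) x - k x\<bar> \<le> d"
    by (rule conv_mollifier_uniform[OF k d])
  then obtain n0 where n0: "\<And>n x. n \<ge> n0 \<Longrightarrow> \<bar>conv k (mollifier n) x - k x\<bar> \<le> d"
    unfolding eventually_sequentially by blast
  have "norm ((LINT x|lebesgue. f x * conv h (mollifier n) x) - (LINT x|lebesgue. f x * h x)) < e"
    if n: "n \<ge> n0" for n
  proof -
    let ?c = "\<lambda>k. conv k (mollifier n)"
    have le1: "1 / real (Suc n) \<le> 1" by simp
    have c0: "?c k x - k x = 0" if "x \<notin> ?K" for x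
    proof -
      have "x \<notin> cthicken (1 / real (Suc n)) K'" using that cthicken_mono[OF le1, of K'] by blast
      moreover have "x \<notin> K'" using that subset_cthicken[of 1 K'] by auto
      ultimately show ?thesis using conv_eq_0[OF k(3) mollifier_le] k(3) by fastforce
    qed
    note sck = sq_int_conv_mollifier[OF sk k(2,3), of n] 
    note sch = sq_int_conv_mollifier[OF h K, of n]
    have lin: "?c (\<lambda>x. h x - k x) x = ?c h x - ?c k x" for x
      using Bochner_Integration.integral_diff[OF integrable_conv[OF sq_int_imp_integrable[OF h K] test_function_mollifier[of n], of x]
          integrable_conv[OF sq_int_imp_integrable[OF sk k(2,3)] test_function_mollifier[of n], of x]]
      by (simp add: conv_def left_diff_distrib)
    have schk: "sq_int (?c (\<lambda>x. h x - k x))"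
      unfolding lin by (rule sq_int_diff[OF sch sck])
    have sd: "sq_int (\<lambda>x. ?c k x - k x)" by (rule sq_int_diff[OF sck sk])
    have e3: "\<bar>LINT x|lebesgue. f x * (?c k x - k x)\<bar> \<le> e / 4"
    proof -
      have "\<bar>LINT x|lebesgue. f x * (?c k x - k x)\<bar> \<le> (LINT x|lebesgue. \<bar>f x * indicator ?K x\<bar> * d)"
      proof (rule integral_abs_bound[THEN order_trans], rule Bochner_Integration.integral_mono)
        show "integrable lebesgue (\<lambda>x. \<bar>f x * (?c k x - k x)\<bar>)"
          by (intro integrable_abs sq_int_mult_integrable f sd)
        show "integrable lebesgue (\<lambda>x. \<bar>f x * indicator ?K x\<bar> * d)" using iK by simp
        show "\<bar>f x * (?c k x - k x)\<bar> \<le> \<bar>f x * indicator ?K x\<bar> * d" for x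
          using n0[OF n, of x] c0[of x] by (cases "x \<in> ?K") (auto simp: abs_mult mult_left_mono)
      qed
      also have "\<dots> = ?I * d" by simp
      finally show ?thesis using dI by linarith
    qed
    have "f x * ?c h x - f x * h x = f x * ?c (\<lambda>x. h x - k x) x + f x * (?c k x - k x) - f x * (h x - k x)" for x
      by (simp add: lin algebra_simps)
    then have "(LINT x|lebesgue. f x * ?c h x) - (LINT x|lebesgue. f x * h x) =
      (LINT x|lebesgue. f x * ?c (\<lambda>x. h x - k x) x) + (LINT x|lebesgue. f x * (?c k x - k x))
       - (LINT x|lebesgue. f x * (h x - k x))"
      using sq_int_mult_integrable[OF f sch] sq_int_mult_integrable[OF f h] sq_int_mult_integrable[OF f schk]
        sq_int_mult_integrable[OF f sd] sq_int_mult_integrable[OF f shk]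
      by (simp flip: Bochner_Integration.integral_diff Bochner_Integration.integral_add)
    then show ?thesis using e1[of n] e2 e3 by simp
  qed
  then show "\<exists>no. \<forall>n\<ge>no. norm ((LINT x|lebesgue. f x * conv h (mollifier n) x) - (LINT x|lebesgue. f x * h x)) < e"
    by blast
qed

text \<open>Test against mollified continuous approximations of the sign of \<open>f\<close> on a
  compact set; in the limit the integral of |f| over that set is zero, and countably many compact
  sets exhaust \<open>W\<close>.\<close>

lemma fundamental_lemma_AE:
  fixes f :: "real^2 \<Rightarrow> real"
  assumes W: "open W" and f: "\<And>K. K \<subseteq> W \<Longrightarrow> compact K \<Longrightarrow> set_integrable lebesgue K f"
    and test: "\<And>\<phi>. test_function W \<phi> \<Longrightarrow> (LINT v|lebesgue. \<phi> v * f v) = 0"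
  shows "AE v in lebesgue. v \<in> W \<longrightarrow> f v = 0"
proof -
  have *: "AE v in lebesgue. v \<in> K \<longrightarrow> f v = 0" if K: "compact K" "K \<subseteq> W" for K
  proof -
    have iK: "integrable lebesgue (\<lambda>x. indicator K x * f x)"
      using f[OF K(2,1)] by (simp add: set_integrable_def)
    define h where "h x = sgn (indicator K x * f x)" for x
    have hm: "h \<in> borel_measurable lebesgue"
      unfolding h_def using borel_measurable_integrable[OF iK] by measurable
    have hb: "\<bar>h x\<bar> \<le> 1" and h0: "x \<notin> K \<Longrightarrow> h x = 0" for x
      by (auto simp: h_def sgn_if indicator_def)
    obtain K' g where K': "compact K'" "K' \<subseteq> W" "K \<subseteq> K'" and g: "\<And>n. continuous_on UNIV (g n)" 
       "\<And>j x. \<bar>g j x\<bar> \<le> 1" "\<And>n x. x \<notin> K' \<Longrightarrow> g n x = 0" and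
       glim: "AE x in lebesgue. (\<lambda>j::nat. g j x) \<longlonglongrightarrow> h x"
      using bounded_measurable_approx[OF hm hb K(1) h0 W K(2)] by blast
    obtain r where r: "r > 0" "cthicken r K' \<subseteq> W" by (rule cthicken_subset_open[OF K'(1) W K'(2)])
    let ?K = "cthicken r K'"
    have cK: "compact ?K" by (rule compact_cthicken[OF K'(1)])
    \<comment> \<open>For each approximant choose a kernel that changes it by at most 1/(j+1) and
      whose radius keeps the support inside one fixed compact set.\<close>
    have "\<exists>n. (\<forall>x. \<bar>conv (g j) (mollifier n) x - g j x\<bar> \<le> 1 / real (Suc j)) \<and> 1 / real (Suc n) < r" for j
    proof -
      have "\<forall>\<^sub>F n in sequentially. \<forall>x. \<bar>conv (g j) (mollifier n) x - g j x\<bar> \<le> 1 / real (Suc j)"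
        by (rule conv_mollifier_uniform[OF g(1) K'(1) g(3)]) simp_all
      moreover have "\<forall>\<^sub>F n in sequentially. 1 / real (Suc n) < r"
        using order_tendstoD(2)[OF LIMSEQ_inverse_real_of_nat r(1)] by (simp add: inverse_eq_divide)
      ultimately have "\<forall>\<^sub>F n in sequentially. (\<forall>x. \<bar>conv (g j) (mollifier n) x - g j x\<bar> \<le> 1 / real (Suc j)) \<and> 1 / real (Suc n) < r"
        by (rule eventually_conj)
      then show ?thesis using eventually_happens trivial_limit_sequentially by blast
    qed
    then obtain N where N: "\<And>j x. \<bar>conv (g j) (mollifier (N j)) x - g j x\<bar> \<le> 1 / real (Suc j)"
        "\<And>j. 1 / real (Suc (N j)) < r" by metis
    define \<phi> where "\<phi> j = conv (g j) (mollifier (N j))" for j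
    have sub: "cthicken (1 / real (Suc (N j))) K' \<subseteq> ?K" for j
      using N(2)[of j] by (intro cthicken_mono) simp
    have t\<phi>: "test_function W (\<phi> j)" for j
      unfolding \<phi>_def
      by (rule test_function_conv_mollifier[OF continuous_compact_support_integrable_lebesgue[OF g(1) K'(1) g(3)] K'(1) g(3)])
        (use sub[of j] r(2) in auto)
    have \<phi>0: "\<phi> j x = 0" if "x \<notin> ?K" for j x
      unfolding \<phi>_def
      using sub[of j] that by (intro conv_eq_0[where r = "1 / real (Suc (N j))", OF g(3) mollifier_le]) auto
    have \<phi>b: "\<bar>\<phi> j x\<bar> \<le> 2" for j x
    proof -
      have "1 / real (Suc j) \<le> 1" by simp
      then show ?thesis using N(1)[of j x] g(2)[of j x] unfolding \<phi>_def by linarith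
    qed
    have \<phi>lim: "AE x in lebesgue. (\<lambda>j. \<phi> j x) \<longlonglongrightarrow> h x"
      using glim
    proof eventually_elim
      case (elim x)
      have "(\<lambda>j. 1 / real (Suc j)) \<longlonglongrightarrow> 0"
        using LIMSEQ_inverse_real_of_nat by (simp add: inverse_eq_divide)
      then have "(\<lambda>j. \<phi> j x - g j x) \<longlonglongrightarrow> 0"
        by (rule Lim_null_comparison[rotated]) (use N(1) in \<open>auto simp: \<phi>_def\<close>)
      from tendsto_add[OF this elim] show ?case by simp
    qed
    have iKr: "integrable lebesgue (\<lambda>x. indicator ?K x * f x)"
      using f[OF r(2) cK] by (simp add: set_integrable_def)
    have "(\<lambda>j. LINT x|lebesgue. \<phi> j x * (indicator ?K x * f x)) \<longlonglongrightarrow> (LINT x|lebesgue. h x * (indicator ?K x * f x))"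
    proof (rule integral_dominated_convergence[where w = "\<lambda>x. 2 * \<bar>indicator ?K x * f x\<bar>"])
      show "(\<lambda>x. h x * (indicator ?K x * f x)) \<in> borel_measurable lebesgue"
        using hm borel_measurable_integrable[OF iKr] by measurable
      show "(\<lambda>x. \<phi> j x * (indicator ?K x * f x)) \<in> borel_measurable lebesgue" for j
        using continuous_imp_measurable_lebesgue[OF test_function_continuous[OF t\<phi>[of j]]]
          borel_measurable_integrable[OF iKr] by measurable
      show "integrable lebesgue (\<lambda>x. 2 * \<bar>indicator ?K x * f x\<bar>)"
        using iKr by (intro integrable_mult_right integrable_abs)
      show "AE x in lebesgue. (\<lambda>j. \<phi> j x * (indicator ?K x * f x)) \<longlonglongrightarrow> h x * (indicator ?K x * f x)"
        using \<phi>lim by eventually_elim (intro tendsto_intros)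
      show "AE x in lebesgue. norm (\<phi> j x * (indicator ?K x * f x)) \<le> 2 * \<bar>indicator ?K x * f x\<bar>" for j
        using \<phi>b[of j] by (intro AE_I2) (simp only: real_norm_def abs_mult[of "\<phi> j _"] mult_right_mono abs_ge_zero)
    qed
    moreover have "(LINT x|lebesgue. \<phi> j x * (indicator ?K x * f x)) = 0" for j
    proof -
      have "(\<lambda>x. \<phi> j x * (indicator ?K x * f x)) = (\<lambda>x. \<phi> j x * f x)"
      proof
        show "\<phi> j x * (indicator ?K x * f x) = \<phi> j x * f x" for x
          using \<phi>0[of x j] by (cases "x \<in> ?K") auto
      qed
      then show ?thesis using test[OF t\<phi>[of j]] by (simp only:)
    qed
    ultimately have "(\<lambda>j::nat. 0) \<longlonglongrightarrow> (LINT x|lebesgue. h x * (indicator ?K x * f x))"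
      by (simp only:)
    then have "(LINT x|lebesgue. h x * (indicator ?K x * f x)) = 0"
      by (rule LIMSEQ_unique) (rule tendsto_const)
    moreover have "h x * (indicator ?K x * f x) = \<bar>indicator K x * f x\<bar>" for x
    proof (cases "x \<in> K")
      case True
      then have "x \<in> ?K" using K'(3) subset_cthicken[of r K'] r(1) by auto
      then show ?thesis using True by (simp add: h_def sgn_if)
    next
      case False
      then show ?thesis using h0 by simp
    qed
    ultimately have "(LINT x|lebesgue. \<bar>indicator K x * f x\<bar>) = 0" by simp
    then have "AE x in lebesgue. \<bar>indicator K x * f x\<bar> = 0"
      using integral_nonneg_eq_0_iff_AE[OF integrable_abs[OF iK]] by simp
    then show ?thesis by eventually_elim auto
  qed
  obtain C where C: "\<And>n::nat. compact (C n)" "\<And>n. C n \<subseteq> W" "\<Union>(range C) = W"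
    using open_Union_compact_subsets[OF W] by metis
  have "AE v in lebesgue. \<forall>n. v \<in> C n \<longrightarrow> f v = 0"
    using *[OF C(1,2)] unfolding AE_all_countable by blast
  then show ?thesis
    by (rule AE_mp) (use C(3) in \<open>auto intro!: AE_I2\<close>)
qed

subsection \<open>Local Stokes formula for Sobolev functions\<close>

text \<open>One derivative only, carried as explicit data: the cutoffs used on the surface are built
  from squares of positive parts, which are C^1 but not C^2.\<close>

definition C1c :: "(real^2) set \<Rightarrow> (real^2 \<Rightarrow> real) \<Rightarrow> (real^2 \<Rightarrow> real^2 \<Rightarrow> real) \<Rightarrow> bool" where
  "C1c W \<phi> \<phi>' \<longleftrightarrow> (\<forall>x. (\<phi> has_derivative \<phi>' x) (at x)) \<and> (\<forall>e. continuous_on UNIV (\<lambda>x. \<phi>' x e)) \<and>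
     (\<exists>K\<subseteq>W. compact K \<and> (\<forall>v. v \<notin> K \<longrightarrow> \<phi> v = 0))"

lemma C1c_has_derivative: "C1c W \<phi> \<phi>' \<Longrightarrow> (\<phi> has_derivative \<phi>' x) (at x)"
  and C1c_continuous_derivative: "C1c W \<phi> \<phi>' \<Longrightarrow> continuous_on UNIV (\<lambda>x. \<phi>' x e)"
  by (auto simp: C1c_def)

lemma C1c_continuous: "C1c W \<phi> \<phi>' \<Longrightarrow> continuous_on UNIV \<phi>"
  using C1c_has_derivative has_derivative_continuous continuous_at_imp_continuous_on by metis

lemma C1c_derivative_eq_0:
  assumes "C1c W \<phi> \<phi>'" "closed K" "\<And>v. v \<notin> K \<Longrightarrow> \<phi> v = 0" "x \<notin> K"
  shows "\<phi>' x e = 0"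
  using frechet_derivative_eq_0_off[of K \<phi>, OF assms(2-4)] frechet_derivative_at[OF C1c_has_derivative[OF assms(1), of x]]
  by simp

lemma test_function_imp_C1c:
  assumes "test_function W \<phi>" shows "C1c W \<phi> (\<lambda>x. frechet_derivative \<phi> (at x))"
  unfolding C1c_def
  using test_function_has_derivative[OF assms] test_function_continuous[OF test_function_frechet_derivative[OF assms]] assms
  by (simp add: test_function_def)

lemma C1c_mult:
  assumes f: "C1c W f f'" and g: "C1c UNIV g g'"
  shows "C1c W (\<lambda>x. g x * f x) (\<lambda>x e. g x * f' x e + g' x e * f x)"
  unfolding C1c_def
proof (intro conjI allI)
  show "((\<lambda>x. g x * f x) has_derivative (\<lambda>e. g x * f' x e + g' x e * f x)) (at x)" for x
    by (intro has_derivative_mult C1c_has_derivative[OF f] C1c_has_derivative[OF g])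
  show "continuous_on UNIV (\<lambda>x. g x * f' x e + g' x e * f x)" for e
    by (intro continuous_intros C1c_continuous_derivative[OF f] C1c_continuous_derivative[OF g] 
        C1c_continuous[OF f] C1c_continuous[OF g])
  obtain K where "K \<subseteq> W" "compact K" "\<forall>v. v \<notin> K \<longrightarrow> f v = 0" using f unfolding C1c_def by metis
  then show "\<exists>K\<subseteq>W. compact K \<and> (\<forall>v. v \<notin> K \<longrightarrow> g v * f v = 0)" by (intro exI[of _ K]) simp
qed

text \<open>This makes the reflected kernel admissible in the weak identity, which is how a
  derivative is passed through a convolution.\<close>

lemma C1c_reflect:
  assumes f: "C1c UNIV f f'"
  shows "C1c UNIV (\<lambda>y. f (x - y)) (\<lambda>y e. - f' (x - y) e)"
  unfolding C1c_def
proof (intro conjI allI)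
  show "((\<lambda>y. f (x - y)) has_derivative (\<lambda>e. - f' (x - y) e)) (at y)" for y
  proof -
    have "((\<lambda>y. x - y) has_derivative (\<lambda>e. - e)) (at y)" by (auto intro!: derivative_eq_intros)
    from diff_chain_at[OF this C1c_has_derivative[OF f]]
    have "((\<lambda>y. f (x - y)) has_derivative (\<lambda>e. f' (x - y) (- e))) (at y)" by (simp add: o_def)
    then show ?thesis
      using linear_neg[OF has_derivative_linear[OF C1c_has_derivative[OF f, of "x - y"]]] by simp
  qed
  show "continuous_on UNIV (\<lambda>y. - f' (x - y) e)" for e
    by (intro continuous_intros continuous_on_compose2[OF C1c_continuous_derivative[OF f]]) auto
  obtain K where K: "compact K" "\<forall>v. v \<notin> K \<longrightarrow> f v = 0" using f unfolding C1c_def by metis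
  have "compact ((\<lambda>y. x - y) ` K)"
    by (intro compact_continuous_image K) (auto intro!: continuous_intros)
  moreover have "f (x - v) = 0" if "v \<notin> (\<lambda>y. x - y) ` K" for v
  proof -
    have "x - v \<notin> K"
    proof
      assume "x - v \<in> K"
      then have "x - (x - v) \<in> (\<lambda>y. x - y) ` K" by blast
      with that show False by simp
    qed
    then show ?thesis using K by blast
  qed
  ultimately show "\<exists>K\<subseteq>UNIV. compact K \<and> (\<forall>v. v \<notin> K \<longrightarrow> f (x - v) = 0)" by blast
qed

lemma integral_translate:
  fixes f :: "real^2 \<Rightarrow> real"
  assumes "continuous_on UNIV f"
  shows "(LINT y|lebesgue. f (y + c)) = (LINT y|lebesgue. f y)"
proof -
  have m: "f \<in> borel_measurable borel" by (simp add: borel_measurable_continuous_onI assms)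
  have "(LINT y|lborel. f (y + c)) = (LINT y|lborel. (\<lambda>z. f (c - z)) (0 - y))"
    by (simp add: add.commute)
  also have "\<dots> = (LINT y|lborel. f (c - y))"
    by (rule integral_reflect_translate) (use m in measurable)
  also have "\<dots> = (LINT y|lborel. f y)" by (rule integral_reflect_translate[OF m])
  finally show ?thesis
    using m by (simp add: integral_completion)
qed

text \<open>The derivative is a bounded limit of difference quotients, whose integrals vanish.\<close>

lemma integral_C1c_derivative:
  assumes f: "C1c W f f'" shows "(LINT x|lebesgue. f' x e) = 0"
proof -
  obtain K where K: "compact K" "\<And>v. v \<notin> K \<Longrightarrow> f v = 0" using f unfolding C1c_def by metis
  obtain B where B: "B \<ge> 0" "\<And>x. \<bar>f' x e\<bar> \<le> B"
    using bounded_continuous_compact_support[OF C1c_continuous_derivative[OF f] K(1) C1c_derivative_eq_0[OF f compact_imp_closed[OF K(1)] K(2)]]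
    by metis
  define t where "t n = 1 / real (Suc n)" for n
  have t: "0 < t n" "t n \<le> 1" for n by (auto simp: t_def)
  have lt: "t \<longlonglongrightarrow> 0" unfolding t_def using LIMSEQ_inverse_real_of_nat by (simp add: inverse_eq_divide)
  note cont = C1c_continuous[OF f]
  let ?q = "\<lambda>n x. (f (x + t n *\<^sub>R e) - f x) / t n"
  have lin: "linear (f' x)" for x using has_derivative_linear[OF C1c_has_derivative[OF f]] .
  have line: "((\<lambda>s. f (x + s *\<^sub>R e)) has_derivative (\<lambda>h. f' (x + s *\<^sub>R e) (h *\<^sub>R e))) (at s)" for x s
  proof -
    have "((\<lambda>s. x + s *\<^sub>R e) has_derivative (\<lambda>h. h *\<^sub>R e)) (at s)" by (auto intro!: derivative_eq_intros)
    from diff_chain_at[OF this C1c_has_derivative[OF f]] show ?thesis by (simp add: o_def)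
  qed
  have qb: "\<bar>?q n x\<bar> \<le> B" for n x
  proof -
    have "norm (f (x + t n *\<^sub>R e) - f (x + 0 *\<^sub>R e)) \<le> B * norm (t n - 0)"
    proof (rule differentiable_bound[of UNIV "\<lambda>s. f (x + s *\<^sub>R e)" "\<lambda>s h. f' (x + s *\<^sub>R e) (h *\<^sub>R e)"])
      show "onorm (\<lambda>h. f' (x + s *\<^sub>R e) (h *\<^sub>R e)) \<le> B" for s
        using mult_left_mono[OF B(2)[of "x + s *\<^sub>R e"] abs_ge_zero]
        by (intro onorm_le) (simp add: linear_cmul[OF lin] abs_mult mult.commute[of B])
    qed (use line in auto)
    then show ?thesis using t(1)[of n] by (simp add: pos_divide_le_eq)
  qed
  have q0: "?q n x = 0" if "x \<notin> cthicken (norm e) K" for n x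
  proof -
    have "x \<notin> K" using that subset_cthicken[of "norm e" K] by auto
    moreover have "x + t n *\<^sub>R e \<notin> K"
    proof
      assume "x + t n *\<^sub>R e \<in> K"
      moreover have "norm (- (t n *\<^sub>R e)) \<le> norm e" using t[of n] by (simp add: mult_left_le_one_le)
      moreover have "x = (x + t n *\<^sub>R e) + (- (t n *\<^sub>R e))" by simp
      ultimately have "x \<in> cthicken (norm e) K" unfolding cthicken_def by (intro CollectI) (metis mem_cball_0)
      with that show False by simp
    qed
    ultimately show ?thesis using K(2) by simp
  qed
  have qc: "continuous_on UNIV (?q n)" for n
    by (intro continuous_intros continuous_on_compose2[OF cont]) (use t(1)[of n] in auto)
  have "(\<lambda>n. LINT x|lebesgue. ?q n x) \<longlonglongrightarrow> (LINT x|lebesgue. f' x e)"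
  proof (rule integral_dominated_convergence[where w = "\<lambda>x. B * indicator (cthicken (norm e) K) x"])
    show "(\<lambda>x. f' x e) \<in> borel_measurable lebesgue"
      by (rule continuous_imp_measurable_lebesgue[OF C1c_continuous_derivative[OF f]])
    show "?q n \<in> borel_measurable lebesgue" for n
      by (rule continuous_imp_measurable_lebesgue[OF qc])
    show "integrable lebesgue (\<lambda>x. B * indicator (cthicken (norm e) K) x)"
      by (intro integrable_mult_right integrable_indicator_compact compact_cthicken K(1))
    show "AE x in lebesgue. (\<lambda>n. ?q n x) \<longlonglongrightarrow> f' x e"
    proof (rule AE_I2)
      fix x
      have "((\<lambda>s. f (x + s *\<^sub>R e)) has_real_derivative f' x e) (at 0)"
        using line[of x 0] by (simp add: has_field_derivative_def linear_cmul[OF lin] mult.commute[of _ "f' x e"])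
      then have "((\<lambda>s. (f (x + s *\<^sub>R e) - f x) / s) \<longlongrightarrow> f' x e) (at 0)"
        by (simp add: DERIV_def)
      moreover have "filterlim t (at 0) sequentially"
        using lt t(1) by (intro filterlim_atI) (auto intro!: always_eventually simp: less_imp_neq[symmetric])
      ultimately show "(\<lambda>n. ?q n x) \<longlonglongrightarrow> f' x e" by (rule filterlim_compose)
    qed
    show "AE x in lebesgue. norm (?q n x) \<le> B * indicator (cthicken (norm e) K) x" for n
    proof (rule AE_I2)
      fix x show "norm (?q n x) \<le> B * indicator (cthicken (norm e) K) x"
        using qb[of x n] q0[of x n] by (cases "x \<in> cthicken (norm e) K") auto
    qed
  qed
  moreover have "(LINT x|lebesgue. ?q n x) = 0" for n
  proof -
    have i: "integrable lebesgue f" by (rule continuous_compact_support_integrable_lebesgue[OF cont K])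
    have i2: "integrable lebesgue (\<lambda>x. f (x + t n *\<^sub>R e))"
    proof (rule Bochner_Integration.integrable_cong[THEN iffD1, rotated 2])
      have "integrable lebesgue (\<lambda>x. t n * ?q n x + f x)"
        using bounded_compact_support_integrable[OF continuous_imp_measurable_lebesgue[OF qc] qb compact_cthicken[OF K(1)] q0] i
        by (intro Bochner_Integration.integrable_add integrable_mult_right)
      then show "integrable lebesgue (\<lambda>x. t n * ?q n x + f x)" .
      show "t n * ?q n x + f x = f (x + t n *\<^sub>R e)" for x using t(1)[of n] by simp
    qed simp
    have "(LINT x|lebesgue. ?q n x) = ((LINT x|lebesgue. f (x + t n *\<^sub>R e)) - (LINT x|lebesgue. f x)) / t n"
      using Bochner_Integration.integral_diff[OF i2 i] by simp
    then show ?thesis using integral_translate[OF cont] by simp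
  qed
  ultimately have "(\<lambda>n::nat. 0) \<longlonglongrightarrow> (LINT x|lebesgue. f' x e)" by (simp only:)
  then show ?thesis by (metis LIMSEQ_unique tendsto_const)
qed

text \<open>The integral of the derivative of the product vanishes.\<close>

lemma C1c_integration_by_parts:
  assumes f: "C1c W f f'" and g: "C1c UNIV g g'"
  shows "(LINT x|lebesgue. g x * f' x e) = - (LINT x|lebesgue. g' x e * f x)"
proof -
  obtain K where K: "compact K" "\<And>v. v \<notin> K \<Longrightarrow> f v = 0" using f unfolding C1c_def by metis
  note f0 = C1c_derivative_eq_0[OF f compact_imp_closed[OF K(1)] K(2)]
  have "integrable lebesgue (\<lambda>x. g x * f' x e)"
    by (rule continuous_compact_support_integrable_lebesgue[OF _ K(1)])
      (auto simp: f0 intro!: continuous_intros C1c_continuous[OF g] C1c_continuous_derivative[OF f])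
  moreover have "integrable lebesgue (\<lambda>x. g' x e * f x)"
    by (rule continuous_compact_support_integrable_lebesgue[OF _ K(1)])
      (auto simp: K intro!: continuous_intros C1c_continuous[OF f] C1c_continuous_derivative[OF g])
  ultimately show ?thesis
    using integral_C1c_derivative[OF C1c_mult[OF f g], of e] by simp
qed

text \<open>A continuous compactly supported \<open>v\<close> with square integrable weak
  differential \<open>H\<close>. The weak identity ranges over test functions on the whole plane, as
  the reflected kernel need not be supported in \<open>W\<close>. The instances are C^1 functions
  and products of a cutoff with a Sobolev function.\<close>

locale mollified =
  fixes W K :: "(real^2) set" and v :: "real^2 \<Rightarrow> real" and H :: "real^2 \<Rightarrow> real^2 \<Rightarrow> real"
  assumes W: "open W" and K: "compact K" "K \<subseteq> W"
    and cont: "continuous_on UNIV v" and v0: "\<And>x. x \<notin> K \<Longrightarrow> v x = 0"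
    and H: "\<And>e. sq_int (\<lambda>x. H x e)" and H0: "\<And>x e. x \<notin> K \<Longrightarrow> H x e = 0"
    and weak: "\<And>\<phi> \<phi>' e. C1c UNIV \<phi> \<phi>' \<Longrightarrow> (LINT x|lebesgue. \<phi> x * H x e) = - (LINT x|lebesgue. \<phi>' x e * v x)"
begin

definition approx :: "nat \<Rightarrow> real^2 \<Rightarrow> real" where
  "approx n = conv v (mollifier n)"

lemma iv: "integrable lebesgue v"
  by (rule continuous_compact_support_integrable_lebesgue[OF cont K(1) v0])

lemma approx_eventually_test: "\<forall>\<^sub>F n in sequentially. test_function W (approx n)"
proof -
  obtain r where r: "r > 0" "cthicken r K \<subseteq> W" by (rule cthicken_subset_open[OF K(1) W K(2)])
  have "\<forall>\<^sub>F n in sequentially. 1 / real (Suc n) < r"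
    using order_tendstoD(2)[OF LIMSEQ_inverse_real_of_nat r(1)] by (simp add: inverse_eq_divide)
  then show ?thesis
  proof eventually_elim
    case (elim n)
    then have "cthicken (1 / real (Suc n)) K \<subseteq> W"
      using cthicken_mono[of "1 / real (Suc n)" r K] r(2) by auto
    from test_function_conv_mollifier[OF iv K(1) v0 this] show ?case unfolding approx_def .
  qed
qed

text \<open>The weak identity, tested with the reflected kernel, moves the derivative from the
  kernel to \<open>v\<close>.\<close>

lemma frechet_derivative_approx:
  "frechet_derivative (approx n) (at x) e = conv (\<lambda>y. H y e) (mollifier n) x"
proof -
  have "frechet_derivative (approx n) (at x) e = (LINT y|lebesgue. v y * frechet_derivative (mollifier n) (at (x - y)) e)"
    unfolding approx_def frechet_derivative_conv[OF iv test_function_mollifier] by (simp add: conv_def)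
  also have "\<dots> = (LINT y|lebesgue. mollifier n (x - y) * H y e)"
    using weak[OF C1c_reflect[OF test_function_imp_C1c[OF test_function_mollifier]], of n x e]
    by (simp add: mult.commute)
  finally show ?thesis by (simp add: conv_def mult.commute)
qed

text \<open>Both derivatives fall on the mollifier, whose second derivative is symmetric.\<close>

lemma approx_mixed_derivative:
  "frechet_derivative (\<lambda>x. frechet_derivative (approx n) (at x) a) (at x) b =
   frechet_derivative (\<lambda>x. frechet_derivative (approx n) (at x) b) (at x) a"
  unfolding approx_def frechet_derivative_conv[OF iv test_function_mollifier]
    frechet_derivative_conv[OF iv test_function_frechet_derivative[OF test_function_mollifier]]
    mollifier_second_derivative_symmetric[of n a _ b] ..

lemma approx_derivative_tendsto:
  "sq_int f \<Longrightarrow> (\<lambda>n. LINT x|lebesgue. f x * frechet_derivative (approx n) (at x) e)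
     \<longlonglongrightarrow> (LINT x|lebesgue. f x * H x e)"
  unfolding frechet_derivative_approx
  by (rule integral_conv_mollifier_tendsto[OF _ H K(1) H0])

lemma approx_tendsto:
  "sq_int f \<Longrightarrow> (\<lambda>n. LINT x|lebesgue. f x * approx n x) \<longlonglongrightarrow> (LINT x|lebesgue. f x * v x)"
  unfolding approx_def
  by (rule integral_conv_mollifier_tendsto[OF _ sq_int_continuous[OF cont K(1) v0] K(1) v0])

lemma approx_support:
  obtains K' where "compact K'" "K' \<subseteq> W" "K \<subseteq> K'" "\<forall>\<^sub>F n in sequentially. \<forall>x. x \<notin> K' \<longrightarrow> approx n x = 0"
proof -
  obtain r where r: "r > 0" "cthicken r K \<subseteq> W" by (rule cthicken_subset_open[OF K(1) W K(2)])
  have "\<forall>\<^sub>F n in sequentially. 1 / real (Suc n) < r"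
    using order_tendstoD(2)[OF LIMSEQ_inverse_real_of_nat r(1)] by (simp add: inverse_eq_divide)
  then have "\<forall>\<^sub>F n in sequentially. \<forall>x. x \<notin> cthicken r K \<longrightarrow> approx n x = 0"
  proof eventually_elim
    case (elim n)
    then have sub: "cthicken (1 / real (Suc n)) K \<subseteq> cthicken r K" by (intro cthicken_mono) simp
    show ?case
    proof (intro allI impI)
      fix x assume "x \<notin> cthicken r K"
      with sub have "x \<notin> cthicken (1 / real (Suc n)) K" by blast
      then show "approx n x = 0" unfolding approx_def by (intro conv_eq_0[OF v0 mollifier_le])
    qed
  qed
  then show thesis
    using r subset_cthicken[of r K] by (intro that[of "cthicken r K"] compact_cthicken K(1)) auto
qed

end

section \<open>Scalar Sobolev functions on open sets of the plane\<close>

definition loc_L2 :: "(real^2) set \<Rightarrow> (real^2 \<Rightarrow> real) \<Rightarrow> bool" where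
  "loc_L2 W f \<longleftrightarrow> (\<forall>K\<subseteq>W. compact K \<longrightarrow> sq_int (\<lambda>x. indicator K x * f x))"

text \<open>The integrals run over the whole plane, since test functions and their derivatives
  vanish off \<open>W\<close>.\<close>

definition H1_loc :: "(real^2) set \<Rightarrow> (real^2 \<Rightarrow> real) \<Rightarrow> (real^2 \<Rightarrow> real^2 \<Rightarrow> real) \<Rightarrow> bool" where
  "H1_loc W f F \<longleftrightarrow> loc_L2 W f \<and> (\<forall>e. loc_L2 W (\<lambda>x. F x e)) \<and>
    (\<forall>\<phi> e. test_function W \<phi> \<longrightarrow>
      (LINT x|lebesgue. \<phi> x * F x e) = - (LINT x|lebesgue. frechet_derivative \<phi> (at x) e * f x))"

lemma H1_loc_test:
  "H1_loc W f F \<Longrightarrow> test_function W \<phi> \<Longrightarrow>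
    (LINT x|lebesgue. \<phi> x * F x e) = - (LINT x|lebesgue. frechet_derivative \<phi> (at x) e * f x)"
  and H1_loc_loc_L2: "H1_loc W f F \<Longrightarrow> loc_L2 W f" "H1_loc W f F \<Longrightarrow> loc_L2 W (\<lambda>x. F x e)"
  by (auto simp: H1_loc_def)

lemma loc_L2_mult_continuous:
  assumes f: "loc_L2 W f" and g: "continuous_on UNIV g" "compact K" "K \<subseteq> W" "\<And>x. x \<notin> K \<Longrightarrow> g x = 0"
  shows "sq_int (\<lambda>x. g x * f x)"
proof -
  obtain B where B: "B \<ge> 0" "\<And>x. \<bar>g x\<bar> \<le> B"
    using bounded_continuous_compact_support[OF g(1,2)] g(4) by metis
  have s: "sq_int (\<lambda>x. indicator K x * f x)" using f g(2,3) unfolding loc_L2_def by blast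
  have "(\<lambda>x. g x * (indicator K x * f x)) = (\<lambda>x. g x * f x)"
  proof
    show "g x * (indicator K x * f x) = g x * f x" for x using g(4)[of x] by (cases "x \<in> K") auto
  qed
  then show ?thesis
    using sq_int_bounded_mult[OF s continuous_imp_measurable_lebesgue[OF g(1)] B(2)] by simp
qed

lemma loc_L2_mult_integrable:
  assumes f: "loc_L2 W f" and g: "continuous_on UNIV g" "compact K" "K \<subseteq> W" "\<And>x. x \<notin> K \<Longrightarrow> g x = 0"
  shows "integrable lebesgue (\<lambda>x. g x * f x)"
  using sq_int_imp_integrable[OF loc_L2_mult_continuous[OF assms] g(2)] g(4) by fastforce

lemma mollified_C1c:
  assumes "open W" "C1c W \<phi> \<phi>'" shows "\<exists>K. mollified W K \<phi> \<phi>'"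
proof -
  obtain K where K: "K \<subseteq> W" "compact K" "\<And>v. v \<notin> K \<Longrightarrow> \<phi> v = 0" using assms(2) unfolding C1c_def by metis
  note f0 = C1c_derivative_eq_0[OF assms(2) compact_imp_closed[OF K(2)] K(3)]
  show ?thesis
    by (rule exI[of _ K], unfold_locales)
      (use assms K f0 C1c_continuous[OF assms(2)] sq_int_continuous[OF C1c_continuous_derivative[OF assms(2)] K(2) f0]
        C1c_integration_by_parts[OF assms(2)] in auto)
qed

lemma eq_indicator_mult: 
  fixes f g :: "'a \<Rightarrow> real"
  shows "(\<And>x. x \<notin> K \<Longrightarrow> g x = 0) \<Longrightarrow> (\<lambda>x. (indicator K x * f x) * g x) = (\<lambda>x. f x * g x)"
  by (rule ext) (metis indicator_simps mult_1 mult_zero_left mult_zero_right)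

text \<open>Eventually all mollifications are supported in one compact subset of \<open>W\<close>;
  \<open>f\<close> may then be cut off there to a globally square integrable function.\<close>

lemma mollified_integral_tendsto:
  assumes "mollified W K v H" "loc_L2 W f"
  shows "(\<lambda>n. LINT x|lebesgue. f x * frechet_derivative (mollified.approx v n) (at x) e) \<longlonglongrightarrow> (LINT x|lebesgue. f x * H x e)"
    and "(\<lambda>n. LINT x|lebesgue. f x * mollified.approx v n x) \<longlonglongrightarrow> (LINT x|lebesgue. f x * v x)"
proof -
  interpret mollified W K v H by fact
  obtain K' where K': "compact K'" "K' \<subseteq> W" "K \<subseteq> K'" 
    and ev: "\<forall>\<^sub>F n in sequentially. \<forall>x. x \<notin> K' \<longrightarrow> approx n x = 0"
    by (rule approx_support)
  have sf: "sq_int (\<lambda>x. indicator K' x * f x)" using assms(2) K' unfolding loc_L2_def by blast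
  have "\<forall>\<^sub>F n in sequentially. (LINT x|lebesgue. indicator K' x * f x * frechet_derivative (approx n) (at x) e) 
      = (LINT x|lebesgue. f x * frechet_derivative (approx n) (at x) e)"
    using ev
  proof eventually_elim
    case (elim n)
    have "frechet_derivative (approx n) (at x) e = 0" if "x \<notin> K'" for x
      using frechet_derivative_eq_0_off[OF compact_imp_closed[OF K'(1)], of "approx n" x] elim that by simp
    from eq_indicator_mult[of K' "\<lambda>x. frechet_derivative (approx n) (at x) e" f, OF this]
    show ?case by simp
  qed
  moreover have "(\<lambda>x. indicator K' x * f x * H x e) = (\<lambda>x. f x * H x e)"
    by (rule eq_indicator_mult) (use H0 K'(3) in blast)
  ultimately show "(\<lambda>n. LINT x|lebesgue. f x * frechet_derivative (approx n) (at x) e) \<longlonglongrightarrow> (LINT x|lebesgue. f x * H x e)"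
    using approx_derivative_tendsto[OF sf, of e] by (simp add: Lim_transform_eventually)
  have "\<forall>\<^sub>F n in sequentially. (LINT x|lebesgue. indicator K' x * f x * approx n x) 
      = (LINT x|lebesgue. f x * approx n x)"
    using ev
  proof eventually_elim
    case (elim n)
    have "(\<lambda>x. indicator K' x * f x * approx n x) = (\<lambda>x. f x * approx n x)"
      by (rule eq_indicator_mult) (use elim in blast)
    then show ?case by simp
  qed
  moreover have "(\<lambda>x. indicator K' x * f x * v x) = (\<lambda>x. f x * v x)"
    by (rule eq_indicator_mult) (use v0 K'(3) in blast)
  ultimately show "(\<lambda>n. LINT x|lebesgue. f x * approx n x) \<longlonglongrightarrow> (LINT x|lebesgue. f x * v x)"
    using approx_tendsto[OF sf] by (simp add: Lim_transform_eventually)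
qed

lemma LIMSEQ_unique_eventually:
  fixes f g :: "nat \<Rightarrow> real"
  assumes "f \<longlonglongrightarrow> a" "g \<longlonglongrightarrow> b" "\<forall>\<^sub>F n in sequentially. f n = g n" shows "a = b"
  using LIMSEQ_unique[OF Lim_transform_eventually[OF assms(1,3)] assms(2)] .

text \<open>Mollify the test function: the smooth approximations satisfy the identity by definition,
  and both sides converge.\<close>

lemma H1_loc_C1c:
  assumes W: "open W" and f: "H1_loc W f F" and \<phi>: "C1c W \<phi> \<phi>'"
  shows "(LINT x|lebesgue. \<phi> x * F x e) = - (LINT x|lebesgue. \<phi>' x e * f x)"
proof -
  obtain K where m: "mollified W K \<phi> \<phi>'" using mollified_C1c[OF W \<phi>] by blast
  interpret mollified W K \<phi> \<phi>' by fact
  have L: "loc_L2 W f" "loc_L2 W (\<lambda>x. F x e)" using f by (auto simp: H1_loc_def)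
  have "\<forall>\<^sub>F n in sequentially. (LINT x|lebesgue. F x e * approx n x) =
     - (LINT x|lebesgue. f x * frechet_derivative (approx n) (at x) e)"
    using approx_eventually_test
  proof eventually_elim
    case (elim n)
    have "(LINT x|lebesgue. approx n x * F x e) = - (LINT x|lebesgue. frechet_derivative (approx n) (at x) e * f x)"
      by (rule H1_loc_test[OF f elim])
    then show ?case by (simp only: mult.commute)
  qed
  from LIMSEQ_unique_eventually[OF mollified_integral_tendsto(2)[OF m L(2)] tendsto_minus[OF mollified_integral_tendsto(1)[OF m L(1), of e]] this]
  show ?thesis by (simp add: mult.commute)
qed

text \<open>Extended by zero, the product is continuous on the plane. Its weak differential obeys
  the product rule, as is seen by testing \<open>w\<close> against the C^1 function \<phi>
  \<theta>.\<close>

lemma mollified_product: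
  assumes W: "open W" and w: "continuous_on W w" and G: "H1_loc W w G" and \<theta>: "C1c W \<theta> \<theta>'"
  shows "\<exists>K. mollified W K (\<lambda>x. \<theta> x * w x) (\<lambda>x e. \<theta> x * G x e + \<theta>' x e * w x)"
proof -
  obtain K where K: "K \<subseteq> W" "compact K" "\<And>v. v \<notin> K \<Longrightarrow> \<theta> v = 0" using \<theta> unfolding C1c_def by metis
  note \<theta>0 = C1c_derivative_eq_0[OF \<theta> compact_imp_closed[OF K(2)] K(3)]
  have L: "loc_L2 W w" "loc_L2 W (\<lambda>x. G x e)" for e using G by (auto simp: H1_loc_def)
  note c = C1c_continuous[OF \<theta>] and c' = C1c_continuous_derivative[OF \<theta>]
  show ?thesis
  proof (rule exI[of _ K], unfold_locales)
    have 1: "continuous_on W (\<lambda>x. \<theta> x * w x)"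
      by (intro continuous_intros w continuous_on_subset[OF c]) simp
    have "continuous_on (- K) (\<lambda>x. 0::real)" by simp
    then have 2: "continuous_on (- K) (\<lambda>x. \<theta> x * w x)"
      by (rule continuous_on_eq) (use K(3) in auto)
    have "continuous_on (W \<union> - K) (\<lambda>x. \<theta> x * w x)"
      using W compact_imp_closed[OF K(2)] by (intro continuous_on_open_Un 1 2) auto
    moreover have "W \<union> - K = UNIV" using K(1) by auto
    ultimately show "continuous_on UNIV (\<lambda>x. \<theta> x * w x)" by simp
    show "sq_int (\<lambda>x. \<theta> x * G x e + \<theta>' x e * w x)" for e
      by (intro sq_int_add loc_L2_mult_continuous[OF L(2) c K(2,1,3)] loc_L2_mult_continuous[OF L(1) c' K(2,1) \<theta>0])
    fix \<phi> \<phi>' e assume \<phi>: "C1c UNIV \<phi> \<phi>'"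
    have "(LINT x|lebesgue. (\<phi> x * \<theta> x) * G x e) = - (LINT x|lebesgue. (\<phi> x * \<theta>' x e + \<phi>' x e * \<theta> x) * w x)"
      by (rule H1_loc_C1c[OF W G C1c_mult[OF \<theta> \<phi>]])
    also have "(\<lambda>x. (\<phi> x * \<theta>' x e + \<phi>' x e * \<theta> x) * w x) = (\<lambda>x. (\<phi> x * \<theta>' x e) * w x + (\<phi>' x e * \<theta> x) * w x)"
      by (simp add: distrib_right)
    also have "(LINT x|lebesgue. \<dots> x) = (LINT x|lebesgue. (\<phi> x * \<theta>' x e) * w x) + (LINT x|lebesgue. (\<phi>' x e * \<theta> x) * w x)"
      by (intro Bochner_Integration.integral_add loc_L2_mult_integrable[OF L(1) _ K(2,1)] continuous_intros
         C1c_continuous[OF \<phi>] C1c_continuous_derivative[OF \<phi>] c c') (auto simp: K(3) \<theta>0)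
    finally have "(LINT x|lebesgue. (\<phi> x * \<theta> x) * G x e) + (LINT x|lebesgue. (\<phi> x * \<theta>' x e) * w x)
        = - (LINT x|lebesgue. (\<phi>' x e * \<theta> x) * w x)" by simp
    also have "(LINT x|lebesgue. (\<phi> x * \<theta> x) * G x e) + (LINT x|lebesgue. (\<phi> x * \<theta>' x e) * w x) = 
       (LINT x|lebesgue. (\<phi> x * \<theta> x) * G x e + (\<phi> x * \<theta>' x e) * w x)"
      by (intro Bochner_Integration.integral_add[symmetric] loc_L2_mult_integrable[OF L(1) _ K(2,1)] loc_L2_mult_integrable[OF L(2) _ K(2,1)] continuous_intros
         C1c_continuous[OF \<phi>] C1c_continuous_derivative[OF \<phi>] c c') (auto simp: K(3) \<theta>0)
    finally show "(LINT x|lebesgue. \<phi> x * (\<theta> x * G x e + \<theta>' x e * w x)) = - (LINT x|lebesgue. \<phi>' x e * (\<theta> x * w x))"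
      by (simp add: distrib_left mult.assoc)
  qed (use W K \<theta>0 in auto)
qed

text \<open>The weak form of 2 w dw = d(w^2), localised by \<theta>: the mollifications of \<theta>
  w are inserted as test functions into the weak identity of \<open>w\<close> itself, and in the
  limit the term \<theta> w dw appears on both sides.\<close>

lemma H1_loc_square:
  assumes W: "open W" and w: "continuous_on W w" and G: "H1_loc W w G" and \<theta>: "C1c W \<theta> \<theta>'"
  shows "2 * (LINT x|lebesgue. \<theta> x * (w x * G x e)) = - (LINT x|lebesgue. \<theta>' x e * (w x)\<^sup>2)"
    and "integrable lebesgue (\<lambda>x. \<theta> x * (w x * G x e))"
proof -
  obtain K where m: "mollified W K (\<lambda>x. \<theta> x * w x) (\<lambda>x e. \<theta> x * G x e + \<theta>' x e * w x)" 
    using mollified_product[OF assms] by blast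
  interpret mollified W K "\<lambda>x. \<theta> x * w x" "\<lambda>x e. \<theta> x * G x e + \<theta>' x e * w x" by fact
  have L: "loc_L2 W w" "loc_L2 W (\<lambda>x. G x e)" using G by (auto simp: H1_loc_def)
  have "\<forall>\<^sub>F n in sequentially. (LINT x|lebesgue. G x e * approx n x) =
     - (LINT x|lebesgue. w x * frechet_derivative (approx n) (at x) e)"
    using approx_eventually_test
  proof eventually_elim
    case (elim n)
    have "(LINT x|lebesgue. approx n x * G x e) = - (LINT x|lebesgue. frechet_derivative (approx n) (at x) e * w x)"
      by (rule H1_loc_test[OF G elim])
    then show ?case by (simp only: mult.commute)
  qed
  from LIMSEQ_unique_eventually[OF mollified_integral_tendsto(2)[OF m L(2)] tendsto_minus[OF mollified_integral_tendsto(1)[OF m L(1), of e]] this]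
  have eq: "(LINT x|lebesgue. G x e * (\<theta> x * w x)) = - (LINT x|lebesgue. w x * (\<theta> x * G x e + \<theta>' x e * w x))" .
  obtain K' where K': "K' \<subseteq> W" "compact K'" "\<And>v. v \<notin> K' \<Longrightarrow> \<theta> v = 0" using \<theta> unfolding C1c_def by metis
  note \<theta>0 = C1c_derivative_eq_0[OF \<theta> compact_imp_closed[OF K'(2)] K'(3)]
  have sw: "sq_int (\<lambda>x. indicator K' x * w x)" using L(1) K' unfolding loc_L2_def by blast
  have i1: "integrable lebesgue (\<lambda>x. indicator K' x * w x * (\<theta> x * G x e))"
    by (intro sq_int_mult_integrable[OF sw] loc_L2_mult_continuous[OF L(2) C1c_continuous[OF \<theta>] K'(2,1)] K'(3))
  have i2: "integrable lebesgue (\<lambda>x. indicator K' x * w x * (\<theta>' x e * w x))"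
    by (intro sq_int_mult_integrable[OF sw] loc_L2_mult_continuous[OF L(1) C1c_continuous_derivative[OF \<theta>] K'(2,1)] \<theta>0)
  have e1: "(\<lambda>x. indicator K' x * w x * (\<theta> x * G x e)) = (\<lambda>x. \<theta> x * (w x * G x e))"
    by (subst eq_indicator_mult) (auto simp: K'(3) fun_eq_iff)
  have e2: "(\<lambda>x. indicator K' x * w x * (\<theta>' x e * w x)) = (\<lambda>x. \<theta>' x e * (w x)\<^sup>2)"
    by (subst eq_indicator_mult) (auto simp: \<theta>0 fun_eq_iff power2_eq_square)
  have e3: "w x * (\<theta> x * G x e + \<theta>' x e * w x) = \<theta> x * (w x * G x e) + \<theta>' x e * (w x)\<^sup>2" for x
    by (simp add: algebra_simps power2_eq_square)
  have e4: "G x e * (\<theta> x * w x) = \<theta> x * (w x * G x e)" for x by simp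
  show "integrable lebesgue (\<lambda>x. \<theta> x * (w x * G x e))" using i1 unfolding e1 .
  show "2 * (LINT x|lebesgue. \<theta> x * (w x * G x e)) = - (LINT x|lebesgue. \<theta>' x e * (w x)\<^sup>2)"
    using eq Bochner_Integration.integral_add[OF i1[unfolded e1] i2[unfolded e2]] unfolding e3 e4 by linarith
qed

text \<open>This says that d\<xi> wedge d(\<theta> w) has integral zero. Testing \<xi> against a
  first derivative of the mollified \<theta> w produces a mixed second derivative, which is
  symmetric, and the resulting symmetric identity passes to the limit.\<close>

lemma local_Stokes:
  assumes W: "open W" and \<xi>: "H1_loc W \<xi> F" and w: "continuous_on W w" and G: "H1_loc W w G" and \<theta>: "C1c W \<theta> \<theta>'"
  shows "(LINT x|lebesgue. F x a * (\<theta> x * G x b + \<theta>' x b * w x)) 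
       = (LINT x|lebesgue. F x b * (\<theta> x * G x a + \<theta>' x a * w x))"
    and "integrable lebesgue (\<lambda>x. F x a * (\<theta> x * G x b + \<theta>' x b * w x))"
proof -
  obtain K where m: "mollified W K (\<lambda>x. \<theta> x * w x) (\<lambda>x e. \<theta> x * G x e + \<theta>' x e * w x)" 
    using mollified_product[OF W w G \<theta>] by blast
  interpret mollified W K "\<lambda>x. \<theta> x * w x" "\<lambda>x e. \<theta> x * G x e + \<theta>' x e * w x" by fact
  have L: "loc_L2 W (\<lambda>x. F x e)" for e using \<xi> by (auto simp: H1_loc_def)
  have "\<forall>\<^sub>F n in sequentially. (LINT x|lebesgue. F x a * frechet_derivative (approx n) (at x) b) =
     (LINT x|lebesgue. F x b * frechet_derivative (approx n) (at x) a)"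
    using approx_eventually_test
  proof eventually_elim
    case (elim n)
    have "(LINT x|lebesgue. frechet_derivative (approx n) (at x) b * F x a) = 
       - (LINT x|lebesgue. frechet_derivative (\<lambda>x. frechet_derivative (approx n) (at x) b) (at x) a * \<xi> x)"
      by (rule H1_loc_test[OF \<xi> test_function_frechet_derivative[OF elim]])
    also have "\<dots> = - (LINT x|lebesgue. frechet_derivative (\<lambda>x. frechet_derivative (approx n) (at x) a) (at x) b * \<xi> x)"
      unfolding approx_mixed_derivative[of n b _ a] ..
    also have "\<dots> = (LINT x|lebesgue. frechet_derivative (approx n) (at x) a * F x b)"
      by (simp only: H1_loc_test[OF \<xi> test_function_frechet_derivative[OF elim]])
    finally show ?case by (simp add: mult.commute)
  qed
  from LIMSEQ_unique_eventually[OF mollified_integral_tendsto(1)[OF m L] mollified_integral_tendsto(1)[OF m L] this]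
  show "(LINT x|lebesgue. F x a * (\<theta> x * G x b + \<theta>' x b * w x)) 
       = (LINT x|lebesgue. F x b * (\<theta> x * G x a + \<theta>' x a * w x))" .
  have "sq_int (\<lambda>x. indicator K x * F x a)" using L K unfolding loc_L2_def by blast
  from sq_int_mult_integrable[OF this H]
  have "integrable lebesgue (\<lambda>x. indicator K x * F x a * (\<theta> x * G x b + \<theta>' x b * w x))" .
  moreover have "(\<lambda>x. indicator K x * F x a * (\<theta> x * G x b + \<theta>' x b * w x)) =
      (\<lambda>x. F x a * (\<theta> x * G x b + \<theta>' x b * w x))"
    by (rule eq_indicator_mult, rule H0)
  ultimately show "integrable lebesgue (\<lambda>x. F x a * (\<theta> x * G x b + \<theta>' x b * w x))"
    by (simp only:)
qed

subsection \<open>Inner products on the plane and oriented frames\<close>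

lemma inner_product_onD:
  assumes "inner_product_on F h"
  shows "subspace F" "bilinear h" "\<And>x y. x \<in> F \<Longrightarrow> y \<in> F \<Longrightarrow> h x y = h y x"
    "\<And>x. x \<in> F \<Longrightarrow> x \<noteq> 0 \<Longrightarrow> h x x > 0"
  using assms by (auto simp: inner_product_on_def)

lemma bilinear_simps:
  assumes "bilinear h"
  shows "h (x + y) z = h x z + h y z" "h x (y + z) = h x y + h x z"
    "h (c *\<^sub>R x) y = c * h x y" "h x (c *\<^sub>R y) = c * h x y"
    "h (- x) y = - h x y" "h x (- y) = - h x y"
    "h (x - y) z = h x z - h y z" "h x (y - z) = h x y - h x z"
    "h 0 y = 0" "h x 0 = 0"
  using assms by (simp_all add: bilinear_ladd bilinear_radd bilinear_lmul bilinear_rmul bilinear_lneg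
      bilinear_rneg bilinear_lsub bilinear_rsub bilinear_lzero bilinear_rzero)

lemma bilinear_sum_left:
  assumes "bilinear h" shows "h (\<Sum>i\<in>I. f i) y = (\<Sum>i\<in>I. h (f i) y)"
  using assms linear_sum[of "\<lambda>x. h x y" f I] by (simp add: bilinear_def)

lemma bilinear_sum_right:
  assumes "bilinear h" shows "h x (\<Sum>i\<in>I. f i) = (\<Sum>i\<in>I. h x (f i))"
  using assms linear_sum[of "h x" f I] by (simp add: bilinear_def)

definition det2 :: "real^2 \<Rightarrow> real^2 \<Rightarrow> real" where
  "det2 x y = x $ 1 * y $ 2 - x $ 2 * y $ 1"

lemma oriented_frame_iff:
  "oriented_frame g (e1, e2) \<longleftrightarrow> g e1 e1 = 1 \<and> g e2 e2 = 1 \<and> g e1 e2 = 0 \<and> det2 e1 e2 > 0"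
  by (simp add: oriented_frame_def det2_def)

lemma det2_combination:
  "det2 (a *\<^sub>R x + b *\<^sub>R y) (c *\<^sub>R x + d *\<^sub>R y) = (a * d - b * c) * det2 x y"
  by (simp add: det2_def algebra_simps)

locale plane =
  fixes g :: "real^2 \<Rightarrow> real^2 \<Rightarrow> real"
  assumes g: "inner_product_on UNIV g"
begin

lemmas gb = inner_product_onD(2)[OF g]
lemmas g_simps = bilinear_simps[OF gb]

lemma g_sym: "g x y = g y x"
  using inner_product_onD(3)[OF g] by simp

lemma g_pos: "x \<noteq> 0 \<Longrightarrow> g x x > 0"
  using inner_product_onD(4)[OF g] by simp

lemma frame_expansion:
  assumes f: "g f1 f1 = 1" "g f2 f2 = 1" "g f1 f2 = 0"
  shows "v = g f1 v *\<^sub>R f1 + g f2 v *\<^sub>R f2"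
proof -
  have f21: "g f2 f1 = 0" using f g_sym by simp
  have ne: "f1 \<noteq> f2" using f by auto
  have "independent {f1, f2}"
    unfolding independent_explicit
  proof (intro conjI allI impI ballI)
    fix c v assume c: "(\<Sum>v\<in>{f1, f2}. c v *\<^sub>R v) = 0" and v: "v \<in> {f1, f2}"
    have "c f1 *\<^sub>R f1 + c f2 *\<^sub>R f2 = 0" using c ne by simp
    then have "g f1 (c f1 *\<^sub>R f1 + c f2 *\<^sub>R f2) = 0" "g f2 (c f1 *\<^sub>R f1 + c f2 *\<^sub>R f2) = 0"
      by (simp_all add: g_simps)
    then show "c v = 0" using v f f21 by (auto simp: g_simps)
  qed simp
  then have "UNIV \<subseteq> span {f1, f2}"
    using card_eq_dim[of "{f1, f2}" UNIV] ne by (simp add: dim_UNIV)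
  then have "v \<in> span {f1, f2}" by blast
  then obtain u where "v = (\<Sum>x\<in>{f1, f2}. u x *\<^sub>R x)" by (auto simp: span_finite)
  then have "v = u f1 *\<^sub>R f1 + u f2 *\<^sub>R f2" using ne by simp
  then show ?thesis using f f21 by (simp add: g_simps)
qed

text \<open>The explicit orthonormalisation is kept in the statement because, applied to a
  coordinate basis, its coefficients are continuous functions of the metric; it also shows that
  \<open>frame\<close> meets its specification.\<close>

lemma frame_Gram_Schmidt:
  assumes "det2 x y > 0"
  defines "D \<equiv> g x x * g y y - (g x y)\<^sup>2"
  shows "D > 0" "g x x > 0"
    "oriented_frame g ((1 / sqrt (g x x)) *\<^sub>R x, (1 / (sqrt (g x x) * sqrt D)) *\<^sub>R (g x x *\<^sub>R y - g x y *\<^sub>R x))"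
proof -
  have x: "x \<noteq> 0" and ny: "g x x *\<^sub>R y - g x y *\<^sub>R x \<noteq> 0"
  proof -
    show x: "x \<noteq> 0" using assms by (auto simp: det2_def)
    show "g x x *\<^sub>R y - g x y *\<^sub>R x \<noteq> 0"
    proof
      assume "g x x *\<^sub>R y - g x y *\<^sub>R x = 0"
      moreover have "det2 x (g x x *\<^sub>R y - g x y *\<^sub>R x) = g x x * det2 x y"
        by (simp add: det2_def algebra_simps)
      ultimately show False using g_pos[OF x] assms by (simp add: det2_def)
    qed
  qed
  show gx: "g x x > 0" by (rule g_pos[OF x])
  have e: "g (g x x *\<^sub>R y - g x y *\<^sub>R x) (g x x *\<^sub>R y - g x y *\<^sub>R x) = g x x * D"
    using g_sym[of y x] by (simp add: D_def g_simps algebra_simps power2_eq_square)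
  then show D: "D > 0" using g_pos[OF ny] gx by (simp add: zero_less_mult_iff)
  define z where "z = g x x *\<^sub>R y - g x y *\<^sub>R x"
  have gz: "g z z = g x x * D" "g x z = 0" using e by (simp_all add: z_def g_simps)
  have "det2 ((1 / sqrt (g x x)) *\<^sub>R x) ((1 / (sqrt (g x x) * sqrt D)) *\<^sub>R z) = det2 x y / sqrt D"
    using gx D by (simp add: z_def det2_def field_simps)
  then have "oriented_frame g ((1 / sqrt (g x x)) *\<^sub>R x, (1 / (sqrt (g x x) * sqrt D)) *\<^sub>R z)"
    using gx D assms(1) real_sqrt_mult_self[of "g x x * D"]
    unfolding oriented_frame_iff by (simp add: g_simps gz real_sqrt_mult)
  then show "oriented_frame g ((1 / sqrt (g x x)) *\<^sub>R x, (1 / (sqrt (g x x) * sqrt D)) *\<^sub>R (g x x *\<^sub>R y - g x y *\<^sub>R x))"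
    unfolding z_def .
qed

lemma oriented_frame_frame: "oriented_frame g (frame g)"
proof -
  have "det2 (axis 1 1) (axis 2 1) > 0" by (simp add: det2_def axis_def)
  from frame_Gram_Schmidt(3)[OF this] show ?thesis unfolding frame_def by (rule someI)
qed

text \<open>Lagrange's identity makes the determinant of the coefficients 1, orientation fixing the
  sign; then a sum of squares vanishes and forces the coefficients to be those of a
  rotation.\<close>

lemma oriented_frames_rotation:
  assumes e: "oriented_frame g (e1, e2)" and f: "oriented_frame g (f1, f2)"
  obtains c s where "c\<^sup>2 + s\<^sup>2 = 1" "f1 = c *\<^sub>R e1 + s *\<^sub>R e2" "f2 = (- s) *\<^sub>R e1 + c *\<^sub>R e2"
proof -
  have E: "g e1 e1 = 1" "g e2 e2 = 1" "g e1 e2 = 0" "g e2 e1 = 0" "det2 e1 e2 > 0"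
    and F: "g f1 f1 = 1" "g f2 f2 = 1" "g f1 f2 = 0" "det2 f1 f2 > 0"
    using e f g_sym[of e2 e1] by (auto simp: oriented_frame_iff)
  define c s a b where "c = g e1 f1" and "s = g e2 f1" and "a = g e1 f2" and "b = g e2 f2"
  have f1: "f1 = c *\<^sub>R e1 + s *\<^sub>R e2" and f2: "f2 = a *\<^sub>R e1 + b *\<^sub>R e2"
    unfolding c_def s_def a_def b_def by (rule frame_expansion[OF E(1-3)])+
  have 1: "c\<^sup>2 + s\<^sup>2 = 1" and 2: "a\<^sup>2 + b\<^sup>2 = 1" and 3: "c * a + s * b = 0"
    using F(1-3) unfolding f1 f2 by (simp_all add: g_simps E power2_eq_square algebra_simps)
  have 4: "c * b - s * a > 0"
    using F(4) E(5) unfolding f1 f2 det2_combination by (simp add: zero_less_mult_iff)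
  have "(c * b - s * a)\<^sup>2 = (c\<^sup>2 + s\<^sup>2) * (a\<^sup>2 + b\<^sup>2) - (c * a + s * b)\<^sup>2"
    by (simp add: power2_eq_square algebra_simps)
  then have "(c * b - s * a)\<^sup>2 = 1" using 1 2 3 by simp
  then have "c * b - s * a = 1" using 4 by (simp add: power2_eq_1_iff)
  moreover have "(a + s)\<^sup>2 + (b - c)\<^sup>2 = (c\<^sup>2 + s\<^sup>2) + (a\<^sup>2 + b\<^sup>2) - 2 * (c * b - s * a)"
    by (simp add: power2_eq_square algebra_simps)
  ultimately have "(a + s)\<^sup>2 + (b - c)\<^sup>2 = 0" using 1 2 by simp
  then have "a = - s" "b = c" by (simp_all add: sum_power2_eq_zero_iff)
  then show thesis using that[OF 1 f1] f2 by simp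
qed

text \<open>\<open>frame\<close> is an arbitrary choice; quantities computed with it are compared
  with a convenient frame through this rotation.\<close>

lemma frame_eq_rotation:
  assumes f: "oriented_frame g (f1, f2)"
  obtains c s where "c\<^sup>2 + s\<^sup>2 = 1" "frame g = (c *\<^sub>R f1 + s *\<^sub>R f2, (- s) *\<^sub>R f1 + c *\<^sub>R f2)"
proof -
  obtain e1 e2 where e: "frame g = (e1, e2)" by fastforce
  obtain c s where "c\<^sup>2 + s\<^sup>2 = 1" "e1 = c *\<^sub>R f1 + s *\<^sub>R f2" "e2 = (- s) *\<^sub>R f1 + c *\<^sub>R f2"
    using oriented_frames_rotation[OF f oriented_frame_frame[unfolded e]] .
  then show thesis using that e by simp
qed

lemma form_wedge_frame:
  fixes A B :: "real^2 \<Rightarrow> 'm::finite mink"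
  assumes "bilinear (lor :: 'm mink \<Rightarrow> _)" "linear A" "linear B" and f: "oriented_frame g (f1, f2)"
  shows "form_wedge g A B = lor (A f1) (B f2) - lor (A f2) (B f1)"
proof -
  obtain c s where cs: "c\<^sup>2 + s\<^sup>2 = 1" "frame g = (c *\<^sub>R f1 + s *\<^sub>R f2, (- s) *\<^sub>R f1 + c *\<^sub>R f2)"
    by (rule frame_eq_rotation[OF f])
  have "form_wedge g A B = (c\<^sup>2 + s\<^sup>2) * (lor (A f1) (B f2) - lor (A f2) (B f1))"
    using assms(2,3) unfolding form_wedge_def cs(2)
    by (simp add: linear_add linear_cmul linear_diff linear_neg bilinear_simps[OF assms(1)] algebra_simps power2_eq_square)
  then show ?thesis using cs(1) by simp
qed

lemma hodge_frame:
  fixes A :: "real^2 \<Rightarrow> 'v::real_vector"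
  assumes "linear A" and f: "oriented_frame g (f1, f2)"
  shows "hodge g A v = g f2 v *\<^sub>R A f1 - g f1 v *\<^sub>R A f2"
proof -
  obtain c s where cs: "c\<^sup>2 + s\<^sup>2 = 1" "frame g = (c *\<^sub>R f1 + s *\<^sub>R f2, (- s) *\<^sub>R f1 + c *\<^sub>R f2)"
    by (rule frame_eq_rotation[OF f])
  have "hodge g A v = (c\<^sup>2 + s\<^sup>2) *\<^sub>R (g f2 v *\<^sub>R A f1 - g f1 v *\<^sub>R A f2)"
    using assms(1) unfolding hodge_def cs(2)
    by (simp add: linear_add linear_cmul linear_diff linear_neg g_simps algebra_simps power2_eq_square)
  then show ?thesis using cs(1) by simp
qed

lemma linear_hodge: "linear (hodge g A)"
  unfolding hodge_def by (auto simp: linear_iff g_simps algebra_simps split: prod.split)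

lemma hodge_frame_values:
  assumes "linear A" and f: "oriented_frame g (f1, f2)"
  shows "hodge g A f1 = - A f2" "hodge g A f2 = A f1"
  using f g_sym[of f2 f1] by (simp_all add: hodge_frame[OF assms] oriented_frame_iff)

lemma linear_eq_on_frame:
  assumes "linear A" "linear B" "g f1 f1 = 1" "g f2 f2 = 1" "g f1 f2 = 0" "A f1 = B f1" "A f2 = B f2"
  shows "A = B"
proof
  fix v
  have v: "v = g f1 v *\<^sub>R f1 + g f2 v *\<^sub>R f2" by (rule frame_expansion[OF assms(3-5)])
  show "A v = B v"
    by (subst (1 2) v) (simp add: assms(6,7) linear_add[OF assms(1)] linear_cmul[OF assms(1)]
        linear_add[OF assms(2)] linear_cmul[OF assms(2)])
qed

end

subsection \<open>Singular value decompositions and the spectral calculus\<close>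

locale plane_pair = plane g for g +
  fixes h :: "'v::euclidean_space \<Rightarrow> 'v \<Rightarrow> real" and F :: "'v set"
  assumes h: "inner_product_on F h"
begin

lemmas hb = inner_product_onD(2)[OF h]
lemmas h_simps = bilinear_simps[OF hb]
lemmas h_sum = bilinear_sum_left[OF hb] bilinear_sum_right[OF hb]
lemmas F_subspace = inner_product_onD(1)[OF h]
lemmas h_sym = inner_product_onD(3)[OF h]
lemmas h_pos = inner_product_onD(4)[OF h]

lemma h_nonneg: "x \<in> F \<Longrightarrow> h x x \<ge> 0"
  using h_pos[of x] by (cases "x = 0") (auto simp: h_simps intro: less_imp_le)

lemma h_eq_0_iff: "x \<in> F \<Longrightarrow> h x x = 0 \<longleftrightarrow> x = 0"
  using h_pos[of x] by (cases "x = 0") (auto simp: h_simps)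

text \<open>A pair of right singular vectors of \<open>A\<close>. Unlike a singular value
  decomposition it does not degenerate when a singular value vanishes, and it carries the
  orientation that the star refers to.\<close>

definition diag_frame :: "(real^2 \<Rightarrow> 'v) \<Rightarrow> real^2 \<Rightarrow> real^2 \<Rightarrow> bool" where
  "diag_frame A b1 b2 \<longleftrightarrow> oriented_frame g (b1, b2) \<and> h (A b1) (A b2) = 0"

text \<open>A rotation diagonalises the symmetric 2 by 2 Gram matrix of \<open>A\<close>. Its angle
  is half the polar angle of the vector formed by half the difference of the diagonal entries and
  the off-diagonal entry, because the rotated off-diagonal entry depends on the double
  angle.\<close>

lemma diag_frame_exists:
  assumes A: "linear A" "range A \<subseteq> F"
  obtains b1 b2 where "diag_frame A b1 b2"
proof -
  obtain f1 f2 where f: "oriented_frame g (f1, f2)" using oriented_frame_frame by (cases "frame g") auto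
  have G: "g f1 f1 = 1" "g f2 f2 = 1" "g f1 f2 = 0" "g f2 f1 = 0" "det2 f1 f2 > 0"
    using f g_sym[of f2 f1] by (auto simp: oriented_frame_iff)
  define a b d where "a = h (A f1) (A f1)" and "b = h (A f1) (A f2)" and "d = h (A f2) (A f2)"
  have b': "h (A f2) (A f1) = b" unfolding b_def using A(2) by (intro h_sym) auto
  define t R where "t = (a - d) / 2" and "R = sqrt (t\<^sup>2 + b\<^sup>2)"
  have "\<exists>c s. c\<^sup>2 + s\<^sup>2 = 1 \<and> c * s * (d - a) + (c\<^sup>2 - s\<^sup>2) * b = 0"
  proof (cases "R = 0")
    case True
    then have "b = 0" unfolding R_def by (simp add: sum_power2_eq_zero_iff)
    then show ?thesis by (intro exI[of _ 1] exI[of _ 0]) simp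
  next
    case False
    have R2: "R\<^sup>2 = t\<^sup>2 + b\<^sup>2" by (simp add: R_def)
    have "(t / R)\<^sup>2 + (b / R)\<^sup>2 = 1"
      using False by (simp add: power_divide add_divide_distrib[symmetric] R2[symmetric])
    then obtain \<phi> where \<phi>: "t / R = cos \<phi>" "b / R = sin \<phi>" using sincos_total_2pi by metis
    define c s where "c = cos (\<phi> / 2)" and "s = sin (\<phi> / 2)"
    have cs: "c\<^sup>2 + s\<^sup>2 = 1" by (simp add: c_def s_def)
    have 1: "c\<^sup>2 - s\<^sup>2 = t / R" using cos_double[of "\<phi> / 2"] by (simp add: c_def s_def \<phi>)
    have 2: "2 * (c * s) = b / R" using sin_double[of "\<phi> / 2"] by (simp add: c_def s_def \<phi>)
    have "c * s * (d - a) + (c\<^sup>2 - s\<^sup>2) * b = - (2 * (c * s)) * t + (c\<^sup>2 - s\<^sup>2) * b"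
      by (simp add: t_def field_simps)
    also have "\<dots> = 0" unfolding 1 2 by simp
    finally show ?thesis using cs by blast
  qed
  then obtain c s where cs: "c\<^sup>2 + s\<^sup>2 = 1" and z: "c * s * (d - a) + (c\<^sup>2 - s\<^sup>2) * b = 0" by blast
  let ?b1 = "c *\<^sub>R f1 + s *\<^sub>R f2" and ?b2 = "(- s) *\<^sub>R f1 + c *\<^sub>R f2"
  have "oriented_frame g (?b1, ?b2)"
    unfolding oriented_frame_iff det2_combination using cs G by (simp add: g_simps power2_eq_square algebra_simps)
  moreover have "h (A ?b1) (A ?b2) = c * s * (d - a) + (c\<^sup>2 - s\<^sup>2) * b"
    using A(1) by (simp add: linear_add linear_cmul linear_diff linear_neg h_simps b' 
        a_def[symmetric] b_def[symmetric] d_def[symmetric] power2_eq_square algebra_simps)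
  ultimately show thesis using z that unfolding diag_frame_def by simp
qed

text \<open>Computing the product of \<open>A (b j)\<close> and \<open>A (b' k)\<close> in both
  decompositions shows that \<open>b j\<close> and \<open>b' k\<close> are orthogonal unless their
  singular values agree. So both sums take the same value on every \<open>b' k\<close>, and both
  kill the kernel of \<open>A\<close>. This makes \<open>Qpow\<close> well defined.\<close>

lemma is_svd_unique:
  assumes 1: "is_svd g h F A n s B b" and 2: "is_svd g h F A n' s' B' b'"
  shows "(\<Sum>j<n. (s j powr r * g (b j) v) *\<^sub>R B j) = (\<Sum>j<n'. (s' j powr r * g (b' j) v) *\<^sub>R B' j)"
proof -
  have A1: "A v = (\<Sum>j<n. (s j * g (b j) v) *\<^sub>R B j)" for v using 1 by (simp add: is_svd_def)
  have A2: "A v = (\<Sum>j<n'. (s' j * g (b' j) v) *\<^sub>R B' j)" for v using 2 by (simp add: is_svd_def)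
  have s1: "s j \<ge> 0" "B j \<in> F" if "j < n" for j using 1 that by (auto simp: is_svd_def)
  have s2: "s' j \<ge> 0" "B' j \<in> F" if "j < n'" for j using 2 that by (auto simp: is_svd_def)
  have o1: "h (B i) (B j) = (if i = j then 1 else 0)" "g (b i) (b j) = (if i = j then 1 else 0)"
    if "i < n" "j < n" for i j using 1 that by (auto simp: is_svd_def)
  have o2: "h (B' i) (B' j) = (if i = j then 1 else 0)" "g (b' i) (b' j) = (if i = j then 1 else 0)"
    if "i < n'" "j < n'" for i j using 2 that by (auto simp: is_svd_def)
  have AF: "A v \<in> F" for v
    unfolding A1 using s1 by (intro subspace_sum[OF F_subspace] subspace_scale[OF F_subspace]) auto
  have Ab1: "A (b j) = s j *\<^sub>R B j" if "j < n" for j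
  proof -
    have "A (b j) = (\<Sum>i<n. if i = j then s j *\<^sub>R B j else 0)"
      unfolding A1 using o1 that by (intro sum.cong) auto
    then show ?thesis using that by simp
  qed
  have Ab2: "A (b' j) = s' j *\<^sub>R B' j" if "j < n'" for j
  proof -
    have "A (b' j) = (\<Sum>i<n'. if i = j then s' j *\<^sub>R B' j else 0)"
      unfolding A2 using o2 that by (intro sum.cong) auto
    then show ?thesis using that by simp
  qed
  have hA1: "h (B j) (A v) = s j * g (b j) v" if "j < n" for j v
  proof -
    have "h (B j) (A v) = (\<Sum>i<n. if i = j then s j * g (b j) v else 0)"
      unfolding A1 h_sum using o1 that by (intro sum.cong) (auto simp: h_simps)
    then show ?thesis using that by simp
  qed
  have hA2: "h (B' j) (A v) = s' j * g (b' j) v" if "j < n'" for j v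
  proof -
    have "h (B' j) (A v) = (\<Sum>i<n'. if i = j then s' j * g (b' j) v else 0)"
      unfolding A2 h_sum using o2 that by (intro sum.cong) (auto simp: h_simps)
    then show ?thesis using that by simp
  qed
  have eq: "s j = s' k" if "j < n" "k < n'" "g (b j) (b' k) \<noteq> 0" for j k
  proof -
    have "h (A (b j)) (A (b' k)) = h (A (b' k)) (A (b j))" by (intro h_sym AF)
    moreover have "h (A (b j)) (A (b' k)) = s j * (s j * g (b j) (b' k))"
      by (simp only: Ab1[OF that(1)] h_simps hA1[OF that(1)])
    moreover have "h (A (b' k)) (A (b j)) = s' k * (s' k * g (b' k) (b j))"
      by (simp only: Ab2[OF that(2)] h_simps hA2[OF that(2)])
    ultimately have "s j * (s j * g (b j) (b' k)) = s' k * (s' k * g (b' k) (b j))" by simp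
    then have "(s j)\<^sup>2 = (s' k)\<^sup>2" using that(3) g_sym[of "b' k"] by (simp add: power2_eq_square)
    then show ?thesis using s1(1)[OF that(1)] s2(1)[OF that(2)] by (simp add: power2_eq_iff_nonneg)
  qed
  define C where "C v = (\<Sum>j<n. (s j powr r * g (b j) v) *\<^sub>R B j)" for v
  have linC: "linear C" unfolding C_def
    by (intro linear_compose_sum ballI) (simp add: linear_iff g_simps algebra_simps)
  have linA: "linear A"
  proof -
    have "linear (\<lambda>v. \<Sum>j<n. (s j * g (b j) v) *\<^sub>R B j)"
      by (intro linear_compose_sum ballI) (simp add: linear_iff g_simps algebra_simps)
    then show ?thesis using A1 by presburger
  qed
  have Cb: "C (b' k) = s' k powr r *\<^sub>R B' k" if k: "k < n'" for k
  proof (cases "s' k = 0")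
    case True
    have "C (b' k) = (\<Sum>j<n. 0)"
      unfolding C_def using eq[OF _ k] True by (intro sum.cong) fastforce+
    then show ?thesis using True by simp
  next
    case False
    have "C (b' k) = (\<Sum>j<n. (s' k powr r / s' k) *\<^sub>R ((s j * g (b j) (b' k)) *\<^sub>R B j))"
      unfolding C_def using eq[OF _ k] False by (intro sum.cong) fastforce+
    also have "\<dots> = (s' k powr r / s' k) *\<^sub>R A (b' k)" by (simp only: A1 scaleR_right.sum)
    finally show ?thesis using False k by (simp add: Ab2)
  qed
  have Cz: "C z = 0" if z: "A z = 0" for z
  proof -
    have "s j * g (b j) z = 0" if "j < n" for j using hA1[OF that, of z] z by (simp add: h_simps)
    then have "C z = (\<Sum>j<n. 0)" unfolding C_def by (intro sum.cong) fastforce+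
    then show ?thesis by simp
  qed
  \<comment> \<open>\<open>v\<close> differs from its projection onto the span of the
    \<open>b'\<close> by an element of the kernel of \<open>A\<close>.\<close>
  let ?p = "\<Sum>k<n'. g (b' k) v *\<^sub>R b' k"
  have "A (v - ?p) = 0"
  proof -
    have "A ?p = (\<Sum>k<n'. (s' k * g (b' k) v) *\<^sub>R B' k)"
      unfolding linear_sum[OF linA] linear_cmul[OF linA] using Ab2 by (intro sum.cong) auto
    then show ?thesis unfolding linear_diff[OF linA] using A2[of v] by simp
  qed
  from Cz[OF this] have "C v = C ?p" by (simp add: linear_diff[OF linC])
  also have "\<dots> = (\<Sum>k<n'. (s' k powr r * g (b' k) v) *\<^sub>R B' k)"
    unfolding linear_sum[OF linC] linear_cmul[OF linC] using Cb by (intro sum.cong) auto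
  finally show ?thesis unfolding C_def .
qed

lemma sum_filter_two:
  fixes f :: "'c \<Rightarrow> 'v"
  shows "(\<Sum>j<length (filter P [x, y]). f (filter P [x, y] ! j)) = (if P x then f x else 0) + (if P y then f y else 0)"
  by (auto simp: numeral_2_eq_2 lessThan_Suc)

text \<open>A decomposition is read off from the frame by keeping the vectors with nonzero image and
  normalising the images. The exponent is (r - 1)/2 because \<open>h (A b) (A b)\<close> is the
  square of the singular value.\<close>

lemma Qpow_diag_frame:
  assumes A: "linear A" "range A \<subseteq> F" and b: "diag_frame A b1 b2"
  shows "Qpow g h F r A v =
    (h (A b1) (A b1) powr ((r - 1) / 2) * g b1 v) *\<^sub>R A b1 + (h (A b2) (A b2) powr ((r - 1) / 2) * g b2 v) *\<^sub>R A b2"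
proof -
  define L where "L = filter (\<lambda>b. A b \<noteq> 0) [b1, b2]"
  define n where "n = length L"
  define s where "s j = sqrt (h (A (L ! j)) (A (L ! j)))" for j
  define B where "B j = (1 / s j) *\<^sub>R A (L ! j)" for j
  have G: "g b1 b1 = 1" "g b2 b2 = 1" "g b1 b2 = 0" "g b2 b1 = 0" and H: "h (A b1) (A b2) = 0"
    using b g_sym[of b2 b1] by (auto simp: diag_frame_def oriented_frame_iff)
  have AF: "A x \<in> F" for x using A(2) by auto
  have H': "h (A b2) (A b1) = 0" using H h_sym[OF AF AF] by simp
  have ne: "b1 \<noteq> b2" using G by auto
  have L: "distinct L" unfolding L_def using ne by simp
  have inL: "L ! j \<in> {b1, b2} \<and> A (L ! j) \<noteq> 0" if "j < n" for j
  proof -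
    have "L ! j \<in> set L" using that unfolding n_def by simp
    then show ?thesis unfolding L_def by (auto split: if_splits)
  qed
  have spos: "s j > 0" if "j < n" for j
    using inL[OF that] h_pos[OF AF, of "L ! j"] by (simp add: s_def)
  have s2: "(s j)\<^sup>2 = h (A (L ! j)) (A (L ! j))" for j
    using h_nonneg[OF AF] by (simp add: s_def)
  have orth: "h (B i) (B j) = (if i = j then 1 else 0) \<and> g (L ! i) (L ! j) = (if i = j then 1 else 0)"
    if i: "i < n" and j: "j < n" for i j
  proof (cases "i = j")
    case True
    have "h (B j) (B j) = (s j)\<^sup>2 / (s j)\<^sup>2" unfolding s2 by (simp add: B_def h_simps s2[symmetric] power2_eq_square)
    moreover have "g (L ! j) (L ! j) = 1" using inL[OF j] G by auto
    ultimately show ?thesis using True spos[OF j] by simp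
  next
    case False
    then have "L ! i \<noteq> L ! j" using L i j by (simp add: nth_eq_iff_index_eq n_def)
    then have "h (A (L ! i)) (A (L ! j)) = 0 \<and> g (L ! i) (L ! j) = 0"
      using inL[OF i] inL[OF j] G H H' by auto
    then show ?thesis using False by (simp add: B_def h_simps)
  qed
  have sB: "s j *\<^sub>R B j = A (L ! j)" if "j < n" for j using spos[OF that] by (simp add: B_def)
  have expand: "(\<Sum>j<n. (s j * g (L ! j) v) *\<^sub>R B j) = A v" for v
  proof -
    have "(\<Sum>j<n. (s j * g (L ! j) v) *\<^sub>R B j) = (\<Sum>j<n. g (L ! j) v *\<^sub>R A (L ! j))"
      by (intro sum.cong refl) (simp add: sB[symmetric] mult.commute)
    also have "\<dots> = g b1 v *\<^sub>R A b1 + g b2 v *\<^sub>R A b2"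
      unfolding n_def L_def sum_filter_two[where f = "\<lambda>b. g b v *\<^sub>R A b"] by simp
    also have "\<dots> = A (g b1 v *\<^sub>R b1 + g b2 v *\<^sub>R b2)" using A(1) by (simp add: linear_add linear_cmul)
    also have "\<dots> = A v" using frame_expansion[OF G(1-3), of v] by simp
    finally show ?thesis .
  qed
  have svd: "is_svd g h F A n s B (\<lambda>j. L ! j)"
    unfolding is_svd_def
    using spos orth expand AF by (auto simp: B_def intro!: subspace_scale[OF F_subspace] less_imp_le)
  let ?C = "\<lambda>v. \<Sum>j<n. (s j powr r * g (L ! j) v) *\<^sub>R B j"
  have Q: "Qpow g h F r A = ?C"
    unfolding Qpow_def
  proof (rule the_equality)
    show "\<exists>n s B b. is_svd g h F A n s B b \<and> (\<forall>v. ?C v = (\<Sum>j<n. (s j powr r * g (b j) v) *\<^sub>R B j))"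
      using svd by blast
    fix C assume "\<exists>n s B b. is_svd g h F A n s B b \<and> (\<forall>v. C v = (\<Sum>j<n. (s j powr r * g (b j) v) *\<^sub>R B j))"
    then obtain n' s' B' b' where "is_svd g h F A n' s' B' b'" 
      "\<And>v. C v = (\<Sum>j<n'. (s' j powr r * g (b' j) v) *\<^sub>R B' j)" by blast
    then show "C = ?C" using is_svd_unique[OF svd] by (intro ext) simp
  qed
  have "Qpow g h F r A v = ?C v" unfolding Q ..
  also have "?C v = (\<Sum>j<n. (h (A (L ! j)) (A (L ! j)) powr ((r - 1) / 2) * g (L ! j) v) *\<^sub>R A (L ! j))"
  proof (intro sum.cong refl)
    fix j assume j: "j \<in> {..<n}"
    then have sj: "s j > 0" using spos by simp
    have "h (A (L ! j)) (A (L ! j)) powr ((r - 1) / 2) = s j powr (r - 1)"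
      using sj powr_powr[of "s j" 2 "(r - 1) / 2", unfolded nonzero_mult_div_cancel_left[OF zero_neq_numeral[symmetric]] times_divide_eq_right]
      by (simp add: s2[symmetric])
    also have "\<dots> = s j powr r / s j" using sj by (simp add: powr_diff)
    finally show "(s j powr r * g (L ! j) v) *\<^sub>R B j = (h (A (L ! j)) (A (L ! j)) powr ((r - 1) / 2) * g (L ! j) v) *\<^sub>R A (L ! j)"
      using sj by (simp add: B_def)
  qed
  also have "\<dots> = (h (A b1) (A b1) powr ((r - 1) / 2) * g b1 v) *\<^sub>R A b1 + (h (A b2) (A b2) powr ((r - 1) / 2) * g b2 v) *\<^sub>R A b2"
    unfolding n_def L_def sum_filter_two[where f = "\<lambda>b. (h (A b) (A b) powr ((r - 1) / 2) * g b v) *\<^sub>R A b"]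
    by (simp add: h_simps)
  finally show ?thesis by simp
qed

section \<open>Orthonormal bases and powers of self-adjoint operators\<close>

lemma orthonormal_basisD:
  assumes "orthonormal_basis h F B"
  shows "finite B" "\<And>b. b \<in> B \<Longrightarrow> b \<in> F" "\<And>a b. a \<in> B \<Longrightarrow> b \<in> B \<Longrightarrow> h a b = (if a = b then 1 else 0)"
    "\<And>Y. Y \<in> F \<Longrightarrow> Y = (\<Sum>b\<in>B. h b Y *\<^sub>R b)"
proof -
  show fin: "finite B" and BF: "\<And>b. b \<in> B \<Longrightarrow> b \<in> F" 
    and o: "\<And>a b. a \<in> B \<Longrightarrow> b \<in> B \<Longrightarrow> h a b = (if a = b then 1 else 0)"
    using assms span_base by (auto simp: orthonormal_basis_def)
  fix Y assume "Y \<in> F"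
  then have "Y \<in> span B" using assms by (simp add: orthonormal_basis_def)
  then obtain c where c: "Y = (\<Sum>b\<in>B. c b *\<^sub>R b)" using fin by (auto simp: span_finite)
  have "h b Y = c b" if "b \<in> B" for b
  proof -
    have "h b Y = (\<Sum>a\<in>B. if a = b then c b else 0)"
      unfolding c h_sum using o that by (intro sum.cong) (auto simp: h_simps)
    then show ?thesis using fin that by simp
  qed
  then show "Y = (\<Sum>b\<in>B. h b Y *\<^sub>R b)" unfolding c by (intro sum.cong) (auto simp: c)
qed

lemma parseval:
  assumes B: "orthonormal_basis h F B" and Y: "Y \<in> F" shows "(\<Sum>b\<in>B. (h b Y)\<^sup>2) = h Y Y"
proof -
  note D = orthonormal_basisD[OF B]
  have "h Y Y = h (\<Sum>b\<in>B. h b Y *\<^sub>R b) Y" using D(4)[OF Y] by simp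
  also have "\<dots> = (\<Sum>b\<in>B. (h b Y)\<^sup>2)" by (simp add: h_sum h_simps power2_eq_square)
  finally show ?thesis by simp
qed

definition orthonormal_subset :: "'v set \<Rightarrow> bool" where
  "orthonormal_subset B \<longleftrightarrow> finite B \<and> B \<subseteq> F \<and> (\<forall>a\<in>B. \<forall>b\<in>B. h a b = (if a = b then 1 else 0))"

lemma orthonormal_subset_independent:
  assumes "orthonormal_subset B" shows "independent B"
proof -
  have o: "\<And>a b. a \<in> B \<Longrightarrow> b \<in> B \<Longrightarrow> h a b = (if a = b then 1 else 0)" and fin: "finite B"
    using assms by (auto simp: orthonormal_subset_def)
  show ?thesis
    unfolding independent_explicit
  proof (intro conjI allI impI ballI fin)
    fix c v assume c: "(\<Sum>v\<in>B. c v *\<^sub>R v) = 0" and v: "v \<in> B"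
    have "h v (\<Sum>v\<in>B. c v *\<^sub>R v) = (\<Sum>a\<in>B. if a = v then c v else 0)"
      unfolding h_sum using o v by (intro sum.cong) (auto simp: h_simps)
    then show "c v = 0" using c v fin by (simp add: h_simps)
  qed
qed

text \<open>Take an orthonormal subset of \<open>F\<close> of largest cardinality. A vector outside
  its span would leave a nonzero remainder, which could be normalised and adjoined. As
  \<open>h\<close> is only known to be definite on \<open>F\<close>, every vector is kept inside
  \<open>F\<close>.\<close>

lemma orthonormal_extension:
  assumes "orthonormal_subset B0" obtains B where "B0 \<subseteq> B" "orthonormal_basis h F B"
proof -
  let ?P = "\<lambda>B. B0 \<subseteq> B \<and> orthonormal_subset B"
  have bound: "card B \<le> DIM('v)" if "?P B" for B
    using independent_bound[OF orthonormal_subset_independent] that by blast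
  have "\<exists>B. ?P B \<and> (\<forall>B'. ?P B' \<longrightarrow> card B' \<le> card B)"
    by (rule ex_has_greatest_nat[of ?P B0 card "Suc DIM('v)"])
      (use assms bound in \<open>auto simp: less_Suc_eq_le\<close>)
  then obtain B where B: "B0 \<subseteq> B" "orthonormal_subset B" and max: "\<And>B'. ?P B' \<Longrightarrow> card B' \<le> card B" by blast
  have o: "\<And>a b. a \<in> B \<Longrightarrow> b \<in> B \<Longrightarrow> h a b = (if a = b then 1 else 0)" and fin: "finite B" and BF: "B \<subseteq> F"
    using B by (auto simp: orthonormal_subset_def)
  have "F \<subseteq> span B"
  proof
    fix Y assume Y: "Y \<in> F"
    let ?p = "\<Sum>b\<in>B. h b Y *\<^sub>R b"
    let ?z = "Y - ?p"
    have pF: "?p \<in> F" using BF by (intro subspace_sum[OF F_subspace] subspace_scale[OF F_subspace]) auto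
    have zF: "?z \<in> F" by (rule subspace_diff[OF F_subspace Y pF])
    have orth: "h b ?z = 0" if "b \<in> B" for b
    proof -
      have "h b ?p = (\<Sum>a\<in>B. if a = b then h b Y else 0)"
        unfolding h_sum using o that by (intro sum.cong) (auto simp: h_simps)
      then show ?thesis using that fin by (simp add: h_simps)
    qed
    have "?z = 0"
    proof (rule ccontr)
      assume z: "?z \<noteq> 0"
      define c where "c = 1 / sqrt (h ?z ?z)"
      have hz: "h ?z ?z > 0" by (rule h_pos[OF zF z])
      let ?e = "c *\<^sub>R ?z"
      have e1: "h ?e ?e = 1" using hz by (simp only: h_simps(3,4) c_def) simp
      have eF: "?e \<in> F" by (rule subspace_scale[OF F_subspace zF])
      have e0: "h b ?e = 0" "h ?e b = 0" if "b \<in> B" for b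
      proof -
        show "h b ?e = 0" by (simp only: h_simps(4) orth[OF that] mult_zero_right)
        then show "h ?e b = 0" using h_sym[OF eF, of b] BF that by auto
      qed
      have eB: "?e \<notin> B" using e0(1) e1 by force
      have "orthonormal_subset (insert ?e B)"
        unfolding orthonormal_subset_def using fin eF BF e1 e0 o eB by auto
      then have "card (insert ?e B) \<le> card B" using B(1) by (intro max) auto
      then show False using eB fin by simp
    qed
    then have "Y = ?p" by simp
    also have "?p \<in> span B" by (intro span_sum span_scale span_base)
    finally show "Y \<in> span B" .
  qed
  moreover have "span B \<subseteq> F" using BF F_subspace by (simp add: span_minimal)
  ultimately show thesis using that B o fin by (auto simp: orthonormal_basis_def)
qed

definition selfadjoint :: "('v \<Rightarrow> 'v) \<Rightarrow> bool" where
  "selfadjoint S \<longleftrightarrow> (\<forall>x\<in>F. \<forall>y\<in>F. h (S x) y = h x (S y))"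

definition eigenbasis :: "('v \<Rightarrow> 'v) \<Rightarrow> 'v set \<Rightarrow> bool" where
  "eigenbasis S B \<longleftrightarrow> orthonormal_basis h F B \<and> (\<forall>b\<in>B. \<exists>c. S b = c *\<^sub>R b)"

lemma eigenbasis_value:
  assumes "eigenbasis S B" "b \<in> B" shows "S b = h b (S b) *\<^sub>R b"
  using assms orthonormal_basisD(3)[of B b b] by (auto simp: eigenbasis_def h_simps)

text \<open>Eigenvectors for different eigenvalues are orthogonal, so f(S) does not depend on the
  eigenbasis. This frees \<open>psd_powr\<close> from the basis that its definition selects.\<close>

lemma eigenbasis_sum_unique:
  assumes S: "selfadjoint S" and B: "eigenbasis S B" and B': "eigenbasis S B'" and Y: "Y \<in> F"
  shows "(\<Sum>b\<in>B. (f (h b (S b)) * h b Y) *\<^sub>R b) = (\<Sum>b\<in>B'. (f (h b (S b)) * h b Y) *\<^sub>R b)"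
proof -
  note D = orthonormal_basisD[OF B[unfolded eigenbasis_def, THEN conjunct1]]
  note D' = orthonormal_basisD[OF B'[unfolded eigenbasis_def, THEN conjunct1]]
  have eq: "f (h b (S b)) * h b b' = f (h b' (S b')) * h b b'" if "b \<in> B" "b' \<in> B'" for b b'
  proof -
    have "h (S b) b' = h b (S b')" using S that D(2) D'(2) by (auto simp: selfadjoint_def)
    then have "h b (S b) * h b b' = h b' (S b') * h b b'"
      using eigenbasis_value[OF B that(1)] eigenbasis_value[OF B' that(2)] by (metis h_simps(3,4))
    then show ?thesis by auto
  qed
  have "(\<Sum>b\<in>B. (f (h b (S b)) * h b Y) *\<^sub>R b) = (\<Sum>b\<in>B. \<Sum>b'\<in>B'. (h b' Y * (f (h b (S b)) * h b b')) *\<^sub>R b)"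
  proof (intro sum.cong refl)
    fix b assume "b \<in> B"
    have "h b Y = (\<Sum>b'\<in>B'. h b' Y * h b b')"
      by (subst D'(4)[OF Y]) (simp add: h_sum h_simps)
    then show "(f (h b (S b)) * h b Y) *\<^sub>R b = (\<Sum>b'\<in>B'. (h b' Y * (f (h b (S b)) * h b b')) *\<^sub>R b)"
      by (simp add: sum_distrib_left scaleR_sum_left mult_ac)
  qed
  also have "\<dots> = (\<Sum>b'\<in>B'. \<Sum>b\<in>B. (h b' Y * (f (h b' (S b')) * h b b')) *\<^sub>R b)"
    by (subst sum.swap) (simp add: eq cong: sum.cong)
  also have "\<dots> = (\<Sum>b'\<in>B'. (f (h b' (S b')) * h b' Y) *\<^sub>R b')"
  proof (intro sum.cong refl)
    fix b' assume b': "b' \<in> B'"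
    have "(\<Sum>b\<in>B. (h b' Y * (f (h b' (S b')) * h b b')) *\<^sub>R b) = (h b' Y * f (h b' (S b'))) *\<^sub>R (\<Sum>b\<in>B. h b b' *\<^sub>R b)"
      by (simp add: scaleR_sum_right mult_ac)
    also have "(\<Sum>b\<in>B. h b b' *\<^sub>R b) = b'" using D(4)[OF D'(2)[OF b']] by simp
    finally show "(\<Sum>b\<in>B. (h b' Y * (f (h b' (S b')) * h b b')) *\<^sub>R b) = (f (h b' (S b')) * h b' Y) *\<^sub>R b'"
      by (simp add: mult.commute)
  qed
  finally show ?thesis .
qed

lemma psd_powr_eigenbasis:
  assumes S: "selfadjoint S" and B: "eigenbasis S B" and Y: "Y \<in> F"
  shows "psd_powr h F S a Y = (\<Sum>b\<in>B. (h b (S b) powr a * h b Y) *\<^sub>R b)"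
proof -
  have "eigenbasis S (SOME B. eigenbasis S B)" using B by (rule someI)
  from eigenbasis_sum_unique[OF S this B Y, of "\<lambda>x. x powr a"]
  show ?thesis unfolding psd_powr_def Let_def eigenbasis_def .
qed

lemma psd_powr_basis_vector:
  assumes S: "selfadjoint S" and B: "eigenbasis S B" and b: "b \<in> B"
  shows "psd_powr h F S a b = (h b (S b) powr a) *\<^sub>R b"
proof -
  note D = orthonormal_basisD[OF B[unfolded eigenbasis_def, THEN conjunct1]]
  have "psd_powr h F S a b = (\<Sum>c\<in>B. if c = b then (h b (S b) powr a) *\<^sub>R b else 0)"
    unfolding psd_powr_eigenbasis[OF S B D(2)[OF b]] using D(3) b by (intro sum.cong) auto
  then show ?thesis using D(1) b by simp
qed

lemma psd_powr_selfadjoint: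
  assumes S: "selfadjoint S" and B: "eigenbasis S B"
  shows "selfadjoint (psd_powr h F S a)" "eigenbasis (psd_powr h F S a) B"
proof -
  note D = orthonormal_basisD[OF B[unfolded eigenbasis_def, THEN conjunct1]]
  have "h (psd_powr h F S a x) y = h x (psd_powr h F S a y)" if "x \<in> F" "y \<in> F" for x y
    unfolding psd_powr_eigenbasis[OF S B that(1)] psd_powr_eigenbasis[OF S B that(2)] h_sum h_simps
    using D(2) that h_sym[of x] by (intro sum.cong) auto
  then show "selfadjoint (psd_powr h F S a)" by (simp add: selfadjoint_def)
  show "eigenbasis (psd_powr h F S a) B"
    using B psd_powr_basis_vector[OF S B] unfolding eigenbasis_def by blast
qed

text \<open>The trace is taken in one arbitrarily selected orthonormal basis and the power in
  another; exchanging the sums and applying Parseval's identity removes both choices.\<close>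

lemma Tr_on_psd_powr:
  assumes S: "selfadjoint S" and B: "eigenbasis S B"
  shows "Tr_on h F (psd_powr h F S a) = (\<Sum>b\<in>B. h b (S b) powr a)"
proof -
  note D = orthonormal_basisD[OF B[unfolded eigenbasis_def, THEN conjunct1]]
  define B' where "B' = (SOME B. orthonormal_basis h F B)"
  have B': "orthonormal_basis h F B'" unfolding B'_def using B unfolding eigenbasis_def by (intro someI) blast
  note D' = orthonormal_basisD[OF B']
  have "Tr_on h F (psd_powr h F S a) = (\<Sum>c\<in>B'. h c (psd_powr h F S a c))"
    by (simp add: Tr_on_def B'_def)
  also have "\<dots> = (\<Sum>c\<in>B'. \<Sum>b\<in>B. h b (S b) powr a * (h c b)\<^sup>2)"
  proof (intro sum.cong refl)
    fix c assume c: "c \<in> B'"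
    show "h c (psd_powr h F S a c) = (\<Sum>b\<in>B. h b (S b) powr a * (h c b)\<^sup>2)"
      unfolding psd_powr_eigenbasis[OF S B D'(2)[OF c]] h_sum h_simps
      using h_sym[OF D(2) D'(2)[OF c]] by (intro sum.cong) (auto simp: power2_eq_square)
  qed
  also have "\<dots> = (\<Sum>b\<in>B. h b (S b) powr a * (\<Sum>c\<in>B'. (h c b)\<^sup>2))"
    by (subst sum.swap) (simp add: sum_distrib_left)
  also have "\<dots> = (\<Sum>b\<in>B. h b (S b) powr a)"
    using parseval[OF B' D(2)] D(3) by (intro sum.cong) auto
  finally show ?thesis .
qed

text \<open>The normalised nonzero images of the frame are eigenvectors of A A^T with eigenvalues
  \<open>h (A b) (A b)\<close>. Completing them to an orthonormal basis adds only null vectors,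
  which contribute nothing because a power of 0 is 0. The square root in Q(A) halves the
  exponent.\<close>

lemma Tr_Q_op_diag_frame:
  assumes A: "linear A" "range A \<subseteq> F" and b: "diag_frame A b1 b2"
  shows "Tr_on h F (psd_powr h F (Q_op g h F A) r) = h (A b1) (A b1) powr (r / 2) + h (A b2) (A b2) powr (r / 2)"
proof -
  have G: "g b1 b1 = 1" "g b2 b2 = 1" "g b1 b2 = 0" "g b2 b1 = 0" and H: "h (A b1) (A b2) = 0"
    using b g_sym[of b2 b1] by (auto simp: diag_frame_def oriented_frame_iff)
  have AF: "A x \<in> F" for x using A(2) by auto
  have H': "h (A b2) (A b1) = 0" using H h_sym[OF AF AF] by simp
  have ne: "b1 \<noteq> b2" using G by auto
  have adj: "adj g h A Y = h Y (A b1) *\<^sub>R b1 + h Y (A b2) *\<^sub>R b2" for Y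
    unfolding adj_def
  proof (rule the_equality)
    show "\<forall>w. g (h Y (A b1) *\<^sub>R b1 + h Y (A b2) *\<^sub>R b2) w = h Y (A w)"
    proof
      fix w
      have "h Y (A w) = h Y (A (g b1 w *\<^sub>R b1 + g b2 w *\<^sub>R b2))" using frame_expansion[OF G(1-3), of w] by simp
      then show "g (h Y (A b1) *\<^sub>R b1 + h Y (A b2) *\<^sub>R b2) w = h Y (A w)"
        using A(1) by (simp add: linear_add linear_cmul h_simps g_simps)
    qed
    fix v assume v: "\<forall>w. g v w = h Y (A w)"
    show "v = h Y (A b1) *\<^sub>R b1 + h Y (A b2) *\<^sub>R b2"
      using frame_expansion[OF G(1-3), of v] v g_sym[of _ v] by simp
  qed
  define T where "T = A \<circ> adj g h A"
  have T: "T Y = h Y (A b1) *\<^sub>R A b1 + h Y (A b2) *\<^sub>R A b2" for Y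
    using A(1) by (simp add: T_def adj linear_add linear_cmul)
  have sT: "selfadjoint T"
    unfolding selfadjoint_def T h_simps using h_sym[OF AF] by auto
  define N where "N = {b \<in> {b1, b2}. A b \<noteq> 0}"
  define e where "e b = (1 / sqrt (h (A b) (A b))) *\<^sub>R A b" for b
  have hpos: "h (A b) (A b) > 0" if "b \<in> N" for b using that h_pos[OF AF] by (auto simp: N_def)
  have ee: "h (e b) (e c) = (if b = c then 1 else 0)" if "b \<in> N" "c \<in> N" for b c
  proof (cases "b = c")
    case True
    then show ?thesis using hpos[OF that(1)] by (simp add: e_def h_simps)
  next
    case False
    then have "h (A b) (A c) = 0" using that H H' by (auto simp: N_def)
    then show ?thesis using False by (simp add: e_def h_simps)
  qed
  have inj: "inj_on e (N)" using ee by (intro inj_onI) (metis zero_neq_one)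
  have "orthonormal_subset (e ` N)"
    unfolding orthonormal_subset_def
  proof (intro conjI ballI)
    show "e ` N \<subseteq> F" using subspace_scale[OF F_subspace AF] by (auto simp: e_def)
    fix x y assume "x \<in> e ` N" "y \<in> e ` N"
    then show "h x y = (if x = y then 1 else 0)" using ee inj by (auto simp: inj_on_def)
  qed (simp add: N_def)
  then obtain B where B: "e ` N \<subseteq> B" "orthonormal_basis h F B" by (rule orthonormal_extension)
  note D = orthonormal_basisD[OF B(2)]
  have Te: "T (e b) = h (A b) (A b) *\<^sub>R e b" if bN: "b \<in> N" for b
  proof -
    consider "b = b1" | "b = b2" using bN by (auto simp: N_def)
    then show ?thesis by cases (simp_all add: T e_def h_simps H H')
  qed
  have T0: "T x = 0" if xB: "x \<in> B - e ` N" for x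
  proof -
    have "h x (A b) = 0" if "b \<in> {b1, b2}" for b
    proof (cases "A b = 0")
      case False
      then have "b \<in> N" using that by (auto simp: N_def)
      then have "e b \<in> B" "x \<noteq> e b" "x \<in> B" using xB B(1) by auto
      then have "h x (e b) = 0" using D(3)[of x "e b"] by simp
      then show ?thesis using hpos[OF \<open>b \<in> N\<close>] by (simp add: e_def h_simps)
    qed (simp add: h_simps)
    then show ?thesis by (simp add: T)
  qed
  have eT: "eigenbasis T B"
    unfolding eigenbasis_def
  proof (intro conjI ballI B(2))
    fix x assume x: "x \<in> B"
    show "\<exists>c. T x = c *\<^sub>R x"
    proof (cases "x \<in> e ` N")
      case True
      then show ?thesis using Te by blast
    next
      case False
      then show ?thesis using T0[of x] x by (intro exI[of _ 0]) simp
    qed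
  qed
  note Q = psd_powr_selfadjoint[OF sT eT, of "1/2"]
  have "Tr_on h F (psd_powr h F (Q_op g h F A) r) = (\<Sum>x\<in>B. h x (psd_powr h F T (1/2) x) powr r)"
    unfolding Q_op_def T_def[symmetric] by (rule Tr_on_psd_powr[OF Q])
  also have "\<dots> = (\<Sum>x\<in>B. h x (T x) powr (r / 2))"
    using D(3) by (intro sum.cong refl) (simp add: psd_powr_basis_vector[OF sT eT] h_simps powr_powr)
  also have "\<dots> = (\<Sum>x\<in>e ` N. h x (T x) powr (r / 2))"
    by (rule sum.mono_neutral_right) (use D(1) B(1) T0 in \<open>auto simp: h_simps\<close>)
  also have "\<dots> = (\<Sum>b\<in>N. h (e b) (T (e b)) powr (r / 2))"
    by (simp add: sum.reindex[OF inj])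
  also have "\<dots> = (\<Sum>b\<in>N. h (A b) (A b) powr (r / 2))"
    by (intro sum.cong refl) (simp add: Te h_simps ee)
  also have "\<dots> = (\<Sum>b\<in>{b1, b2}. h (A b) (A b) powr (r / 2))"
    by (rule sum.mono_neutral_left) (auto simp: N_def h_simps)
  finally show ?thesis using ne by simp
qed

end

subsection \<open>The pointwise duality inequality\<close>

lemma linear_Qpow_combination:
  "linear (\<lambda>v. (x * g b1 v) *\<^sub>R y + (x' * g b2 v) *\<^sub>R y')" if "bilinear (g :: real^2 \<Rightarrow> real^2 \<Rightarrow> real)"
  by (rule linearI) (simp_all add: bilinear_simps[OF that] algebra_simps)

lemma powr_minus_one_mult: "x \<ge> 0 \<Longrightarrow> x powr (r - 1) * x = (x::real) powr r"
  by (cases "x = 0") (auto simp: powr_diff)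

lemma half_sums_le: "x + z \<le> 1 \<Longrightarrow> y + w \<le> 1 \<Longrightarrow> (x + y) / 2 + (z + w) / 2 \<le> (1::real)"
proof -
  assume "x + z \<le> 1" "y + w \<le> 1"
  then have "((x + z) + (y + w)) / 2 \<le> (1 + 1) / 2" by (intro divide_right_mono add_mono) auto
  then show ?thesis by (simp add: add_divide_distrib)
qed

text \<open>Each of \<open>P1\<close>, \<open>P2\<close>, \<open>S1\<close>, \<open>S2\<close> is
  collected with a row or column sum as its total weight.\<close>

lemma doubly_substochastic_bound:
  fixes a11 :: real
  assumes "a11 + a12 \<le> 1" "a21 + a22 \<le> 1" "a11 + a21 \<le> 1" "a12 + a22 \<le> 1"
    "P1 \<ge> 0" "P2 \<ge> 0" "S1 \<ge> 0" "S2 \<ge> 0"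
  shows "a11 * (P1 + S1) + a12 * (P1 + S2) + a21 * (P2 + S1) + a22 * (P2 + S2) \<le> P1 + P2 + S1 + S2"
proof -
  have "P1 * (a11 + a12) \<le> P1 * 1" "P2 * (a21 + a22) \<le> P2 * 1" "S1 * (a11 + a21) \<le> S1 * 1" "S2 * (a12 + a22) \<le> S2 * 1"
    using assms by (intro mult_left_mono; simp)+
  then show ?thesis by (simp add: algebra_simps)
qed

context plane_pair
begin

lemma diag_frameD:
  assumes "range A \<subseteq> F" "diag_frame A b1 b2"
  shows "g b1 b1 = 1" "g b2 b2 = 1" "g b1 b2 = 0" "g b2 b1 = 0"
    "h (A b1) (A b2) = 0" "h (A b2) (A b1) = 0" "oriented_frame g (b1, b2)"
    "h (A b1) (A b1) \<ge> 0" "h (A b2) (A b2) \<ge> 0"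
    "h (A b1) (A b1) = 0 \<longleftrightarrow> A b1 = 0" "h (A b2) (A b2) = 0 \<longleftrightarrow> A b2 = 0"
proof -
  have AF: "A x \<in> F" for x using assms(1) by auto
  show "h (A b2) (A b1) = 0" using assms(2) h_sym[OF AF AF] by (simp add: diag_frame_def)
  show "h (A b1) (A b1) = 0 \<longleftrightarrow> A b1 = 0" "h (A b2) (A b2) = 0 \<longleftrightarrow> A b2 = 0"
    by (rule h_eq_0_iff[OF AF])+
qed (use assms g_sym[of b2 b1] in \<open>auto simp: diag_frame_def oriented_frame_iff intro!: h_nonneg\<close>)

lemma Qpow_properties:
  assumes A: "linear A" "range A \<subseteq> F" and b: "diag_frame A b1 b2"
  shows "Qpow g h F r A b1 = (h (A b1) (A b1) powr ((r - 1) / 2)) *\<^sub>R A b1"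
    "Qpow g h F r A b2 = (h (A b2) (A b2) powr ((r - 1) / 2)) *\<^sub>R A b2"
    "linear (Qpow g h F r A)" "range (Qpow g h F r A) \<subseteq> F"
proof -
  note D = diag_frameD[OF A(2) b]
  note Q = Qpow_diag_frame[OF A b, of r]
  show "Qpow g h F r A b1 = (h (A b1) (A b1) powr ((r - 1) / 2)) *\<^sub>R A b1"
    "Qpow g h F r A b2 = (h (A b2) (A b2) powr ((r - 1) / 2)) *\<^sub>R A b2"
    unfolding Q by (simp_all add: D)
  show "linear (Qpow g h F r A)"
    using linear_Qpow_combination[OF gb] unfolding Q[abs_def] by blast
  show "range (Qpow g h F r A) \<subseteq> F"
    unfolding Q[abs_def] using A(2)
    by (auto intro!: subspace_add[OF F_subspace] subspace_scale[OF F_subspace])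
qed

lemma Qpow_norm:
  assumes A: "linear A" "range A \<subseteq> F" and b: "diag_frame A b1 b2"
  shows "h (Qpow g h F r A b1) (Qpow g h F r A b1) = h (A b1) (A b1) powr r"
    "h (Qpow g h F r A b2) (Qpow g h F r A b2) = h (A b2) (A b2) powr r"
proof -
  note D = diag_frameD[OF A(2) b]
  have "x powr ((r - 1) / 2) * (x powr ((r - 1) / 2) * x) = x powr r" if "x \<ge> 0" for x :: real
  proof -
    have "x powr ((r - 1) / 2) * x powr ((r - 1) / 2) = x powr (r - 1)"
      by (simp flip: powr_add)
    then show ?thesis using powr_minus_one_mult[OF that, of r] by (metis mult.assoc)
  qed
  then show "h (Qpow g h F r A b1) (Qpow g h F r A b1) = h (A b1) (A b1) powr r"
    "h (Qpow g h F r A b2) (Qpow g h F r A b2) = h (A b2) (A b2) powr r"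
    unfolding Qpow_properties[OF A b] using D(8,9) by (simp_all add: h_simps)
qed

text \<open>The star of S_r(A) at one point; for r = p - 1 and A = du this is the value of
  Z.\<close>

definition dual_form :: "real \<Rightarrow> (real^2 \<Rightarrow> 'v) \<Rightarrow> real^2 \<Rightarrow> 'v" where
  "dual_form r A = hodge g (Qpow g h F r A)"

text \<open>On an oriented singular frame the star exchanges the two axes up to sign, so the same
  frame diagonalises the result, and the singular values are exchanged and raised to the power
  r.\<close>

lemma dual_form_properties:
  assumes A: "linear A" "range A \<subseteq> F" and b: "diag_frame A b1 b2"
  shows "linear (dual_form r A)" "range (dual_form r A) \<subseteq> F" "diag_frame (dual_form r A) b1 b2"
    "dual_form r A b1 = - ((h (A b2) (A b2) powr ((r - 1) / 2)) *\<^sub>R A b2)"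
    "dual_form r A b2 = (h (A b1) (A b1) powr ((r - 1) / 2)) *\<^sub>R A b1"
    "h (dual_form r A b1) (dual_form r A b1) = h (A b2) (A b2) powr r"
    "h (dual_form r A b2) (dual_form r A b2) = h (A b1) (A b1) powr r"
proof -
  note D = diag_frameD[OF A(2) b]
  note Q = Qpow_properties[OF A b, of r]
  note V = hodge_frame_values[OF Q(3) D(7)]
  show "linear (dual_form r A)" unfolding dual_form_def by (rule linear_hodge)
  show 1: "dual_form r A b1 = - ((h (A b2) (A b2) powr ((r - 1) / 2)) *\<^sub>R A b2)"
    and 2: "dual_form r A b2 = (h (A b1) (A b1) powr ((r - 1) / 2)) *\<^sub>R A b1"
    unfolding dual_form_def V Q by simp_all
  show "range (dual_form r A) \<subseteq> F"
  proof -
    have "Qpow g h F r A x \<in> F" for x using Q(4) by auto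
    then show ?thesis
      unfolding dual_form_def hodge_def
      by (auto split: prod.split intro!: subspace_diff[OF F_subspace] subspace_scale[OF F_subspace])
  qed
  show "diag_frame (dual_form r A) b1 b2"
    unfolding diag_frame_def 1 2 using D by (simp add: h_simps)
  show "h (dual_form r A b1) (dual_form r A b1) = h (A b2) (A b2) powr r"
    "h (dual_form r A b2) (dual_form r A b2) = h (A b1) (A b1) powr r"
    unfolding dual_form_def V using Qpow_norm[OF A b, of r] by (simp_all add: h_simps)
qed

text \<open>Along each axis the scalar factors multiply to 1 by the relation between p and q, and
  the two quarter turns compose to -1.\<close>

lemma dual_form_dual_form:
  assumes A: "linear A" "range A \<subseteq> F" and pq: "(p - 1) * (q - 1) = 1"
  shows "dual_form (q - 1) (dual_form (p - 1) A) v = - A v"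
proof -
  obtain b1 b2 where b: "diag_frame A b1 b2" by (rule diag_frame_exists[OF A])
  note D = diag_frameD[OF A(2) b]
  note Z = dual_form_properties[OF A b, of "p - 1"]
  note ZZ = dual_form_properties[OF Z(1-3), of "q - 1"]
  have e: "(p - 1) * ((q - 1 - 1) / 2) + (p - 1 - 1) / 2 = 0"
    using pq by (simp add: field_simps)
  have x: "(h y y powr (p - 1)) powr ((q - 1 - 1) / 2) *\<^sub>R (h y y powr ((p - 1 - 1) / 2)) *\<^sub>R y = y"
    if "h y y = 0 \<longleftrightarrow> y = 0" for y
  proof (cases "y = 0")
    case False
    then have "(h y y powr (p - 1)) powr ((q - 1 - 1) / 2) * h y y powr ((p - 1 - 1) / 2) = 1"
      unfolding powr_powr powr_add[symmetric] e using that by simp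
    then show ?thesis by (simp only: scaleR_scaleR scaleR_one)
  qed simp
  have "dual_form (q - 1) (dual_form (p - 1) A) = (\<lambda>v. - A v)"
  proof (rule linear_eq_on_frame[OF ZZ(1) _ D(1-3)])
    show "linear (\<lambda>v. - A v)" using A(1) by (rule linear_compose_neg)
    show "dual_form (q - 1) (dual_form (p - 1) A) b1 = - A b1"
      unfolding ZZ(4) unfolding Z(7) unfolding Z(5) x[OF D(10)] ..
    show "dual_form (q - 1) (dual_form (p - 1) A) b2 = - A b2"
      unfolding ZZ(5) unfolding Z(6) unfolding Z(4) scaleR_minus_right x[OF D(11)] ..
  qed
  then show ?thesis by simp
qed

abbreviation TrQ :: "real \<Rightarrow> (real^2 \<Rightarrow> 'v) \<Rightarrow> real" where
  "TrQ r A \<equiv> Tr_on h F (psd_powr h F (Q_op g h F A) r)"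

text \<open>Bessel's inequality for vectors of length at most 1 rather than exactly 1: a singular
  direction with vanishing singular value will be represented by the zero vector.\<close>

lemma Bessel_two:
  assumes "B \<in> F" "D1 \<in> F" "D2 \<in> F" "h D1 D2 = 0" "h D1 D1 \<le> 1" "h D2 D2 \<le> 1" "h B B \<le> 1"
  shows "(h B D1)\<^sup>2 + (h B D2)\<^sup>2 \<le> 1"
proof -
  let ?x = "h B D1" and ?y = "h B D2"
  have s: "h D1 B = ?x" "h D2 B = ?y" "h D2 D1 = 0" using assms h_sym by auto
  have "0 \<le> h (B - (?x *\<^sub>R D1 + ?y *\<^sub>R D2)) (B - (?x *\<^sub>R D1 + ?y *\<^sub>R D2))"
    using assms by (intro h_nonneg subspace_diff[OF F_subspace] subspace_add[OF F_subspace] subspace_scale[OF F_subspace])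
  also have "\<dots> = h B B - 2 * (?x\<^sup>2 + ?y\<^sup>2) + (?x\<^sup>2 * h D1 D1 + ?y\<^sup>2 * h D2 D2)"
    using s assms(4) by (simp add: h_simps power2_eq_square algebra_simps)
  also have "\<dots> \<le> 1 - 2 * (?x\<^sup>2 + ?y\<^sup>2) + (?x\<^sup>2 * 1 + ?y\<^sup>2 * 1)"
    using assms by (intro add_mono diff_mono mult_left_mono) auto
  finally show ?thesis by simp
qed

text \<open>In the singular frames of \<open>A\<close> and \<open>X\<close> the left side is a sum
  over pairs of singular values, each product bounded by Young's inequality. The coefficients are
  dominated by a doubly substochastic matrix, so every power is counted at most once, in the spirit
  of von Neumann's trace inequality.\<close>

lemma trace_Young:
  assumes A: "linear A" "range A \<subseteq> F" "diag_frame A b1 b2" and X: "linear X" "range X \<subseteq> F"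
    and pq: "p > 1" "q > 1" "1 / p + 1 / q = 1"
  shows "h (A b1) (X b2) - h (A b2) (X b1) \<le> TrQ p A / p + TrQ q X / q"
proof -
  obtain c1 c2 where c: "diag_frame X c1 c2" by (rule diag_frame_exists[OF X])
  note D = diag_frameD[OF A(2,3)] and E = diag_frameD[OF X(2) c]
  have AF: "A v \<in> F" "X v \<in> F" for v using A X by auto
  define l where "l v = sqrt (h (A v) (A v))" for v
  define m where "m v = sqrt (h (X v) (X v))" for v
  \<comment> \<open>If the image vanishes, division by zero gives 0, and
    \<open>A v = l v *\<^sub>R B v\<close> still holds.\<close>
  define B where "B v = (1 / l v) *\<^sub>R A v" for v
  define C where "C v = (1 / m v) *\<^sub>R X v" for v
  have l0: "l v \<ge> 0" and m0: "m v \<ge> 0" for v by (simp_all add: l_def m_def h_nonneg[OF AF(1)] h_nonneg[OF AF(2)])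
  have lB: "A v = l v *\<^sub>R B v" and mC: "X v = m v *\<^sub>R C v" for v
    using h_eq_0_iff[OF AF(1), of v] h_eq_0_iff[OF AF(2), of v] by (auto simp: B_def C_def l_def m_def)
  have BF: "B v \<in> F" "C v \<in> F" for v by (simp_all add: B_def C_def subspace_scale[OF F_subspace] AF)
  have l2: "l v * l v = h (A v) (A v)" "m v * m v = h (X v) (X v)" for v
    using h_nonneg[OF AF(1), of v] h_nonneg[OF AF(2), of v] by (simp_all add: l_def m_def)
  have n1: "h (B v) (B v) \<le> 1" "h (C v) (C v) \<le> 1" for v
    by (simp_all add: B_def C_def h_simps l2[symmetric])
  have o: "h (B b1) (B b2) = 0" "h (C c1) (C c2) = 0" by (simp_all add: B_def C_def h_simps D E)
  define K where "K v w = h (B v) (C w)" for v w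
  have hK: "h (A v) (X w) = l v * m w * K v w" for v w
    by (subst lB, subst mC) (simp add: h_simps K_def)
  have Krow: "(K v c1)\<^sup>2 + (K v c2)\<^sup>2 \<le> 1" for v
    unfolding K_def by (rule Bessel_two) (use BF n1 o in auto)
  have Kcol: "(K b1 w)\<^sup>2 + (K b2 w)\<^sup>2 \<le> 1" for w
    using Bessel_two[of "C w" "B b1" "B b2"] BF n1 o h_sym[OF BF(2) BF(1), of w] by (simp add: K_def)
  have Xe: "X v = g c1 v *\<^sub>R X c1 + g c2 v *\<^sub>R X c2" for v
    using arg_cong[OF frame_expansion[OF E(1-3), of v], of X] X(1) by (simp add: linear_add linear_cmul)
  have row_g: "(g c1 v)\<^sup>2 + (g c2 v)\<^sup>2 = g v v" for v
  proof -
    have "g v v = g v (g c1 v *\<^sub>R c1 + g c2 v *\<^sub>R c2)"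
      by (rule arg_cong[OF frame_expansion[OF E(1-3)]])
    also have "\<dots> = (g c1 v)\<^sup>2 + (g c2 v)\<^sup>2"
      by (simp only: g_simps g_sym[of v c1] g_sym[of v c2] power2_eq_square)
    finally show ?thesis by simp
  qed
  have col_g: "(g v b1)\<^sup>2 + (g v b2)\<^sup>2 = g v v" for v
  proof -
    have "g v v = g v (g b1 v *\<^sub>R b1 + g b2 v *\<^sub>R b2)"
      by (rule arg_cong[OF frame_expansion[OF D(1-3)]])
    also have "\<dots> = (g b1 v)\<^sup>2 + (g b2 v)\<^sup>2"
      by (simp only: g_simps g_sym[of v b1] g_sym[of v b2] power2_eq_square)
    finally show ?thesis by (simp add: g_sym[of v b1] g_sym[of v b2])
  qed
  define P where "P v = l v powr p / p" for v
  define S where "S w = m w powr q / q" for w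
  have young: "l v * m w \<le> P v + S w" for v w
    using Youngs_inequality[of p q "l v" "m w"] pq l0 m0 by (simp add: P_def S_def)
  \<comment> \<open>The mean of the two squares dominates the product of the coefficients; its row
    and column sums are bounded by Parseval in the plane and Bessel in \<open>F\<close>.\<close>
  define a where "a x y v w = ((g x y)\<^sup>2 + (K v w)\<^sup>2) / 2" for x y v w
  have term_le: "\<bar>g x y * (l v * m w * K v w)\<bar> \<le> a x y v w * (P v + S w)" for x y v w
  proof -
    have "\<bar>g x y * K v w\<bar> \<le> a x y v w"
    proof -
      have "0 \<le> (\<bar>g x y\<bar> - \<bar>K v w\<bar>)\<^sup>2" by simp
      then show ?thesis by (simp add: a_def power2_diff abs_mult)
    qed
    then have "\<bar>g x y * K v w\<bar> * (l v * m w) \<le> a x y v w * (P v + S w)"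
      using young l0 m0 by (intro mult_mono) (auto simp: a_def)
    then show ?thesis using l0 m0 by (simp add: abs_mult mult_ac)
  qed
  have "h (A b1) (X b2) = g c1 b2 * (l b1 * m c1 * K b1 c1) + g c2 b2 * (l b1 * m c2 * K b1 c2)"
    by (subst Xe) (simp add: h_simps hK)
  moreover have "h (A b2) (X b1) = g c1 b1 * (l b2 * m c1 * K b2 c1) + g c2 b1 * (l b2 * m c2 * K b2 c2)"
    by (subst Xe) (simp add: h_simps hK)
  ultimately have "h (A b1) (X b2) - h (A b2) (X b1) \<le> 
     a c1 b2 b1 c1 * (P b1 + S c1) + a c2 b2 b1 c2 * (P b1 + S c2) + a c1 b1 b2 c1 * (P b2 + S c1) + a c2 b1 b2 c2 * (P b2 + S c2)"
    using term_le[of c1 b2 b1 c1] term_le[of c2 b2 b1 c2] term_le[of c1 b1 b2 c1] term_le[of c2 b1 b2 c2] by linarith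
  also have "\<dots> \<le> P b1 + P b2 + S c1 + S c2"
  proof (rule doubly_substochastic_bound)
    show "a c1 b2 b1 c1 + a c2 b2 b1 c2 \<le> 1"
      using row_g[of b2] Krow[of b1] D(2) unfolding a_def by (intro half_sums_le) simp_all
    show "a c1 b1 b2 c1 + a c2 b1 b2 c2 \<le> 1"
      using row_g[of b1] Krow[of b2] D(1) unfolding a_def by (intro half_sums_le) simp_all
    show "a c1 b2 b1 c1 + a c1 b1 b2 c1 \<le> 1"
      using col_g[of c1] Kcol[of c1] E(1) unfolding a_def by (intro half_sums_le) simp_all
    show "a c2 b2 b1 c2 + a c2 b1 b2 c2 \<le> 1"
      using col_g[of c2] Kcol[of c2] E(2) unfolding a_def by (intro half_sums_le) simp_all
  qed (use pq in \<open>auto simp: P_def S_def\<close>)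
  also have "\<dots> = TrQ p A / p + TrQ q X / q"
  proof -
    have s: "sqrt x powr r = x powr (r / 2)" if "x \<ge> 0" for x r :: real
      using that by (simp add: powr_half_sqrt[symmetric] powr_powr)
    show ?thesis
      unfolding Tr_Q_op_diag_frame[OF A] Tr_Q_op_diag_frame[OF X c] P_def S_def l_def m_def
      using D(8,9) E(8,9) by (simp add: s add_divide_distrib)
  qed
  finally show ?thesis .
qed

text \<open>The singular values of the dual form are the powers s^(p-1), and (p - 1) q = p.\<close>

lemma trace_dual_form:
  assumes A: "linear A" "range A \<subseteq> F" "diag_frame A b1 b2" and pq: "p > 1" "1 / p + 1 / q = 1"
  shows "TrQ q (dual_form (p - 1) A) = TrQ p A"
proof -
  have q: "(p - 1) * (q / 2) = p / 2"
  proof -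
    have "p \<noteq> 0" "q \<noteq> 0" using pq by auto
    then show ?thesis using pq by (simp add: field_simps)
  qed
  note Z = dual_form_properties[OF A, of "p - 1"]
  show ?thesis
    unfolding Tr_Q_op_diag_frame[OF A] Tr_Q_op_diag_frame[OF Z(1-3)] Z(6,7) powr_powr q by simp
qed

text \<open>Trace Young is an equality at the dual form, so it also gives the subgradient inequality there.\<close>

lemma trace_subgradient:
  assumes A: "linear A" "range A \<subseteq> F" and B: "linear B" "range B \<subseteq> F"
    and pq: "p > 1" "q > 1" "1 / p + 1 / q = 1" and f: "oriented_frame g (f1, f2)"
  shows "TrQ q (dual_form (p - 1) A) + q * (h (A f1) (B f2) - h (A f2) (B f1))
    \<le> TrQ q (\<lambda>v. dual_form (p - 1) A v + B v)"
proof -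
  obtain b1 b2 where b: "diag_frame A b1 b2" by (rule diag_frame_exists[OF A])
  note D = diag_frameD[OF A(2) b]
  note Z = dual_form_properties[OF A b, of "p - 1"]
  let ?Z = "dual_form (p - 1) A"
  let ?X = "\<lambda>v. ?Z v + B v"
  have X: "linear ?X" "range ?X \<subseteq> F"
    using Z(1,2) B by (auto intro!: linear_compose_add subspace_add[OF F_subspace])
  have "h (A b1) (?Z b2) - h (A b2) (?Z b1) = TrQ p A"
  proof -
    have e: "x powr ((p - 2) / 2) * x = x powr (p / 2)" if "x \<ge> 0" for x :: real
    proof -
      have e: "(p - 2) / 2 = p / 2 - 1" by (simp add: field_simps)
      show ?thesis unfolding e by (rule powr_minus_one_mult[OF that])
    qed
    show ?thesis unfolding Z(4,5) Tr_Q_op_diag_frame[OF A b] using D(8,9) by (simp add: h_simps e)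
  qed
  moreover have "h (A b1) (?X b2) - h (A b2) (?X b1) \<le> TrQ p A / p + TrQ q ?X / q"
    by (rule trace_Young[OF A b X pq])
  ultimately have 1: "TrQ p A + (h (A b1) (B b2) - h (A b2) (B b1)) \<le> TrQ p A / p + TrQ q ?X / q"
    by (simp add: h_simps)
  have "q * (TrQ p A + (h (A b1) (B b2) - h (A b2) (B b1))) \<le> q * (TrQ p A / p + TrQ q ?X / q)"
    using 1 pq by (intro mult_left_mono) auto
  \<comment> \<open>After multiplication by \<open>q\<close> this turns \<open>TrQ p A / p\<close>
    into (q - 1) times the trace, which leaves exactly one copy of the trace on the left.\<close>
  moreover have "q / p = q - 1"
  proof -
    have "q * (1 / p + 1 / q) = q" using pq(3) by simp
    then show ?thesis using pq(2) by (simp add: distrib_left)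
  qed
  ultimately have "q * (TrQ p A + (h (A b1) (B b2) - h (A b2) (B b1))) \<le> (q - 1) * TrQ p A + TrQ q ?X"
    using pq by (simp add: distrib_left flip: \<open>q / p = q - 1\<close>)
  then have 2: "TrQ p A + q * (h (A b1) (B b2) - h (A b2) (B b1)) \<le> TrQ q ?X"
    by (simp add: algebra_simps)
  \<comment> \<open>The wedge coefficient is invariant under rotation, so the singular frame may be
    exchanged for the given one.\<close>
  obtain c s where cs: "c\<^sup>2 + s\<^sup>2 = 1" "b1 = c *\<^sub>R f1 + s *\<^sub>R f2" "b2 = (- s) *\<^sub>R f1 + c *\<^sub>R f2"
    by (rule oriented_frames_rotation[OF f D(7)])
  have "h (A b1) (B b2) - h (A b2) (B b1) = (c\<^sup>2 + s\<^sup>2) * (h (A f1) (B f2) - h (A f2) (B f1))"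
    unfolding cs(2,3) using A(1) B(1)
    by (simp add: linear_add linear_cmul linear_diff linear_neg h_simps algebra_simps power2_eq_square)
  then have "h (A b1) (B b2) - h (A b2) (B b1) = h (A f1) (B f2) - h (A f2) (B f1)" using cs(1) by simp
  then show ?thesis using 2 trace_dual_form[OF A b pq(1,3)] by simp
qed

end

subsection \<open>Explicit formulas in an arbitrary frame\<close>

text \<open>The two roots of x^2 - t x + d. Singular frames depend on choices without measurability,
  whereas these are Borel functions of the trace and determinant of the Gram matrix in any oriented
  orthonormal frame.\<close>

definition ev1 :: "real \<Rightarrow> real \<Rightarrow> real" where "ev1 t d = (t + sqrt (t\<^sup>2 - 4 * d)) / 2"
definition ev2 :: "real \<Rightarrow> real \<Rightarrow> real" where "ev2 t d = (t - sqrt (t\<^sup>2 - 4 * d)) / 2"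

text \<open>The coefficients of the linear polynomial interpolating the power at the two eigenvalues.\<close>

definition interp1 :: "real \<Rightarrow> real \<Rightarrow> real \<Rightarrow> real" where
  "interp1 a t d = (ev1 t d powr a - ev2 t d powr a) / (ev1 t d - ev2 t d)"

definition interp0 :: "real \<Rightarrow> real \<Rightarrow> real \<Rightarrow> real" where
  "interp0 a t d = ev1 t d powr a - interp1 a t d * ev1 t d"

lemma ev_cases:
  assumes "x + y = t" "x * y = d"
  shows "(ev1 t d = x \<and> ev2 t d = y) \<or> (ev1 t d = y \<and> ev2 t d = x)"
proof -
  have "t\<^sup>2 - 4 * d = (x - y)\<^sup>2" using assms by (auto simp: power2_eq_square algebra_simps)
  then have "sqrt (t\<^sup>2 - 4 * d) = \<bar>x - y\<bar>" by simp
  then show ?thesis using assms by (auto simp: ev1_def ev2_def abs_if)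
qed

text \<open>Equal eigenvalues are covered: then \<open>interp1\<close> is 0 by the convention for
  division by zero, and \<open>interp0\<close> is the power itself.\<close>

lemma interp_value:
  assumes "x + y = t" "x * y = d"
  shows "interp0 a t d + interp1 a t d * x = x powr a"
proof -
  have "interp0 a t d + interp1 a t d * ev2 t d = ev2 t d powr a"
  proof -
    have "interp1 a t d * (ev1 t d - ev2 t d) = ev1 t d powr a - ev2 t d powr a" by (simp add: interp1_def)
    then show ?thesis by (simp add: interp0_def algebra_simps)
  qed
  moreover have "interp0 a t d + interp1 a t d * ev1 t d = ev1 t d powr a" by (simp add: interp0_def)
  ultimately show ?thesis using ev_cases[OF assms] by metis
qed

context plane_pair
begin

definition trace2 :: "(real^2 \<Rightarrow> 'v) \<Rightarrow> real^2 \<Rightarrow> real^2 \<Rightarrow> real" where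
  "trace2 A f1 f2 = h (A f1) (A f1) + h (A f2) (A f2)"

definition gram2 :: "(real^2 \<Rightarrow> 'v) \<Rightarrow> real^2 \<Rightarrow> real^2 \<Rightarrow> real" where
  "gram2 A f1 f2 = h (A f1) (A f1) * h (A f2) (A f2) - (h (A f1) (A f2))\<^sup>2"

text \<open>Trace and determinant of the Gram matrix are invariant under rotation of the
  frame.\<close>

lemma trace2_gram2_diag:
  assumes A: "linear A" "range A \<subseteq> F" and b: "diag_frame A b1 b2" and f: "oriented_frame g (f1, f2)"
  shows "h (A b1) (A b1) + h (A b2) (A b2) = trace2 A f1 f2"
    "h (A b1) (A b1) * h (A b2) (A b2) = gram2 A f1 f2"
proof -
  note D = diag_frameD[OF A(2) b]
  have AF: "A x \<in> F" for x using A(2) by auto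
  obtain c s where cs: "c\<^sup>2 + s\<^sup>2 = 1" "b1 = c *\<^sub>R f1 + s *\<^sub>R f2" "b2 = (- s) *\<^sub>R f1 + c *\<^sub>R f2"
    by (rule oriented_frames_rotation[OF f D(7)])
  have sym: "h (A f2) (A f1) = h (A f1) (A f2)" by (rule h_sym[OF AF AF])
  have Ab: "A b1 = c *\<^sub>R A f1 + s *\<^sub>R A f2" "A b2 = (- s) *\<^sub>R A f1 + c *\<^sub>R A f2"
    unfolding cs(2,3) using A(1) by (simp_all add: linear_add linear_cmul linear_diff linear_neg)
  have "h (A b1) (A b1) + h (A b2) (A b2) = (c\<^sup>2 + s\<^sup>2) * trace2 A f1 f2"
    unfolding Ab trace2_def by (simp add: h_simps sym algebra_simps power2_eq_square)
  then show "h (A b1) (A b1) + h (A b2) (A b2) = trace2 A f1 f2" using cs(1) by simp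
  have "h (A b1) (A b1) * h (A b2) (A b2) - (h (A b1) (A b2))\<^sup>2 = (c\<^sup>2 + s\<^sup>2)\<^sup>2 * gram2 A f1 f2"
    unfolding Ab gram2_def by (simp add: h_simps sym algebra_simps power2_eq_square)
  then show "h (A b1) (A b1) * h (A b2) (A b2) = gram2 A f1 f2" using cs(1) D(5) by simp
qed

lemma TrQ_frame:
  assumes A: "linear A" "range A \<subseteq> F" and f: "oriented_frame g (f1, f2)"
  shows "TrQ r A = ev1 (trace2 A f1 f2) (gram2 A f1 f2) powr (r / 2) + ev2 (trace2 A f1 f2) (gram2 A f1 f2) powr (r / 2)"
proof -
  obtain b1 b2 where b: "diag_frame A b1 b2" by (rule diag_frame_exists[OF A])
  show ?thesis
    unfolding Tr_Q_op_diag_frame[OF A b]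
    using ev_cases[OF trace2_gram2_diag[OF A b f]] by auto
qed

lemma TrQ_bounds:
  assumes A: "linear A" "range A \<subseteq> F" and f: "oriented_frame g (f1, f2)" and r: "r > 0"
  shows "0 \<le> TrQ r A" "TrQ r A \<le> 2 * trace2 A f1 f2 powr (r / 2)"
proof -
  obtain b1 b2 where b: "diag_frame A b1 b2" by (rule diag_frame_exists[OF A])
  note D = diag_frameD[OF A(2) b]
  note T = trace2_gram2_diag(1)[OF A b f]
  have "h (A b1) (A b1) powr (r / 2) \<le> trace2 A f1 f2 powr (r / 2)"
    "h (A b2) (A b2) powr (r / 2) \<le> trace2 A f1 f2 powr (r / 2)"
    using D(8,9) T r by (auto intro!: powr_mono2)
  then show "0 \<le> TrQ r A" "TrQ r A \<le> 2 * trace2 A f1 f2 powr (r / 2)"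
    unfolding Tr_Q_op_diag_frame[OF A b] by auto
qed

text \<open>At the two squared singular values the power (r - 1)/2 agrees with a linear polynomial,
  so Q(A)^(r-1) A is that polynomial in A A^T applied to A; and A A^T has the same expression in
  every oriented orthonormal frame.\<close>

lemma Qpow_frame:
  assumes A: "linear A" "range A \<subseteq> F" and f: "oriented_frame g (f1, f2)"
  shows "Qpow g h F r A v = interp0 ((r - 1) / 2) (trace2 A f1 f2) (gram2 A f1 f2) *\<^sub>R A v +
     interp1 ((r - 1) / 2) (trace2 A f1 f2) (gram2 A f1 f2) *\<^sub>R (h (A f1) (A v) *\<^sub>R A f1 + h (A f2) (A v) *\<^sub>R A f2)"
proof -
  obtain b1 b2 where b: "diag_frame A b1 b2" by (rule diag_frame_exists[OF A])
  note D = diag_frameD[OF A(2) b]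
  note T = trace2_gram2_diag[OF A b f]
  have T': "h (A b2) (A b2) + h (A b1) (A b1) = trace2 A f1 f2" "h (A b2) (A b2) * h (A b1) (A b1) = gram2 A f1 f2"
    using T by (simp_all add: add.commute mult.commute)
  let ?a = "(r - 1) / 2"
  let ?x = "interp0 ?a (trace2 A f1 f2) (gram2 A f1 f2)" and ?y = "interp1 ?a (trace2 A f1 f2) (gram2 A f1 f2)"
  obtain c s where cs: "c\<^sup>2 + s\<^sup>2 = 1" "b1 = c *\<^sub>R f1 + s *\<^sub>R f2" "b2 = (- s) *\<^sub>R f1 + c *\<^sub>R f2"
    by (rule oriented_frames_rotation[OF f D(7)])
  have rot: "h (A f1) w *\<^sub>R A f1 + h (A f2) w *\<^sub>R A f2 = h (A b1) w *\<^sub>R A b1 + h (A b2) w *\<^sub>R A b2" for w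
  proof -
    have "h (A b1) w *\<^sub>R A b1 + h (A b2) w *\<^sub>R A b2 = (c\<^sup>2 + s\<^sup>2) *\<^sub>R (h (A f1) w *\<^sub>R A f1 + h (A f2) w *\<^sub>R A f2)"
      unfolding cs(2,3) using A(1)
      by (simp add: linear_add linear_cmul linear_diff linear_neg h_simps algebra_simps power2_eq_square)
    then show ?thesis using cs(1) by simp
  qed
  let ?R = "\<lambda>v. ?x *\<^sub>R A v + ?y *\<^sub>R (h (A b1) (A v) *\<^sub>R A b1 + h (A b2) (A v) *\<^sub>R A b2)"
  have "Qpow g h F r A = ?R"
  proof (rule linear_eq_on_frame[OF Qpow_properties(3)[OF A b] _ D(1-3)])
    show "linear ?R"
      by (rule linearI) (simp_all add: linear_add[OF A(1)] linear_cmul[OF A(1)] h_simps algebra_simps)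
    show "Qpow g h F r A b1 = ?R b1"
      unfolding Qpow_properties(1)[OF A b] interp_value[OF T, of ?a, symmetric] by (simp add: D algebra_simps)
    show "Qpow g h F r A b2 = ?R b2"
      unfolding Qpow_properties(2)[OF A b] interp_value[OF T', of ?a, symmetric] by (simp add: D algebra_simps)
  qed
  then show ?thesis unfolding rot by simp
qed

text \<open>Each squared singular value of the dual form is the power r of one of \<open>A\<close>,
  and the latter is at most the trace.\<close>

lemma dual_form_trace2:
  assumes A: "linear A" "range A \<subseteq> F" and f: "oriented_frame g (f1, f2)" and r: "r > 0"
  shows "0 \<le> trace2 (dual_form r A) f1 f2" "trace2 (dual_form r A) f1 f2 \<le> 2 * trace2 A f1 f2 powr r"
proof -
  obtain b1 b2 where b: "diag_frame A b1 b2" by (rule diag_frame_exists[OF A])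
  note D = diag_frameD[OF A(2) b]
  note Z = dual_form_properties[OF A b, of r]
  have "h (A b1) (A b1) powr r \<le> trace2 A f1 f2 powr r"
    "h (A b2) (A b2) powr r \<le> trace2 A f1 f2 powr r"
    using D(8,9) trace2_gram2_diag(1)[OF A b f] r by (auto intro!: powr_mono2)
  then show "0 \<le> trace2 (dual_form r A) f1 f2" "trace2 (dual_form r A) f1 f2 \<le> 2 * trace2 A f1 f2 powr r"
    unfolding trace2_gram2_diag(1)[OF Z(1-3) f, symmetric] Z(6,7) by auto
qed

end

subsection \<open>Tangent spaces of hyperbolic space\<close>

lemma bilinear_lor: "bilinear (lor :: 'm::finite mink \<Rightarrow> 'm mink \<Rightarrow> real)"
  unfolding bilinear_def lor_def
  by (auto intro!: linearI simp: sum.distrib sum_distrib_left algebra_simps)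

lemmas lor_simps = bilinear_simps[OF bilinear_lor]

lemma lor_sym: "lor X Y = lor Y X"
  by (simp add: lor_def mult.commute)

text \<open>Vectors Lorentz-orthogonal to a timelike vector are spacelike. With spatial parts x', w'
  and last coordinates x0, w0, orthogonality reads x' . w' = x0 w0, and Cauchy-Schwarz together with
  w0^2 = 1 + |w'|^2 excludes |x'|^2 \<le> x0^2 unless x = 0.\<close>

lemma inner_product_on_tan_space:
  assumes w: "w \<in> (hyp :: 'm::finite mink set)"
  shows "inner_product_on (tan_space w) lor"
  unfolding inner_product_on_def
proof (intro conjI ballI impI bilinear_lor)
  show "subspace (tan_space w)"
    by (auto simp: subspace_def tan_space_def lor_simps)
  fix x assume x: "x \<in> tan_space w" and nz: "x \<noteq> 0"
  let ?s = "\<lambda>x y. \<Sum>i\<in>UNIV. (x :: 'm mink) $ Some i * y $ Some i"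
  have ww: "(w $ None)\<^sup>2 = 1 + ?s w w" using w by (simp add: hyp_def lor_def power2_eq_square)
  have xw: "?s x w = x $ None * w $ None" using x by (simp add: tan_space_def lor_def)
  have cs: "(?s x w)\<^sup>2 \<le> ?s x x * ?s w w"
    using Cauchy_Schwarz_ineq_sum[of "\<lambda>i. x $ Some i" "\<lambda>i. w $ Some i" UNIV] by (simp add: power2_eq_square)
  have sx: "?s x x \<ge> 0" "?s w w \<ge> 0" by (auto intro: sum_nonneg)
  show "lor x x > 0"
  proof (rule ccontr)
    assume "\<not> lor x x > 0"
    then have le: "?s x x \<le> (x $ None)\<^sup>2" by (simp add: lor_def power2_eq_square)
    have "(x $ None)\<^sup>2 * (1 + ?s w w) \<le> ?s x x * ?s w w"
      using cs unfolding xw power_mult_distrib ww .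
    also have "\<dots> \<le> (x $ None)\<^sup>2 * ?s w w" using le sx by (intro mult_right_mono) auto
    finally have x0: "x $ None = 0" by (simp add: distrib_left)
    then have "?s x x = 0" using le sx by simp
    then have "x $ Some i = 0" for i by (subst (asm) sum_nonneg_eq_0_iff) auto
    then have "x $ j = 0" for j using x0 by (cases j) auto
    with nz show False by (simp add: vec_eq_iff)
  qed
qed (rule lor_sym)

lemma tan_proj_in_tan_space: "w \<in> hyp \<Longrightarrow> tan_proj w Y \<in> tan_space w"
  by (simp add: tan_space_def tan_proj_def lor_simps hyp_def)

lemma lor_tan_proj: "lor X w = 0 \<Longrightarrow> lor X (tan_proj w Y) = lor X Y"
  by (simp add: tan_proj_def lor_simps)

lemma linear_tan_proj: "linear (tan_proj w)"
  by (rule linearI) (simp_all add: tan_proj_def lor_simps algebra_simps)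

lemma plane_pair_tan_space:
  assumes "inner_product_on UNIV g" "w \<in> hyp" shows "plane_pair g lor (tan_space w)"
  using assms inner_product_on_tan_space by (simp add: plane_pair_def plane_def plane_pair_axioms_def)

subsection \<open>Charts, frames and lifts\<close>

lemma has_derivative_imp_frechet_continuous:
  "smooth_on D t \<Longrightarrow> x \<in> D \<Longrightarrow> (t has_derivative frechet_derivative t (at x)) (at x)"
  "smooth_on D t \<Longrightarrow> continuous_on D (\<lambda>x. frechet_derivative t (at x) e)"
proof -
  assume s: "smooth_on D t"
  then have "C_k_on (Suc 0) D t" unfolding smooth_on_def by blast
  then show "x \<in> D \<Longrightarrow> (t has_derivative frechet_derivative t (at x)) (at x)"
    "continuous_on D (\<lambda>x. frechet_derivative t (at x) e)"
    using frechet_derivative_works by auto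
qed

abbreviation ex :: "real^2" where "ex \<equiv> axis 1 1"
abbreviation ey :: "real^2" where "ey \<equiv> axis 2 1"

locale riemannian_surface =
  fixes S :: "('a::t2_space, 'b::topological_space) surface"
  assumes S: "closed_oriented_riemannian_surface S"
begin

lemma compact_pts: "compact (pts S)"
  and atlas: "oriented_smooth_atlas (pts S) (charts S)"
  and metric: "riemannian_metric S" and area: "riemannian_area S" and ucover: "universal_covering S"
  using S by (auto simp: closed_oriented_riemannian_surface_def)

lemma chart_open: "c \<in> charts S \<Longrightarrow> open (fst c)"
  and chart_image_openin: "c \<in> charts S \<Longrightarrow> openin (top_of_set (pts S)) (snd c ` fst c)"
  and chart_homeo: "c \<in> charts S \<Longrightarrow> \<exists>\<theta>. homeomorphism (fst c) (snd c ` fst c) (snd c) \<theta>"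
  using atlas by (auto simp: oriented_smooth_atlas_def split_beta)

lemma chart_inj: "c \<in> charts S \<Longrightarrow> inj_on (snd c) (fst c)"
  using chart_homeo[of c] unfolding homeomorphism_def by (auto intro: inj_on_inverseI)

lemma chart_continuous: "c \<in> charts S \<Longrightarrow> continuous_on (fst c) (snd c)"
  using chart_homeo[of c] unfolding homeomorphism_def by blast

lemma chart_in_pts: "c \<in> charts S \<Longrightarrow> v \<in> fst c \<Longrightarrow> snd c v \<in> pts S"
  using openin_imp_subset[OF chart_image_openin] by blast

lemma chart_cover: "x \<in> pts S \<Longrightarrow> \<exists>c\<in>charts S. x \<in> snd c ` fst c"
proof -
  assume "x \<in> pts S"
  moreover have "(\<Union>c\<in>charts S. snd c ` fst c) = pts S"
    using atlas by (simp add: oriented_smooth_atlas_def split_beta)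
  ultimately show ?thesis by blast
qed

lemma coord_chart: "c \<in> charts S \<Longrightarrow> v \<in> fst c \<Longrightarrow> coord c (snd c v) = v"
  unfolding coord_def using the_inv_into_f_f[OF chart_inj] by blast

lemma chart_at_in: "x \<in> pts S \<Longrightarrow> chart_at S x \<in> charts S \<and> x \<in> snd (chart_at S x) ` fst (chart_at S x)"
proof -
  assume "x \<in> pts S"
  from someI_ex[OF chart_cover[OF this, unfolded Bex_def]] show ?thesis unfolding chart_at_def .
qed

lemma open_chart_preimage:
  assumes "c \<in> charts S" "openin (top_of_set (pts S)) U" shows "open (fst c \<inter> snd c -` U)"
proof -
  obtain T where T: "open T" "U = pts S \<inter> T" using assms(2) by (auto simp: openin_open)
  have "fst c \<inter> snd c -` U = fst c \<inter> snd c -` T" using chart_in_pts[OF assms(1)] T(2) by auto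
  then show ?thesis
    using continuous_open_preimage[OF chart_continuous[OF assms(1)] chart_open[OF assms(1)] T(1)] by simp
qed

abbreviation overlap :: "(real^2) set \<times> (real^2 \<Rightarrow> 'a) \<Rightarrow> (real^2) set \<times> (real^2 \<Rightarrow> 'a) \<Rightarrow> (real^2) set" where
  "overlap c d \<equiv> fst c \<inter> snd c -` (snd d ` fst d)"

lemma transition:
  assumes "c \<in> charts S" "d \<in> charts S"
  shows "smooth_on (overlap c d) (coord d \<circ> snd c)"
    "v \<in> overlap c d \<Longrightarrow> det (matrix (frechet_derivative (coord d \<circ> snd c) (at v))) > 0"
    "open (overlap c d)"
  using atlas assms open_chart_preimage[OF assms(1) chart_image_openin[OF assms(2)]]
  unfolding oriented_smooth_atlas_def Let_def by blast+

lemma coord_in: "d \<in> charts S \<Longrightarrow> v \<in> overlap c d \<Longrightarrow> coord d (snd c v) \<in> fst d \<and> snd d (coord d (snd c v)) = snd c v"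
proof -
  assume d: "d \<in> charts S" and "v \<in> overlap c d"
  then obtain x where x: "x \<in> fst d" "snd c v = snd d x" by auto
  then show ?thesis using coord_chart[OF d x(1)] by simp
qed

lemma in_overlap_chart_at: 
  "c \<in> charts S \<Longrightarrow> v \<in> fst c \<Longrightarrow> chart_at S (snd c v) \<in> charts S \<and> v \<in> overlap c (chart_at S (snd c v))"
  using chart_at_in[OF chart_in_pts] by blast

lemma dpar_has_derivative:
  assumes "c \<in> charts S" "v \<in> fst c"
  shows "((coord (chart_at S (snd c v)) \<circ> snd c) has_derivative dpar S c v) (at v)"
  unfolding dpar_def
  using has_derivative_imp_frechet_continuous(1) transition(1)[OF assms(1)] in_overlap_chart_at[OF assms] by blast

lemma det2_dpar:
  assumes "c \<in> charts S" "v \<in> fst c" shows "det2 (dpar S c v ex) (dpar S c v ey) > 0"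
  using transition(2)[OF assms(1), of "chart_at S (snd c v)" v] in_overlap_chart_at[OF assms]
  unfolding dpar_def[symmetric] by (simp add: det_2 matrix_def det2_def mult.commute)

lemma plane_metric: "x \<in> pts S \<Longrightarrow> plane (metric S x)"
  using metric by (simp add: riemannian_metric_def plane_def)

lemma inner_product_metric: "x \<in> pts S \<Longrightarrow> inner_product_on UNIV (metric S x)"
  using metric by (simp add: riemannian_metric_def)

lemma metric_coeff_continuous: "c \<in> charts S \<Longrightarrow> continuous_on (fst c) (metric_coeff S c a b)"
  using metric smooth_on_imp_continuous_on unfolding riemannian_metric_def by blast

text \<open>Together with \<open>mc2\<close> and \<open>mc3\<close>, the coefficients of the
  Gram-Schmidt frame in the coordinate basis of the chart. They are continuous on the chart, while
  \<open>dpar\<close> need not be: it refers to the chart selected at each point, which may jump.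
  Measurability and bounds are therefore phrased with these coefficients.\<close>

definition mc1 :: "(real^2) set \<times> (real^2 \<Rightarrow> 'a) \<Rightarrow> real^2 \<Rightarrow> real" where
  "mc1 c v = 1 / sqrt (metric_coeff S c ex ex v)"
definition mc2 :: "(real^2) set \<times> (real^2 \<Rightarrow> 'a) \<Rightarrow> real^2 \<Rightarrow> real" where
  "mc2 c v = - metric_coeff S c ex ey v / (sqrt (metric_coeff S c ex ex v) * area_density S c v)"
definition mc3 :: "(real^2) set \<times> (real^2 \<Rightarrow> 'a) \<Rightarrow> real^2 \<Rightarrow> real" where
  "mc3 c v = metric_coeff S c ex ex v / (sqrt (metric_coeff S c ex ex v) * area_density S c v)"

definition fr1 :: "(real^2) set \<times> (real^2 \<Rightarrow> 'a) \<Rightarrow> real^2 \<Rightarrow> real^2" where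
  "fr1 c v = mc1 c v *\<^sub>R dpar S c v ex"
definition fr2 :: "(real^2) set \<times> (real^2 \<Rightarrow> 'a) \<Rightarrow> real^2 \<Rightarrow> real^2" where
  "fr2 c v = mc2 c v *\<^sub>R dpar S c v ex + mc3 c v *\<^sub>R dpar S c v ey"

lemma area_density_eq: "area_density S c v =
    sqrt (metric_coeff S c ex ex v * metric_coeff S c ey ey v - (metric_coeff S c ex ey v)\<^sup>2)"
  by (simp add: area_density_def Let_def)

lemma chart_frame:
  assumes "c \<in> charts S" "v \<in> fst c"
  shows "area_density S c v > 0" "metric_coeff S c ex ex v > 0"
    "oriented_frame (metric S (snd c v)) (fr1 c v, fr2 c v)"
    "mc1 c v * mc3 c v * area_density S c v = 1"
proof -
  interpret plane "metric S (snd c v)" by (rule plane_metric[OF chart_in_pts[OF assms]])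
  note G = frame_Gram_Schmidt[OF det2_dpar[OF assms]]
  show d: "area_density S c v > 0" and m: "metric_coeff S c ex ex v > 0"
    using G(1,2) by (simp_all add: area_density_eq metric_coeff_def)
  have "fr2 c v = (1 / (sqrt (metric_coeff S c ex ex v) * area_density S c v)) *\<^sub>R
     (metric_coeff S c ex ex v *\<^sub>R dpar S c v ey - metric_coeff S c ex ey v *\<^sub>R dpar S c v ex)"
    by (simp add: fr2_def mc2_def mc3_def scaleR_diff_right)
  then show "oriented_frame (metric S (snd c v)) (fr1 c v, fr2 c v)"
    using G(3) unfolding fr1_def mc1_def area_density_eq metric_coeff_def by simp
  show "mc1 c v * mc3 c v * area_density S c v = 1"
    using d m real_sqrt_mult_self[of "metric_coeff S c ex ex v"] by (simp add: mc1_def mc3_def)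
qed

lemma continuous_mc:
  assumes "c \<in> charts S"
  shows "continuous_on (fst c) (area_density S c)" "continuous_on (fst c) (mc1 c)"
    "continuous_on (fst c) (mc2 c)" "continuous_on (fst c) (mc3 c)"
proof -
  note m = metric_coeff_continuous[OF assms]
  show d: "continuous_on (fst c) (area_density S c)"
    unfolding area_density_eq[abs_def] by (intro continuous_intros m)
  have nz: "metric_coeff S c ex ex v \<noteq> 0" "area_density S c v \<noteq> 0" if "v \<in> fst c" for v
    using chart_frame(1,2)[OF assms that] by auto
  show "continuous_on (fst c) (mc1 c)" "continuous_on (fst c) (mc2 c)" "continuous_on (fst c) (mc3 c)"
    unfolding mc1_def[abs_def] mc2_def[abs_def] mc3_def[abs_def]
    by (intro continuous_intros m d ballI; simp add: nz)+
qed

text \<open>The area density cancels the normalisation of the frame, so integrals of wedge products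
  become integrals of coordinate coefficients in which the metric no longer occurs.\<close>

lemma chart_form_wedge:
  assumes c: "c \<in> charts S" "v \<in> fst c" and lin: "linear A" "linear B"
  shows "area_density S c v * form_wedge (metric S (snd c v)) A B =
     lor (A (dpar S c v ex)) (B (dpar S c v ey)) - lor (A (dpar S c v ey)) (B (dpar S c v ex))"
proof -
  interpret plane "metric S (snd c v)" by (rule plane_metric[OF chart_in_pts[OF c]])
  have "form_wedge (metric S (snd c v)) A B = 
    mc1 c v * mc3 c v * (lor (A (dpar S c v ex)) (B (dpar S c v ey)) - lor (A (dpar S c v ey)) (B (dpar S c v ex)))"
    unfolding form_wedge_frame[OF bilinear_lor lin chart_frame(3)[OF c]] fr1_def fr2_def
    using lin by (simp add: linear_add linear_cmul lor_simps algebra_simps)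
  then have "area_density S c v * form_wedge (metric S (snd c v)) A B = (mc1 c v * mc3 c v * area_density S c v) *
      (lor (A (dpar S c v ex)) (B (dpar S c v ey)) - lor (A (dpar S c v ey)) (B (dpar S c v ex)))"
    by (simp only: mult_ac)
  then show ?thesis unfolding chart_frame(4)[OF c] by simp
qed

lemma dpar_onto:
  assumes c: "c \<in> charts S" "v \<in> fst c" and lin: "linear A" "linear B"
    and eq: "A (dpar S c v ex) = B (dpar S c v ex)" "A (dpar S c v ey) = B (dpar S c v ey)"
  shows "A = B"
proof -
  interpret plane "metric S (snd c v)" by (rule plane_metric[OF chart_in_pts[OF c]])
  show ?thesis
    by (rule linear_eq_on_frame[of A B "fr1 c v" "fr2 c v"])
      (use lin chart_frame(3)[OF c] eq in \<open>auto simp: oriented_frame_iff fr1_def fr2_def linear_add linear_cmul\<close>)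
qed

section \<open>The universal covering and functions invariant under deck transformations\<close>

lemma uproj_pts: "uproj S ` ucov S = pts S" and uproj_continuous: "continuous_on (ucov S) (uproj S)"
  using ucover by (auto simp: universal_covering_def covering_space_def)

lemma fibre_nonempty: "x \<in> pts S \<Longrightarrow> \<exists>y. y \<in> ucov S \<and> uproj S y = x"
  unfolding uproj_pts[symmetric] by auto

lemma uproj_in_pts: "y \<in> ucov S \<Longrightarrow> uproj S y \<in> pts S"
  unfolding uproj_pts[symmetric] by auto

lemma deck_transitive:
  "y \<in> ucov S \<Longrightarrow> z \<in> ucov S \<Longrightarrow> uproj S y = uproj S z \<Longrightarrow> \<exists>\<tau>\<in>deck S. \<tau> y = z"
  using ucover by (auto simp: universal_covering_def)

lemma deck_ucov: "\<tau> \<in> deck S \<Longrightarrow> y \<in> ucov S \<Longrightarrow> \<tau> y \<in> ucov S \<and> uproj S (\<tau> y) = uproj S y"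
  unfolding deck_def homeomorphism_def by blast

text \<open>Compose the parametrisation with the inverse of the projection on one sheet over an
  evenly covered neighbourhood.\<close>

lemma lifted_chart_exists:
  assumes c: "c \<in> charts S" and v: "v \<in> fst c"
  obtains W \<sigma> where "lifted_chart S c W \<sigma>" "v \<in> W"
proof -
  obtain T \<V> where T: "snd c v \<in> T" "openin (top_of_set (pts S)) T" "\<Union>\<V> = ucov S \<inter> uproj S -` T"
    and \<V>: "\<And>U. U \<in> \<V> \<Longrightarrow> \<exists>q. homeomorphism U T (uproj S) q"
    using ucover chart_in_pts[OF c v] unfolding universal_covering_def covering_space_def by meson
  obtain y where "y \<in> ucov S" "uproj S y = snd c v"
    using fibre_nonempty[OF chart_in_pts[OF c v]] by auto
  then have "y \<in> \<Union>\<V>" using T by auto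
  then obtain U where U: "U \<in> \<V>" by blast
  obtain q where q: "homeomorphism U T (uproj S) q" using \<V>[OF U] by blast
  define W where "W = fst c \<inter> snd c -` T"
  have "continuous_on W (snd c)" using chart_continuous[OF c] by (rule continuous_on_subset) (simp add: W_def)
  then have "continuous_on W (q \<circ> snd c)"
    using q by (intro continuous_on_compose) (auto simp: homeomorphism_def W_def elim: continuous_on_subset)
  moreover have "open W" unfolding W_def by (rule open_chart_preimage[OF c T(2)])
  moreover have "(q \<circ> snd c) ` W \<subseteq> ucov S"
    using q U T(3) unfolding homeomorphism_def W_def by auto
  moreover have "uproj S ((q \<circ> snd c) x) = snd c x" if "x \<in> W" for x
    using q that unfolding homeomorphism_def W_def by auto
  ultimately have "lifted_chart S c W (q \<circ> snd c)"
    unfolding lifted_chart_def using c by (auto simp: W_def)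
  then show thesis using that v T(1) by (auto simp: W_def)
qed

lemma lifted_chartD:
  assumes "lifted_chart S c W \<sigma>"
  shows "c \<in> charts S" "open W" "W \<subseteq> fst c" "continuous_on W \<sigma>"
    "\<And>v. v \<in> W \<Longrightarrow> v \<in> fst c" "\<And>v. v \<in> W \<Longrightarrow> \<sigma> v \<in> ucov S" "\<And>v. v \<in> W \<Longrightarrow> uproj S (\<sigma> v) = snd c v"
  using assms unfolding lifted_chart_def by auto

text \<open>The value at the point of the fibre that \<open>surface_integral\<close> selects; for
  deck-invariant functions the selection is immaterial.\<close>

definition desc :: "('b \<Rightarrow> real) \<Rightarrow> 'a \<Rightarrow> real" where
  "desc f x = f (SOME y. y \<in> ucov S \<and> uproj S y = x)"

lemma surface_integral_desc: "surface_integral S f = (LINT x|area S. desc f x)"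
  by (simp add: surface_integral_def desc_def)

lemma desc_eq:
  assumes "y \<in> ucov S" "\<And>\<tau>. \<tau> \<in> deck S \<Longrightarrow> f (\<tau> y) = f y" shows "desc f (uproj S y) = f y"
proof -
  define z where "z = (SOME z. z \<in> ucov S \<and> uproj S z = uproj S y)"
  have "\<exists>z. z \<in> ucov S \<and> uproj S z = uproj S y" using assms(1) by auto
  from someI_ex[OF this] have "z \<in> ucov S \<and> uproj S z = uproj S y" unfolding z_def .
  then obtain \<tau> where "\<tau> \<in> deck S" "\<tau> y = z" using deck_transitive[OF assms(1)] by metis
  then have "f z = f y" using assms(2) by blast
  then show ?thesis by (simp add: desc_def z_def)
qed

lemma desc_lift:
  assumes "x \<in> pts S" shows "\<exists>y\<in>ucov S. uproj S y = x \<and> desc f x = f y"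
proof -
  from someI_ex[OF fibre_nonempty[OF assms]] show ?thesis unfolding desc_def by auto
qed

subsection \<open>The area measure in charts\<close>

lemma space_area: "space (area S) = pts S"
  and sets_area: "sets (area S) = {A. A \<subseteq> pts S \<and> (\<forall>c\<in>charts S. fst c \<inter> snd c -` A \<in> sets lebesgue)}"
  and emeasure_area: "c \<in> charts S \<Longrightarrow> A \<in> sets (area S) \<Longrightarrow> A \<subseteq> snd c ` fst c \<Longrightarrow>
     emeasure (area S) A = (\<integral>\<^sup>+ v. ennreal (area_density S c v) * indicator (fst c \<inter> snd c -` A) v \<partial>lebesgue)"
  using area by (auto simp: riemannian_area_def split_beta)

lemma openin_sets_area: "openin (top_of_set (pts S)) U \<Longrightarrow> U \<in> sets (area S)"
  unfolding sets_area using open_chart_preimage[of _ U] openin_imp_subset[of euclidean "pts S" U] by auto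

text \<open>By Lindelof's theorem, countably many of the given neighbourhoods cover each chart
  domain.\<close>

lemma sets_area_local:
  assumes "A \<subseteq> pts S"
    and loc: "\<And>c v. c \<in> charts S \<Longrightarrow> v \<in> fst c \<Longrightarrow> \<exists>W. open W \<and> v \<in> W \<and> W \<subseteq> fst c \<and> W \<inter> snd c -` A \<in> sets lebesgue"
  shows "A \<in> sets (area S)"
  unfolding sets_area
proof (intro CollectI conjI ballI assms(1))
  fix c assume c: "c \<in> charts S"
  let ?F = "{W. open W \<and> W \<subseteq> fst c \<and> W \<inter> snd c -` A \<in> sets lebesgue}"
  have "\<And>W. W \<in> ?F \<Longrightarrow> open W" by simp
  from Lindelof[OF this] obtain F' where F': "F' \<subseteq> ?F" "countable F'" "\<Union>F' = \<Union>?F" .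
  have "\<Union>?F = fst c"
  proof (intro equalityI subsetI)
    fix v assume "v \<in> fst c"
    from loc[OF c this] obtain W where "open W" "v \<in> W" "W \<subseteq> fst c" "W \<inter> snd c -` A \<in> sets lebesgue" by auto
    then show "v \<in> \<Union>?F" by (intro UnionI[of W]) simp_all
  qed auto
  with F'(3) have "\<Union>F' = fst c" by simp
  then have "fst c \<inter> snd c -` A = (\<Union>W\<in>F'. W \<inter> snd c -` A)" by auto
  also have "\<dots> \<in> sets lebesgue" using F'(1,2) by (intro sets.countable_UN') auto
  finally show "fst c \<inter> snd c -` A \<in> sets lebesgue" .
qed

lemma measurable_area_local:
  fixes G :: "'a \<Rightarrow> real"
  assumes loc: "\<And>c v. c \<in> charts S \<Longrightarrow> v \<in> fst c \<Longrightarrow>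
    \<exists>W. open W \<and> v \<in> W \<and> W \<subseteq> fst c \<and> (\<lambda>v. indicator W v * G (snd c v)) \<in> borel_measurable lebesgue"
  shows "G \<in> borel_measurable (area S)"
proof (rule measurableI)
  fix B :: "real set" assume B: "B \<in> sets borel"
  show "G -` B \<inter> space (area S) \<in> sets (area S)"
  proof (rule sets_area_local)
    fix c v assume cv: "c \<in> charts S" "v \<in> fst c"
    then obtain W where W: "open W" "v \<in> W" "W \<subseteq> fst c" 
      and m: "(\<lambda>v. indicator W v * G (snd c v)) \<in> borel_measurable lebesgue" using loc by blast
    have "W \<inter> snd c -` (G -` B \<inter> space (area S)) = W \<inter> (\<lambda>v. indicator W v * G (snd c v)) -` B"
      using W(3) chart_in_pts[OF cv(1)] by (auto simp: space_area)
    also have "\<dots> \<in> sets lebesgue"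
      using measurable_sets[OF m B] W(1) by (intro sets.Int) auto
    finally show "\<exists>W. open W \<and> v \<in> W \<and> W \<subseteq> fst c \<and> W \<inter> snd c -` (G -` B \<inter> space (area S)) \<in> sets lebesgue"
      using W by blast
  qed (auto simp: space_area)
qed simp

lemma measurable_chart:
  fixes G :: "'a \<Rightarrow> real"
  assumes c: "c \<in> charts S" and G: "G \<in> borel_measurable (area S)"
  shows "(\<lambda>v. indicator (fst c) v * G (snd c v)) \<in> borel_measurable lebesgue"
proof -
  have "(\<lambda>v. G (snd c v)) \<in> borel_measurable (lebesgue_on (fst c))"
  proof (rule measurableI)
    fix B :: "real set" assume B: "B \<in> sets borel"
    have "fst c \<inter> snd c -` (G -` B \<inter> pts S) \<in> sets lebesgue"
      using measurable_sets[OF G B] c unfolding space_area sets_area by blast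
    moreover have "fst c \<inter> snd c -` (G -` B \<inter> pts S) = (\<lambda>v. G (snd c v)) -` B \<inter> fst c"
      using chart_in_pts[OF c] by auto
    ultimately show "(\<lambda>v. G (snd c v)) -` B \<inter> space (lebesgue_on (fst c)) \<in> sets (lebesgue_on (fst c))"
      using chart_open[OF c] by (simp add: sets_restrict_space_iff)
  qed simp
  then show ?thesis
    using chart_open[OF c] by (simp add: borel_measurable_restrict_space_iff mult.commute)
qed

text \<open>On a chart image the area measure is the pushforward of Lebesgue measure weighted by the
  area density; integration on the surface then follows the general rules for densities and image
  measures.\<close>

lemma chart_measure:
  assumes c: "c \<in> charts S"
  shows "distr (density (lebesgue_on (fst c)) (\<lambda>v. ennreal (area_density S c v))) (area S) (snd c)
    = density (area S) (\<lambda>x. ennreal (indicator (snd c ` fst c) x))" (is "?L = ?R")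
    "(\<lambda>v. ennreal (area_density S c v)) \<in> borel_measurable (lebesgue_on (fst c))"
    "snd c \<in> measurable (lebesgue_on (fst c)) (area S)"
proof -
  let ?V = "fst c"
  have V: "?V \<in> sets lebesgue" using chart_open[OF c] by simp
  show sm: "snd c \<in> measurable (lebesgue_on ?V) (area S)"
  proof (rule measurableI)
    show "snd c v \<in> space (area S)" if "v \<in> space (lebesgue_on ?V)" for v
      using that chart_in_pts[OF c] by (simp add: space_area)
    show "snd c -` A \<inter> space (lebesgue_on ?V) \<in> sets (lebesgue_on ?V)" if "A \<in> sets (area S)" for A
      using that c V unfolding sets_area by (simp add: sets_restrict_space_iff Int_commute)
  qed
  have "area_density S c \<in> borel_measurable (lebesgue_on ?V)"
    by (rule continuous_imp_measurable_on_sets_lebesgue[OF continuous_mc(1)[OF c] V])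
  then show dm: "(\<lambda>v. ennreal (area_density S c v)) \<in> borel_measurable (lebesgue_on ?V)" by measurable
  have U: "snd c ` ?V \<in> sets (area S)" by (rule openin_sets_area[OF chart_image_openin[OF c]])
  show "?L = ?R"
  proof (rule measure_eqI)
    fix A assume "A \<in> sets ?L"
    then have A: "A \<in> sets (area S)" by simp
    have "emeasure ?L A = (\<integral>\<^sup>+ v. ennreal (area_density S c v) * indicator (snd c -` A \<inter> ?V) v \<partial>lebesgue_on ?V)"
      using sm A dm measurable_sets[OF sm A]
      by (simp add: emeasure_distr emeasure_density)
    also have "\<dots> = (\<integral>\<^sup>+ v. ennreal (area_density S c v) * indicator (?V \<inter> snd c -` (A \<inter> snd c ` ?V)) v \<partial>lebesgue)"
      using V by (subst nn_integral_restrict_space) (auto intro!: nn_integral_cong simp: indicator_def)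
    also have "\<dots> = emeasure (area S) (A \<inter> snd c ` ?V)"
      by (rule emeasure_area[OF c sets.Int[OF A U], symmetric]) simp
    also have "\<dots> = emeasure ?R A"
    proof -
      have "emeasure ?R A = (\<integral>\<^sup>+ x. ennreal (indicator (snd c ` ?V) x) * indicator A x \<partial>area S)"
        by (rule emeasure_density[OF measurable_compose[OF borel_measurable_indicator[OF U] measurable_ennreal] A])
      also have "\<dots> = (\<integral>\<^sup>+ x. indicator (A \<inter> snd c ` ?V) x \<partial>area S)"
        by (intro nn_integral_cong) (auto simp: indicator_def)
      finally show ?thesis using A U by simp
    qed
    finally show "emeasure ?L A = emeasure ?R A" .
  qed simp
qed

lemma chart_integral:
  fixes G :: "'a \<Rightarrow> real"
  assumes c: "c \<in> charts S" and G: "G \<in> borel_measurable (area S)" and G0: "\<And>x. x \<in> pts S \<Longrightarrow> x \<notin> snd c ` fst c \<Longrightarrow> G x = 0"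
  shows "integrable (area S) G \<longleftrightarrow> integrable lebesgue (\<lambda>v. indicator (fst c) v * (area_density S c v * G (snd c v)))"
    "(LINT x|area S. G x) = (LINT v|lebesgue. indicator (fst c) v * (area_density S c v * G (snd c v)))"
proof -
  let ?V = "fst c"
  have V: "?V \<in> sets lebesgue" using chart_open[OF c] by simp
  have U: "snd c ` ?V \<in> sets (area S)" by (rule openin_sets_area[OF chart_image_openin[OF c]])
  note M = chart_measure[OF c]
  have dm: "area_density S c \<in> borel_measurable (lebesgue_on ?V)"
    by (rule continuous_imp_measurable_on_sets_lebesgue[OF continuous_mc(1)[OF c] V])
  have dn: "AE v in lebesgue_on ?V. 0 \<le> area_density S c v"
    using chart_frame(1)[OF c] by (intro AE_I2) (auto intro: less_imp_le)
  have Gm: "(\<lambda>v. G (snd c v)) \<in> borel_measurable (lebesgue_on ?V)" using measurable_compose[OF M(3) G] .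
  have sm': "snd c \<in> measurable (density (lebesgue_on ?V) (\<lambda>v. ennreal (area_density S c v))) (area S)"
    using M(3) by simp
  have eq: "indicator (snd c ` ?V) x *\<^sub>R G x = G x" if "x \<in> space (area S)" for x
    using G0[of x] that by (auto simp: indicator_def space_area)
  have im: "indicator (snd c ` ?V) \<in> borel_measurable (area S)" using U by simp
  have nn: "AE x in area S. 0 \<le> (indicator (snd c ` ?V) x :: real)" by simp
  have "integrable (area S) G \<longleftrightarrow> integrable (density (area S) (\<lambda>x. ennreal (indicator (snd c ` ?V) x))) G"
    unfolding integrable_density[OF G im nn] by (rule Bochner_Integration.integrable_cong[OF refl]) (simp only: eq)
  also have "\<dots> \<longleftrightarrow> integrable lebesgue (\<lambda>v. indicator ?V v *\<^sub>R (area_density S c v *\<^sub>R G (snd c v)))"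
    unfolding M(1)[symmetric] integrable_distr_eq[OF sm' G] integrable_density[OF Gm dm dn]
    using V by (subst integrable_restrict_space) auto
  finally show "integrable (area S) G \<longleftrightarrow> integrable lebesgue (\<lambda>v. indicator ?V v * (area_density S c v * G (snd c v)))"
    by simp
  have "(LINT x|area S. G x) = integral\<^sup>L (density (area S) (\<lambda>x. ennreal (indicator (snd c ` ?V) x))) G"
    unfolding integral_density[OF G im nn] by (rule Bochner_Integration.integral_cong[OF refl]) (simp only: eq)
  also have "\<dots> = (LINT v|lebesgue. indicator ?V v *\<^sub>R (area_density S c v *\<^sub>R G (snd c v)))"
    unfolding M(1)[symmetric] integral_distr[OF sm' G] integral_density[OF Gm dm dn]
    using V by (subst integral_restrict_space) auto
  finally show "(LINT x|area S. G x) = (LINT v|lebesgue. indicator ?V v * (area_density S c v * G (snd c v)))"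
    by simp
qed

lemma finite_compact_cover:
  assumes P: "\<And>x. x \<in> pts S \<Longrightarrow> \<exists>c v. c \<in> charts S \<and> v \<in> fst c \<and> snd c v = x \<and> (\<exists>r>0. cball v r \<subseteq> fst c \<and> P c v r)"
  shows "\<exists>I. finite I \<and> (\<forall>c v r. (c, v, r) \<in> I \<longrightarrow> c \<in> charts S \<and> r > 0 \<and> cball v r \<subseteq> fst c \<and> P c v r) \<and>
    pts S = (\<Union>(c, v, r)\<in>I. snd c ` ball v r)"
proof -
  let ?J = "{(c, v, r). c \<in> charts S \<and> r > 0 \<and> cball v r \<subseteq> fst c \<and> P c v r}"
  have op: "openin (top_of_set (pts S)) (snd c ` ball v r)" if J: "(c, v, r) \<in> ?J" for c v r
  proof -
    have c: "c \<in> charts S" using J by simp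
    obtain \<theta> where h: "homeomorphism (fst c) (snd c ` fst c) (snd c) \<theta>" using chart_homeo[OF c] by auto
    have "ball v r \<subseteq> fst c" using J ball_subset_cball[of v r] by auto
    then have "openin (top_of_set (fst c)) (ball v r)" by (simp add: open_subset)
    then have "openin (top_of_set (snd c ` fst c)) (snd c ` ball v r)"
      by (rule homeomorphism_imp_open_map[OF h])
    then show ?thesis by (rule openin_trans[OF _ chart_image_openin[OF c]])
  qed
  let ?U = "\<lambda>j. case j of (c, v, r) \<Rightarrow> snd c ` ball v r"
  have cov: "pts S \<subseteq> \<Union>(?U ` ?J)"
  proof
    fix x assume "x \<in> pts S"
    then obtain c v r where "c \<in> charts S" "snd c v = x" "r > 0" "cball v r \<subseteq> fst c" "P c v r" using P by blast
    then have "(c, v, r) \<in> ?J" "x \<in> ?U (c, v, r)" by auto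
    then show "x \<in> \<Union>(?U ` ?J)" by blast
  qed
  have op': "\<forall>T\<in>?U ` ?J. openin (top_of_set (pts S)) T" using op by auto
  have "\<exists>D\<subseteq>?U ` ?J. finite D \<and> pts S \<subseteq> \<Union>D"
    using compact_pts[unfolded compact_eq_openin_cover, rule_format, of "?U ` ?J"] op' cov by simp
  then obtain D where D: "D \<subseteq> ?U ` ?J" "finite D" "pts S \<subseteq> \<Union>D" by auto
  obtain I where I: "I \<subseteq> ?J" "finite I" "D = ?U ` I" using finite_subset_image[OF D(2,1)] by auto
  have "\<Union>(?U ` I) \<subseteq> pts S"
  proof
    fix x assume "x \<in> \<Union>(?U ` I)"
    then obtain c v r where "(c, v, r) \<in> ?J" "x \<in> snd c ` ball v r" using I(1) by auto
    then show "x \<in> pts S" using openin_imp_subset[OF op] by blast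
  qed
  then have "pts S = \<Union>(?U ` I)" using D(3) I(3) by auto
  moreover have "\<forall>c v r. (c, v, r) \<in> I \<longrightarrow> c \<in> charts S \<and> r > 0 \<and> cball v r \<subseteq> fst c \<and> P c v r"
  proof (intro allI impI)
    fix c v r assume "(c, v, r) \<in> I"
    from subsetD[OF I(1) this] show "c \<in> charts S \<and> r > 0 \<and> cball v r \<subseteq> fst c \<and> P c v r" by simp
  qed
  ultimately show ?thesis using I(2) by (intro exI[of _ I]) simp
qed

text \<open>The doubled ball is placed in a lifted chart because the cutoff that is 1 on the ball of
  radius r is supported in the ball of radius 2r.\<close>

lemma finite_lifted_cover:
  "\<exists>I. finite I \<and> (\<forall>c v r. (c, v, r) \<in> I \<longrightarrow> c \<in> charts S \<and> r > 0 \<and> cball v r \<subseteq> fst c \<and> 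
      (\<exists>W \<sigma>. lifted_chart S c W \<sigma> \<and> cball v (2 * r) \<subseteq> W)) \<and>
    pts S = (\<Union>(c, v, r)\<in>I. snd c ` ball v r)"
proof (rule finite_compact_cover)
  fix x assume x: "x \<in> pts S"
  from chart_cover[OF x] obtain c where c1: "c \<in> charts S" "x \<in> snd c ` fst c" ..
  from c1(2) obtain v where "x = snd c v" "v \<in> fst c" by (rule imageE)
  then have c: "c \<in> charts S" "v \<in> fst c" "snd c v = x" using c1(1) by simp_all
  obtain W \<sigma> where L: "lifted_chart S c W \<sigma>" "v \<in> W" by (rule lifted_chart_exists[OF c(1,2)])
  obtain r where r: "r > 0" "cball v r \<subseteq> W"
    using L(2) lifted_chartD(2)[OF L(1)] unfolding open_contains_cball by auto
  have "cball v (r / 2) \<subseteq> W" using r subset_cball[of "r / 2" r v] by auto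
  then show "\<exists>c v. c \<in> charts S \<and> v \<in> fst c \<and> snd c v = x \<and>
      (\<exists>r>0. cball v r \<subseteq> fst c \<and> (\<exists>W \<sigma>. lifted_chart S c W \<sigma> \<and> cball v (2 * r) \<subseteq> W))"
    using c L(1) r lifted_chartD(3)[OF L(1)]
    by (intro exI[of _ c] exI[of _ v] conjI exI[of _ "r / 2"] exI[of _ W] exI[of _ \<sigma>]) auto
qed

text \<open>By deck invariance, failure at one point of a fibre is failure at all of them, so the
  exceptional set on the surface is seen in any lifted chart. Finitely many charts cover, and
  completeness of Lebesgue measure makes the exceptional set measurable.\<close>

lemma AE_area:
  assumes inv: "\<And>y \<tau>. y \<in> ucov S \<Longrightarrow> \<tau> \<in> deck S \<Longrightarrow> P y \<Longrightarrow> P (\<tau> y)"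
    and loc: "\<And>c W \<sigma>. lifted_chart S c W \<sigma> \<Longrightarrow> AE v in lebesgue. v \<in> W \<longrightarrow> P (\<sigma> v)"
  shows "AE x in area S. \<forall>y\<in>ucov S. uproj S y = x \<longrightarrow> P y"
proof -
  define N where "N = {x \<in> pts S. \<exists>y\<in>ucov S. uproj S y = x \<and> \<not> P y}"
  have all: "P y \<longleftrightarrow> P z" if "y \<in> ucov S" "z \<in> ucov S" "uproj S y = uproj S z" for y z
    using that inv deck_transitive by metis
  have negl: "W \<inter> snd c -` N \<in> null_sets lebesgue" if L: "lifted_chart S c W \<sigma>" for c W \<sigma>
  proof -
    note D = lifted_chartD[OF L]
    have "W \<inter> snd c -` N \<subseteq> {v. \<not> (v \<in> W \<longrightarrow> P (\<sigma> v))}"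
    proof
      fix v assume v: "v \<in> W \<inter> snd c -` N"
      then obtain y where "y \<in> ucov S" "uproj S y = snd c v" "\<not> P y" by (auto simp: N_def)
      then have "\<not> P (\<sigma> v)" using all[of y "\<sigma> v"] D(6,7)[of v] v by simp
      then show "v \<in> {v. \<not> (v \<in> W \<longrightarrow> P (\<sigma> v))}" using v by simp
    qed
    moreover have "AE v in lebesgue. v \<in> W \<longrightarrow> P (\<sigma> v)" by (rule loc[OF L])
    then obtain N' where N': "N' \<in> null_sets lebesgue" "{v. \<not> (v \<in> W \<longrightarrow> P (\<sigma> v))} \<subseteq> N'"
      by (auto simp: eventually_ae_filter)
    ultimately show ?thesis by (meson completion.complete2 subset_trans)
  qed
  have NS: "N \<in> sets (area S)"
  proof (rule sets_area_local)
    fix c v assume "c \<in> charts S" "v \<in> fst c"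
    then obtain W \<sigma> where L: "lifted_chart S c W \<sigma>" "v \<in> W" by (rule lifted_chart_exists)
    from negl[OF L(1)] show "\<exists>W. open W \<and> v \<in> W \<and> W \<subseteq> fst c \<and> W \<inter> snd c -` N \<in> sets lebesgue"
      using lifted_chartD(2,3)[OF L(1)] L(2) by (intro exI[of _ W]) auto
  qed (auto simp: N_def)
  obtain I where I: "finite I" "\<forall>c v r. (c, v, r) \<in> I \<longrightarrow> c \<in> charts S \<and> r > 0 \<and> cball v r \<subseteq> fst c \<and>
      (\<exists>W \<sigma>. lifted_chart S c W \<sigma> \<and> cball v (2 * r) \<subseteq> W)" "pts S = (\<Union>(c, v, r)\<in>I. snd c ` ball v r)"
    using finite_lifted_cover by auto
  have "N \<inter> snd c ` ball v r \<in> null_sets (area S)" if J: "(c, v, r) \<in> I" for c v r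
  proof -
    obtain W \<sigma> where L: "lifted_chart S c W \<sigma>" "cball v r \<subseteq> W"
      using I(2)[rule_format, OF J] subset_cball[of r "2 * r" v] by auto
    note D = lifted_chartD[OF L(1)]
    have op: "openin (top_of_set (pts S)) (snd c ` ball v r)"
    proof -
      obtain \<theta> where h: "homeomorphism (fst c) (snd c ` fst c) (snd c) \<theta>" using chart_homeo[OF D(1)] by auto
      have "ball v r \<subseteq> fst c" using L(2) D(3) ball_subset_cball by blast
      then have "openin (top_of_set (fst c)) (ball v r)" by (simp add: open_subset)
      then have "openin (top_of_set (snd c ` fst c)) (snd c ` ball v r)"
        by (rule homeomorphism_imp_open_map[OF h])
      then show ?thesis by (rule openin_trans[OF _ chart_image_openin[OF D(1)]])
    qed
    have NI: "N \<inter> snd c ` ball v r \<in> sets (area S)" using NS openin_sets_area[OF op] by blast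
    have sub: "fst c \<inter> snd c -` (N \<inter> snd c ` ball v r) \<subseteq> W \<inter> snd c -` N"
    proof
      fix x assume x: "x \<in> fst c \<inter> snd c -` (N \<inter> snd c ` ball v r)"
      then obtain x' where x': "x' \<in> ball v r" "snd c x = snd c x'" by auto
      then have "x' \<in> W" using L(2) ball_subset_cball by blast
      then have "x = x'" using x x' chart_inj[OF D(1)] D(5) by (auto simp: inj_on_def)
      then show "x \<in> W \<inter> snd c -` N" using x \<open>x' \<in> W\<close> by auto
    qed
    have "emeasure (area S) (N \<inter> snd c ` ball v r) = 
      (\<integral>\<^sup>+ x. ennreal (area_density S c x) * indicator (fst c \<inter> snd c -` (N \<inter> snd c ` ball v r)) x \<partial>lebesgue)"
      using L(2) D(3) ball_subset_cball[of v r] by (intro emeasure_area[OF D(1) NI]) blast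
    also have "\<dots> = (\<integral>\<^sup>+ x. 0 \<partial>(lebesgue :: (real^2) measure))"
    proof (rule nn_integral_cong_AE)
      have "AE x in lebesgue. x \<notin> W \<inter> snd c -` N" by (rule AE_not_in[OF negl[OF L(1)]])
      then show "AE x in lebesgue. ennreal (area_density S c x) * indicator (fst c \<inter> snd c -` (N \<inter> snd c ` ball v r)) x = 0"
        by eventually_elim (use sub in \<open>auto simp: indicator_def\<close>)
    qed
    finally show ?thesis using NI by (simp add: null_sets_def)
  qed
  then have "(\<Union>(c, v, r)\<in>I. N \<inter> snd c ` ball v r) \<in> null_sets (area S)"
    using I(1) by (intro null_sets_UN' countable_finite) auto
  moreover have "N = (\<Union>(c, v, r)\<in>I. N \<inter> snd c ` ball v r)"
  proof -
    have "N \<subseteq> pts S" by (auto simp: N_def)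
    then have "N \<subseteq> (\<Union>(c, v, r)\<in>I. snd c ` ball v r)" unfolding I(3) .
    then show ?thesis by (auto simp: split_beta)
  qed
  ultimately have "N \<in> null_sets (area S)" by simp
  then have "AE x in area S. x \<notin> N" by (rule AE_not_in)
  then show ?thesis by (rule AE_mp) (auto intro!: AE_I2 simp: N_def space_area)
qed

end

subsection \<open>Continuously differentiable partitions of unity\<close>

definition sqpos :: "real \<Rightarrow> real" where "sqpos x = (max 0 x)\<^sup>2"

lemma has_real_derivative_sqpos: "(sqpos has_real_derivative 2 * max 0 x) (at x)"
proof (cases x "0::real" rule: linorder_cases)
  case less
  have "((\<lambda>_. 0) has_real_derivative 0) (at x)" by simp
  then have "(sqpos has_real_derivative 0) (at x)"
    by (rule has_field_derivative_transform_within_open[of _ _ _ "{..<0}"])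
      (use less in \<open>auto simp: sqpos_def\<close>)
  then show ?thesis using less by simp
next
  case equal
  have "(\<lambda>h. (sqpos (0 + h) - sqpos 0) / h) = (\<lambda>h. max 0 h)"
    by (auto simp: sqpos_def max_def power2_eq_square fun_eq_iff)
  moreover have "((\<lambda>h::real. max 0 h) \<longlongrightarrow> max 0 0) (at 0)" by (intro tendsto_intros)
  ultimately show ?thesis using equal by (simp add: DERIV_def)
next
  case greater
  have "((\<lambda>x. x\<^sup>2) has_real_derivative 2 * x) (at x)" by (auto intro!: derivative_eq_intros)
  then have "(sqpos has_real_derivative 2 * x) (at x)"
    by (rule has_field_derivative_transform_within_open[of _ _ _ "{0<..}"])
      (use greater in \<open>auto simp: sqpos_def\<close>)
  then show ?thesis using greater by simp
qed

text \<open>At distance r from the centre the inner quotient is 0, and at distance 2r it is (4 r^2 -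
  r^2) / (3 r^2) = 1, so the function falls from 1 to 0 between these radii. Squared positive parts
  join the pieces with continuous first derivatives.\<close>

definition cutoff :: "real^2 \<Rightarrow> real \<Rightarrow> real^2 \<Rightarrow> real" where
  "cutoff z r v = sqpos (1 - sqpos (((v - z) \<bullet> (v - z) - r\<^sup>2) / (3 * r\<^sup>2)))"

text \<open>The radial factor of the gradient of \<open>cutoff\<close>: the gradient is this
  coefficient times v - z.\<close>

definition cutoff_coeff :: "real^2 \<Rightarrow> real \<Rightarrow> real^2 \<Rightarrow> real" where
  "cutoff_coeff z r v = - (2 * max 0 (1 - sqpos (((v - z) \<bullet> (v - z) - r\<^sup>2) / (3 * r\<^sup>2)))) *
     (2 * max 0 (((v - z) \<bullet> (v - z) - r\<^sup>2) / (3 * r\<^sup>2))) * (2 / (3 * r\<^sup>2))"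

lemma has_derivative_cutoff:
  assumes "r > 0"
  shows "(cutoff z r has_derivative (\<lambda>e. cutoff_coeff z r v * ((v - z) \<bullet> e))) (at v)"
proof -
  let ?s = "\<lambda>v. ((v - z) \<bullet> (v - z) - r\<^sup>2) / (3 * r\<^sup>2)"
  have sq: "(sqpos has_derivative (\<lambda>h. 2 * max 0 x * h)) (at x)" for x
    using has_real_derivative_sqpos by (simp add: has_field_derivative_def)
  have "(?s has_derivative (\<lambda>e. 2 / (3 * r\<^sup>2) * ((v - z) \<bullet> e))) (at v)"
    using assms by (auto intro!: derivative_eq_intros simp: inner_commute field_simps)
  from diff_chain_at[OF this sq]
  have "((\<lambda>v. sqpos (?s v)) has_derivative (\<lambda>e. 2 * max 0 (?s v) * (2 / (3 * r\<^sup>2) * ((v - z) \<bullet> e)))) (at v)"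
    by (simp add: o_def)
  then have "((\<lambda>v. 1 - sqpos (?s v)) has_derivative (\<lambda>e. - (2 * max 0 (?s v) * (2 / (3 * r\<^sup>2) * ((v - z) \<bullet> e))))) (at v)"
    by (auto intro!: derivative_eq_intros)
  from diff_chain_at[OF this sq] show ?thesis
    by (simp add: o_def cutoff_def[abs_def] cutoff_coeff_def mult_ac)
qed

lemma continuous_sqpos: "continuous_on UNIV sqpos"
  unfolding sqpos_def by (intro continuous_intros)

lemma continuous_cutoff_coeff: "r > 0 \<Longrightarrow> continuous_on UNIV (cutoff_coeff z r)"
  unfolding cutoff_coeff_def[abs_def]
  by (intro continuous_intros continuous_on_compose2[OF continuous_sqpos]) auto

lemma cutoff_eq_1:
  assumes "r > 0" "v \<in> ball z r" shows "cutoff z r v = 1"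
proof -
  have "(v - z) \<bullet> (v - z) \<le> r\<^sup>2"
    using assms by (simp add: dot_square_norm dist_norm norm_minus_commute abs_le_square_iff[symmetric])
  then show ?thesis using assms(1) by (simp add: cutoff_def sqpos_def divide_nonpos_nonneg max_absorb1)
qed

lemma cutoff_eq_0:
  assumes "r > 0" "v \<notin> cball z (2 * r)" shows "cutoff z r v = 0" "cutoff_coeff z r v = 0"
proof -
  have "(2 * r)\<^sup>2 \<le> (norm (v - z))\<^sup>2"
    using assms by (intro power_mono) (auto simp: dist_norm norm_minus_commute)
  then have "1 \<le> ((v - z) \<bullet> (v - z) - r\<^sup>2) / (3 * r\<^sup>2)"
    using assms(1) by (simp add: dot_square_norm pos_le_divide_eq power_mult_distrib)
  then have "1 \<le> sqpos (((v - z) \<bullet> (v - z) - r\<^sup>2) / (3 * r\<^sup>2))"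
    unfolding sqpos_def by simp
  then show "cutoff z r v = 0" "cutoff_coeff z r v = 0"
    by (simp_all add: cutoff_def cutoff_coeff_def sqpos_def[of "1 - _"])
qed

context riemannian_surface
begin

text \<open>The differential is taken in the tangent identification by the preferred charts, which
  may jump from point to point; continuity is therefore asked after composition with
  \<open>dpar\<close>, that is, in chart coordinates.\<close>

definition C1M :: "('a \<Rightarrow> real) \<Rightarrow> ('a \<Rightarrow> real^2 \<Rightarrow> real) \<Rightarrow> bool" where
  "C1M \<theta> \<theta>' \<longleftrightarrow> (\<forall>x\<in>pts S. linear (\<theta>' x)) \<and> (\<forall>c\<in>charts S.
     (\<forall>v\<in>fst c. ((\<lambda>v. \<theta> (snd c v)) has_derivative (\<lambda>e. \<theta>' (snd c v) (dpar S c v e))) (at v)) \<and>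
     (\<forall>e. continuous_on (fst c) (\<lambda>v. \<theta>' (snd c v) (dpar S c v e))))"

lemma C1M_linear: "C1M \<theta> \<theta>' \<Longrightarrow> x \<in> pts S \<Longrightarrow> linear (\<theta>' x)"
  and C1M_derivative: "C1M \<theta> \<theta>' \<Longrightarrow> c \<in> charts S \<Longrightarrow> v \<in> fst c \<Longrightarrow>
     ((\<lambda>v. \<theta> (snd c v)) has_derivative (\<lambda>e. \<theta>' (snd c v) (dpar S c v e))) (at v)"
  and C1M_continuous_derivative: "C1M \<theta> \<theta>' \<Longrightarrow> c \<in> charts S \<Longrightarrow>
     continuous_on (fst c) (\<lambda>v. \<theta>' (snd c v) (dpar S c v e))"
  by (auto simp: C1M_def)

lemma C1M_continuous: "C1M \<theta> \<theta>' \<Longrightarrow> c \<in> charts S \<Longrightarrow> continuous_on (fst c) (\<lambda>v. \<theta> (snd c v))"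
  using C1M_derivative has_derivative_continuous continuous_at_imp_continuous_on by metis

lemma C1M_const: "C1M (\<lambda>_. k) (\<lambda>_ _. 0)"
  by (auto simp: C1M_def linear_iff)

lemma C1M_mult:
  assumes f: "C1M f f'" and g: "C1M g g'"
  shows "C1M (\<lambda>x. f x * g x) (\<lambda>x e. f x * g' x e + f' x e * g x)"
  unfolding C1M_def
proof (intro conjI ballI allI)
  show "linear (\<lambda>e. f x * g' x e + f' x e * g x)" if "x \<in> pts S" for x
    using C1M_linear[OF f that] C1M_linear[OF g that] by (simp add: linear_iff algebra_simps)
  show "((\<lambda>v. f (snd c v) * g (snd c v)) has_derivative
     (\<lambda>e. f (snd c v) * g' (snd c v) (dpar S c v e) + f' (snd c v) (dpar S c v e) * g (snd c v))) (at v)"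
    if "c \<in> charts S" "v \<in> fst c" for c v
    by (intro has_derivative_mult C1M_derivative[OF f that] C1M_derivative[OF g that])
  show "continuous_on (fst c) (\<lambda>v. f (snd c v) * g' (snd c v) (dpar S c v e) + f' (snd c v) (dpar S c v e) * g (snd c v))"
    if "c \<in> charts S" for c e
    by (intro continuous_intros C1M_continuous[OF f that] C1M_continuous[OF g that]
        C1M_continuous_derivative[OF f that] C1M_continuous_derivative[OF g that])
qed

lemma C1M_diff:
  assumes f: "C1M f f'" and g: "C1M g g'"
  shows "C1M (\<lambda>x. f x - g x) (\<lambda>x e. f' x e - g' x e)"
  unfolding C1M_def
proof (intro conjI ballI allI)
  show "linear (\<lambda>e. f' x e - g' x e)" if "x \<in> pts S" for x
    using C1M_linear[OF f that] C1M_linear[OF g that] by (simp add: linear_iff algebra_simps)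
  show "((\<lambda>v. f (snd c v) - g (snd c v)) has_derivative
     (\<lambda>e. f' (snd c v) (dpar S c v e) - g' (snd c v) (dpar S c v e))) (at v)"
    if "c \<in> charts S" "v \<in> fst c" for c v
    by (intro has_derivative_diff C1M_derivative[OF f that] C1M_derivative[OF g that])
  show "continuous_on (fst c) (\<lambda>v. f' (snd c v) (dpar S c v e) - g' (snd c v) (dpar S c v e))"
    if "c \<in> charts S" for c e
    by (intro continuous_intros C1M_continuous_derivative[OF f that] C1M_continuous_derivative[OF g that])
qed

text \<open>Define the differential in the preferred chart at each point; the chain rule through the
  transition map, whose derivative is \<open>dpar\<close>, recovers the derivative in every other
  chart.\<close>

lemma C1M_intro:
  assumes "\<And>c. c \<in> charts S \<Longrightarrow> \<exists>f'. (\<forall>v\<in>fst c. ((\<lambda>v. \<theta> (snd c v)) has_derivative f' v) (at v)) \<and>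
     (\<forall>e. continuous_on (fst c) (\<lambda>v. f' v e))"
  shows "\<exists>\<theta>'. C1M \<theta> \<theta>'"
proof -
  define \<theta>' where "\<theta>' x = frechet_derivative (\<lambda>v. \<theta> (snd (chart_at S x) v)) (at (coord (chart_at S x) x))" for x
  have at_chart: "((\<lambda>v. \<theta> (snd (chart_at S x) v)) has_derivative \<theta>' x) (at (coord (chart_at S x) x))"
    if x: "x \<in> pts S" for x
  proof -
    have d: "chart_at S x \<in> charts S" "x \<in> snd (chart_at S x) ` fst (chart_at S x)" using chart_at_in[OF x] by auto
    from d(2) obtain v where v: "x = snd (chart_at S x) v" "v \<in> fst (chart_at S x)" by (rule imageE)
    then have c: "coord (chart_at S x) x = v" using coord_chart[OF d(1) v(2)] by simp
    from assms[OF d(1)] obtain f' where "((\<lambda>v. \<theta> (snd (chart_at S x) v)) has_derivative f' v) (at v)"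
      using v(2) by auto
    then have "(\<lambda>v. \<theta> (snd (chart_at S x) v)) differentiable (at v)" by (auto simp: differentiable_def)
    then show ?thesis unfolding \<theta>'_def c by (rule frechet_derivative_works[THEN iffD1])
  qed
  have key: "((\<lambda>v. \<theta> (snd c v)) has_derivative (\<lambda>e. \<theta>' (snd c v) (dpar S c v e))) (at v)"
    if c: "c \<in> charts S" and v: "v \<in> fst c" for c v
  proof -
    let ?d = "chart_at S (snd c v)"
    have d: "?d \<in> charts S" "v \<in> overlap c ?d" using in_overlap_chart_at[OF c v] by auto
    have "((\<lambda>v. \<theta> (snd ?d v)) has_derivative \<theta>' (snd c v)) (at ((coord ?d \<circ> snd c) v))"
      using at_chart[OF chart_in_pts[OF c v]] by simp
    from diff_chain_at[OF dpar_has_derivative[OF c v] this]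
    have "((\<lambda>v. \<theta> (snd ?d (coord ?d (snd c v)))) has_derivative (\<lambda>e. \<theta>' (snd c v) (dpar S c v e))) (at v)"
      by (simp add: o_def)
    then show ?thesis
      by (rule has_derivative_transform_within_open[OF _ transition(3)[OF c d(1)] d(2)])
        (use coord_in[OF d(1)] in simp)
  qed
  have "C1M \<theta> \<theta>'"
    unfolding C1M_def
  proof (intro conjI ballI allI)
    show "linear (\<theta>' x)" if "x \<in> pts S" for x using at_chart[OF that] by (rule has_derivative_linear)
    show "((\<lambda>v. \<theta> (snd c v)) has_derivative (\<lambda>e. \<theta>' (snd c v) (dpar S c v e))) (at v)"
      if "c \<in> charts S" "v \<in> fst c" for c v by (rule key[OF that])
    fix c e assume c: "c \<in> charts S"
    obtain f' where f': "\<forall>v\<in>fst c. ((\<lambda>v. \<theta> (snd c v)) has_derivative f' v) (at v)" "\<forall>e. continuous_on (fst c) (\<lambda>v. f' v e)"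
      using assms[OF c] by auto
    have eq: "f' v e = \<theta>' (snd c v) (dpar S c v e)" if "v \<in> fst c" for v
      using has_derivative_unique[OF f'(1)[rule_format, OF that] key[OF c that]] by simp
    show "continuous_on (fst c) (\<lambda>v. \<theta>' (snd c v) (dpar S c v e))"
      by (rule continuous_on_eq[OF f'(2)[rule_format, of e] eq])
  qed
  then show ?thesis by blast
qed

lemma openin_minus_chart_image:
  assumes "d \<in> charts S" "compact K" "K \<subseteq> fst d"
  shows "openin (top_of_set (pts S)) (pts S - snd d ` K)"
proof -
  have "compact (snd d ` K)"
    by (rule compact_continuous_image[OF continuous_on_subset[OF chart_continuous[OF assms(1)] assms(3)] assms(2)])
  then have "open (- (snd d ` K))" by (intro open_Compl compact_imp_closed)
  then have "openin (top_of_set (pts S)) (pts S \<inter> - (snd d ` K))" by (rule openin_open_Int)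
  then show ?thesis by (simp add: Diff_eq)
qed

text \<open>The cutoff is transported from a chart and extended by zero. The image of the closed
  ball is compact, hence closed in a Hausdorff space, so its complement is open and together with
  the chart image covers the surface; on the overlap both expressions for the derivative
  vanish.\<close>

lemma C1M_cutoff:
  assumes d: "d \<in> charts S" and r: "r > 0" "cball z (2 * r) \<subseteq> fst d"
  shows "\<exists>\<theta> \<theta>'. C1M \<theta> \<theta>' \<and> (\<forall>v\<in>ball z r. \<theta> (snd d v) = 1) \<and>
     (\<forall>x\<in>pts S. x \<notin> snd d ` cball z (2 * r) \<longrightarrow> \<theta> x = 0)"
proof -
  let ?K = "cball z (2 * r)"
  define \<theta> where "\<theta> x = (if x \<in> snd d ` fst d then cutoff z r (coord d x) else 0)" for x
  have 0: "\<theta> x = 0" if x: "x \<notin> snd d ` ?K" for x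
  proof (cases "x \<in> snd d ` fst d")
    case True
    then obtain v where v: "x = snd d v" "v \<in> fst d" by (rule imageE)
    then have "v \<notin> ?K" using x by auto
    then show ?thesis using cutoff_eq_0(1)[OF r(1), of v z] coord_chart[OF d v(2)] v(1) by (simp add: \<theta>_def)
  qed (simp add: \<theta>_def)
  have 1: "\<theta> (snd d v) = 1" if v: "v \<in> ball z r" for v
  proof -
    have "v \<in> fst d" using v r by auto
    then show ?thesis using cutoff_eq_1[OF r(1) v] coord_chart[OF d] by (simp add: \<theta>_def)
  qed
  have "\<exists>\<theta>'. C1M \<theta> \<theta>'"
  proof (rule C1M_intro)
    fix c assume c: "c \<in> charts S"
    let ?t = "coord d \<circ> snd c"
    let ?D = "overlap c d"
    let ?E = "fst c \<inter> snd c -` (pts S - snd d ` ?K)"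
    define f' where "f' v e = (if v \<in> ?D then cutoff_coeff z r (?t v) * ((?t v - z) \<bullet> frechet_derivative ?t (at v) e) else 0)" for v e
    have oE: "open ?E" by (rule open_chart_preimage[OF c openin_minus_chart_image[OF d compact_cball r(2)]])
    have oD: "open ?D" by (rule transition(3)[OF c d])
    have cover: "v \<in> ?D \<or> v \<in> ?E" if "v \<in> fst c" for v
      using that r(2) chart_in_pts[OF c that] by auto
    have E0: "f' v = (\<lambda>e. 0)" if v: "v \<in> ?E" for v
    proof (cases "v \<in> ?D")
      case True
      have t: "?t v \<in> fst d" "snd d (?t v) = snd c v" using coord_in[OF d True] by auto
      have "?t v \<notin> ?K"
      proof
        assume "?t v \<in> ?K"
        then have "snd d (?t v) \<in> snd d ` ?K" by (rule imageI)
        then show False using t v by simp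
      qed
      then have "cutoff_coeff z r (?t v) = 0" by (rule cutoff_eq_0(2)[OF r(1)])
      then show ?thesis by (simp add: f'_def fun_eq_iff)
    next
      case False
      show ?thesis by (rule ext) (simp only: f'_def if_not_P[OF False])
    qed
    have t': "(?t has_derivative frechet_derivative ?t (at v)) (at v)" if "v \<in> ?D" for v
      by (rule has_derivative_imp_frechet_continuous(1)[OF transition(1)[OF c d] that])
    have der: "((\<lambda>v. \<theta> (snd c v)) has_derivative f' v) (at v)" if v: "v \<in> fst c" for v
    proof (cases "v \<in> ?E")
      case False
      then have D: "v \<in> ?D" using cover[OF v] by blast
      have "((\<lambda>v. cutoff z r (?t v)) has_derivative f' v) (at v)"
        using diff_chain_at[OF t'[OF D] has_derivative_cutoff[OF r(1), of z "?t v"]] D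
        by (simp add: o_def f'_def[abs_def])
      then show ?thesis
        by (rule has_derivative_transform_within_open[OF _ oD D]) (simp add: \<theta>_def)
    next
      case True
      have "((\<lambda>_. 0) has_derivative f' v) (at v)" unfolding E0[OF True] by simp
      then show ?thesis
        by (rule has_derivative_transform_within_open[OF _ oE True]) (use 0 in simp)
    qed
    have cont: "continuous_on (fst c) (\<lambda>v. f' v e)" for e
    proof -
      have ct: "continuous_on ?D ?t" by (rule smooth_on_imp_continuous_on[OF transition(1)[OF c d]])
      have "continuous_on ?D (\<lambda>v. cutoff_coeff z r (?t v) * ((?t v - z) \<bullet> frechet_derivative ?t (at v) e))"
        by (intro continuous_intros continuous_on_compose2[OF continuous_cutoff_coeff[OF r(1)] ct] ct
            has_derivative_imp_frechet_continuous(2)[OF transition(1)[OF c d]]) simp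
      then have D: "continuous_on ?D (\<lambda>v. f' v e)"
        by (rule continuous_on_eq) (simp add: f'_def)
      have "continuous_on ?E (\<lambda>v. 0::real)" by simp
      then have E: "continuous_on ?E (\<lambda>v. f' v e)"
        by (rule continuous_on_eq) (simp add: E0)
      have "?D \<union> ?E = fst c" using cover by blast
      then show ?thesis using continuous_on_open_Un[OF oD oE D E] by simp
    qed
    show "\<exists>f'. (\<forall>v\<in>fst c. ((\<lambda>v. \<theta> (snd c v)) has_derivative f' v) (at v)) \<and> (\<forall>e. continuous_on (fst c) (\<lambda>v. f' v e))"
      using der cont by (intro exI[of _ f']) simp
  qed
  then obtain \<theta>' where "C1M \<theta> \<theta>'" by (rule exE)
  then show ?thesis using 0 1 by (intro exI[of _ \<theta>] exI[of _ \<theta>']) simp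
qed

text \<open>A telescoping product: with \<open>R\<close> the product of the factors 1 - \<beta> so
  far, each new function is R \<beta>. This avoids dividing by a sum of cutoffs, and
  \<open>R\<close> vanishes wherever some cutoff equals 1.\<close>

lemma C1M_partition_aux:
  assumes "finite I" "\<And>i. i \<in> I \<Longrightarrow> C1M (\<beta> i) (\<beta>' i)"
  shows "\<exists>\<theta> \<theta>' R R'. (\<forall>i\<in>I. C1M (\<theta> i) (\<theta>' i) \<and> (\<forall>x. \<beta> i x = 0 \<longrightarrow> \<theta> i x = 0)) \<and> C1M R R' \<and>
     (\<forall>x. (\<Sum>i\<in>I. \<theta> i x) + R x = 1) \<and> (\<forall>x. R x = (\<Prod>i\<in>I. 1 - \<beta> i x))"
  using assms
proof (induction I rule: finite_induct)
  case empty
  show ?case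
    by (rule exI, rule exI, rule exI[of _ "\<lambda>_. 1"], rule exI[of _ "\<lambda>_ _. 0"]) (simp add: C1M_const)
next
  case (insert i I)
  then obtain \<theta> \<theta>' R R' where
    IH: "\<forall>i\<in>I. C1M (\<theta> i) (\<theta>' i) \<and> (\<forall>x. \<beta> i x = 0 \<longrightarrow> \<theta> i x = 0)" "C1M R R'"
     "\<forall>x. (\<Sum>i\<in>I. \<theta> i x) + R x = 1" "\<forall>x. R x = (\<Prod>i\<in>I. 1 - \<beta> i x)" by auto
  have \<beta>: "C1M (\<beta> i) (\<beta>' i)" using insert.prems by simp
  let ?f = "\<lambda>x. R x * \<beta> i x" and ?f' = "\<lambda>x e. R x * \<beta>' i x e + R' x e * \<beta> i x"
  have f: "C1M ?f ?f'" by (rule C1M_mult[OF IH(2) \<beta>])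
  have R: "C1M (\<lambda>x. R x - ?f x) (\<lambda>x e. R' x e - ?f' x e)" by (rule C1M_diff[OF IH(2) f])
  have s: "(\<Sum>j\<in>I. (\<theta>(i := ?f)) j x) = (\<Sum>j\<in>I. \<theta> j x)" for x
    using insert.hyps by (intro sum.cong) auto
  show ?case
  proof (intro exI conjI)
    show "\<forall>j\<in>insert i I. C1M ((\<theta>(i := ?f)) j) ((\<theta>'(i := ?f')) j) \<and> (\<forall>x. \<beta> j x = 0 \<longrightarrow> (\<theta>(i := ?f)) j x = 0)"
      using IH(1) f insert.hyps(2) by auto
    show "C1M (\<lambda>x. R x - ?f x) (\<lambda>x e. R' x e - ?f' x e)" by (rule R)
    show "\<forall>x. (\<Sum>j\<in>insert i I. (\<theta>(i := ?f)) j x) + (R x - ?f x) = 1"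
    proof
      fix x
      have "(\<Sum>j\<in>insert i I. (\<theta>(i := ?f)) j x) = R x * \<beta> i x + (\<Sum>j\<in>I. \<theta> j x)"
        by (simp only: sum.insert[OF insert.hyps] fun_upd_same s)
      then show "(\<Sum>j\<in>insert i I. (\<theta>(i := ?f)) j x) + (R x - ?f x) = 1"
        using IH(3)[rule_format, of x] by linarith
    qed
    show "\<forall>x. R x - ?f x = (\<Prod>j\<in>insert i I. 1 - \<beta> j x)"
      using insert.hyps IH(4) by (simp add: algebra_simps)
  qed
qed

text \<open>Differentiate the constant sum in a chart; the coordinate vectors span the tangent
  plane.\<close>

lemma C1M_partition_derivative:
  assumes fin: "finite I" and C: "\<And>i. i \<in> I \<Longrightarrow> C1M (\<theta> i) (\<theta>' i)" 
    and 1: "\<And>x. x \<in> pts S \<Longrightarrow> (\<Sum>i\<in>I. \<theta> i x) = 1" and x: "x \<in> pts S"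
  shows "(\<Sum>i\<in>I. \<theta>' i x e) = 0"
proof -
  from chart_cover[OF x] obtain c where c: "c \<in> charts S" "x \<in> snd c ` fst c" ..
  from c(2) obtain v where v: "x = snd c v" "v \<in> fst c" by (rule imageE)
  have "((\<lambda>v. \<Sum>i\<in>I. \<theta> i (snd c v)) has_derivative (\<lambda>e. \<Sum>i\<in>I. \<theta>' i (snd c v) (dpar S c v e))) (at v)"
    by (intro has_derivative_sum C1M_derivative[OF C c(1) v(2)])
  then have "((\<lambda>v. 1) has_derivative (\<lambda>e. \<Sum>i\<in>I. \<theta>' i x (dpar S c v e))) (at v)"
    unfolding v(1)
    by (rule has_derivative_transform_within_open[OF _ chart_open[OF c(1)] v(2)]) (use 1 chart_in_pts[OF c(1)] in simp)
  from has_derivative_unique[OF this has_derivative_const]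
  have z: "(\<Sum>i\<in>I. \<theta>' i x (dpar S c v e)) = 0" for e by meson
  have "(\<lambda>e. \<Sum>i\<in>I. \<theta>' i x e) = (\<lambda>e. 0)"
  proof (rule dpar_onto[OF c(1) v(2)])
    show "linear (\<lambda>e. \<Sum>i\<in>I. \<theta>' i x e)"
      by (intro linear_compose_sum ballI C1M_linear[OF C x])
    show "linear (\<lambda>e::real^2. 0::real)" by (simp add: linear_iff)
  qed (simp_all add: z)
  then show ?thesis by meson
qed

text \<open>The index set is the finite family of chart balls. At every point some cutoff equals 1,
  which annihilates the remainder of the telescoping product.\<close>

lemma C1_partition_of_unity:
  "\<exists>(I :: (((real^2) set \<times> (real^2 \<Rightarrow> 'a)) \<times> (real^2) \<times> real) set) \<theta> \<theta>'. finite I \<and>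
    (\<forall>i\<in>I. C1M (\<theta> i) (\<theta>' i) \<and> (\<exists>c W \<sigma> K. lifted_chart S c W \<sigma> \<and> compact K \<and> K \<subseteq> W \<and>
      (\<forall>x\<in>pts S. x \<notin> snd c ` K \<longrightarrow> \<theta> i x = 0))) \<and>
    (\<forall>x\<in>pts S. (\<Sum>i\<in>I. \<theta> i x) = 1) \<and> (\<forall>x\<in>pts S. \<forall>e. (\<Sum>i\<in>I. \<theta>' i x e) = 0)"
proof -
  obtain I where I: "finite I" "\<forall>c v r. (c, v, r) \<in> I \<longrightarrow> c \<in> charts S \<and> r > 0 \<and> cball v r \<subseteq> fst c \<and>
      (\<exists>W \<sigma>. lifted_chart S c W \<sigma> \<and> cball v (2 * r) \<subseteq> W)" "pts S = (\<Union>(c, v, r)\<in>I. snd c ` ball v r)"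
    using finite_lifted_cover by auto
  let ?P = "\<lambda>i f f'. C1M f f' \<and> (\<forall>v\<in>ball (fst (snd i)) (snd (snd i)). f (snd (fst i) v) = 1) \<and>
     (\<forall>x\<in>pts S. x \<notin> snd (fst i) ` cball (fst (snd i)) (2 * snd (snd i)) \<longrightarrow> f x = 0)"
  have "\<exists>f f'. ?P i f f'" if i: "i \<in> I" for i
  proof -
    obtain c v r where e: "i = (c, v, r)" by (cases i)
    have m: "(c, v, r) \<in> I" using i e by simp
    note J = I(2)[rule_format, OF m]
    then obtain W \<sigma> where L: "lifted_chart S c W \<sigma>" "cball v (2 * r) \<subseteq> W" by auto
    have "cball v (2 * r) \<subseteq> fst c" using L(2) lifted_chartD(3)[OF L(1)] by (rule subset_trans)
    from C1M_cutoff[OF J[THEN conjunct1] J[THEN conjunct2, THEN conjunct1] this] show ?thesis unfolding e by simp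
  qed
  then obtain \<beta> \<beta>' where \<beta>: "\<And>i. i \<in> I \<Longrightarrow> ?P i (\<beta> i) (\<beta>' i)" by metis
  obtain \<theta> \<theta>' R R' where P: "\<forall>i\<in>I. C1M (\<theta> i) (\<theta>' i) \<and> (\<forall>x. \<beta> i x = 0 \<longrightarrow> \<theta> i x = 0)"
     "\<forall>x. (\<Sum>i\<in>I. \<theta> i x) + R x = 1" "\<forall>x. R x = (\<Prod>i\<in>I. 1 - \<beta> i x)"
    using C1M_partition_aux[OF I(1), of \<beta> \<beta>'] \<beta> by auto
  have one: "(\<Sum>i\<in>I. \<theta> i x) = 1" if x: "x \<in> pts S" for x
  proof -
    obtain i where i: "i \<in> I" "x \<in> snd (fst i) ` ball (fst (snd i)) (snd (snd i))"
      using x unfolding I(3) by auto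
    then have "\<beta> i x = 1" using \<beta>[OF i(1)] by auto
    then have "R x = 0" unfolding P(3)[rule_format] using I(1) i(1) by (intro prod_zero) auto
    then show ?thesis using P(2)[rule_format, of x] by simp
  qed
  show ?thesis
  proof (rule exI[of _ I], rule exI[of _ \<theta>], rule exI[of _ \<theta>'], intro conjI ballI allI)
    show "finite I" by (rule I(1))
    show "C1M (\<theta> i) (\<theta>' i)" if "i \<in> I" for i using P(1) that by blast
    show "(\<Sum>i\<in>I. \<theta> i x) = 1" if "x \<in> pts S" for x by (rule one[OF that])
    show "(\<Sum>i\<in>I. \<theta>' i x e) = 0" if "x \<in> pts S" for x e
      using P(1) by (intro C1M_partition_derivative[where \<theta> = \<theta> and I = I, OF I(1) _ one that]) blast+
    fix i assume i: "i \<in> I"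
    obtain c v r where e: "i = (c, v, r)" by (cases i)
    have m: "(c, v, r) \<in> I" using i e by simp
    from I(2)[rule_format, OF m] obtain W \<sigma> where L: "lifted_chart S c W \<sigma>" "cball v (2 * r) \<subseteq> W" by auto
    have "\<forall>x\<in>pts S. x \<notin> snd c ` cball v (2 * r) \<longrightarrow> \<theta> i x = 0"
      using P(1) \<beta>[OF i] i unfolding e by simp
    then show "\<exists>c W \<sigma> K. lifted_chart S c W \<sigma> \<and> compact K \<and> K \<subseteq> W \<and> (\<forall>x\<in>pts S. x \<notin> snd c ` K \<longrightarrow> \<theta> i x = 0)"
      using L by (intro exI[of _ c] exI[of _ W] exI[of _ \<sigma>] exI[of _ "cball v (2 * r)"]) simp
  qed
qed

text \<open>Extension by zero in chart coordinates; the chart domain and the complement of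
  \<open>K\<close> are open and cover the plane.\<close>

lemma C1M_imp_C1c:
  assumes \<theta>: "C1M \<theta> \<theta>'" and L: "lifted_chart S c W \<sigma>" and K: "compact K" "K \<subseteq> W"
    and 0: "\<And>x. x \<in> pts S \<Longrightarrow> x \<notin> snd c ` K \<Longrightarrow> \<theta> x = 0"
  shows "C1c W (\<lambda>v. if v \<in> fst c then \<theta> (snd c v) else 0) (\<lambda>v e. if v \<in> fst c then \<theta>' (snd c v) (dpar S c v e) else 0)"
proof -
  note D = lifted_chartD[OF L]
  let ?f = "\<lambda>v. if v \<in> fst c then \<theta> (snd c v) else 0"
  let ?f' = "\<lambda>v e. if v \<in> fst c then \<theta>' (snd c v) (dpar S c v e) else 0"
  have KV: "K \<subseteq> fst c" using K(2) D(3) by auto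
  have oK: "open (- K)" using compact_imp_closed[OF K(1)] by (simp add: open_Compl)
  have off: "?f v = 0" if v: "v \<notin> K" for v
  proof (cases "v \<in> fst c")
    case True
    have "snd c v \<notin> snd c ` K"
    proof
      assume "snd c v \<in> snd c ` K"
      then obtain k where "k \<in> K" "snd c v = snd c k" by auto
      then have "v = k" using True KV chart_inj[OF D(1)] by (auto simp: inj_on_def)
      with v \<open>k \<in> K\<close> show False by simp
    qed
    then show ?thesis using 0[OF chart_in_pts[OF D(1) True]] True by simp
  qed simp
  have der0: "(?f has_derivative (\<lambda>e. 0)) (at v)" if "v \<notin> K" for v
  proof -
    have "((\<lambda>_. 0) has_derivative (\<lambda>e. 0)) (at v)" by simp
    then show ?thesis
      by (rule has_derivative_transform_within_open[OF _ oK]) (use that off in auto)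
  qed
  have derV: "(?f has_derivative ?f' v) (at v)" if v: "v \<in> fst c" for v
    using C1M_derivative[OF \<theta> D(1) v]
    by (rule has_derivative_transform_within_open[OF _ chart_open[OF D(1)] v, THEN has_derivative_eq_rhs])
      (use v in auto)
  have z: "?f' v e = 0" if "v \<notin> K" for v e
  proof (cases "v \<in> fst c")
    case True
    from has_derivative_unique[OF derV[OF True] der0[OF that]] show ?thesis by meson
  qed simp
  show ?thesis
    unfolding C1c_def
  proof (intro conjI allI)
    show "(?f has_derivative ?f' v) (at v)" for v
    proof (cases "v \<in> fst c")
      case False
      then have "v \<notin> K" using KV by auto
      from der0[OF this] z[OF this] show ?thesis by presburger
    qed (rule derV)
    show "continuous_on UNIV (\<lambda>v. ?f' v e)" for e
    proof -
      have 1: "continuous_on (fst c) (\<lambda>v. ?f' v e)"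
        by (rule continuous_on_eq[OF C1M_continuous_derivative[OF \<theta> D(1), of e]]) simp
      have "continuous_on (- K) (\<lambda>v. 0::real)" by simp
      then have 2: "continuous_on (- K) (\<lambda>v. ?f' v e)" by (rule continuous_on_eq) (simp add: z)
      have "fst c \<union> - K = UNIV" using KV by auto
      then show ?thesis using continuous_on_open_Un[OF chart_open[OF D(1)] oK 1 2] by simp
    qed
    show "\<exists>K\<subseteq>W. compact K \<and> (\<forall>v. v \<notin> K \<longrightarrow> ?f v = 0)" using K off by blast
  qed
qed

end

subsection \<open>Sobolev sections in charts\<close>

lemma integrable_bounded_scaleR:
  fixes f :: "'a \<Rightarrow> 'e::euclidean_space" and g :: "'a \<Rightarrow> real"
  assumes "integrable M f" "g \<in> borel_measurable M" "\<And>x. \<bar>g x\<bar> \<le> B"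
  shows "integrable M (\<lambda>x. g x *\<^sub>R f x)"
proof (rule Bochner_Integration.integrable_bound)
  show "integrable M (\<lambda>x. B *\<^sub>R f x)" using assms(1) by (rule integrable_scaleR_right)
  show "(\<lambda>x. g x *\<^sub>R f x) \<in> borel_measurable M"
    by (rule borel_measurable_scaleR[OF assms(2) borel_measurable_integrable[OF assms(1)]])
  show "AE x in M. norm (g x *\<^sub>R f x) \<le> norm (B *\<^sub>R f x)"
  proof (rule AE_I2)
    fix x show "norm (g x *\<^sub>R f x) \<le> norm (B *\<^sub>R f x)"
      using assms(3)[of x] by (auto intro!: mult_right_mono)
  qed
qed

lemma set_integral_eq_integral:
  fixes g :: "'a \<Rightarrow> 'e::euclidean_space"
  assumes "\<And>x. x \<notin> W \<Longrightarrow> g x = 0" shows "(LINT x:W|M. g x) = (LINT x|M. g x)"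
proof -
  have "(\<lambda>x. indicator W x *\<^sub>R g x) = g" using assms by (auto simp: indicator_def fun_eq_iff)
  then show ?thesis by (simp add: set_lebesgue_integral_def)
qed

lemma weak_deriv_on_integrable:
  assumes "weak_deriv_on W f F" "K \<subseteq> W" "compact K"
  shows "integrable lebesgue (\<lambda>v. indicator K v *\<^sub>R f v)" "integrable lebesgue (\<lambda>v. indicator K v *\<^sub>R F v e)"
  using assms unfolding weak_deriv_on_def set_integrable_def by blast+

lemma weak_deriv_on_test:
  fixes f :: "real^2 \<Rightarrow> 'e::euclidean_space"
  assumes w: "weak_deriv_on W f F" and \<phi>: "test_function W \<phi>"
  shows "integrable lebesgue (\<lambda>v. \<phi> v *\<^sub>R F v e)" "integrable lebesgue (\<lambda>v. frechet_derivative \<phi> (at v) e *\<^sub>R f v)"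
    "(LINT v|lebesgue. \<phi> v *\<^sub>R F v e) = - (LINT v|lebesgue. frechet_derivative \<phi> (at v) e *\<^sub>R f v)"
proof -
  obtain K where K: "K \<subseteq> W" "compact K" "\<And>v. v \<notin> K \<Longrightarrow> \<phi> v = 0" using \<phi> unfolding test_function_def by auto
  have d0: "frechet_derivative \<phi> (at v) e = 0" if "v \<notin> K" for v
    using frechet_derivative_eq_0_off[OF compact_imp_closed[OF K(2)] K(3) that] by simp
  have gen: "integrable lebesgue (\<lambda>v. g v *\<^sub>R h v)"
    if hi: "integrable lebesgue (\<lambda>v. indicator K v *\<^sub>R h v)" and gc: "continuous_on UNIV g" and g0: "\<And>v. v \<notin> K \<Longrightarrow> g v = 0"
    for g :: "real^2 \<Rightarrow> real" and h :: "real^2 \<Rightarrow> 'e"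
  proof -
    obtain B where "B \<ge> 0" "\<And>x. \<bar>g x\<bar> \<le> B"
      using bounded_continuous_compact_support[OF gc K(2)] g0 by metis
    from integrable_bounded_scaleR[OF hi continuous_imp_measurable_lebesgue[OF gc] this(2)]
    have "integrable lebesgue (\<lambda>v. g v *\<^sub>R indicator K v *\<^sub>R h v)" .
    moreover have "(\<lambda>v. g v *\<^sub>R indicator K v *\<^sub>R h v) = (\<lambda>v. g v *\<^sub>R h v)"
      using g0 by (auto simp: indicator_def fun_eq_iff)
    ultimately show ?thesis by simp
  qed
  show "integrable lebesgue (\<lambda>v. \<phi> v *\<^sub>R F v e)"
    by (rule gen[OF weak_deriv_on_integrable(2)[OF w K(1,2)] test_function_continuous[OF \<phi>] K(3)])
  show "integrable lebesgue (\<lambda>v. frechet_derivative \<phi> (at v) e *\<^sub>R f v)"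
    by (rule gen[OF weak_deriv_on_integrable(1)[OF w K(1,2)]
          test_function_continuous[OF test_function_frechet_derivative[OF \<phi>]] d0])
  have "(LINT v:W|lebesgue. \<phi> v *\<^sub>R F v e) = - (LINT v:W|lebesgue. frechet_derivative \<phi> (at v) e *\<^sub>R f v)"
    using w \<phi> unfolding weak_deriv_on_def by blast
  moreover have "(LINT v:W|lebesgue. \<phi> v *\<^sub>R F v e) = (LINT v|lebesgue. \<phi> v *\<^sub>R F v e)"
    using K(1,3) by (intro set_integral_eq_integral) auto
  moreover have "(LINT v:W|lebesgue. frechet_derivative \<phi> (at v) e *\<^sub>R f v) = (LINT v|lebesgue. frechet_derivative \<phi> (at v) e *\<^sub>R f v)"
    using K(1) d0 by (intro set_integral_eq_integral) auto
  ultimately show "(LINT v|lebesgue. \<phi> v *\<^sub>R F v e) = - (LINT v|lebesgue. frechet_derivative \<phi> (at v) e *\<^sub>R f v)"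
    by simp
qed

lemma integral_vec_nth:
  fixes f :: "'a \<Rightarrow> real^'n"
  shows "integrable M f \<Longrightarrow> integral\<^sup>L M f $ i = (LINT x|M. f x $ i)"
  using integral_bounded_linear[OF bounded_linear_vec_nth[of i], of M f] by simp

lemma integrable_vec_nth:
  fixes f :: "'a \<Rightarrow> real^'n"
  shows "integrable M f \<Longrightarrow> integrable M (\<lambda>x. f x $ i)"
  using integrable_bounded_linear[OF bounded_linear_vec_nth[of i], of M f] by simp

lemma weak_deriv_on_component:
  fixes f :: "real^2 \<Rightarrow> real^'n"
  assumes w: "weak_deriv_on W f F" and \<phi>: "test_function W \<phi>"
  shows "(LINT v|lebesgue. \<phi> v * F v e $ i) = - (LINT v|lebesgue. frechet_derivative \<phi> (at v) e * f v $ i)"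
    "integrable lebesgue (\<lambda>v. \<phi> v * F v e $ i)"
proof -
  note T = weak_deriv_on_test[OF w \<phi>, of e]
  show "(LINT v|lebesgue. \<phi> v * F v e $ i) = - (LINT v|lebesgue. frechet_derivative \<phi> (at v) e * f v $ i)"
    using arg_cong[OF T(3), of "\<lambda>x. x $ i"] integral_vec_nth[OF T(1), of i] integral_vec_nth[OF T(2), of i] by simp
  show "integrable lebesgue (\<lambda>v. \<phi> v * F v e $ i)" using integrable_vec_nth[OF T(1), of i] by simp
qed

text \<open>Up to 1 the constant suffices, beyond 1 the larger exponent does. On compact sets, where
  constants are integrable, this turns p-integrability into square integrability.\<close>

lemma powr_dominates_square:
  fixes x p :: real assumes "x \<ge> 0" "p \<ge> 2" shows "x\<^sup>2 \<le> 1 + x powr p"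
proof (cases "x \<le> 1")
  case True
  then have "x\<^sup>2 \<le> 1" using assms power_le_one by blast
  then show ?thesis by (smt (verit) powr_ge_zero)
next
  case False
  then have "x powr 2 \<le> x powr p" using assms by (intro powr_mono) auto
  then show ?thesis using False by simp
qed

text \<open>\<open>Lp_loc_on\<close> speaks of the norm alone, so measurability of the components is
  taken from the local integrability.\<close>

lemma Lp_loc_component_loc_L2:
  fixes f :: "real^2 \<Rightarrow> real^'n"
  assumes L: "Lp_loc_on p W f" and p: "p \<ge> 2"
    and m: "\<And>K. K \<subseteq> W \<Longrightarrow> compact K \<Longrightarrow> integrable lebesgue (\<lambda>v. indicator K v *\<^sub>R f v)"
  shows "loc_L2 W (\<lambda>v. f v $ i)"
  unfolding loc_L2_def
proof (intro allI impI)
  fix K assume K: "K \<subseteq> W" "compact K"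
  have meas: "(\<lambda>v. indicator K v * f v $ i) \<in> borel_measurable lebesgue"
    using borel_measurable_integrable[OF integrable_vec_nth[OF m[OF K], of i]] by simp
  have "integrable lebesgue (\<lambda>v. (indicator K v * f v $ i)\<^sup>2)"
  proof (rule Bochner_Integration.integrable_bound)
    have "integrable lebesgue (\<lambda>v. indicator K v *\<^sub>R norm (f v) powr p)"
      using L K unfolding Lp_loc_on_def set_integrable_def by blast
    then show "integrable lebesgue (\<lambda>v. indicator K v + indicator K v *\<^sub>R norm (f v) powr p)"
      by (intro Bochner_Integration.integrable_add integrable_indicator_compact K)
    show "(\<lambda>v. (indicator K v * f v $ i)\<^sup>2) \<in> borel_measurable lebesgue" using meas by measurable
    show "AE v in lebesgue. norm ((indicator K v * f v $ i)\<^sup>2) \<le> norm (indicator K v + indicator K v *\<^sub>R norm (f v) powr p)"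
    proof (rule AE_I2)
      fix v
      have "\<bar>f v $ i\<bar>\<^sup>2 \<le> (norm (f v))\<^sup>2" by (intro power_mono component_le_norm_cart) simp
      also have "\<dots> \<le> 1 + norm (f v) powr p" by (rule powr_dominates_square[OF norm_ge_zero p])
      finally show "norm ((indicator K v * f v $ i)\<^sup>2) \<le> norm (indicator K v + indicator K v *\<^sub>R norm (f v) powr p)"
        by (auto simp: indicator_def)
    qed
  qed
  with meas show "sq_int (\<lambda>v. indicator K v * f v $ i)" by (simp add: sq_int_def)
qed

lemma weak_deriv_on_imp_H1_loc:
  fixes f :: "real^2 \<Rightarrow> real^'n"
  assumes w: "weak_deriv_on W f F" and p: "p \<ge> 2" and f: "Lp_loc_on p W f" and F: "\<And>e. Lp_loc_on p W (\<lambda>v. F v e)"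
  shows "H1_loc W (\<lambda>v. f v $ i) (\<lambda>v e. F v e $ i)"
  unfolding H1_loc_def
  using Lp_loc_component_loc_L2[OF f p weak_deriv_on_integrable(1)[OF w]]
    Lp_loc_component_loc_L2[OF F p weak_deriv_on_integrable(2)[OF w]] weak_deriv_on_component(1)[OF w] by blast

text \<open>The fundamental lemma applied to the components of the difference.\<close>

lemma weak_deriv_on_unique:
  fixes f :: "real^2 \<Rightarrow> real^'n"
  assumes W: "open W" and F: "weak_deriv_on W f F" and G: "weak_deriv_on W f G"
  shows "AE v in lebesgue. v \<in> W \<longrightarrow> F v e = G v e"
proof -
  have "AE v in lebesgue. v \<in> W \<longrightarrow> F v e $ i - G v e $ i = 0" for i
  proof (rule fundamental_lemma_AE[OF W])
    fix K assume K: "K \<subseteq> W" "compact K"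
    have "integrable lebesgue (\<lambda>v. (indicator K v *\<^sub>R F v e) $ i - (indicator K v *\<^sub>R G v e) $ i)"
      by (intro Bochner_Integration.integrable_diff integrable_vec_nth weak_deriv_on_integrable(2)[OF F K] weak_deriv_on_integrable(2)[OF G K])
    then show "set_integrable lebesgue K (\<lambda>v. F v e $ i - G v e $ i)"
      by (simp add: set_integrable_def right_diff_distrib)
  next
    fix \<phi> assume \<phi>: "test_function W \<phi>"
    have "(LINT v|lebesgue. \<phi> v * (F v e $ i - G v e $ i)) = (LINT v|lebesgue. \<phi> v * F v e $ i) - (LINT v|lebesgue. \<phi> v * G v e $ i)"
      unfolding right_diff_distrib
      by (rule Bochner_Integration.integral_diff[OF weak_deriv_on_component(2)[OF F \<phi>] weak_deriv_on_component(2)[OF G \<phi>]])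
    then show "(LINT v|lebesgue. \<phi> v * (F v e $ i - G v e $ i)) = 0"
      unfolding weak_deriv_on_component(1)[OF F \<phi>] weak_deriv_on_component(1)[OF G \<phi>] by simp
  qed
  then have "AE v in lebesgue. \<forall>i\<in>UNIV. v \<in> W \<longrightarrow> F v e $ i - G v e $ i = 0"
    by (intro AE_finite_allI) simp_all
  then show ?thesis by (rule AE_mp) (auto intro!: AE_I2 simp: vec_eq_iff)
qed

lemma Lp_loc_on_AE:
  fixes F G :: "real^2 \<Rightarrow> 'e::euclidean_space"
  assumes F: "Lp_loc_on p W F" and eq: "AE v in lebesgue. v \<in> W \<longrightarrow> F v = G v"
    and m: "\<And>K. K \<subseteq> W \<Longrightarrow> compact K \<Longrightarrow> integrable lebesgue (\<lambda>v. indicator K v *\<^sub>R G v)"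
  shows "Lp_loc_on p W G"
  unfolding Lp_loc_on_def set_integrable_def
proof (intro allI impI)
  fix K assume K: "K \<subseteq> W" "compact K"
  have iF: "integrable lebesgue (\<lambda>v. indicator K v *\<^sub>R norm (F v) powr p)"
    using F K unfolding Lp_loc_on_def set_integrable_def by blast
  have ae: "AE v in lebesgue. indicator K v *\<^sub>R norm (F v) powr p = indicator K v *\<^sub>R norm (G v) powr p"
    using eq by (rule AE_mp) (use K(1) in \<open>auto intro!: AE_I2 simp: indicator_def\<close>)
  have "(\<lambda>v. indicator K v *\<^sub>R norm (G v) powr p) \<in> borel_measurable lebesgue"
    by (rule borel_measurable_AE[OF borel_measurable_integrable[OF iF] ae])
  then show "integrable lebesgue (\<lambda>v. indicator K v *\<^sub>R norm (G v) powr p)"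
    using integrable_cong_AE[OF borel_measurable_integrable[OF iF] _ ae] iF by blast
qed

text \<open>The Lorentz signature as one sign per coordinate, so that scalar identities can be
  applied to components and summed.\<close>

definition lsgn :: "'m option \<Rightarrow> real" where "lsgn i = (if i = None then - 1 else 1)"

lemma lor_sum: "lor X Y = (\<Sum>i\<in>UNIV. lsgn i * (X $ i * Y $ i))"
proof -
  have "(\<Sum>i\<in>UNIV. lsgn i * (X $ i * Y $ i)) = - (X $ None * Y $ None) + (\<Sum>i\<in>range Some. lsgn i * (X $ i * Y $ i))"
    unfolding UNIV_option_conv by (subst sum.insert) (auto simp: lsgn_def)
  also have "(\<Sum>i\<in>range Some. lsgn i * (X $ i * Y $ i)) = (\<Sum>i\<in>UNIV. X $ Some i * Y $ Some i)"
    by (subst sum.reindex) (auto simp: lsgn_def)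
  finally show ?thesis by (simp add: lor_def)
qed

section \<open>Equivariant lifts and their weak differentials\<close>

locale hyperbolic_lift = riemannian_surface S
  for S :: "('a::t2_space, 'b::topological_space) surface" +
  fixes \<Gamma> :: "(real ^ ('m::finite option) ^ ('m option)) set"
    and u :: "'a \<Rightarrow> 'm mink set" and \<rho> :: "('b \<Rightarrow> 'b) \<Rightarrow> real ^ ('m option) ^ ('m option)" and w :: "'b \<Rightarrow> 'm mink"
  assumes \<Gamma>: "closed_hyperbolic_group \<Gamma>" and lift: "equivariant_lift S \<Gamma> u \<rho> w"
begin

lemma w_hyp: "y \<in> ucov S \<Longrightarrow> w y \<in> hyp"
  and w_continuous: "continuous_on (ucov S) w"
  and w_deck: "\<tau> \<in> deck S \<Longrightarrow> y \<in> ucov S \<Longrightarrow> w (\<tau> y) = \<rho> \<tau> *v w y"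
  and \<rho>_in: "\<tau> \<in> deck S \<Longrightarrow> \<rho> \<tau> \<in> \<Gamma>"
  using lift by (auto simp: equivariant_lift_def)

lemma \<rho>_lor: "\<tau> \<in> deck S \<Longrightarrow> lor (\<rho> \<tau> *v X) (\<rho> \<tau> *v Y) = lor X Y"
proof -
  assume "\<tau> \<in> deck S"
  moreover have "\<Gamma> \<subseteq> SO_plus" using \<Gamma> by (simp add: closed_hyperbolic_group_def)
  ultimately have "\<rho> \<tau> \<in> SO_plus" using \<rho>_in by auto
  then show ?thesis by (simp add: SO_plus_def)
qed

lemma E_form_linear: "E_form S \<rho> \<omega> \<Longrightarrow> y \<in> ucov S \<Longrightarrow> linear (\<omega> y)"
  and E_form_deck: "E_form S \<rho> \<omega> \<Longrightarrow> \<tau> \<in> deck S \<Longrightarrow> y \<in> ucov S \<Longrightarrow> \<omega> (\<tau> y) v = \<rho> \<tau> *v \<omega> y v"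
  by (auto simp: E_form_def)

lemma deck_eq: "\<tau> \<in> deck S \<Longrightarrow> y \<in> ucov S \<Longrightarrow> uproj S (\<tau> y) = uproj S y"
  using deck_ucov by blast

text \<open>What the later arguments use of a weak differential: equivariance, scalar Sobolev
  functions as components, and local p-integrability.\<close>

definition sobolev_form :: "real \<Rightarrow> ('b \<Rightarrow> 'm mink) \<Rightarrow> ('b \<Rightarrow> real^2 \<Rightarrow> 'm mink) \<Rightarrow> bool" where
  "sobolev_form p \<xi> \<omega> \<longleftrightarrow> E_form S \<rho> \<omega> \<and> (\<forall>c W \<sigma>. lifted_chart S c W \<sigma> \<longrightarrow>
     (\<forall>i. H1_loc W (\<lambda>v. \<xi> (\<sigma> v) $ i) (\<lambda>v e. \<omega> (\<sigma> v) (dpar S c v e) $ i)) \<and>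
     (\<forall>e. Lp_loc_on p W (\<lambda>v. \<omega> (\<sigma> v) (dpar S c v e))))"

lemma sobolev_formD:
  assumes "sobolev_form p \<xi> \<omega>"
  shows "E_form S \<rho> \<omega>"
    "lifted_chart S c W \<sigma> \<Longrightarrow> H1_loc W (\<lambda>v. \<xi> (\<sigma> v) $ i) (\<lambda>v e. \<omega> (\<sigma> v) (dpar S c v e) $ i)"
    "lifted_chart S c W \<sigma> \<Longrightarrow> Lp_loc_on p W (\<lambda>v. \<omega> (\<sigma> v) (dpar S c v e))"
  using assms unfolding sobolev_form_def by blast+

lemma weak_differential_unique:
  assumes 1: "weak_differential S \<rho> \<xi> \<omega>1" and 2: "weak_differential S \<rho> \<xi> \<omega>2" and L: "lifted_chart S c W \<sigma>"
  shows "AE v in lebesgue. v \<in> W \<longrightarrow> \<omega>1 (\<sigma> v) = \<omega>2 (\<sigma> v)"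
proof -
  note D = lifted_chartD[OF L]
  have w1: "weak_deriv_on W (\<lambda>v. \<xi> (\<sigma> v)) (\<lambda>v e. \<omega>1 (\<sigma> v) (dpar S c v e))"
    and w2: "weak_deriv_on W (\<lambda>v. \<xi> (\<sigma> v)) (\<lambda>v e. \<omega>2 (\<sigma> v) (dpar S c v e))"
    using 1 2 L unfolding weak_differential_def by blast+
  have l: "E_form S \<rho> \<omega>1" "E_form S \<rho> \<omega>2" using 1 2 unfolding weak_differential_def by blast+
  have "AE v in lebesgue. (v \<in> W \<longrightarrow> \<omega>1 (\<sigma> v) (dpar S c v ex) = \<omega>2 (\<sigma> v) (dpar S c v ex)) \<and>
     (v \<in> W \<longrightarrow> \<omega>1 (\<sigma> v) (dpar S c v ey) = \<omega>2 (\<sigma> v) (dpar S c v ey))"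
    using weak_deriv_on_unique[OF D(2) w1 w2] by (intro AE_conjI) blast+
  then show ?thesis
  proof (rule AE_mp, intro AE_I2 impI)
    fix v assume v: "v \<in> W" and eq: "(v \<in> W \<longrightarrow> \<omega>1 (\<sigma> v) (dpar S c v ex) = \<omega>2 (\<sigma> v) (dpar S c v ex)) \<and>
     (v \<in> W \<longrightarrow> \<omega>1 (\<sigma> v) (dpar S c v ey) = \<omega>2 (\<sigma> v) (dpar S c v ey))"
    show "\<omega>1 (\<sigma> v) = \<omega>2 (\<sigma> v)"
      by (rule dpar_onto[OF D(1) D(5)[OF v] E_form_linear[OF l(1) D(6)[OF v]] E_form_linear[OF l(2) D(6)[OF v]]])
        (use v eq in auto)
  qed
qed

text \<open>\<open>flat_d\<close> selects an arbitrary weak differential, while the p-bound is given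
  for a possibly different one; the two agree almost everywhere.\<close>

lemma sobolev_form_flat_d:
  assumes \<xi>: "W1p_section p S \<rho> \<xi>" and p: "p \<ge> 2"
  shows "sobolev_form p \<xi> (flat_d S \<rho> \<xi>)"
proof -
  obtain \<omega> where \<omega>: "weak_differential S \<rho> \<xi> \<omega>" and L: "\<And>c W \<sigma>. lifted_chart S c W \<sigma> \<Longrightarrow>
           Lp_loc_on p W (\<lambda>v. \<xi> (\<sigma> v)) \<and> (\<forall>e. Lp_loc_on p W (\<lambda>v. \<omega> (\<sigma> v) (dpar S c v e)))"
    using \<xi> unfolding W1p_section_def by blast
  let ?\<omega> = "flat_d S \<rho> \<xi>"
  have fd: "weak_differential S \<rho> \<xi> ?\<omega>" unfolding flat_d_def using \<omega> by (rule someI[of "weak_differential S \<rho> \<xi>"])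
  show ?thesis
    unfolding sobolev_form_def
  proof (intro conjI allI impI)
    show "E_form S \<rho> ?\<omega>" using fd unfolding weak_differential_def by (rule conjunct1)
    fix c W \<sigma> assume lc: "lifted_chart S c W \<sigma>"
    have wd: "weak_deriv_on W (\<lambda>v. \<xi> (\<sigma> v)) (\<lambda>v e. ?\<omega> (\<sigma> v) (dpar S c v e))"
      using fd lc unfolding weak_differential_def by blast
    show Lp: "Lp_loc_on p W (\<lambda>v. ?\<omega> (\<sigma> v) (dpar S c v e))" for e
    proof (rule Lp_loc_on_AE)
      show "Lp_loc_on p W (\<lambda>v. \<omega> (\<sigma> v) (dpar S c v e))" using L[OF lc] by blast
      show "AE v in lebesgue. v \<in> W \<longrightarrow> \<omega> (\<sigma> v) (dpar S c v e) = ?\<omega> (\<sigma> v) (dpar S c v e)"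
        using weak_differential_unique[OF \<omega> fd lc] by (rule AE_mp) (auto intro!: AE_I2)
    qed (rule weak_deriv_on_integrable(2)[OF wd])
    show "H1_loc W (\<lambda>v. \<xi> (\<sigma> v) $ i) (\<lambda>v e. ?\<omega> (\<sigma> v) (dpar S c v e) $ i)" for i
      using weak_deriv_on_imp_H1_loc[OF wd p _ Lp] L[OF lc] by blast
  qed
qed

lemma w_lifted_continuous: "lifted_chart S c W \<sigma> \<Longrightarrow> continuous_on W (\<lambda>v. w (\<sigma> v))"
proof -
  assume L: "lifted_chart S c W \<sigma>"
  note D = lifted_chartD[OF L]
  have "\<sigma> ` W \<subseteq> ucov S" using D(6) by (rule image_subsetI)
  then show ?thesis by (rule continuous_on_compose2[OF w_continuous D(4)])
qed

text \<open>The constant function (w, w) = -1 has weak derivative zero: the identity for squares is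
  summed over components with the Lorentz signs, and what remains is the integral of a derivative of
  the test function.\<close>

lemma sobolev_form_tangent:
  assumes A: "sobolev_form p w A" and L: "lifted_chart S c W \<sigma>"
  shows "AE v in lebesgue. v \<in> W \<longrightarrow> (\<forall>e. lor (A (\<sigma> v) e) (w (\<sigma> v)) = 0)"
proof -
  note D = lifted_chartD[OF L]
  note H = sobolev_formD(2)[OF A L]
  have wc: "continuous_on W (\<lambda>v. w (\<sigma> v) $ i)" for i
    by (intro continuous_intros w_lifted_continuous[OF L])
  let ?h = "\<lambda>e v. lor (w (\<sigma> v)) (A (\<sigma> v) (dpar S c v e))"
  have "AE v in lebesgue. v \<in> W \<longrightarrow> ?h e v = 0" for e
  proof (rule fundamental_lemma_AE[OF D(2)])
    fix K assume K: "K \<subseteq> W" "compact K"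
    have "integrable lebesgue (\<lambda>v. (indicator K v * w (\<sigma> v) $ i) * (indicator K v * A (\<sigma> v) (dpar S c v e) $ i))" for i
      using H1_loc_loc_L2[OF H] K unfolding loc_L2_def by (intro sq_int_mult_integrable) blast+
    then have "integrable lebesgue (\<lambda>v. \<Sum>i\<in>UNIV. lsgn i * ((indicator K v * w (\<sigma> v) $ i) * (indicator K v * A (\<sigma> v) (dpar S c v e) $ i)))"
      by (intro Bochner_Integration.integrable_sum integrable_mult_right)
    moreover have "(\<lambda>v. \<Sum>i\<in>UNIV. lsgn i * ((indicator K v * w (\<sigma> v) $ i) * (indicator K v * A (\<sigma> v) (dpar S c v e) $ i))) =
       (\<lambda>v. indicator K v *\<^sub>R ?h e v)"
      unfolding lor_sum by (auto simp: indicator_def fun_eq_iff)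
    ultimately show "set_integrable lebesgue K (?h e)" unfolding set_integrable_def by simp
  next
    fix \<phi> assume \<phi>: "test_function W \<phi>"
    let ?\<phi>' = "\<lambda>v. frechet_derivative \<phi> (at v) e"
    have C: "C1c W \<phi> (\<lambda>v. frechet_derivative \<phi> (at v))" by (rule test_function_imp_C1c[OF \<phi>])
    obtain K where K: "K \<subseteq> W" "compact K" "\<And>v. v \<notin> K \<Longrightarrow> \<phi> v = 0" using \<phi> unfolding test_function_def by auto
    have d0: "?\<phi>' v = 0" if "v \<notin> K" for v
      using C1c_derivative_eq_0[OF C compact_imp_closed[OF K(2)] K(3) that] .
    note S = H1_loc_square[OF D(2) wc H C]
    have i2: "integrable lebesgue (\<lambda>v. ?\<phi>' v * (w (\<sigma> v) $ i)\<^sup>2)" for i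
    proof -
      have "sq_int (\<lambda>v. ?\<phi>' v * w (\<sigma> v) $ i)"
        by (rule loc_L2_mult_continuous[OF H1_loc_loc_L2(1)[OF H] C1c_continuous_derivative[OF C] K(2,1) d0])
      moreover have "sq_int (\<lambda>v. indicator K v * w (\<sigma> v) $ i)" using H1_loc_loc_L2(1)[OF H] K unfolding loc_L2_def by blast
      ultimately have "integrable lebesgue (\<lambda>v. (indicator K v * w (\<sigma> v) $ i) * (?\<phi>' v * w (\<sigma> v) $ i))"
        by (intro sq_int_mult_integrable)
      moreover have "(\<lambda>v. (indicator K v * w (\<sigma> v) $ i) * (?\<phi>' v * w (\<sigma> v) $ i)) = (\<lambda>v. ?\<phi>' v * (w (\<sigma> v) $ i)\<^sup>2)"
        using d0 by (auto simp: indicator_def fun_eq_iff power2_eq_square)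
      ultimately show ?thesis by simp
    qed
    have "2 * (LINT v|lebesgue. \<phi> v * ?h e v) = 2 * (\<Sum>i\<in>UNIV. lsgn i * (LINT v|lebesgue. \<phi> v * (w (\<sigma> v) $ i * A (\<sigma> v) (dpar S c v e) $ i)))"
    proof -
      have "(LINT v|lebesgue. \<phi> v * ?h e v) = (LINT v|lebesgue. (\<Sum>i\<in>UNIV. lsgn i * (\<phi> v * (w (\<sigma> v) $ i * A (\<sigma> v) (dpar S c v e) $ i))))"
        unfolding lor_sum sum_distrib_left by (simp only: mult.left_commute)
      also have "\<dots> = (\<Sum>i\<in>UNIV. LINT v|lebesgue. lsgn i * (\<phi> v * (w (\<sigma> v) $ i * A (\<sigma> v) (dpar S c v e) $ i)))"
        by (rule Bochner_Integration.integral_sum) (intro integrable_mult_right S(2))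
      finally show ?thesis by simp
    qed
    also have "\<dots> = - (\<Sum>i\<in>UNIV. lsgn i * (LINT v|lebesgue. ?\<phi>' v * (w (\<sigma> v) $ i)\<^sup>2))"
      using S(1)[of _ e] by (simp add: sum_distrib_left mult.left_commute[of 2] sum_negf)
    also have "(\<Sum>i\<in>UNIV. lsgn i * (LINT v|lebesgue. ?\<phi>' v * (w (\<sigma> v) $ i)\<^sup>2)) = 
        (LINT v|lebesgue. (\<Sum>i\<in>UNIV. lsgn i * (?\<phi>' v * (w (\<sigma> v) $ i)\<^sup>2)))"
      by (subst Bochner_Integration.integral_sum) (auto intro!: integrable_mult_right i2)
    \<comment> \<open>On \<open>W\<close> the Lorentz square of the lift is -1, and off
      \<open>W\<close> the derivative of the test function vanishes.\<close>
    also have "(\<lambda>v. \<Sum>i\<in>UNIV. lsgn i * (?\<phi>' v * (w (\<sigma> v) $ i)\<^sup>2)) = (\<lambda>v. - ?\<phi>' v)"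
    proof
      fix v
      have "(\<Sum>i\<in>UNIV. lsgn i * (?\<phi>' v * (w (\<sigma> v) $ i)\<^sup>2)) = ?\<phi>' v * lor (w (\<sigma> v)) (w (\<sigma> v))"
        unfolding lor_sum sum_distrib_left by (simp only: mult.left_commute power2_eq_square)
      also have "\<dots> = - ?\<phi>' v"
      proof (cases "v \<in> W")
        case True
        then show ?thesis using w_hyp[OF D(6)[OF True]] by (simp add: hyp_def)
      next
        case False
        then have "v \<notin> K" using K(1) by auto
        then show ?thesis using d0 by simp
      qed
      finally show "(\<Sum>i\<in>UNIV. lsgn i * (?\<phi>' v * (w (\<sigma> v) $ i)\<^sup>2)) = - ?\<phi>' v" .
    qed
    finally show "(LINT v|lebesgue. \<phi> v * ?h e v) = 0"
      using integral_C1c_derivative[OF C, of e] by simp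
  qed
  from AE_conjI[OF this[of ex] this[of ey]]
  show ?thesis
  proof (rule AE_mp, intro AE_I2 impI)
    fix v assume v: "v \<in> W" and eq: "(v \<in> W \<longrightarrow> ?h ex v = 0) \<and> (v \<in> W \<longrightarrow> ?h ey v = 0)"
    have "(\<lambda>e. lor (w (\<sigma> v)) (A (\<sigma> v) e)) = (\<lambda>e. 0)"
    proof (rule dpar_onto[OF D(1) D(5)[OF v]])
      show "linear (\<lambda>e. lor (w (\<sigma> v)) (A (\<sigma> v) e))"
        using E_form_linear[OF sobolev_formD(1)[OF A] D(6)[OF v]]
        by (simp add: linear_iff lor_simps)
      show "linear (\<lambda>e::real^2. 0::real)" by (simp add: linear_iff)
    qed (use v eq in auto)
    then have "lor (w (\<sigma> v)) (A (\<sigma> v) e) = 0" for e by meson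
    then show "\<forall>e. lor (A (\<sigma> v) e) (w (\<sigma> v)) = 0" by (simp add: lor_sym[of "A (\<sigma> v) _"])
  qed
qed

end

subsection \<open>The Stokes formula on the surface\<close>

context riemannian_surface
begin

lemma measurable_area_lebesgue_on:
  fixes G :: "'a \<Rightarrow> real"
  assumes loc: "\<And>c v. c \<in> charts S \<Longrightarrow> v \<in> fst c \<Longrightarrow>
    \<exists>W E. open W \<and> v \<in> W \<and> W \<subseteq> fst c \<and> E \<in> borel_measurable (lebesgue_on W) \<and>
      (AE v in lebesgue. v \<in> W \<longrightarrow> G (snd c v) = E v)"
  shows "G \<in> borel_measurable (area S)"
proof (rule measurable_area_local)
  fix c v assume "c \<in> charts S" "v \<in> fst c"
  from loc[OF this] obtain W E where W: "open W" "v \<in> W" "W \<subseteq> fst c" 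
    and E: "E \<in> borel_measurable (lebesgue_on W)" and eq: "AE v in lebesgue. v \<in> W \<longrightarrow> G (snd c v) = E v" by auto
  have "(\<lambda>v. indicator W v * E v) \<in> borel_measurable lebesgue"
    using E W(1) by (simp add: borel_measurable_restrict_space_iff mult.commute)
  moreover have "AE v in lebesgue. indicator W v * E v = indicator W v * G (snd c v)"
    using eq by (rule AE_mp) (auto intro!: AE_I2 simp: indicator_def)
  ultimately have "(\<lambda>v. indicator W v * G (snd c v)) \<in> borel_measurable lebesgue"
    by (rule borel_measurable_AE)
  with W show "\<exists>W. open W \<and> v \<in> W \<and> W \<subseteq> fst c \<and> (\<lambda>v. indicator W v * G (snd c v)) \<in> borel_measurable lebesgue"
    by auto
qed

lemma loc_L2_measurable_on:
  assumes "loc_L2 W f" "compact K" "K \<subseteq> W" "B \<subseteq> K" "B \<in> sets lebesgue"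
  shows "f \<in> borel_measurable (lebesgue_on B)"
proof -
  have "(\<lambda>x. indicator K x * f x) \<in> borel_measurable lebesgue"
    using assms(1-3) unfolding loc_L2_def sq_int_def by blast
  then have "(\<lambda>x. indicator B x * (indicator K x * f x)) \<in> borel_measurable lebesgue"
    by (rule borel_measurable_times[OF borel_measurable_indicator[OF assms(5)]])
  moreover have "(\<lambda>x. indicator B x * (indicator K x * f x)) = (\<lambda>x. indicator B x * f x)"
    using assms(4) by (auto simp: indicator_def fun_eq_iff)
  ultimately show ?thesis
    using assms(5) by (simp add: borel_measurable_restrict_space_iff mult.commute)
qed

lemma continuous_measurable_on:
  fixes f :: "real^2 \<Rightarrow> real"
  shows "continuous_on W f \<Longrightarrow> B \<subseteq> W \<Longrightarrow> B \<in> sets lebesgue \<Longrightarrow> f \<in> borel_measurable (lebesgue_on B)"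
  by (rule continuous_imp_measurable_on_sets_lebesgue[OF continuous_on_subset])

lemma C1M_zero:
  assumes \<theta>: "C1M \<theta> \<theta>'" and U: "openin (top_of_set (pts S)) U" and z: "\<And>x. x \<in> U \<Longrightarrow> \<theta> x = 0" and x: "x \<in> U"
  shows "\<theta>' x e = 0"
proof -
  have xp: "x \<in> pts S" using openin_imp_subset[OF U] x by auto
  from chart_cover[OF xp] obtain c where c: "c \<in> charts S" "x \<in> snd c ` fst c" ..
  from c(2) obtain v where v: "x = snd c v" "v \<in> fst c" by (rule imageE)
  have "((\<lambda>v. 0) has_derivative (\<lambda>e. \<theta>' (snd c v) (dpar S c v e))) (at v)"
    using C1M_derivative[OF \<theta> c(1) v(2)]
    by (rule has_derivative_transform_within_open[OF _ open_chart_preimage[OF c(1) U]])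
      (use v x z in auto)
  from has_derivative_unique[OF this has_derivative_const]
  have d: "\<theta>' x (dpar S c v e) = 0" for e unfolding v(1) by meson
  have "\<theta>' x = (\<lambda>e. 0)"
  proof (rule dpar_onto[OF c(1) v(2) C1M_linear[OF \<theta> xp]])
    show "linear (\<lambda>e::real^2. 0::real)" by (simp add: linear_iff)
  qed (simp_all add: d)
  then show ?thesis by meson
qed

end

context hyperbolic_lift
begin

abbreviation wedge :: "('b \<Rightarrow> real^2 \<Rightarrow> 'm mink) \<Rightarrow> ('b \<Rightarrow> real^2 \<Rightarrow> 'm mink) \<Rightarrow> 'b \<Rightarrow> real" where
  "wedge \<alpha> \<beta> y \<equiv> form_wedge (metric S (uproj S y)) (\<alpha> y) (\<beta> y)"

lemma wedge_deck:
  assumes "E_form S \<rho> \<alpha>" "E_form S \<rho> \<beta>" "\<tau> \<in> deck S" "y \<in> ucov S"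
  shows "wedge \<alpha> \<beta> (\<tau> y) = wedge \<alpha> \<beta> y"
  unfolding form_wedge_def deck_eq[OF assms(3,4)]
  by (simp add: E_form_deck[OF assms(1,3,4)] E_form_deck[OF assms(2,3,4)] \<rho>_lor[OF assms(3)] split: prod.split)

text \<open>The product with the area density is written out by components so that the scalar Stokes
  formula applies to each of them.\<close>

lemma desc_wedge_chart:
  assumes \<alpha>: "E_form S \<rho> \<alpha>" and \<beta>: "E_form S \<rho> \<beta>" and L: "lifted_chart S c W \<sigma>" and v: "v \<in> W"
  shows "area_density S c v * desc (wedge \<alpha> \<beta>) (snd c v) =
    (\<Sum>i\<in>UNIV. lsgn i * (\<alpha> (\<sigma> v) (dpar S c v ex) $ i * \<beta> (\<sigma> v) (dpar S c v ey) $ i -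
       \<alpha> (\<sigma> v) (dpar S c v ey) $ i * \<beta> (\<sigma> v) (dpar S c v ex) $ i))"
proof -
  note D = lifted_chartD[OF L]
  have "desc (wedge \<alpha> \<beta>) (uproj S (\<sigma> v)) = wedge \<alpha> \<beta> (\<sigma> v)"
    by (rule desc_eq[OF D(6)[OF v]], rule wedge_deck[OF \<alpha> \<beta> _ D(6)[OF v]])
  then have "desc (wedge \<alpha> \<beta>) (snd c v) = form_wedge (metric S (snd c v)) (\<alpha> (\<sigma> v)) (\<beta> (\<sigma> v))"
    unfolding D(7)[OF v] .
  then show ?thesis
    using chart_form_wedge[OF D(1) D(5)[OF v] E_form_linear[OF \<alpha> D(6)[OF v]] E_form_linear[OF \<beta> D(6)[OF v]]]
    by (simp add: lor_sum right_diff_distrib sum_subtractf)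
qed

lemma measurable_desc_wedge:
  assumes \<alpha>: "E_form S \<rho> \<alpha>" and \<beta>: "E_form S \<rho> \<beta>"
    and m: "\<And>c W \<sigma> K B e i. lifted_chart S c W \<sigma> \<Longrightarrow> compact K \<Longrightarrow> K \<subseteq> W \<Longrightarrow> B \<subseteq> K \<Longrightarrow> B \<in> sets lebesgue \<Longrightarrow>
      (\<lambda>v. \<alpha> (\<sigma> v) (dpar S c v e) $ i) \<in> borel_measurable (lebesgue_on B) \<and>
      (\<lambda>v. \<beta> (\<sigma> v) (dpar S c v e) $ i) \<in> borel_measurable (lebesgue_on B)"
  shows "desc (wedge \<alpha> \<beta>) \<in> borel_measurable (area S)"
proof (rule measurable_area_lebesgue_on)
  fix c v assume cv: "c \<in> charts S" "v \<in> fst c"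
  obtain W \<sigma> where L: "lifted_chart S c W \<sigma>" "v \<in> W" by (rule lifted_chart_exists[OF cv])
  note D = lifted_chartD[OF L(1)]
  obtain r where r: "r > 0" "cball v r \<subseteq> W" using L(2) D(2) unfolding open_contains_cball by auto
  let ?B = "ball v r"
  have BK: "?B \<subseteq> cball v r" "?B \<in> sets lebesgue" by auto
  note m' = m[OF L(1) compact_cball r(2) BK]
  have ma: "(\<lambda>v. \<alpha> (\<sigma> v) (dpar S c v e) $ i) \<in> borel_measurable (lebesgue_on ?B)"
    and mb: "(\<lambda>v. \<beta> (\<sigma> v) (dpar S c v e) $ i) \<in> borel_measurable (lebesgue_on ?B)" for e i using m' by auto
  have md: "area_density S c \<in> borel_measurable (lebesgue_on ?B)"
    by (rule continuous_measurable_on[OF continuous_mc(1)[OF D(1)] order_trans[OF BK(1) order_trans[OF r(2) D(3)]] BK(2)])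
  define E where "E v = (\<Sum>i\<in>UNIV. lsgn i * (\<alpha> (\<sigma> v) (dpar S c v ex) $ i * \<beta> (\<sigma> v) (dpar S c v ey) $ i -
       \<alpha> (\<sigma> v) (dpar S c v ey) $ i * \<beta> (\<sigma> v) (dpar S c v ex) $ i)) / area_density S c v" for v
  have "E \<in> borel_measurable (lebesgue_on ?B)"
    unfolding E_def
    by (intro borel_measurable_divide borel_measurable_sum borel_measurable_times borel_measurable_diff
        borel_measurable_const ma mb md)
  moreover have "desc (wedge \<alpha> \<beta>) (snd c x) = E x" if x: "x \<in> ?B" for x
  proof -
    have xW: "x \<in> W" using x r(2) by auto
    show ?thesis
      unfolding E_def desc_wedge_chart[OF \<alpha> \<beta> L(1) xW, symmetric]
      using chart_frame(1)[OF D(1) D(5)[OF xW]] by simp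
  qed
  ultimately show "\<exists>W E. open W \<and> v \<in> W \<and> W \<subseteq> fst c \<and> E \<in> borel_measurable (lebesgue_on W) \<and>
      (AE x in lebesgue. x \<in> W \<longrightarrow> desc (wedge \<alpha> \<beta>) (snd c x) = E x)"
    using order_trans[OF BK(1) order_trans[OF r(2) D(3)]] r(1)
    by (intro exI[of _ ?B] exI[of _ E]) (auto intro!: AE_I2)
qed

lemma sobolev_form_measurable_on:
  assumes A: "sobolev_form p \<xi> A" and L: "lifted_chart S c W \<sigma>" and K: "compact K" "K \<subseteq> W" "B \<subseteq> K" "B \<in> sets lebesgue"
  shows "(\<lambda>v. A (\<sigma> v) (dpar S c v e) $ i) \<in> borel_measurable (lebesgue_on B)"
  by (rule loc_L2_measurable_on[OF H1_loc_loc_L2(2)[OF sobolev_formD(2)[OF A L]] K])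

text \<open>Multiplying the lift by a partition of unity reduces the global statement to the local one:
  the differential of \<open>\<theta> w\<close> is \<open>\<theta> dw + d\<theta> w\<close>.\<close>

lemma Stokes:
  assumes A: "sobolev_form p w A" and B: "sobolev_form p \<xi> B"
  shows "integrable (area S) (desc (wedge A B))" "(LINT x|area S. desc (wedge A B) x) = 0"
proof -
  obtain I :: "(((real^2) set \<times> (real^2 \<Rightarrow> 'a)) \<times> (real^2) \<times> real) set" and \<theta> \<theta>' where I: "finite I"
    "\<forall>i\<in>I. C1M (\<theta> i) (\<theta>' i) \<and> (\<exists>c W \<sigma> K. lifted_chart S c W \<sigma> \<and> compact K \<and> K \<subseteq> W \<and>
      (\<forall>x\<in>pts S. x \<notin> snd c ` K \<longrightarrow> \<theta> i x = 0))"
    "\<forall>x\<in>pts S. (\<Sum>i\<in>I. \<theta> i x) = 1" "\<forall>x\<in>pts S. \<forall>e. (\<Sum>i\<in>I. \<theta>' i x e) = 0"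
    using C1_partition_of_unity by auto
  note EA = sobolev_formD(1)[OF A] and EB = sobolev_formD(1)[OF B]
  \<comment> \<open>The differential of \<theta>_k w by the product rule. Since the \<theta>_k sum
    to 1 and their differentials to 0, these forms sum to \<open>A\<close>.\<close>
  define Ak where "Ak k y e = \<theta> k (uproj S y) *\<^sub>R A y e + \<theta>' k (uproj S y) e *\<^sub>R w y" for k y e
  have EAk: "E_form S \<rho> (Ak k)" if k: "k \<in> I" for k
    unfolding E_form_def
  proof (intro conjI ballI allI)
    fix y assume y: "y \<in> ucov S"
    have "linear (\<theta>' k (uproj S y))" using I(2) k C1M_linear uproj_in_pts[OF y] by blast
    then show "linear (Ak k y)"
      using E_form_linear[OF EA y] unfolding Ak_def by (simp add: linear_iff algebra_simps)
    fix \<tau> v assume "\<tau> \<in> deck S"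
    then show "Ak k (\<tau> y) v = \<rho> \<tau> *v Ak k y v"
      using y by (simp add: Ak_def deck_eq E_form_deck[OF EA] w_deck matrix_vector_right_distrib scaleR_matrix_vector_assoc[symmetric]
          matrix_vector_mult_scaleR)
  qed
  have key: "integrable (area S) (desc (wedge (Ak k) B)) \<and> (LINT x|area S. desc (wedge (Ak k) B) x) = 0"
    if k: "k \<in> I" for k
  proof -
    have C: "C1M (\<theta> k) (\<theta>' k)" using bspec[OF I(2) k] by (rule conjunct1)
    have "\<exists>c W \<sigma> K. lifted_chart S c W \<sigma> \<and> compact K \<and> K \<subseteq> W \<and>
      (\<forall>x\<in>pts S. x \<notin> snd c ` K \<longrightarrow> \<theta> k x = 0)" using bspec[OF I(2) k] by (rule conjunct2)
    then obtain c W \<sigma> K where LK: "lifted_chart S c W \<sigma> \<and> compact K \<and> K \<subseteq> W \<and>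
      (\<forall>x\<in>pts S. x \<notin> snd c ` K \<longrightarrow> \<theta> k x = 0)" by (elim exE) (rule that)
    then have L: "lifted_chart S c W \<sigma>" and K: "compact K" "K \<subseteq> W"
      and z: "\<And>x. x \<in> pts S \<Longrightarrow> x \<notin> snd c ` K \<Longrightarrow> \<theta> k x = 0" by (elim conjE; simp)+
    note D = lifted_chartD[OF L]
    have KV: "K \<subseteq> fst c" using K(2) D(3) by auto
    have z': "\<theta>' k x e = 0" if x: "x \<in> pts S" "x \<notin> snd c ` K" for x e
      by (rule C1M_zero[OF C openin_minus_chart_image[OF D(1) K(1) KV]]) (use x z in auto)
    let ?\<phi> = "\<lambda>v. if v \<in> fst c then \<theta> k (snd c v) else 0"
    let ?\<phi>' = "\<lambda>v e. if v \<in> fst c then \<theta>' k (snd c v) (dpar S c v e) else 0"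
    have \<phi>: "C1c W ?\<phi> ?\<phi>'" by (rule C1M_imp_C1c[OF C L K z])
    have Gm: "desc (wedge (Ak k) B) \<in> borel_measurable (area S)"
    proof (rule measurable_desc_wedge[OF EAk[OF k] EB])
      fix c W \<sigma> K and X :: "(real^2) set" and e i assume L: "lifted_chart S c W \<sigma>" and K: "compact K" "K \<subseteq> W" "X \<subseteq> K" "X \<in> sets lebesgue"
      note D = lifted_chartD[OF L]
      have sub: "X \<subseteq> W" "X \<subseteq> fst c" using K D(3) by auto
      have 1: "(\<lambda>v. \<theta> k (snd c v)) \<in> borel_measurable (lebesgue_on X)"
        by (rule continuous_measurable_on[OF C1M_continuous[OF C D(1)] sub(2) K(4)])
      have 2: "(\<lambda>v. \<theta>' k (snd c v) (dpar S c v e)) \<in> borel_measurable (lebesgue_on X)"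
        by (rule continuous_measurable_on[OF C1M_continuous_derivative[OF C D(1)] sub(2) K(4)])
      have 3: "(\<lambda>v. w (\<sigma> v) $ i) \<in> borel_measurable (lebesgue_on X)"
        by (rule continuous_measurable_on[OF _ sub(1) K(4)]) (intro continuous_intros w_lifted_continuous[OF L])
      have "(\<lambda>v. \<theta> k (snd c v) * A (\<sigma> v) (dpar S c v e) $ i + \<theta>' k (snd c v) (dpar S c v e) * w (\<sigma> v) $ i) \<in> borel_measurable (lebesgue_on X)"
        by (intro borel_measurable_add borel_measurable_times 1 2 3 sobolev_form_measurable_on[OF A L K])
      moreover have "(\<theta> k (snd c v) * A (\<sigma> v) (dpar S c v e) $ i + \<theta>' k (snd c v) (dpar S c v e) * w (\<sigma> v) $ i) = Ak k (\<sigma> v) (dpar S c v e) $ i"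
        if "v \<in> space (lebesgue_on X)" for v
      proof -
        have "v \<in> W" using that sub by auto
        then show ?thesis using D(7) by (simp add: Ak_def)
      qed
      ultimately have "(\<lambda>v. Ak k (\<sigma> v) (dpar S c v e) $ i) \<in> borel_measurable (lebesgue_on X)"
        by (subst (asm) measurable_cong) auto
      then show "(\<lambda>v. Ak k (\<sigma> v) (dpar S c v e) $ i) \<in> borel_measurable (lebesgue_on X) \<and>
        (\<lambda>v. B (\<sigma> v) (dpar S c v e) $ i) \<in> borel_measurable (lebesgue_on X)"
        using sobolev_form_measurable_on[OF B L K] by blast
    qed
    have G0: "desc (wedge (Ak k) B) x = 0" if x: "x \<in> pts S" "x \<notin> snd c ` K" for x
    proof -
      obtain y where y: "y \<in> ucov S" "uproj S y = x" "desc (wedge (Ak k) B) x = wedge (Ak k) B y"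
        using desc_lift[OF x(1)] by blast
      have "Ak k y = (\<lambda>e. 0)" unfolding Ak_def y(2) using z[OF x] z'[OF x] by (simp add: fun_eq_iff)
      then have "wedge (Ak k) B y = 0" unfolding form_wedge_def by (simp add: lor_simps split: prod.split)
      then show ?thesis unfolding y(3) .
    qed
    \<comment> \<open>One component of the localised integrand, in the form of the local Stokes
      formula; exchanging \<open>a\<close> and \<open>b\<close> does not change its
      integral.\<close>
    define T where "T a b i v = B (\<sigma> v) (dpar S c v a) $ i * (?\<phi> v * A (\<sigma> v) (dpar S c v b) $ i + ?\<phi>' v b * w (\<sigma> v) $ i)" for a b i v
    have wc: "continuous_on W (\<lambda>v. w (\<sigma> v) $ i)" for i
      by (intro continuous_intros w_lifted_continuous[OF L])
    have St: "(LINT v|lebesgue. T ex ey i v) = (LINT v|lebesgue. T ey ex i v)" for i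
      unfolding T_def by (rule local_Stokes(1)[OF D(2) sobolev_formD(2)[OF B L] wc sobolev_formD(2)[OF A L] \<phi>])
    have iT: "integrable lebesgue (T a b i)" for a b i
      unfolding T_def[abs_def] by (rule local_Stokes(2)[OF D(2) sobolev_formD(2)[OF B L] wc sobolev_formD(2)[OF A L] \<phi>])
    have pt: "indicator (fst c) v * (area_density S c v * desc (wedge (Ak k) B) (snd c v)) = 
        (\<Sum>i\<in>UNIV. lsgn i * (T ey ex i v - T ex ey i v))" for v
    proof (cases "v \<in> W")
      case True
      have v: "v \<in> fst c" by (rule D(5)[OF True])
      have "T a b i v = Ak k (\<sigma> v) (dpar S c v b) $ i * B (\<sigma> v) (dpar S c v a) $ i" for a b i
        unfolding T_def Ak_def D(7)[OF True] using v by simp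
      then show ?thesis
        using v desc_wedge_chart[OF EAk[OF k] EB L True] by simp
    next
      case False
      then have vK: "v \<notin> K" using K(2) by auto
      have p0: "?\<phi> v = 0 \<and> (\<forall>e. ?\<phi>' v e = 0) \<and> (v \<in> fst c \<longrightarrow> desc (wedge (Ak k) B) (snd c v) = 0)"
      proof (cases "v \<in> fst c")
        case True
        have "snd c v \<notin> snd c ` K"
        proof
          assume "snd c v \<in> snd c ` K"
          then obtain k' where "k' \<in> K" "snd c v = snd c k'" by auto
          then have "v = k'" using True KV chart_inj[OF D(1)] by (auto simp: inj_on_def)
          with vK \<open>k' \<in> K\<close> show False by simp
        qed
        then show ?thesis using z z' G0 chart_in_pts[OF D(1) True] True by simp
      qed simp
      then have "T a b i v = 0" for a b i unfolding T_def by simp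
      then show ?thesis using p0 by (simp add: indicator_def)
    qed
    have G0': "desc (wedge (Ak k) B) x = 0" if x: "x \<in> pts S" "x \<notin> snd c ` fst c" for x
      by (rule G0[OF x(1)]) (use x(2) KV in auto)
    have CI: "integrable (area S) (desc (wedge (Ak k) B)) \<longleftrightarrow>
        integrable lebesgue (\<lambda>v. \<Sum>i\<in>UNIV. lsgn i * (T ey ex i v - T ex ey i v))"
      "(LINT x|area S. desc (wedge (Ak k) B) x) = (LINT v|lebesgue. (\<Sum>i\<in>UNIV. lsgn i * (T ey ex i v - T ex ey i v)))"
      unfolding pt[symmetric] by (rule chart_integral[OF D(1) Gm], rule G0'; assumption)+
    have iT': "integrable lebesgue (\<lambda>v. lsgn i * (T ey ex i v - T ex ey i v))" for i
      by (intro integrable_mult_right Bochner_Integration.integrable_diff iT)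
    have "integrable (area S) (desc (wedge (Ak k) B))"
      unfolding CI(1) by (intro Bochner_Integration.integrable_sum iT')
    moreover have "(LINT x|area S. desc (wedge (Ak k) B) x) = 0"
      unfolding CI(2) Bochner_Integration.integral_sum[OF iT'] 
      by (simp add: Bochner_Integration.integral_diff[OF iT iT] St)
    ultimately show ?thesis by blast
  qed
  have sum: "desc (wedge A B) x = (\<Sum>k\<in>I. desc (wedge (Ak k) B) x)" if x: "x \<in> space (area S)" for x
  proof -
    have xp: "x \<in> pts S" using x by (simp add: space_area)
    define y where "y = (SOME y. y \<in> ucov S \<and> uproj S y = x)"
    have y: "y \<in> ucov S" "uproj S y = x" using someI_ex[OF fibre_nonempty[OF xp]] unfolding y_def by auto
    have s: "(\<Sum>k\<in>I. Ak k y e) = A y e" for e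
    proof -
      have "(\<Sum>k\<in>I. Ak k y e) = (\<Sum>k\<in>I. \<theta> k x) *\<^sub>R A y e + (\<Sum>k\<in>I. \<theta>' k x e) *\<^sub>R w y"
        unfolding Ak_def y(2) by (simp add: sum.distrib scaleR_sum_left)
      then show ?thesis using I(3,4) xp by simp
    qed
    obtain e1 e2 where fr: "frame (metric S (uproj S y)) = (e1, e2)" by fastforce
    have "wedge A B y = (\<Sum>k\<in>I. wedge (Ak k) B y)"
      unfolding form_wedge_def fr
      by (simp add: s[symmetric] bilinear_sum_left[OF bilinear_lor] sum_subtractf)
    then show ?thesis unfolding desc_def y_def .
  qed
  show "integrable (area S) (desc (wedge A B))"
    using key by (subst Bochner_Integration.integrable_cong[OF refl sum]) (auto intro!: Bochner_Integration.integrable_sum)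
  have "(LINT x|area S. desc (wedge A B) x) = (LINT x|area S. (\<Sum>k\<in>I. desc (wedge (Ak k) B) x))"
    by (rule Bochner_Integration.integral_cong[OF refl sum])
  also have "\<dots> = (\<Sum>k\<in>I. LINT x|area S. desc (wedge (Ak k) B) x)"
    using key by (intro Bochner_Integration.integral_sum) blast
  also have "\<dots> = 0" using key by simp
  finally show "(LINT x|area S. desc (wedge A B) x) = 0" .
qed

end

subsection \<open>Integrability of the dual energy\<close>

context riemannian_surface
begin

text \<open>Finitely many closed coordinate balls cover the surface. On each the area density is
  bounded, so a majorant integrable in coordinates controls the piece, and \<open>G\<close> is
  dominated by the sum of its pieces.\<close>

lemma integrable_area_local:
  assumes Gm: "G \<in> borel_measurable (area S)"
    and loc: "\<And>c W \<sigma> K. lifted_chart S c W \<sigma> \<Longrightarrow> compact K \<Longrightarrow> K \<subseteq> W \<Longrightarrow>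
      \<exists>H :: real^2 \<Rightarrow> real. integrable lebesgue (\<lambda>v. indicator K v * H v) \<and> (\<forall>v\<in>K. \<bar>G (snd c v)\<bar> \<le> H v)"
  shows "integrable (area S) G"
proof -
  obtain I where I: "finite I" and I1: "\<forall>c v r. (c, v, r) \<in> I \<longrightarrow> c \<in> charts S \<and> r > 0 \<and> cball v r \<subseteq> fst c \<and> 
      (\<exists>W \<sigma>. lifted_chart S c W \<sigma> \<and> cball v (2 * r) \<subseteq> W)"
    and cov: "pts S = (\<Union>(c, v, r)\<in>I. snd c ` ball v r)"
    using finite_lifted_cover by (elim exE conjE) (rule that)
  define U where "U k = (\<lambda>(c, v, r). snd c ` cball v r) k" for k :: "((real^2) set \<times> (real^2 \<Rightarrow> 'a)) \<times> (real^2) \<times> real"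
  define Gk where "Gk k x = indicator (U k) x * G x" for k x
  have key: "integrable (area S) (Gk k)" if k: "k \<in> I" for k
  proof -
    obtain c v r where ke: "k = (c, v, r)" by (rule prod_cases3)
    have "c \<in> charts S \<and> r > 0 \<and> cball v r \<subseteq> fst c \<and> (\<exists>W \<sigma>. lifted_chart S c W \<sigma> \<and> cball v (2 * r) \<subseteq> W)"
      using I1 k unfolding ke by blast
    then obtain W \<sigma> where c: "c \<in> charts S" and r: "r > 0" "cball v r \<subseteq> fst c" and L: "lifted_chart S c W \<sigma>" and W: "cball v (2 * r) \<subseteq> W"
      by (elim conjE exE) (rule that)
    let ?K = "cball v r"
    have KW: "?K \<subseteq> W" using W r(1) by (intro order_trans[OF subset_cball W]) simp
    have Uk: "U k = snd c ` ?K" by (simp add: U_def ke)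
    have Up: "U k \<subseteq> pts S" using chart_in_pts[OF c] r(2) by (auto simp: Uk)
    have "pts S - U k \<in> sets (area S)"
      unfolding Uk by (rule openin_sets_area[OF openin_minus_chart_image[OF c compact_cball r(2)]])
    from sets.compl_sets[OF this] Up have Us: "U k \<in> sets (area S)"
      by (simp add: space_area double_diff)
    have Gkm: "Gk k \<in> borel_measurable (area S)"
      unfolding Gk_def[abs_def] by (rule borel_measurable_times[OF borel_measurable_indicator[OF Us] Gm])
    have z: "Gk k x = 0" if "x \<in> pts S" "x \<notin> snd c ` fst c" for x
    proof -
      have "x \<notin> U k" using that(2) r(2) by (auto simp: Uk)
      then show ?thesis by (simp add: Gk_def)
    qed
    obtain H :: "real^2 \<Rightarrow> real" where H: "integrable lebesgue (\<lambda>v. indicator ?K v * H v)" "\<forall>v\<in>?K. \<bar>G (snd c v)\<bar> \<le> H v"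
      using loc[OF L compact_cball KW] by (elim exE conjE) (rule that)
    obtain N where N: "\<forall>v\<in>?K. \<bar>area_density S c v\<bar> \<le> N"
      using compact_imp_bounded[OF compact_continuous_image[OF continuous_on_subset[OF continuous_mc(1)[OF c] r(2)] compact_cball]]
      unfolding bounded_iff by auto
    let ?g = "\<lambda>v. indicator (fst c) v * (area_density S c v * Gk k (snd c v))"
    have dm: "(\<lambda>v. indicator (fst c) v * area_density S c v) \<in> borel_measurable lebesgue"
      using continuous_imp_measurable_on_sets_lebesgue[OF continuous_mc(1)[OF c]] chart_open[OF c]
      by (simp add: borel_measurable_restrict_space_iff mult.commute)
    have gm: "?g \<in> borel_measurable lebesgue"
    proof -
      have "(\<lambda>v. (indicator (fst c) v * area_density S c v) * (indicator (fst c) v * Gk k (snd c v))) \<in> borel_measurable lebesgue"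
        by (rule borel_measurable_times[OF dm measurable_chart[OF c Gkm]])
      moreover have "(\<lambda>v. (indicator (fst c) v * area_density S c v) * (indicator (fst c) v * Gk k (snd c v))) = ?g"
        by (auto simp: indicator_def)
      ultimately show ?thesis by simp
    qed
    have inK: "snd c x \<in> U k \<longleftrightarrow> x \<in> ?K" if x: "x \<in> fst c" for x
      unfolding Uk using inj_on_image_mem_iff[OF chart_inj[OF c] x r(2)] .
    have "integrable lebesgue ?g"
    proof (rule Bochner_Integration.integrable_bound[OF _ gm])
      show "integrable lebesgue (\<lambda>v. N * (indicator ?K v * H v))"
        by (rule integrable_mult_right[OF H(1)])
      show "AE x in lebesgue. norm (?g x) \<le> norm (N * (indicator ?K x * H x))"
      proof (intro AE_I2)
        fix x
        show "norm (?g x) \<le> norm (N * (indicator ?K x * H x))"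
        proof (cases "x \<in> ?K")
          case True
          then have "x \<in> fst c" using r(2) by auto
          have a: "\<bar>area_density S c x\<bar> \<le> N" using N True by (rule bspec)
          have b: "\<bar>G (snd c x)\<bar> \<le> H x" using H(2) True by blast
          have "\<bar>area_density S c x\<bar> * \<bar>G (snd c x)\<bar> \<le> N * H x"
            using a b abs_ge_zero[of "area_density S c x"] by (intro mult_mono) linarith+
          also have "\<dots> \<le> \<bar>N * H x\<bar>" by simp
          finally show ?thesis using True inK[OF \<open>x \<in> fst c\<close>] \<open>x \<in> fst c\<close> by (simp add: Gk_def abs_mult)
        next
          case False
          then show ?thesis using inK[of x] by (cases "x \<in> fst c") (simp_all add: Gk_def)
        qed
      qed
    qed
    then show ?thesis using chart_integral(1)[OF c Gkm z] by simp
  qed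
  show ?thesis
  proof (rule Bochner_Integration.integrable_bound[OF _ Gm])
    show "integrable (area S) (\<lambda>x. \<Sum>k\<in>I. \<bar>Gk k x\<bar>)"
      by (intro Bochner_Integration.integrable_sum integrable_abs key)
    show "AE x in area S. norm (G x) \<le> norm (\<Sum>k\<in>I. \<bar>Gk k x\<bar>)"
    proof (rule AE_I2)
      fix x assume "x \<in> space (area S)"
      then obtain k where k: "k \<in> I" "x \<in> U k"
        unfolding space_area cov U_def by fastforce
      have "\<bar>G x\<bar> = \<bar>Gk k x\<bar>" using k by (simp add: Gk_def)
      also have "\<dots> \<le> (\<Sum>k\<in>I. \<bar>Gk k x\<bar>)" using k(1) I by (intro member_le_sum) auto
      finally show "norm (G x) \<le> norm (\<Sum>k\<in>I. \<bar>Gk k x\<bar>)" by simp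
    qed
  qed
qed

text \<open>\<open>desc\<close> evaluates at an unspecified point of the fibre; invariance of
  \<open>P\<close> carries the agreement seen in lifted charts to that point, and completeness of
  Lebesgue measure gives measurability. Every passage between dw and its projection goes through
  this.\<close>

lemma desc_AE_cong:
  assumes m: "desc F' \<in> borel_measurable (area S)"
    and inv: "\<And>y \<tau>. y \<in> ucov S \<Longrightarrow> \<tau> \<in> deck S \<Longrightarrow> P y \<Longrightarrow> P (\<tau> y)"
    and loc: "\<And>c W \<sigma>. lifted_chart S c W \<sigma> \<Longrightarrow> AE v in lebesgue. v \<in> W \<longrightarrow> P (\<sigma> v)"
    and eq: "\<And>y. y \<in> ucov S \<Longrightarrow> P y \<Longrightarrow> F y = F' y"
  shows "desc F \<in> borel_measurable (area S)" "AE x in area S. desc F x = desc F' x"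
proof -
  have d: "desc F x = desc F' x" if x: "x \<in> pts S" "\<forall>y\<in>ucov S. uproj S y = x \<longrightarrow> P y" for x
    using someI_ex[OF fibre_nonempty[OF x(1)]] x(2) eq unfolding desc_def by blast
  have "AE x in area S. x \<in> pts S" using AE_space[of "area S"] by (simp add: space_area)
  moreover have "AE x in area S. \<forall>y\<in>ucov S. uproj S y = x \<longrightarrow> P y"
    by (rule AE_area) (rule inv loc; assumption)+
  ultimately show "AE x in area S. desc F x = desc F' x"
    by eventually_elim (rule d)
  show "desc F \<in> borel_measurable (area S)"
  proof (rule measurable_area_local)
    fix c v assume cv: "c \<in> charts S" "v \<in> fst c"
    obtain W \<sigma> where L: "lifted_chart S c W \<sigma>" "v \<in> W" by (rule lifted_chart_exists[OF cv])
    note D = lifted_chartD[OF L(1)]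
    have "(\<lambda>v. indicator W v * (indicator (fst c) v * desc F' (snd c v))) \<in> borel_measurable lebesgue"
      using D(2) by (intro borel_measurable_times[OF borel_measurable_indicator measurable_chart[OF D(1) m]]) simp
    moreover have "AE v in lebesgue. indicator W v * (indicator (fst c) v * desc F' (snd c v)) = indicator W v * desc F (snd c v)"
      using loc[OF L(1)]
    proof (rule AE_mp, intro AE_I2 impI)
      fix x assume P: "x \<in> W \<longrightarrow> P (\<sigma> x)"
      show "indicator W x * (indicator (fst c) x * desc F' (snd c x)) = indicator W x * desc F (snd c x)"
      proof (cases "x \<in> W")
        case True
        have "P y" if y: "y \<in> ucov S" "uproj S y = snd c x" for y
        proof -
          have "uproj S (\<sigma> x) = uproj S y" using D(7)[OF True] y(2) by simp
          then obtain \<tau> where "\<tau> \<in> deck S" "\<tau> (\<sigma> x) = y" using deck_transitive[OF D(6)[OF True] y(1)] by metis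
          then show ?thesis using inv[OF D(6)[OF True]] P True by blast
        qed
        then have "desc F (snd c x) = desc F' (snd c x)" using d chart_in_pts[OF D(1) D(5)[OF True]] by blast
        then show ?thesis using True D(5) by simp
      qed simp
    qed
    ultimately have "(\<lambda>v. indicator W v * desc F (snd c v)) \<in> borel_measurable lebesgue"
      by (rule borel_measurable_AE)
    then show "\<exists>W. open W \<and> v \<in> W \<and> W \<subseteq> fst c \<and> (\<lambda>v. indicator W v * desc F (snd c v)) \<in> borel_measurable lebesgue"
      using L(2) D(2,3) by blast
  qed
qed

end

section \<open>Growth of the dual energy in terms of the p-energy\<close>

context plane_pair
begin

lemma trace2_nonneg:
  assumes "range A \<subseteq> F" shows "0 \<le> trace2 A f1 f2"
  unfolding trace2_def using assms by (intro add_nonneg_nonneg h_nonneg) auto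

lemma h_add_le:
  assumes "x \<in> F" "y \<in> F" shows "h (x + y) (x + y) \<le> 2 * h x x + 2 * h y y"
proof -
  have "0 \<le> h (x - y) (x - y)" using assms F_subspace by (intro h_nonneg subspace_diff)
  then show ?thesis by (simp add: h_simps)
qed

lemma trace2_add_le:
  assumes "range A \<subseteq> F" "range B \<subseteq> F"
  shows "trace2 (\<lambda>v. A v + B v) f1 f2 \<le> 2 * (trace2 A f1 f2 + trace2 B f1 f2)"
  using h_add_le[of "A f1" "B f1"] h_add_le[of "A f2" "B f2"] assms
  unfolding trace2_def by (auto simp: image_subset_iff)

lemma powr_sum_le:
  fixes x y r :: real
  assumes "0 \<le> x" "0 \<le> y" "0 \<le> r" shows "(x + y) powr r \<le> 2 powr r * (x powr r + y powr r)"
proof -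
  have "(x + y) powr r \<le> (2 * max x y) powr r" using assms by (intro powr_mono2) auto
  also have "\<dots> = 2 powr r * max x y powr r" using assms by (simp add: powr_mult)
  also have "max x y powr r \<le> x powr r + y powr r" by (simp add: max_def)
  finally show ?thesis by simp
qed

lemma powr_le_one_plus:
  fixes t a b :: real assumes "0 \<le> t" "0 \<le> a" "a \<le> b" shows "t powr a \<le> 1 + t powr b"
proof (cases "t \<le> 1")
  case True
  then have "t powr a \<le> 1" using assms by (metis powr_mono2 powr_one_eq_one)
  then show ?thesis by (smt (verit) powr_ge_zero)
next
  case False
  then have "t powr a \<le> t powr b" using assms by (intro powr_mono) auto
  then show ?thesis by simp
qed

text \<open>The dual form grows like the power p - 1 of \<open>A\<close>, and (p - 1) q = p, so its
  contribution is of order p in \<open>A\<close>; the term of \<open>B\<close> has order q \<le> p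
  and is raised to order p at the cost of the constant 1.\<close>

lemma TrQ_dual_add_le:
  assumes A: "linear A" "range A \<subseteq> F" and B: "linear B" "range B \<subseteq> F" and f: "oriented_frame g (f1, f2)"
    and pq: "p > 1" "q > 0" "(p - 1) * q = p" "q \<le> p"
  shows "TrQ q (\<lambda>v. dual_form (p - 1) A v + B v) \<le>
    2 * 2 powr (q / 2) * (4 powr (q / 2) * trace2 A f1 f2 powr (p / 2) + 2 powr (q / 2) * (1 + trace2 B f1 f2 powr (p / 2)))"
proof -
  let ?Z = "dual_form (p - 1) A"
  obtain b1 b2 where b: "diag_frame A b1 b2" by (rule diag_frame_exists[OF A])
  note Z = dual_form_properties(1,2)[OF A b, of "p - 1"]
  have tB: "0 \<le> trace2 B f1 f2" by (rule trace2_nonneg[OF B(2)])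
  have ZB: "linear (\<lambda>v. ?Z v + B v)" "range (\<lambda>v. ?Z v + B v) \<subseteq> F"
    using Z B F_subspace by (auto intro!: linear_compose_add subspace_add)
  have "trace2 (\<lambda>v. ?Z v + B v) f1 f2 \<le> 4 * trace2 A f1 f2 powr (p - 1) + 2 * trace2 B f1 f2"
    using trace2_add_le[OF Z(2) B(2), of f1 f2] dual_form_trace2(2)[OF A f, of "p - 1"] pq(1) by simp
  then have "trace2 (\<lambda>v. ?Z v + B v) f1 f2 powr (q / 2) \<le> (4 * trace2 A f1 f2 powr (p - 1) + 2 * trace2 B f1 f2) powr (q / 2)"
    using trace2_nonneg[OF ZB(2)] pq(2) by (intro powr_mono2) auto
  also have "\<dots> \<le> 2 powr (q / 2) * ((4 * trace2 A f1 f2 powr (p - 1)) powr (q / 2) + (2 * trace2 B f1 f2) powr (q / 2))"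
    using tB pq(2) by (intro powr_sum_le) auto
  also have "(4 * trace2 A f1 f2 powr (p - 1)) powr (q / 2) = 4 powr (q / 2) * trace2 A f1 f2 powr (p / 2)"
  proof -
    have "(p - 1) * (q / 2) = p / 2" using pq(3) by simp
    then show ?thesis by (simp add: powr_mult powr_powr)
  qed
  also have "(2 * trace2 B f1 f2) powr (q / 2) = 2 powr (q / 2) * trace2 B f1 f2 powr (q / 2)"
    using tB by (simp add: powr_mult)
  also have "2 powr (q / 2) * (4 powr (q / 2) * trace2 A f1 f2 powr (p / 2) + 2 powr (q / 2) * trace2 B f1 f2 powr (q / 2))
     \<le> 2 powr (q / 2) * (4 powr (q / 2) * trace2 A f1 f2 powr (p / 2) + 2 powr (q / 2) * (1 + trace2 B f1 f2 powr (p / 2)))"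
    using powr_le_one_plus[OF tB, of "q / 2" "p / 2"] pq by (intro mult_left_mono add_left_mono) auto
  finally have "2 * trace2 (\<lambda>v. ?Z v + B v) f1 f2 powr (q / 2) \<le> 2 * (2 powr (q / 2) * (4 powr (q / 2) * trace2 A f1 f2 powr (p / 2) + 2 powr (q / 2) * (1 + trace2 B f1 f2 powr (p / 2))))"
    by (rule mult_left_mono) simp
  with TrQ_bounds(2)[OF ZB f pq(2)] show ?thesis by (simp add: mult.assoc)
qed

end

section \<open>Measurable tangential forms\<close>

context hyperbolic_lift
begin

text \<open>Tangential at every point, with components measurable in the Gram-Schmidt frame of each
  chart. Integrability is left out, so that the class is stable under the nonlinear map that sends a
  form to the star of its power.\<close>

definition tangent_form :: "('b \<Rightarrow> real^2 \<Rightarrow> 'm mink) \<Rightarrow> bool" where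
  "tangent_form \<alpha> \<longleftrightarrow> E_form S \<rho> \<alpha> \<and> (\<forall>y\<in>ucov S. range (\<alpha> y) \<subseteq> tan_space (w y)) \<and>
     (\<forall>c W \<sigma> K i. lifted_chart S c W \<sigma> \<longrightarrow> compact K \<longrightarrow> K \<subseteq> W \<longrightarrow>
       (\<lambda>v. \<alpha> (\<sigma> v) (fr1 c v) $ i) \<in> borel_measurable (lebesgue_on K) \<and>
       (\<lambda>v. \<alpha> (\<sigma> v) (fr2 c v) $ i) \<in> borel_measurable (lebesgue_on K))"

lemma tangent_formD:
  assumes "tangent_form \<alpha>"
  shows "E_form S \<rho> \<alpha>" "y \<in> ucov S \<Longrightarrow> linear (\<alpha> y)" "y \<in> ucov S \<Longrightarrow> range (\<alpha> y) \<subseteq> tan_space (w y)"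
    "lifted_chart S c W \<sigma> \<Longrightarrow> compact K \<Longrightarrow> K \<subseteq> W \<Longrightarrow> (\<lambda>v. \<alpha> (\<sigma> v) (fr1 c v) $ i) \<in> borel_measurable (lebesgue_on K)"
    "lifted_chart S c W \<sigma> \<Longrightarrow> compact K \<Longrightarrow> K \<subseteq> W \<Longrightarrow> (\<lambda>v. \<alpha> (\<sigma> v) (fr2 c v) $ i) \<in> borel_measurable (lebesgue_on K)"
proof -
  show 1: "E_form S \<rho> \<alpha>" using assms unfolding tangent_form_def by (elim conjE)
  show "linear (\<alpha> y)" if "y \<in> ucov S" by (rule E_form_linear[OF 1 that])
  have 2: "\<forall>y\<in>ucov S. range (\<alpha> y) \<subseteq> tan_space (w y)" using assms unfolding tangent_form_def by (elim conjE)
  show "range (\<alpha> y) \<subseteq> tan_space (w y)" if "y \<in> ucov S" by (rule bspec[OF 2 that])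
  have 3: "\<forall>c W \<sigma> K i. lifted_chart S c W \<sigma> \<longrightarrow> compact K \<longrightarrow> K \<subseteq> W \<longrightarrow>
       (\<lambda>v. \<alpha> (\<sigma> v) (fr1 c v) $ i) \<in> borel_measurable (lebesgue_on K) \<and>
       (\<lambda>v. \<alpha> (\<sigma> v) (fr2 c v) $ i) \<in> borel_measurable (lebesgue_on K)"
    using assms unfolding tangent_form_def by (elim conjE)
  show "(\<lambda>v. \<alpha> (\<sigma> v) (fr1 c v) $ i) \<in> borel_measurable (lebesgue_on K)"
    if "lifted_chart S c W \<sigma>" "compact K" "K \<subseteq> W"
    by (rule conjunct1[OF 3[rule_format, OF that]])
  show "(\<lambda>v. \<alpha> (\<sigma> v) (fr2 c v) $ i) \<in> borel_measurable (lebesgue_on K)"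
    if "lifted_chart S c W \<sigma>" "compact K" "K \<subseteq> W"
    by (rule conjunct2[OF 3[rule_format, OF that]])
qed

lemma plane_pair_at: "y \<in> ucov S \<Longrightarrow> plane_pair (metric S (uproj S y)) lor (tan_space (w y))"
  by (intro plane_pair_tan_space inner_product_metric uproj_in_pts w_hyp)

lemma frame_at: "y \<in> ucov S \<Longrightarrow> \<exists>f1 f2. oriented_frame (metric S (uproj S y)) (f1, f2)"
proof -
  assume "y \<in> ucov S"
  then interpret plane "metric S (uproj S y)" by (intro plane_metric uproj_in_pts)
  show ?thesis using oriented_frame_frame by (metis surj_pair)
qed

lemma measurable_lor:
  assumes "\<And>i. (\<lambda>v. X v $ i) \<in> borel_measurable M" "\<And>i. (\<lambda>v. Y v $ i) \<in> borel_measurable M"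
  shows "(\<lambda>v. lor (X v :: 'm mink) (Y v)) \<in> borel_measurable M"
  unfolding lor_sum by (intro borel_measurable_sum borel_measurable_times borel_measurable_const assms)

lemma tangent_form_add:
  assumes A: "tangent_form \<alpha>" and B: "tangent_form \<beta>"
  shows "tangent_form (\<lambda>y v. \<alpha> y v + \<beta> y v)"
  unfolding tangent_form_def
proof (intro conjI ballI allI impI)
  show "E_form S \<rho> (\<lambda>y v. \<alpha> y v + \<beta> y v)"
    using tangent_formD(1)[OF A] tangent_formD(1)[OF B] unfolding E_form_def
    by (auto intro!: linear_compose_add simp: matrix_vector_right_distrib)
  fix y assume y: "y \<in> ucov S"
  interpret plane_pair "metric S (uproj S y)" lor "tan_space (w y)" by (rule plane_pair_at[OF y])
  show "range (\<lambda>v. \<alpha> y v + \<beta> y v) \<subseteq> tan_space (w y)"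
    using tangent_formD(3)[OF A y] tangent_formD(3)[OF B y] F_subspace by (auto intro: subspace_add)
qed (use tangent_formD(4,5)[OF A] tangent_formD(4,5)[OF B] in \<open>simp_all\<close>)

lemma Qpow_at:
  assumes A: "tangent_form \<alpha>" and y: "y \<in> ucov S" and f: "oriented_frame (metric S (uproj S y)) (f1, f2)"
  defines "t \<equiv> lor (\<alpha> y f1) (\<alpha> y f1) + lor (\<alpha> y f2) (\<alpha> y f2)"
    and "d \<equiv> lor (\<alpha> y f1) (\<alpha> y f1) * lor (\<alpha> y f2) (\<alpha> y f2) - (lor (\<alpha> y f1) (\<alpha> y f2))\<^sup>2"
  shows "S_form S w r \<alpha> y v = interp0 ((r - 1) / 2) t d *\<^sub>R \<alpha> y v +
     interp1 ((r - 1) / 2) t d *\<^sub>R (lor (\<alpha> y f1) (\<alpha> y v) *\<^sub>R \<alpha> y f1 + lor (\<alpha> y f2) (\<alpha> y v) *\<^sub>R \<alpha> y f2)"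
proof -
  interpret plane_pair "metric S (uproj S y)" lor "tan_space (w y)" by (rule plane_pair_at[OF y])
  show ?thesis
    unfolding S_form_def t_def d_def
    by (rule Qpow_frame[OF tangent_formD(2,3)[OF A y] f, unfolded trace2_def gram2_def])
qed

lemma TrQ_at:
  assumes A: "tangent_form \<alpha>" and y: "y \<in> ucov S" and f: "oriented_frame (metric S (uproj S y)) (f1, f2)"
  defines "t \<equiv> lor (\<alpha> y f1) (\<alpha> y f1) + lor (\<alpha> y f2) (\<alpha> y f2)"
    and "d \<equiv> lor (\<alpha> y f1) (\<alpha> y f1) * lor (\<alpha> y f2) (\<alpha> y f2) - (lor (\<alpha> y f1) (\<alpha> y f2))\<^sup>2"
  shows "Tr_Q S w r \<alpha> y = ev1 t d powr (r / 2) + ev2 t d powr (r / 2)"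
proof -
  interpret plane_pair "metric S (uproj S y)" lor "tan_space (w y)" by (rule plane_pair_at[OF y])
  show ?thesis
    unfolding Tr_Q_def Let_def t_def d_def
    by (rule TrQ_frame[OF tangent_formD(2,3)[OF A y] f, unfolded trace2_def gram2_def])
qed

text \<open>The metrics at y and \<tau> y coincide, so the same frame serves at both points; \<rho>
  \<tau> preserves the Lorentz form, and the trace depends on \<alpha> through Lorentz products
  only.\<close>

lemma TrQ_deck:
  assumes A: "tangent_form \<alpha>" and y: "y \<in> ucov S" and \<tau>: "\<tau> \<in> deck S"
  shows "Tr_Q S w r \<alpha> (\<tau> y) = Tr_Q S w r \<alpha> y"
proof -
  obtain f1 f2 where f: "oriented_frame (metric S (uproj S y)) (f1, f2)" using frame_at[OF y] by (elim exE) (rule that)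
  have ty: "\<tau> y \<in> ucov S" using deck_ucov[OF \<tau> y] by blast
  have f': "oriented_frame (metric S (uproj S (\<tau> y))) (f1, f2)" unfolding deck_eq[OF \<tau> y] by (rule f)
  show ?thesis
    unfolding TrQ_at[OF A y f] TrQ_at[OF A ty f'] E_form_deck[OF tangent_formD(1)[OF A] \<tau> y] \<rho>_lor[OF \<tau>] ..
qed

lemma S_form_deck:
  assumes A: "tangent_form \<alpha>" and y: "y \<in> ucov S" and \<tau>: "\<tau> \<in> deck S"
  shows "S_form S w r \<alpha> (\<tau> y) v = \<rho> \<tau> *v S_form S w r \<alpha> y v"
proof -
  obtain f1 f2 where f: "oriented_frame (metric S (uproj S y)) (f1, f2)" using frame_at[OF y] by (elim exE) (rule that)
  have ty: "\<tau> y \<in> ucov S" using deck_ucov[OF \<tau> y] by blast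
  have f': "oriented_frame (metric S (uproj S (\<tau> y))) (f1, f2)" unfolding deck_eq[OF \<tau> y] by (rule f)
  show ?thesis
    unfolding Qpow_at[OF A y f] Qpow_at[OF A ty f'] E_form_deck[OF tangent_formD(1)[OF A] \<tau> y] \<rho>_lor[OF \<tau>]
    by (simp only: matrix_vector_right_distrib matrix_vector_mult_scaleR)
qed

lemma star_S_form_at:
  assumes A: "tangent_form \<alpha>" and y: "y \<in> ucov S"
  shows "linear (star S (S_form S w r \<alpha>) y)" "range (star S (S_form S w r \<alpha>) y) \<subseteq> tan_space (w y)"
    "oriented_frame (metric S (uproj S y)) (f1, f2) \<Longrightarrow> star S (S_form S w r \<alpha>) y f1 = - S_form S w r \<alpha> y f2"
    "oriented_frame (metric S (uproj S y)) (f1, f2) \<Longrightarrow> star S (S_form S w r \<alpha>) y f2 = S_form S w r \<alpha> y f1"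
proof -
  interpret plane_pair "metric S (uproj S y)" lor "tan_space (w y)" by (rule plane_pair_at[OF y])
  note L = tangent_formD(2,3)[OF A y]
  obtain b1 b2 where b: "diag_frame (\<alpha> y) b1 b2" by (rule diag_frame_exists[OF L])
  have eq: "star S (S_form S w r \<alpha>) y = dual_form r (\<alpha> y)"
    by (simp add: star_def S_form_def dual_form_def[abs_def])
  show "linear (star S (S_form S w r \<alpha>) y)" "range (star S (S_form S w r \<alpha>) y) \<subseteq> tan_space (w y)"
    unfolding eq by (rule dual_form_properties[OF L b])+
  have lin: "linear (S_form S w r \<alpha> y)"
    unfolding S_form_def by (rule Qpow_properties(3)[OF L b])
  show "oriented_frame (metric S (uproj S y)) (f1, f2) \<Longrightarrow> star S (S_form S w r \<alpha>) y f1 = - S_form S w r \<alpha> y f2"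
    "oriented_frame (metric S (uproj S y)) (f1, f2) \<Longrightarrow> star S (S_form S w r \<alpha>) y f2 = S_form S w r \<alpha> y f1"
    unfolding star_def by (rule hodge_frame_values[OF lin]; assumption)+
qed

lemma measurable_interp:
  assumes [measurable]: "T \<in> borel_measurable M" "D \<in> borel_measurable M"
  shows "(\<lambda>v. ev1 (T v) (D v) powr r) \<in> borel_measurable M" "(\<lambda>v. ev2 (T v) (D v) powr r) \<in> borel_measurable M"
    "(\<lambda>v. interp0 r (T v) (D v)) \<in> borel_measurable M" "(\<lambda>v. interp1 r (T v) (D v)) \<in> borel_measurable M"
  unfolding ev1_def ev2_def interp0_def interp1_def by measurable

text \<open>In the chart frame the star exchanges the two values up to sign, and the power is given
  by interpolation, so the new components are Borel expressions in the components of \<alpha> and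
  their Lorentz products.\<close>

lemma tangent_form_star_S_form:
  assumes A: "tangent_form \<alpha>"
  shows "tangent_form (star S (S_form S w r \<alpha>))"
  unfolding tangent_form_def
proof (intro conjI ballI allI impI)
  show "E_form S \<rho> (star S (S_form S w r \<alpha>))"
    unfolding E_form_def
  proof (intro conjI ballI allI)
    fix \<tau> y v assume \<tau>: "\<tau> \<in> deck S" and y: "y \<in> ucov S"
    show "star S (S_form S w r \<alpha>) (\<tau> y) v = \<rho> \<tau> *v star S (S_form S w r \<alpha>) y v"
      unfolding star_def hodge_def deck_eq[OF \<tau> y] S_form_deck[OF A y \<tau>]
      by (simp add: matrix_vector_mult_diff_distrib matrix_vector_mult_scaleR split: prod.split)
  qed (rule star_S_form_at[OF A])
  fix c W \<sigma> K i assume L: "lifted_chart S c W \<sigma>" and K: "compact K" "K \<subseteq> W"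
  note D = lifted_chartD[OF L]
  have f: "oriented_frame (metric S (uproj S (\<sigma> v))) (fr1 c v, fr2 c v)" if "v \<in> K" for v
    using chart_frame(3)[OF D(1) D(5)] D(7) K(2) that by (metis subsetD)
  have u: "\<sigma> v \<in> ucov S" if "v \<in> K" for v using D(6) K(2) that by blast
  note m = tangent_formD(4,5)[OF A L K]
  define X1 where "X1 v = \<alpha> (\<sigma> v) (fr1 c v)" for v
  define X2 where "X2 v = \<alpha> (\<sigma> v) (fr2 c v)" for v
  define t where "t v = lor (X1 v) (X1 v) + lor (X2 v) (X2 v)" for v
  define d where "d v = lor (X1 v) (X1 v) * lor (X2 v) (X2 v) - (lor (X1 v) (X2 v))\<^sup>2" for v
  define P where "P v X = interp0 ((r - 1) / 2) (t v) (d v) *\<^sub>R X +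
     interp1 ((r - 1) / 2) (t v) (d v) *\<^sub>R (lor (X1 v) X *\<^sub>R X1 v + lor (X2 v) X *\<^sub>R X2 v)" for v X
  have m: "(\<lambda>v. X1 v $ i) \<in> borel_measurable (lebesgue_on K)" "(\<lambda>v. X2 v $ i) \<in> borel_measurable (lebesgue_on K)" for i
    unfolding X1_def X2_def by (rule tangent_formD(4,5)[OF A L K])+
  have Pm: "(\<lambda>v. P v (X v) $ i) \<in> borel_measurable (lebesgue_on K)"
    if X: "\<And>i. (\<lambda>v. X v $ i) \<in> borel_measurable (lebesgue_on K)" for X i
    unfolding P_def t_def d_def vector_add_component vector_scaleR_component real_scaleR_def
    by (intro borel_measurable_add borel_measurable_times borel_measurable_diff borel_measurable_power measurable_interp measurable_lor m X)
  have eq: "star S (S_form S w r \<alpha>) (\<sigma> v) (fr1 c v) = - P v (X2 v)"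
    "star S (S_form S w r \<alpha>) (\<sigma> v) (fr2 c v) = P v (X1 v)" if v: "v \<in> K" for v
    unfolding star_S_form_at(3,4)[OF A u[OF v] f[OF v]] Qpow_at[OF A u[OF v] f[OF v]] P_def t_def d_def X1_def X2_def by simp_all
  have "(\<lambda>v. - (P v (X2 v) $ i)) \<in> borel_measurable (lebesgue_on K)"
    by (rule borel_measurable_uminus[OF Pm[OF m(2)]])
  moreover have "- (P v (X2 v) $ i) = star S (S_form S w r \<alpha>) (\<sigma> v) (fr1 c v) $ i" if "v \<in> space (lebesgue_on K)" for v
    using eq(1)[of v] that by simp
  ultimately show "(\<lambda>v. star S (S_form S w r \<alpha>) (\<sigma> v) (fr1 c v) $ i) \<in> borel_measurable (lebesgue_on K)"
    by (subst (asm) measurable_cong)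
  have "P v (X1 v) $ i = star S (S_form S w r \<alpha>) (\<sigma> v) (fr2 c v) $ i" if "v \<in> space (lebesgue_on K)" for v
    using eq(2)[of v] that by simp
  then show "(\<lambda>v. star S (S_form S w r \<alpha>) (\<sigma> v) (fr2 c v) $ i) \<in> borel_measurable (lebesgue_on K)"
    using Pm[OF m(1), of i] by (subst (asm) measurable_cong)
qed (rule star_S_form_at[OF A])

text \<open>The trace is a Borel function of Lorentz products of the frame values; these are
  measurable on compact sets, hence on a small ball around each point.\<close>

lemma measurable_desc_TrQ:
  assumes A: "tangent_form \<alpha>"
  shows "desc (Tr_Q S w r \<alpha>) \<in> borel_measurable (area S)"
proof (rule measurable_area_lebesgue_on)
  fix c v assume cv: "c \<in> charts S" "v \<in> fst c"
  obtain W \<sigma> where L: "lifted_chart S c W \<sigma>" "v \<in> W" by (rule lifted_chart_exists[OF cv])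
  note D = lifted_chartD[OF L(1)]
  obtain e where e: "e > 0" "cball v e \<subseteq> W" using L(2) D(2) unfolding open_contains_cball by auto
  have BW: "ball v e \<subseteq> W" using e(2) ball_subset_cball by (rule order_trans[rotated])
  define X1 where "X1 x = \<alpha> (\<sigma> x) (fr1 c x)" for x
  define X2 where "X2 x = \<alpha> (\<sigma> x) (fr2 c x)" for x
  define t where "t x = lor (X1 x) (X1 x) + lor (X2 x) (X2 x)" for x
  define d where "d x = lor (X1 x) (X1 x) * lor (X2 x) (X2 x) - (lor (X1 x) (X2 x))\<^sup>2" for x
  define E where "E x = ev1 (t x) (d x) powr (r / 2) + ev2 (t x) (d x) powr (r / 2)" for x
  have m: "(\<lambda>v. X1 v $ i) \<in> borel_measurable (lebesgue_on (cball v e))" "(\<lambda>v. X2 v $ i) \<in> borel_measurable (lebesgue_on (cball v e))" for i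
    unfolding X1_def X2_def by (rule tangent_formD(4,5)[OF A L(1) compact_cball e(2)])+
  have "E \<in> borel_measurable (lebesgue_on (cball v e))"
    unfolding E_def[abs_def] t_def d_def
    by (intro borel_measurable_add borel_measurable_times borel_measurable_diff borel_measurable_power measurable_interp measurable_lor m)
  then have "E \<in> borel_measurable (lebesgue_on (ball v e))"
    using ball_subset_cball measurable_restrict_mono by blast
  moreover have "desc (Tr_Q S w r \<alpha>) (snd c x) = E x" if x: "x \<in> W" for x
  proof -
    have f: "oriented_frame (metric S (uproj S (\<sigma> x))) (fr1 c x, fr2 c x)"
      unfolding D(7)[OF x] by (rule chart_frame(3)[OF D(1) D(5)[OF x]])
    have "desc (Tr_Q S w r \<alpha>) (uproj S (\<sigma> x)) = Tr_Q S w r \<alpha> (\<sigma> x)"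
      by (rule desc_eq[OF D(6)[OF x]], rule TrQ_deck[OF A D(6)[OF x]])
    then show ?thesis unfolding D(7)[OF x] TrQ_at[OF A D(6)[OF x] f] E_def t_def d_def X1_def X2_def .
  qed
  ultimately show "\<exists>W E. open W \<and> v \<in> W \<and> W \<subseteq> fst c \<and> E \<in> borel_measurable (lebesgue_on W) \<and>
      (AE x in lebesgue. x \<in> W \<longrightarrow> desc (Tr_Q S w r \<alpha>) (snd c x) = E x)"
    using order_trans[OF BW D(3)] BW e(1) by (intro exI[of _ "ball v e"] exI[of _ E]) (auto intro!: AE_I2)
qed

end

context hyperbolic_lift
begin

abbreviation proj_form :: "('b \<Rightarrow> real^2 \<Rightarrow> 'm mink) \<Rightarrow> 'b \<Rightarrow> real^2 \<Rightarrow> 'm mink" where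
  "proj_form \<alpha> \<equiv> \<lambda>y v. tan_proj (w y) (\<alpha> y v)"

lemma frame_values:
  assumes "E_form S \<rho> \<alpha>" "lifted_chart S c W \<sigma>" "v \<in> W"
  shows "\<alpha> (\<sigma> v) (fr1 c v) = mc1 c v *\<^sub>R \<alpha> (\<sigma> v) (dpar S c v ex)"
    "\<alpha> (\<sigma> v) (fr2 c v) = mc2 c v *\<^sub>R \<alpha> (\<sigma> v) (dpar S c v ex) + mc3 c v *\<^sub>R \<alpha> (\<sigma> v) (dpar S c v ey)"
  using E_form_linear[OF assms(1) lifted_chartD(6)[OF assms(2,3)]]
  by (simp_all add: fr1_def fr2_def linear_add linear_cmul)

text \<open>Projection makes the form tangential at every point, as the pointwise calculus of
  singular values requires, since the Lorentz form is positive on tangent spaces only.\<close>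

lemma tangent_form_proj:
  assumes A: "sobolev_form p \<xi> A"
  shows "tangent_form (proj_form A)"
  unfolding tangent_form_def
proof (intro conjI ballI allI impI)
  note EA = sobolev_formD(1)[OF A]
  show "E_form S \<rho> (proj_form A)"
    unfolding E_form_def
  proof (intro conjI ballI allI)
    fix y assume y: "y \<in> ucov S"
    show "linear (proj_form A y)"
      using linear_compose[OF E_form_linear[OF EA y] linear_tan_proj] by (simp add: o_def)
  next
    fix \<tau> y v assume \<tau>: "\<tau> \<in> deck S" and y: "y \<in> ucov S"
    show "proj_form A (\<tau> y) v = \<rho> \<tau> *v proj_form A y v"
      unfolding tan_proj_def E_form_deck[OF EA \<tau> y] w_deck[OF \<tau> y] \<rho>_lor[OF \<tau>]
      by (simp only: matrix_vector_right_distrib matrix_vector_mult_scaleR)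
  qed
  fix c W \<sigma> K i assume L: "lifted_chart S c W \<sigma>" and K: "compact K" "K \<subseteq> W"
  note D = lifted_chartD[OF L]
  have Ks: "K \<in> sets lebesgue" using K(1) by (intro lmeasurable_compact[THEN fmeasurableD])
  have Kc: "K \<subseteq> fst c" using K(2) D(3) by (rule order_trans)
  have a: "(\<lambda>v. A (\<sigma> v) (dpar S c v e) $ i) \<in> borel_measurable (lebesgue_on K)" for e i
    by (rule sobolev_form_measurable_on[OF A L K order_refl Ks])
  have m: "mc1 c \<in> borel_measurable (lebesgue_on K)" "mc2 c \<in> borel_measurable (lebesgue_on K)" "mc3 c \<in> borel_measurable (lebesgue_on K)"
    by (rule continuous_measurable_on[OF continuous_mc(2)[OF D(1)] Kc Ks] continuous_measurable_on[OF continuous_mc(3)[OF D(1)] Kc Ks]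
        continuous_measurable_on[OF continuous_mc(4)[OF D(1)] Kc Ks])+
  have wm: "(\<lambda>v. w (\<sigma> v) $ i) \<in> borel_measurable (lebesgue_on K)" for i
    by (rule continuous_measurable_on[OF _ K(2) Ks]) (intro continuous_intros w_lifted_continuous[OF L])
  have pm: "(\<lambda>v. tan_proj (w (\<sigma> v)) (X v) $ i) \<in> borel_measurable (lebesgue_on K)"
    if X: "\<And>i. (\<lambda>v. X v $ i) \<in> borel_measurable (lebesgue_on K)" for X i
    unfolding tan_proj_def vector_add_component vector_scaleR_component real_scaleR_def
    by (intro borel_measurable_add borel_measurable_times measurable_lor X wm)
  have x1: "(\<lambda>v. A (\<sigma> v) (fr1 c v) $ i) \<in> borel_measurable (lebesgue_on K)" for i
  proof -
    have "(\<lambda>v. mc1 c v * A (\<sigma> v) (dpar S c v ex) $ i) \<in> borel_measurable (lebesgue_on K)"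
      by (intro borel_measurable_times m a)
    moreover have "mc1 c v * A (\<sigma> v) (dpar S c v ex) $ i = A (\<sigma> v) (fr1 c v) $ i" if "v \<in> space (lebesgue_on K)" for v
      using frame_values(1)[OF EA L, of v] that K(2) by auto
    ultimately show ?thesis by (subst (asm) measurable_cong)
  qed
  have x2: "(\<lambda>v. A (\<sigma> v) (fr2 c v) $ i) \<in> borel_measurable (lebesgue_on K)" for i
  proof -
    have "(\<lambda>v. mc2 c v * A (\<sigma> v) (dpar S c v ex) $ i + mc3 c v * A (\<sigma> v) (dpar S c v ey) $ i) \<in> borel_measurable (lebesgue_on K)"
      by (intro borel_measurable_add borel_measurable_times m a)
    moreover have "mc2 c v * A (\<sigma> v) (dpar S c v ex) $ i + mc3 c v * A (\<sigma> v) (dpar S c v ey) $ i = A (\<sigma> v) (fr2 c v) $ i" if "v \<in> space (lebesgue_on K)" for v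
      using frame_values(2)[OF EA L, of v] that K(2) by auto
    ultimately show ?thesis by (subst (asm) measurable_cong)
  qed
  show "(\<lambda>v. proj_form A (\<sigma> v) (fr1 c v) $ i) \<in> borel_measurable (lebesgue_on K)"
    by (rule pm[OF x1])
  show "(\<lambda>v. proj_form A (\<sigma> v) (fr2 c v) $ i) \<in> borel_measurable (lebesgue_on K)"
    by (rule pm[OF x2])
qed (use tan_proj_in_tan_space[OF w_hyp] in auto)

lemma lor_bound: "\<exists>N>0. \<forall>X Y :: 'm mink. \<bar>lor X Y\<bar> \<le> N * (norm X * norm Y)"
proof -
  have "bounded_bilinear (lor :: 'm mink \<Rightarrow> _)" using bilinear_lor by (simp add: bilinear_conv_bounded_bilinear)
  from bounded_bilinear.pos_bounded[OF this] show ?thesis by (auto simp: mult_ac)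
qed

lemma lor_tan_proj_square: "W \<in> hyp \<Longrightarrow> lor (tan_proj W X) (tan_proj W X) = lor X X + (lor X W)\<^sup>2"
  by (simp add: tan_proj_def lor_simps hyp_def lor_sym[of W X] power2_eq_square)

lemma bounded_on_compact:
  fixes f :: "real^2 \<Rightarrow> 'c::real_normed_vector"
  assumes "continuous_on W f" "compact K" "K \<subseteq> W" shows "\<exists>M\<ge>0. \<forall>v\<in>K. norm (f v) \<le> M"
proof -
  have "bounded (f ` K)" using assms by (intro compact_imp_bounded compact_continuous_image continuous_on_subset[of W f K])
  then obtain M where "\<forall>x\<in>f ` K. norm x \<le> M" unfolding bounded_iff ..
  then show ?thesis by (intro exI[of _ "max M 0"]) (auto simp: le_max_iff_disj)
qed

abbreviation trace_at :: "('b \<Rightarrow> real^2 \<Rightarrow> 'm mink) \<Rightarrow> (real^2) set \<times> (real^2 \<Rightarrow> 'a) \<Rightarrow> (real^2 \<Rightarrow> 'b) \<Rightarrow> real^2 \<Rightarrow> real" where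
  "trace_at \<alpha> c \<sigma> v \<equiv> lor (\<alpha> (\<sigma> v) (fr1 c v)) (\<alpha> (\<sigma> v) (fr1 c v)) + lor (\<alpha> (\<sigma> v) (fr2 c v)) (\<alpha> (\<sigma> v) (fr2 c v))"

text \<open>The Lorentz form is bounded by a multiple of the product of norms, and on a compact set
  \<open>w\<close> and the frame coefficients are bounded; so the trace is at most a constant times
  the square of the size of the coordinate components, and local p-integrability controls its power
  p/2.\<close>

lemma trace_powr_integrable:
  assumes A: "sobolev_form p \<xi> A" and p: "p > 0" and L: "lifted_chart S c W \<sigma>" and K: "compact K" "K \<subseteq> W"
  shows "integrable lebesgue (\<lambda>v. indicator K v * trace_at (proj_form A) c \<sigma> v powr (p / 2))"
proof -
  note D = lifted_chartD[OF L] and EA = sobolev_formD(1)[OF A]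
  have Ks: "K \<in> sets lebesgue" using K(1) by (intro lmeasurable_compact[THEN fmeasurableD])
  have Kc: "K \<subseteq> fst c" using K(2) D(3) by (rule order_trans)
  define X1 where "X1 v = A (\<sigma> v) (dpar S c v ex)" for v
  define X2 where "X2 v = A (\<sigma> v) (dpar S c v ey)" for v
  obtain N where N: "N > 0" "\<forall>X Y :: 'm mink. \<bar>lor X Y\<bar> \<le> N * (norm X * norm Y)" using lor_bound by (elim exE conjE) (rule that)
  obtain M where M: "M \<ge> 0" "\<forall>v\<in>K. norm (w (\<sigma> v)) \<le> M"
    using bounded_on_compact[OF w_lifted_continuous[OF L] K] by (elim exE conjE) (rule that)
  obtain m1 where m1: "m1 \<ge> 0" "\<forall>v\<in>K. norm (mc1 c v) \<le> m1"
    using bounded_on_compact[OF continuous_mc(2)[OF D(1)] K(1) Kc] by (elim exE conjE) (rule that)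
  obtain m2 where m2: "m2 \<ge> 0" "\<forall>v\<in>K. norm (mc2 c v) \<le> m2"
    using bounded_on_compact[OF continuous_mc(3)[OF D(1)] K(1) Kc] by (elim exE conjE) (rule that)
  obtain m3 where m3: "m3 \<ge> 0" "\<forall>v\<in>K. norm (mc3 c v) \<le> m3"
    using bounded_on_compact[OF continuous_mc(4)[OF D(1)] K(1) Kc] by (elim exE conjE) (rule that)
  define m where "m = m1 + m2 + m3"
  define C where "C = 2 * (N + N\<^sup>2 * M\<^sup>2) * m\<^sup>2"
  have C0: "C \<ge> 0" unfolding C_def using N(1) by (intro mult_nonneg_nonneg add_nonneg_nonneg) auto
  have tp: "lor (tan_proj (w (\<sigma> v)) X) (tan_proj (w (\<sigma> v)) X) \<le> (N + N\<^sup>2 * M\<^sup>2) * (norm X)\<^sup>2" if v: "v \<in> K" for v X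
  proof -
    have h: "w (\<sigma> v) \<in> hyp" using w_hyp D(6) K(2) v by blast
    have 1: "lor X X \<le> N * (norm X)\<^sup>2" using spec[OF spec[OF N(2), of X], of X] by (simp add: power2_eq_square)
    have "\<bar>lor X (w (\<sigma> v))\<bar> \<le> N * (norm X * norm (w (\<sigma> v)))" using N(2) by blast
    also have "\<dots> \<le> N * (norm X * M)" using M(2) v N(1) by (intro mult_left_mono) auto
    finally have "\<bar>lor X (w (\<sigma> v))\<bar>\<^sup>2 \<le> (N * (norm X * M))\<^sup>2" by (intro power_mono) auto
    then have "(lor X (w (\<sigma> v)))\<^sup>2 \<le> N\<^sup>2 * M\<^sup>2 * (norm X)\<^sup>2" by (simp add: power_mult_distrib mult_ac)
    with 1 show ?thesis unfolding lor_tan_proj_square[OF h] by (simp add: distrib_right)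
  qed
  have bound: "trace_at (proj_form A) c \<sigma> v powr (p / 2) \<le> C powr (p / 2) * (2 powr p * (norm (X1 v) powr p + norm (X2 v) powr p))" if v: "v \<in> K" for v
  proof -
    have vW: "v \<in> W" using v K(2) by blast
    interpret plane_pair "metric S (uproj S (\<sigma> v))" lor "tan_space (w (\<sigma> v))" by (rule plane_pair_at[OF D(6)[OF vW]])
    define s where "s = norm (X1 v) + norm (X2 v)"
    define s' where "s' = max (norm (X1 v)) (norm (X2 v))"
    have mm: "\<bar>mc1 c v\<bar> \<le> m" "\<bar>mc2 c v\<bar> \<le> m2" "\<bar>mc3 c v\<bar> \<le> m3" "m2 \<le> m" "m3 \<le> m" "m \<ge> 0"
      using m1 m2 m3 v unfolding m_def by (auto intro: order_trans)
    have f1: "norm (A (\<sigma> v) (fr1 c v)) \<le> m * s"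
    proof -
      have "\<bar>mc1 c v\<bar> * norm (X1 v) \<le> m * s" using mm by (intro mult_mono) (auto simp: s_def)
      then show ?thesis unfolding frame_values(1)[OF EA L vW] X1_def by simp
    qed
    have f2: "norm (A (\<sigma> v) (fr2 c v)) \<le> m * s"
    proof -
      have "norm (A (\<sigma> v) (fr2 c v)) \<le> \<bar>mc2 c v\<bar> * norm (X1 v) + \<bar>mc3 c v\<bar> * norm (X2 v)"
        unfolding frame_values(2)[OF EA L vW] X1_def X2_def by (rule norm_triangle_le) simp
      also have "\<dots> \<le> m * norm (X1 v) + m * norm (X2 v)"
        using mm by (intro add_mono mult_right_mono) auto
      finally show ?thesis by (simp add: s_def distrib_left)
    qed
    have sq: "(norm X)\<^sup>2 \<le> (m * s)\<^sup>2" if "norm X \<le> m * s" for X :: "'m mink" using that by (intro power_mono) auto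
    have NN: "N + N\<^sup>2 * M\<^sup>2 \<ge> 0" using N(1) by auto
    have "trace_at (proj_form A) c \<sigma> v \<le> (N + N\<^sup>2 * M\<^sup>2) * (m * s)\<^sup>2 + (N + N\<^sup>2 * M\<^sup>2) * (m * s)\<^sup>2"
      by (intro add_mono order_trans[OF tp[OF v] mult_left_mono[OF sq NN]] f1 f2)
    also have "\<dots> = C * s\<^sup>2" by (simp add: C_def power_mult_distrib)
    finally have T: "trace_at (proj_form A) c \<sigma> v \<le> C * s\<^sup>2" .
    have T0: "0 \<le> trace_at (proj_form A) c \<sigma> v"
      using tan_proj_in_tan_space[OF w_hyp[OF D(6)[OF vW]]] by (intro add_nonneg_nonneg h_nonneg) auto
    have "trace_at (proj_form A) c \<sigma> v powr (p / 2) \<le> (C * s\<^sup>2) powr (p / 2)"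
      using T T0 p by (intro powr_mono2) auto
    also have "\<dots> = C powr (p / 2) * s powr p"
    proof -
      have s0: "s \<ge> 0" by (simp add: s_def)
      have "s\<^sup>2 powr (p / 2) = s powr p"
      proof (cases "s = 0")
        case False
        then have "s\<^sup>2 = s powr 2" using s0 by (simp add: powr_numeral)
        then show ?thesis by (simp add: powr_powr)
      qed (use p in simp)
      then show ?thesis using C0 by (simp add: powr_mult)
    qed
    also have "\<dots> \<le> C powr (p / 2) * (2 powr p * (norm (X1 v) powr p + norm (X2 v) powr p))"
      using powr_sum_le[of "norm (X1 v)" "norm (X2 v)" p] p by (intro mult_left_mono) (auto simp: s_def)
    finally show ?thesis .
  qed
  have Lp: "integrable lebesgue (\<lambda>v. indicator K v * norm (A (\<sigma> v) (dpar S c v e)) powr p)" for e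
    using sobolev_formD(3)[OF A L, of e] K unfolding Lp_loc_on_def set_integrable_def by simp
  show ?thesis
  proof (rule Bochner_Integration.integrable_bound)
    show "integrable lebesgue (\<lambda>v. C powr (p / 2) * (2 powr p * (indicator K v * norm (X1 v) powr p + indicator K v * norm (X2 v) powr p)))"
      unfolding X1_def X2_def by (intro integrable_mult_right Bochner_Integration.integrable_add Lp)
    have "(\<lambda>v. trace_at (proj_form A) c \<sigma> v powr (p / 2)) \<in> borel_measurable (lebesgue_on K)"
      using tangent_formD(4,5)[OF tangent_form_proj[OF A] L K]
      by (intro powr_real_measurable borel_measurable_add measurable_lor borel_measurable_const)
    then show "(\<lambda>v. indicator K v * trace_at (proj_form A) c \<sigma> v powr (p / 2)) \<in> borel_measurable lebesgue"
      using Ks by (simp add: borel_measurable_restrict_space_iff mult.commute)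
    show "AE v in lebesgue. norm (indicator K v * trace_at (proj_form A) c \<sigma> v powr (p / 2)) \<le>
        norm (C powr (p / 2) * (2 powr p * (indicator K v * norm (X1 v) powr p + indicator K v * norm (X2 v) powr p)))"
    proof (intro AE_I2)
      fix v show "norm (indicator K v * trace_at (proj_form A) c \<sigma> v powr (p / 2)) \<le>
        norm (C powr (p / 2) * (2 powr p * (indicator K v * norm (X1 v) powr p + indicator K v * norm (X2 v) powr p)))"
      proof (cases "v \<in> K")
        case True
        then show ?thesis using order_trans[OF bound[OF True] abs_ge_self] by simp
      qed simp
    qed
  qed
qed

text \<open>The pointwise growth bound supplies an integrable majorant on every compact coordinate
  set. Finiteness is what allows the inequality between the energy densities to be
  integrated.\<close>

lemma integrable_dual_energy:
  assumes A: "sobolev_form p w A" and B: "sobolev_form p \<xi> B"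
    and pq: "p > 1" "q > 0" "(p - 1) * q = p" "q \<le> p"
  shows "integrable (area S) (desc (Tr_Q S w q (\<lambda>y v. star S (S_form S w (p - 1) (proj_form A)) y v + proj_form B y v)))"
proof -
  let ?A = "proj_form A" and ?B = "proj_form B"
  let ?\<gamma> = "\<lambda>y v. star S (S_form S w (p - 1) ?A) y v + ?B y v"
  note TA = tangent_form_proj[OF A] and TB = tangent_form_proj[OF B]
  have T\<gamma>: "tangent_form ?\<gamma>" by (rule tangent_form_add[OF tangent_form_star_S_form[OF TA] TB])
  show ?thesis
  proof (rule integrable_area_local[OF measurable_desc_TrQ[OF T\<gamma>]])
    fix c W \<sigma> K assume L: "lifted_chart S c W \<sigma>" and K: "compact K" "K \<subseteq> W"
    note D = lifted_chartD[OF L]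
    have p0: "p > 0" using pq by simp
    have Ki: "integrable lebesgue (indicator K :: real^2 \<Rightarrow> real)"
      using lmeasurable_compact[OF K(1)] by (auto simp: fmeasurable_def intro!: integrable_real_indicator)
    define a where "a v = trace_at ?A c \<sigma> v powr (p / 2)" for v
    define b where "b v = trace_at ?B c \<sigma> v powr (p / 2)" for v
    define H where "H v = 2 * 2 powr (q / 2) * (4 powr (q / 2) * a v + 2 powr (q / 2) * (1 + b v))" for v
    have "integrable lebesgue (\<lambda>v. 2 * 2 powr (q / 2) * (4 powr (q / 2) * (indicator K v * a v) + 2 powr (q / 2) * (indicator K v + indicator K v * b v)))"
      unfolding a_def b_def
      by (intro integrable_mult_right Bochner_Integration.integrable_add trace_powr_integrable[OF A p0 L K] trace_powr_integrable[OF B p0 L K]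
          Ki)
    moreover have "2 * 2 powr (q / 2) * (4 powr (q / 2) * (indicator K v * a v) + 2 powr (q / 2) * (indicator K v + indicator K v * b v)) = indicator K v * H v" for v
      by (simp add: H_def indicator_def)
    ultimately have i: "integrable lebesgue (\<lambda>v. indicator K v * H v)" by (simp only:)
    have "\<bar>desc (Tr_Q S w q ?\<gamma>) (snd c v)\<bar> \<le> H v" if v: "v \<in> K" for v
    proof -
      have vW: "v \<in> W" using v K(2) by blast
      note y = D(6)[OF vW]
      interpret plane_pair "metric S (uproj S (\<sigma> v))" lor "tan_space (w (\<sigma> v))" by (rule plane_pair_at[OF y])
      have f: "oriented_frame (metric S (uproj S (\<sigma> v))) (fr1 c v, fr2 c v)"
        unfolding D(7)[OF vW] by (rule chart_frame(3)[OF D(1) D(5)[OF vW]])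
      have "desc (Tr_Q S w q ?\<gamma>) (uproj S (\<sigma> v)) = Tr_Q S w q ?\<gamma> (\<sigma> v)"
        by (rule desc_eq[OF y], rule TrQ_deck[OF T\<gamma> y])
      then have d: "desc (Tr_Q S w q ?\<gamma>) (snd c v) = Tr_Q S w q ?\<gamma> (\<sigma> v)" unfolding D(7)[OF vW] .
      have "Tr_Q S w q ?\<gamma> (\<sigma> v) = TrQ q (?\<gamma> (\<sigma> v))" by (simp add: Tr_Q_def Let_def)
      also have "?\<gamma> (\<sigma> v) = (\<lambda>e. dual_form (p - 1) (?A (\<sigma> v)) e + ?B (\<sigma> v) e)"
        by (simp add: star_def S_form_def dual_form_def)
      finally have t: "Tr_Q S w q ?\<gamma> (\<sigma> v) = TrQ q (\<lambda>e. dual_form (p - 1) (?A (\<sigma> v)) e + ?B (\<sigma> v) e)" .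
      have "0 \<le> Tr_Q S w q ?\<gamma> (\<sigma> v)"
        unfolding Tr_Q_def Let_def by (rule TrQ_bounds(1)[OF tangent_formD(2,3)[OF T\<gamma> y] f pq(2)])
      moreover have "Tr_Q S w q ?\<gamma> (\<sigma> v) \<le> H v"
        unfolding t H_def a_def b_def
        by (rule TrQ_dual_add_le[OF tangent_formD(2,3)[OF TA y] tangent_formD(2,3)[OF TB y] f pq, unfolded trace2_def])
      ultimately show ?thesis unfolding d by simp
    qed
    then show "\<exists>H :: real^2 \<Rightarrow> real. integrable lebesgue (\<lambda>v. indicator K v * H v) \<and> (\<forall>v\<in>K. \<bar>desc (Tr_Q S w q ?\<gamma>) (snd c v)\<bar> \<le> H v)"
      using i by (intro exI[of _ H] conjI ballI)
  qed
qed

lemma zero_section: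
  shows "(\<lambda>_. 0) \<in> W1p_tangent_sections p S \<rho> w" "weak_differential S \<rho> (\<lambda>_. 0) (\<lambda>_ _. 0)"
proof -
  show wd: "weak_differential S \<rho> (\<lambda>_. 0) (\<lambda>_ _. 0)"
    unfolding weak_differential_def E_form_def weak_deriv_on_def
    by (simp add: set_lebesgue_integral_def set_integrable_def linear_iff)
  then show "(\<lambda>_. 0) \<in> W1p_tangent_sections p S \<rho> w"
    unfolding W1p_tangent_sections_def W1p_section_def E_section_def Lp_loc_on_def
    by (auto intro!: exI[of _ "\<lambda>_ _. 0"] simp: set_integrable_def tan_proj_def lor_simps)
qed

text \<open>The differential selected for the zero section need not vanish identically; it is
  determined up to null sets.\<close>

lemma flat_d_zero:
  assumes L: "lifted_chart S c W \<sigma>"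
  shows "AE v in lebesgue. v \<in> W \<longrightarrow> flat_d S \<rho> (\<lambda>_. 0) (\<sigma> v) = (\<lambda>_. 0)"
proof -
  have "weak_differential S \<rho> (\<lambda>_. 0) (flat_d S \<rho> (\<lambda>_. 0))"
    unfolding flat_d_def by (rule someI[of "weak_differential S \<rho> (\<lambda>_. 0)", OF zero_section(2)])
  from weak_differential_unique[OF this zero_section(2) L] show ?thesis .
qed

theorem dual_minimum:
  assumes W: "W1p_section p S \<rho> w" and p: "p > 2" and q: "1 / p + 1 / q = 1"
  shows "is_arg_min (J_dual q S \<rho> w (Z_form p S \<rho> w)) (\<lambda>\<xi>. \<xi> \<in> W1p_tangent_sections p S \<rho> w) (\<lambda>_. 0)"
    "weakly_D_closed p S \<rho> w (star S (S_form S w (q - 1) (Z_form p S \<rho> w)))"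
proof -
  have "q \<noteq> 0" using p q by (auto simp: field_simps)
  then have pq: "p + q = p * q" using p q by (simp add: field_simps)
  then have q_eq: "q = p / (p - 1)" using p by (simp add: field_simps)
  \<comment> \<open>With q = p / (p - 1), the inequality q \<le> p amounts to p \<ge> 2.\<close>
  have q1: "1 < q" "q \<le> p" unfolding q_eq using p by (simp_all add: field_simps) 
  have pq1: "(p - 1) * (q - 1) = 1" "(p - 1) * q = p" using pq by (simp_all add: algebra_simps)
  define A where "A = flat_d S \<rho> w"
  have A: "sobolev_form p w A" unfolding A_def by (rule sobolev_form_flat_d[OF W]) (use p in simp)
  \<comment> \<open>Tangentiality of dw at a point: a deck-invariant property that holds almost
    everywhere.\<close>
  define P where "P y \<longleftrightarrow> (\<forall>e. lor (A y e) (w y) = 0)" for y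
  have P_inv: "P (\<tau> y)" if "y \<in> ucov S" "\<tau> \<in> deck S" "P y" for y \<tau>
    using that(3) unfolding P_def E_form_deck[OF sobolev_formD(1)[OF A] that(2,1)] w_deck[OF that(2,1)] \<rho>_lor[OF that(2)] .
  have P_loc: "AE v in lebesgue. v \<in> W \<longrightarrow> P (\<sigma> v)" if "lifted_chart S c W \<sigma>" for c W \<sigma>
    unfolding P_def by (rule sobolev_form_tangent[OF A that])
  have P_eq: "proj_form A y = A y" if "P y" for y using that by (simp add: P_def tan_proj_def)
  have P_tan: "range (A y) \<subseteq> tan_space (w y)" if "P y" for y using that by (auto simp: P_def tan_space_def)
  define Z where "Z = Z_form p S \<rho> w"
  \<comment> \<open>Formed from the projected differential, so that it is tangential at every point;
    it equals Z wherever \<open>P\<close> holds.\<close>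
  define Z' where "Z' = star S (S_form S w (p - 1) (proj_form A))"
  have Z_eq: "Z y = Z' y" if "P y" for y
    unfolding Z_def Z'_def Z_form_def A_def[symmetric] star_def S_form_def using P_eq[OF that] by simp
  have TA: "tangent_form (proj_form A)" by (rule tangent_form_proj[OF A])
  have TZ: "tangent_form Z'" unfolding Z'_def by (rule tangent_form_star_S_form[OF TA])
  have SF: "sobolev_form p \<xi> (flat_d S \<rho> \<xi>)" if "\<xi> \<in> W1p_tangent_sections p S \<rho> w" for \<xi>
    using that p by (intro sobolev_form_flat_d) (auto simp: W1p_tangent_sections_def)
  \<comment> \<open>Where dw is tangential, pairing it with a projected form is the same as pairing
    it with the form itself; this brings in the Stokes formula of the flat bundle.\<close>
  have wedge_proj: "wedge (proj_form A) (proj_form B) y = wedge A B y" if "P y" for B y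
    unfolding form_wedge_def P_eq[OF that] using that by (simp add: P_def lor_tan_proj split: prod.split)
  have Wd: "integrable (area S) (desc (wedge (proj_form A) (proj_form B)))" 
      "(LINT x|area S. desc (wedge (proj_form A) (proj_form B)) x) = 0" if B: "sobolev_form p \<xi> B" for \<xi> B
  proof -
    note St = Stokes[OF A B]
    note m = borel_measurable_integrable[OF St(1)]
    have m': "desc (wedge (proj_form A) (proj_form B)) \<in> borel_measurable (area S)"
      and ae: "AE x in area S. desc (wedge (proj_form A) (proj_form B)) x = desc (wedge A B) x"
      by (rule desc_AE_cong[OF m, of P]; (rule P_inv P_loc wedge_proj; assumption))+
    show "integrable (area S) (desc (wedge (proj_form A) (proj_form B)))"
      using St(1) integrable_cong_AE[OF m' m ae] by simp
    show "(LINT x|area S. desc (wedge (proj_form A) (proj_form B)) x) = 0"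
      using St(2) integral_cong_AE[OF m' m ae] by simp
  qed
  show "weakly_D_closed p S \<rho> w (star S (S_form S w (q - 1) (Z_form p S \<rho> w)))"
    unfolding weakly_D_closed_def surface_integral_desc Z_def[symmetric]
  proof
    fix \<xi> assume \<xi>: "\<xi> \<in> W1p_tangent_sections p S \<rho> w"
    let ?B = "flat_d S \<rho> \<xi>" and ?\<alpha> = "star S (S_form S w (q - 1) Z)"
    \<comment> \<open>Where \<open>P\<close> holds, dualising dw twice gives -dw.\<close>
    have \<alpha>: "?\<alpha> y e = - A y e" if y: "y \<in> ucov S" "P y" for y e
    proof -
      interpret plane_pair "metric S (uproj S y)" lor "tan_space (w y)" by (rule plane_pair_at[OF y(1)])
      have "Z y = dual_form (p - 1) (A y)"
        by (simp add: Z_def Z_form_def A_def star_def S_form_def dual_form_def fun_eq_iff)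
      then have "?\<alpha> y e = dual_form (q - 1) (dual_form (p - 1) (A y)) e"
        by (simp add: star_def S_form_def dual_form_def)
      then show ?thesis
        using dual_form_dual_form[OF E_form_linear[OF sobolev_formD(1)[OF A] y(1)] P_tan[OF y(2)] pq1(1)] by simp
    qed
    \<comment> \<open>Two signs cancel: one from the double dual, one from exchanging the factors of
      the wedge product.\<close>
    have eq: "wedge (D_pull S \<rho> w \<xi>) ?\<alpha> y = wedge A ?B y" if y: "y \<in> ucov S" "P y" for y
    proof -
      have l: "lor (D_pull S \<rho> w \<xi> y e) (A y e') = lor (A y e') (?B y e)" for e e'
        unfolding D_pull_def using y(2) by (subst lor_sym) (simp add: P_def lor_tan_proj)
      show ?thesis
        unfolding form_wedge_def \<alpha>[OF y] by (simp add: lor_simps l split: prod.split)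
    qed
    note St = Stokes[OF A SF[OF \<xi>]]
    note m = borel_measurable_integrable[OF St(1)]
    have m': "desc (wedge (D_pull S \<rho> w \<xi>) ?\<alpha>) \<in> borel_measurable (area S)"
      and ae: "AE x in area S. desc (wedge (D_pull S \<rho> w \<xi>) ?\<alpha>) x = desc (wedge A ?B) x"
      by (rule desc_AE_cong[OF m, of P]; (rule P_inv P_loc eq; assumption))+
    show "(LINT x|area S. desc (wedge (D_pull S \<rho> w \<xi>) ?\<alpha>) x) = 0"
      using St(2) integral_cong_AE[OF m' m ae] by simp
  qed
  let ?F = "\<lambda>\<xi>. Tr_Q S w q (\<lambda>y v. Z' y v + proj_form (flat_d S \<rho> \<xi>) y v)"
  have F_int: "integrable (area S) (desc (?F \<xi>))" if "\<xi> \<in> W1p_tangent_sections p S \<rho> w" for \<xi>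
    unfolding Z'_def by (rule integrable_dual_energy[OF A SF[OF that]]) (use p q1 pq1 in auto)
  have J: "J_dual q S \<rho> w Z \<xi> = (LINT x|area S. desc (?F \<xi>) x)" if \<xi>: "\<xi> \<in> W1p_tangent_sections p S \<rho> w" for \<xi>
    unfolding J_dual_def surface_integral_desc
  proof (rule integral_cong_AE)
    have eq: "Tr_Q S w q (\<lambda>y v. Z y v + tan_proj (w y) (flat_d S \<rho> \<xi> y v)) y = ?F \<xi> y" if "y \<in> ucov S" "P y" for y
      unfolding Tr_Q_def Z_eq[OF that(2)] ..
    note m = borel_measurable_integrable[OF F_int[OF \<xi>]]
    show "desc (?F \<xi>) \<in> borel_measurable (area S)" by (rule m)
    show "desc (Tr_Q S w q (\<lambda>y v. Z y v + tan_proj (w y) (flat_d S \<rho> \<xi> y v))) \<in> borel_measurable (area S)"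
      "AE x in area S. desc (Tr_Q S w q (\<lambda>y v. Z y v + tan_proj (w y) (flat_d S \<rho> \<xi> y v))) x = desc (?F \<xi>) x"
      by (rule desc_AE_cong[OF m, of P]; (rule P_inv P_loc eq; assumption))+
  qed
  \<comment> \<open>The energy density at \<xi> = 0 without the differential selected for the zero
    section, which vanishes only almost everywhere.\<close>
  let ?G = "Tr_Q S w q Z'"
  have F0: "integrable (area S) (desc ?G)" "(LINT x|area S. desc (?F (\<lambda>_. 0)) x) = (LINT x|area S. desc ?G x)"
  proof -
    define P0 where "P0 y \<longleftrightarrow> flat_d S \<rho> (\<lambda>_. 0) y = (\<lambda>_. 0)" for y
    have inv: "P0 (\<tau> y)" if "y \<in> ucov S" "\<tau> \<in> deck S" "P0 y" for y \<tau>
      using that(3) E_form_deck[OF sobolev_formD(1)[OF SF[OF zero_section(1)]] that(2,1)]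
      unfolding P0_def by (simp add: fun_eq_iff)
    have loc: "AE v in lebesgue. v \<in> W \<longrightarrow> P0 (\<sigma> v)" if "lifted_chart S c W \<sigma>" for c W \<sigma>
      unfolding P0_def by (rule flat_d_zero[OF that])
    have eq: "?F (\<lambda>_. 0) y = ?G y" if "y \<in> ucov S" "P0 y" for y
      using that(2) unfolding Tr_Q_def P0_def by (simp add: tan_proj_def lor_simps)
    note m = measurable_desc_TrQ[OF TZ, of q]
    have m': "desc (?F (\<lambda>_. 0)) \<in> borel_measurable (area S)"
      and ae: "AE x in area S. desc (?F (\<lambda>_. 0)) x = desc ?G x"
      by (rule desc_AE_cong[OF m, of P0]; (rule inv loc eq; assumption))+
    show "integrable (area S) (desc ?G)"
      using F_int[OF zero_section(1)] integrable_cong_AE[OF m' m ae] by simp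
    show "(LINT x|area S. desc (?F (\<lambda>_. 0)) x) = (LINT x|area S. desc ?G x)"
      by (rule integral_cong_AE[OF m' m ae])
  qed
  show "is_arg_min (J_dual q S \<rho> w (Z_form p S \<rho> w)) (\<lambda>\<xi>. \<xi> \<in> W1p_tangent_sections p S \<rho> w) (\<lambda>_. 0)"
    unfolding is_arg_min_def Z_def[symmetric]
  proof (intro conjI zero_section notI, elim exE conjE)
    fix \<xi> assume \<xi>: "\<xi> \<in> W1p_tangent_sections p S \<rho> w" and less: "J_dual q S \<rho> w Z \<xi> < J_dual q S \<rho> w Z (\<lambda>_. 0)"
    let ?B = "proj_form (flat_d S \<rho> \<xi>)"
    note TB = tangent_form_proj[OF SF[OF \<xi>]]
    note Wd\<xi> = Wd[OF SF[OF \<xi>]]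
    have pt: "?G y + q * wedge (proj_form A) ?B y \<le> ?F \<xi> y" if y: "y \<in> ucov S" for y
    proof -
      interpret plane_pair "metric S (uproj S y)" lor "tan_space (w y)" by (rule plane_pair_at[OF y])
      obtain f1 f2 where f: "oriented_frame (metric S (uproj S y)) (f1, f2)" using frame_at[OF y] by (elim exE) (rule that)
      note TAy = tangent_formD(2,3)[OF TA y] and TBy = tangent_formD(2,3)[OF TB y]
      have Zy: "Z' y = dual_form (p - 1) (proj_form A y)"
        by (simp add: Z'_def star_def S_form_def dual_form_def fun_eq_iff)
      show ?thesis
        unfolding Tr_Q_def Let_def form_wedge_frame[OF bilinear_lor TAy(1) TBy(1) f] Zy
        by (rule trace_subgradient[OF TAy TBy _ q1(1) q f]) (use p in simp)
    qed
    \<comment> \<open>The subgradient inequality is integrated; its linear term then drops out by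
      the Stokes formula.\<close>
    have "(LINT x|area S. desc ?G x + q * desc (wedge (proj_form A) ?B) x) \<le> (LINT x|area S. desc (?F \<xi>) x)"
    proof (rule integral_mono)
      show "integrable (area S) (\<lambda>x. desc ?G x + q * desc (wedge (proj_form A) ?B) x)"
        by (intro Bochner_Integration.integrable_add integrable_mult_right F0(1) Wd\<xi>(1))
      fix x assume "x \<in> space (area S)"
      then have "x \<in> pts S" by (simp add: space_area)
      from someI_ex[OF fibre_nonempty[OF this]]
      show "desc ?G x + q * desc (wedge (proj_form A) ?B) x \<le> desc (?F \<xi>) x"
        unfolding desc_def by (intro pt) blast
    qed (rule F_int[OF \<xi>])
    then have "(LINT x|area S. desc ?G x) \<le> (LINT x|area S. desc (?F \<xi>) x)"
      using Bochner_Integration.integral_add[OF F0(1) integrable_mult_right[OF Wd\<xi>(1), of q]] Wd\<xi>(2) by simp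
    with less show False unfolding J[OF \<xi>] J[OF zero_section(1)] F0(2) by simp
  qed
qed

end

subsection \<open>Uniqueness of the equivariant lift\<close>

text \<open>Any two constant loops are freely homotopic, and the track of the base point under the
  homotopy is a path between them.\<close>

lemma simply_connected_imp_connected_top:
  fixes U :: "'b::topological_space set"
  assumes "simply_connected U" shows "connected U"
proof (rule path_connected_imp_connected)
  show "path_connected U"
    unfolding path_connected_def
  proof (intro ballI)
    fix a b assume ab: "a \<in> U" "b \<in> U"
    have pc: "path (\<lambda>_. x) \<and> pathfinish (\<lambda>_. x) = pathstart (\<lambda>_. x) \<and> path_image (\<lambda>_. x) \<subseteq> U" if "x \<in> U" for x
      using that by (auto simp: path_def pathfinish_def pathstart_def path_image_def)
    have "homotopic_loops U (\<lambda>_. a) (\<lambda>_. b)"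
      using assms pc[OF ab(1)] pc[OF ab(2)] unfolding simply_connected_def by blast
    then obtain h where h: "continuous_on ({0..1::real} \<times> {0..1::real}) h" "h \<in> ({0..1} \<times> {0..1}) \<rightarrow> U"
       "\<forall>x \<in> {0..1}. h (0, x) = a" "\<forall>x \<in> {0..1}. h (1, x) = b"
      unfolding homotopic_loops by auto
    let ?g = "\<lambda>t. h (t, 0)"
    have c: "continuous_on {0..1} ?g"
      by (rule continuous_on_compose2[OF h(1)]) (auto intro!: continuous_intros)
    show "\<exists>g. path g \<and> path_image g \<subseteq> U \<and> pathstart g = a \<and> pathfinish g = b"
      using c h(2-4) by (intro exI[of _ ?g]) (auto simp: path_def path_image_def pathstart_def pathfinish_def)
  qed
qed

text \<open>A constant linear map commutes with integration against test functions. It will be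
  applied to the matrix that relates two lifts.\<close>

lemma weak_deriv_on_linear:
  assumes wd: "weak_deriv_on W f F" and T: "bounded_linear T"
    and g: "\<And>v. v \<in> W \<Longrightarrow> g v = T (f v)" and G: "\<And>v e. v \<in> W \<Longrightarrow> G v e = T (F v e)"
  shows "weak_deriv_on W g G"
proof -
  interpret T: bounded_linear T by (rule T)
  have c: "integrable lebesgue (\<lambda>v. indicator K v *\<^sub>R k v)"
    if K: "K \<subseteq> W" and i: "integrable lebesgue (\<lambda>v. indicator K v *\<^sub>R h v)" and k: "\<And>v. v \<in> W \<Longrightarrow> k v = T (h v)" for K h k
  proof -
    have "integrable lebesgue (\<lambda>v. T (indicator K v *\<^sub>R h v))" by (rule integrable_bounded_linear[OF T i])
    moreover have "T (indicator K v *\<^sub>R h v) = indicator K v *\<^sub>R k v" for v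
      using k[of v] K by (cases "v \<in> K") (auto simp: T.zero)
    ultimately show ?thesis by simp
  qed
  show ?thesis
    unfolding weak_deriv_on_def set_integrable_def
  proof (intro conjI allI impI)
    fix K assume K: "K \<subseteq> W" "compact K"
    show "integrable lebesgue (\<lambda>v. indicator K v *\<^sub>R g v)"
      by (rule c[OF K(1) weak_deriv_on_integrable(1)[OF wd K] g])
    show "integrable lebesgue (\<lambda>v. indicator K v *\<^sub>R G v e)" for e
      by (rule c[OF K(1) weak_deriv_on_integrable(2)[OF wd K] G])
  next
    fix \<phi> e assume \<phi>: "test_function W \<phi>"
    obtain K where K: "K \<subseteq> W" "compact K" "\<And>v. v \<notin> K \<Longrightarrow> \<phi> v = 0" using \<phi> unfolding test_function_def by auto
    have d0: "frechet_derivative \<phi> (at v) e = 0" if "v \<notin> K" for v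
      using frechet_derivative_eq_0_off[OF compact_imp_closed[OF K(2)] K(3) that] by simp
    note t = weak_deriv_on_test[OF wd \<phi>, where e = e]
    have "(LINT v:W|lebesgue. \<phi> v *\<^sub>R G v e) = (LINT v|lebesgue. T (\<phi> v *\<^sub>R F v e))"
      unfolding set_lebesgue_integral_def using K(1,3) G
      by (intro Bochner_Integration.integral_cong) (auto simp: indicator_def T.scaleR T.zero)
    also have "\<dots> = T (LINT v|lebesgue. \<phi> v *\<^sub>R F v e)"
      by (rule integral_bounded_linear[OF T t(1)])
    also have "\<dots> = - T (LINT v|lebesgue. frechet_derivative \<phi> (at v) e *\<^sub>R f v)"
      unfolding t(3) by (rule linear_neg[OF bounded_linear.linear[OF T]])
    also have "T (LINT v|lebesgue. frechet_derivative \<phi> (at v) e *\<^sub>R f v) = (LINT v|lebesgue. T (frechet_derivative \<phi> (at v) e *\<^sub>R f v))"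
      by (rule integral_bounded_linear[OF T t(2), symmetric])
    also have "\<dots> = (LINT v:W|lebesgue. frechet_derivative \<phi> (at v) e *\<^sub>R g v)"
      unfolding set_lebesgue_integral_def using K(1) d0 g
      by (intro Bochner_Integration.integral_cong) (auto simp: indicator_def T.scaleR T.zero)
    finally show "(LINT v:W|lebesgue. \<phi> v *\<^sub>R G v e) = - (LINT v:W|lebesgue. frechet_derivative \<phi> (at v) e *\<^sub>R g v)" .
  qed
qed

lemma Lp_loc_on_linear:
  fixes f :: "real^2 \<Rightarrow> 'e::euclidean_space" and T :: "'e \<Rightarrow> 'e"
  assumes f: "Lp_loc_on p W f" and p: "p \<ge> 0" and T: "bounded_linear T"
    and g: "\<And>v. v \<in> W \<Longrightarrow> g v = T (f v)"
    and m: "\<And>K. K \<subseteq> W \<Longrightarrow> compact K \<Longrightarrow> integrable lebesgue (\<lambda>v. indicator K v *\<^sub>R f v)"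
  shows "Lp_loc_on p W g"
  unfolding Lp_loc_on_def set_integrable_def
proof (intro allI impI)
  fix K assume K: "K \<subseteq> W" "compact K"
  interpret T: bounded_linear T by (rule T)
  obtain B where B: "B \<ge> 0" "\<And>x. norm (T x) \<le> norm x * B" using T.nonneg_bounded by blast
  have iF: "integrable lebesgue (\<lambda>v. indicator K v *\<^sub>R norm (f v) powr p)"
    using f K unfolding Lp_loc_on_def set_integrable_def by blast
  have gm: "(\<lambda>v. T (indicator K v *\<^sub>R f v)) \<in> borel_measurable lebesgue"
    by (rule borel_measurable_integrable[OF integrable_bounded_linear[OF T m[OF K]]])
  have nm: "(\<lambda>v. norm (T (indicator K v *\<^sub>R f v))) \<in> borel_measurable lebesgue" using gm by measurable
  have Ks: "K \<in> sets lebesgue" using K(2) by (intro lmeasurable_compact[THEN fmeasurableD])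
  have eq: "indicator K v *\<^sub>R norm (g v) powr p = indicator K v * norm (T (indicator K v *\<^sub>R f v)) powr p" for v
    using g[of v] K(1) by (cases "v \<in> K") auto
  show "integrable lebesgue (\<lambda>v. indicator K v *\<^sub>R norm (g v) powr p)"
    unfolding eq
  proof (rule Bochner_Integration.integrable_bound)
    show "integrable lebesgue (\<lambda>v. B powr p * (indicator K v *\<^sub>R norm (f v) powr p))"
      by (rule integrable_mult_right[OF iF])
    show "(\<lambda>v. indicator K v * norm (T (indicator K v *\<^sub>R f v)) powr p) \<in> borel_measurable lebesgue"
      by (intro borel_measurable_times borel_measurable_indicator Ks powr_real_measurable nm borel_measurable_const)
    show "AE v in lebesgue. norm (indicator K v * norm (T (indicator K v *\<^sub>R f v)) powr p) \<le>
      norm (B powr p * (indicator K v *\<^sub>R norm (f v) powr p))"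
    proof (intro AE_I2)
      fix v
      have "norm (T (f v)) powr p \<le> (norm (f v) * B) powr p" using B p by (intro powr_mono2) auto
      also have "\<dots> = B powr p * norm (f v) powr p" using B by (simp add: powr_mult mult.commute)
      finally show "norm (indicator K v * norm (T (indicator K v *\<^sub>R f v)) powr p) \<le>
        norm (B powr p * (indicator K v *\<^sub>R norm (f v) powr p))" by (cases "v \<in> K") auto
    qed
  qed
qed

section \<open>The discrete group and the comparison of two lifts\<close>

context hyperbolic_lift
begin

lemma \<Gamma>_facts: "\<Gamma> \<subseteq> SO_plus" "mat 1 \<in> \<Gamma>" "\<forall>A\<in>\<Gamma>. \<forall>B\<in>\<Gamma>. A ** B \<in> \<Gamma>" "\<forall>A\<in>\<Gamma>. matrix_inv A \<in> \<Gamma>"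
  "\<forall>A\<in>\<Gamma>. \<forall>X\<in>hyp. A *v X = X \<longrightarrow> A = mat 1"
  "\<forall>K\<subseteq>hyp. compact K \<longrightarrow> finite {A\<in>\<Gamma>. (\<lambda>X. A *v X) ` K \<inter> K \<noteq> {}}"
proof -
  note c = \<Gamma>[unfolded closed_hyperbolic_group_def]
  show "\<Gamma> \<subseteq> SO_plus" by (rule conjunct1[OF c])
  show "mat 1 \<in> \<Gamma>" by (rule conjunct1[OF conjunct2[OF c]])
  show "\<forall>A\<in>\<Gamma>. \<forall>B\<in>\<Gamma>. A ** B \<in> \<Gamma>" by (rule conjunct1[OF conjunct2[OF conjunct2[OF c]]])
  show "\<forall>A\<in>\<Gamma>. matrix_inv A \<in> \<Gamma>" by (rule conjunct1[OF conjunct2[OF conjunct2[OF conjunct2[OF c]]]])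
  show "\<forall>A\<in>\<Gamma>. \<forall>X\<in>hyp. A *v X = X \<longrightarrow> A = mat 1" by (rule conjunct1[OF conjunct2[OF conjunct2[OF conjunct2[OF conjunct2[OF c]]]]])
  show "\<forall>K\<subseteq>hyp. compact K \<longrightarrow> finite {A\<in>\<Gamma>. (\<lambda>X. A *v X) ` K \<inter> K \<noteq> {}}" by (rule conjunct1[OF conjunct2[OF conjunct2[OF conjunct2[OF conjunct2[OF conjunct2[OF c]]]]]])
qed

lemmas \<Gamma>_one = \<Gamma>_facts(2)
  and \<Gamma>_SO = subsetD[OF \<Gamma>_facts(1)]
  and \<Gamma>_mult = bspec[OF bspec[OF \<Gamma>_facts(3)]]
  and \<Gamma>_inv = bspec[OF \<Gamma>_facts(4)]
  and \<Gamma>_free1 = \<Gamma>_facts(5)[rule_format]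
  and \<Gamma>_finite = \<Gamma>_facts(6)[rule_format]

lemma \<Gamma>_matrix_inv:
  assumes "A \<in> \<Gamma>" shows "A ** matrix_inv A = mat 1" "matrix_inv A ** A = mat 1"
proof -
  have "det A = 1" using \<Gamma>_SO[OF assms] by (simp add: SO_plus_def)
  then have "invertible A" by (simp add: invertible_det_nz)
  then have "\<exists>A'. A ** A' = mat 1 \<and> A' ** A = mat 1" unfolding invertible_def .
  from someI_ex[OF this] show "A ** matrix_inv A = mat 1" "matrix_inv A ** A = mat 1"
    unfolding matrix_inv_def by blast+
qed

text \<open>Freeness of the action, applied to the product of the inverse of \<open>B\<close> with
  \<open>A\<close>.\<close>

lemma \<Gamma>_free:
  assumes A: "A \<in> \<Gamma>" and B: "B \<in> \<Gamma>" and X: "X \<in> hyp" and eq: "A *v X = B *v X"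
  shows "A = B"
proof -
  have "(matrix_inv B ** A) *v X = (matrix_inv B ** B) *v X"
    by (simp only: matrix_vector_mul_assoc[symmetric] eq)
  then have "matrix_inv B ** A = mat 1"
    using \<Gamma>_free1[OF \<Gamma>_mult[OF \<Gamma>_inv[OF B] A] X] by (simp add: \<Gamma>_matrix_inv[OF B])
  then have "B ** (matrix_inv B ** A) = B" by simp
  then show ?thesis by (simp add: matrix_mul_assoc \<Gamma>_matrix_inv[OF B])
qed

lemma closed_hyp: "closed (hyp :: 'm mink set)"
proof -
  have "closed {X :: 'm mink. lor X X = - 1}" "closed {X :: 'm mink. 1 \<le> X $ None}"
    unfolding lor_def by (intro closed_Collect_eq closed_Collect_le continuous_intros)+
  then show ?thesis unfolding hyp_def Collect_conj_eq by (intro closed_Int) 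
qed

text \<open>Near a point only finitely many elements of the discrete group can relate the two lifts, so each
  of the closed coincidence sets is also open.\<close>

lemma lift_unique:
  assumes lift': "equivariant_lift S \<Gamma> u \<rho>' w'"
  shows "\<exists>A\<in>\<Gamma>. \<forall>y\<in>ucov S. w' y = A *v w y"
proof (cases "ucov S = {}")
  case True
  then show ?thesis using \<Gamma>_one by blast
next
  case False
  have w'c: "continuous_on (ucov S) w'" and w'h: "\<And>y. y \<in> ucov S \<Longrightarrow> w' y \<in> hyp"
    and orb': "\<And>y. y \<in> ucov S \<Longrightarrow> u (uproj S y) = orbit \<Gamma> (w' y)"
    using lift' by (auto simp: equivariant_lift_def)
  have orb: "\<And>y. y \<in> ucov S \<Longrightarrow> u (uproj S y) = orbit \<Gamma> (w y)" using lift by (auto simp: equivariant_lift_def)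
  define D where "D A = {y \<in> ucov S. w' y = A *v w y}" for A
  have cover: "\<exists>A\<in>\<Gamma>. y \<in> D A" if y: "y \<in> ucov S" for y
  proof -
    have "w' y \<in> orbit \<Gamma> (w' y)" unfolding orbit_def using \<Gamma>_one by (intro image_eqI[of _ _ "mat 1"]) auto
    then have "w' y \<in> orbit \<Gamma> (w y)" using orb[OF y] orb'[OF y] by simp
    then show ?thesis using y unfolding orbit_def D_def by blast
  qed
  have disj: "A = B" if "A \<in> \<Gamma>" "B \<in> \<Gamma>" "y \<in> D A" "y \<in> D B" for A B y
    using that w_hyp by (intro \<Gamma>_free[of A B "w y"]) (auto simp: D_def)
  have closed: "closedin (top_of_set (ucov S)) (D A)" for A
  proof -
    have "continuous_on (ucov S) (\<lambda>y. w' y - A *v w y)"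
      by (intro continuous_on_diff w'c bounded_linear.continuous_on[OF matrix_vector_mul_bounded_linear] w_continuous)
    from continuous_closedin_preimage[OF this closed_singleton, of 0]
    have "closedin (top_of_set (ucov S)) (ucov S \<inter> (\<lambda>y. w' y - A *v w y) -` {0})" .
    moreover have "ucov S \<inter> (\<lambda>y. w' y - A *v w y) -` {0} = D A" by (auto simp: D_def)
    ultimately show ?thesis by simp
  qed
  have opn: "openin (top_of_set (ucov S)) (D A)" if A: "A \<in> \<Gamma>" for A
  proof (subst openin_subopen, intro ballI)
    fix y0 assume y0: "y0 \<in> D A"
    then have y0u: "y0 \<in> ucov S" by (simp add: D_def)
    \<comment> \<open>Near \<open>y0\<close> both lifts take values in this compact set, and by
      proper discontinuity only finitely many group elements carry a point of \<open>K\<close> into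
      \<open>K\<close>.\<close>
    define K where "K = hyp \<inter> (cball (w y0) 1 \<union> cball (w' y0) 1)"
    have K: "K \<subseteq> hyp" "compact K" unfolding K_def by (auto intro!: closed_Int_compact closed_hyp compact_Un)
    \<comment> \<open>The candidates other than \<open>A\<close>. Removing their coincidence sets,
      finitely many and closed, leaves a neighbourhood of \<open>y0\<close> on which only
      \<open>A\<close> can relate the lifts.\<close>
    define FS where "FS = {A\<in>\<Gamma>. (\<lambda>X. A *v X) ` K \<inter> K \<noteq> {}} - {A}"
    have FS: "finite FS" unfolding FS_def using \<Gamma>_finite[OF K] by simp
    define U where "U = (ucov S \<inter> w -` ball (w y0) 1) \<inter> (ucov S \<inter> w' -` ball (w' y0) 1)"
    have U: "openin (top_of_set (ucov S)) U"
      unfolding U_def by (intro openin_Int continuous_openin_preimage_gen w_continuous w'c open_ball)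
    have C: "closedin (top_of_set (ucov S)) (\<Union>C\<in>FS. D C)" using FS closed by (intro closedin_Union) auto
    have "y0 \<notin> (\<Union>C\<in>FS. D C)"
      using disj[OF A _ y0] by (auto simp: FS_def)
    then have y: "y0 \<in> U - (\<Union>C\<in>FS. D C)" using y0u by (simp add: U_def)
    have "U - (\<Union>C\<in>FS. D C) \<subseteq> D A"
    proof
      fix y assume y: "y \<in> U - (\<Union>C\<in>FS. D C)"
      then have yu: "y \<in> ucov S" by (simp add: U_def)
      obtain B where B: "B \<in> \<Gamma>" "y \<in> D B" using cover[OF yu] by blast
      have "w y \<in> K" "w' y \<in> K" using y w_hyp[OF yu] w'h[OF yu] by (auto simp: K_def U_def)
      moreover have "w' y = B *v w y" using B(2) by (simp add: D_def)
      ultimately have "(\<lambda>X. B *v X) ` K \<inter> K \<noteq> {}" by blast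
      then have "B \<in> FS \<or> B = A" using B(1) by (simp add: FS_def)
      then show "y \<in> D A" using y B(2) by blast
    qed
    then show "\<exists>T. openin (top_of_set (ucov S)) T \<and> y0 \<in> T \<and> T \<subseteq> D A"
      using y openin_diff[OF U C] by blast
  qed
  have con: "connected (ucov S)"
    using S by (intro simply_connected_imp_connected_top) (simp add: closed_oriented_riemannian_surface_def universal_covering_def)
  obtain y0 where y0: "y0 \<in> ucov S" using False by blast
  obtain A where A: "A \<in> \<Gamma>" "y0 \<in> D A" using cover[OF y0] by blast
  have "D A = ucov S" using con opn[OF A(1)] closed[of A] A(2) unfolding connected_clopen by blast
  then show ?thesis using A(1) unfolding D_def by blast
qed

text \<open>\<open>W1p_map\<close> provides some Sobolev lift. It differs from the given one by a
  constant element of the group, and constant linear maps preserve weak differentials and local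
  p-integrability.\<close>

lemma W1p_section_lift:
  assumes W: "W1p_map p S \<Gamma> u" and p: "p \<ge> 0" shows "W1p_section p S \<rho> w"
proof -
  obtain \<rho>' w' where lift': "equivariant_lift S \<Gamma> u \<rho>' w'" and W': "W1p_section p S \<rho>' w'"
    using W unfolding W1p_map_def by blast
  obtain A where A: "A \<in> \<Gamma>" "\<And>y. y \<in> ucov S \<Longrightarrow> w' y = A *v w y" using lift_unique[OF lift'] by blast
  obtain \<omega>' where wd: "weak_differential S \<rho>' w' \<omega>'" and Lp: "\<And>c W \<sigma>. lifted_chart S c W \<sigma> \<Longrightarrow>
           Lp_loc_on p W (\<lambda>v. w' (\<sigma> v)) \<and> (\<forall>e. Lp_loc_on p W (\<lambda>v. \<omega>' (\<sigma> v) (dpar S c v e)))"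
    using W' unfolding W1p_section_def by blast
  let ?T = "\<lambda>X. matrix_inv A *v X"
  define \<omega> where "\<omega> y v = ?T (\<omega>' y v)" for y v
  note I = \<Gamma>_matrix_inv[OF A(1)]
  have T: "bounded_linear ?T" by (rule matrix_vector_mul_bounded_linear)
  have w: "w y = ?T (w' y)" if "y \<in> ucov S" for y
    unfolding A(2)[OF that] matrix_vector_mul_assoc I by simp
  \<comment> \<open>The two representations are conjugate: both products send \<open>w y\<close> to
    \<open>w' (\<tau> y)\<close>, and by freeness a group element is determined by one of its values
    on hyperbolic space.\<close>
  have comm: "matrix_inv A ** \<rho>' \<tau> = \<rho> \<tau> ** matrix_inv A" if \<tau>: "\<tau> \<in> deck S" and y: "y \<in> ucov S" for \<tau> y
  proof -
    have r: "\<rho>' \<tau> \<in> \<Gamma>" and w\<tau>: "w' (\<tau> y) = \<rho>' \<tau> *v w' y" using lift' \<tau> y by (auto simp: equivariant_lift_def)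
    have "(\<rho>' \<tau> ** A) *v w y = w' (\<tau> y)" unfolding w\<tau> A(2)[OF y] matrix_vector_mul_assoc ..
    also have "\<dots> = (A ** \<rho> \<tau>) *v w y"
      using A(2)[of "\<tau> y"] deck_ucov[OF \<tau> y] by (simp add: w_deck[OF \<tau> y] matrix_vector_mul_assoc)
    finally have "\<rho>' \<tau> ** A = A ** \<rho> \<tau>"
      by (rule \<Gamma>_free[OF \<Gamma>_mult[OF r A(1)] \<Gamma>_mult[OF A(1) \<rho>_in[OF \<tau>]] w_hyp[OF y]])
    then have "matrix_inv A ** (\<rho>' \<tau> ** A) ** matrix_inv A = matrix_inv A ** (A ** \<rho> \<tau>) ** matrix_inv A" by simp
    then have "(matrix_inv A ** \<rho>' \<tau>) ** (A ** matrix_inv A) = (matrix_inv A ** A) ** (\<rho> \<tau> ** matrix_inv A)"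
      by (simp only: matrix_mul_assoc)
    then show ?thesis unfolding I by simp
  qed
  have E': "E_form S \<rho>' \<omega>'" using wd unfolding weak_differential_def by blast
  have E: "E_form S \<rho> \<omega>"
    unfolding E_form_def
  proof (intro conjI ballI allI)
    fix y assume y: "y \<in> ucov S"
    have "linear (\<omega>' y)" using E' y by (simp add: E_form_def)
    then show "linear (\<omega> y)"
      using linear_compose[OF _ matrix_vector_mul_linear, of "\<omega>' y" "matrix_inv A"] unfolding \<omega>_def by (simp add: o_def)
  next
    fix \<tau> y v assume \<tau>: "\<tau> \<in> deck S" and y: "y \<in> ucov S"
    have "\<omega>' (\<tau> y) v = \<rho>' \<tau> *v \<omega>' y v" using E' \<tau> y by (simp add: E_form_def)
    then show "\<omega> (\<tau> y) v = \<rho> \<tau> *v \<omega> y v"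
      by (simp add: \<omega>_def matrix_vector_mul_assoc comm[OF \<tau> y])
  qed
  have wd\<omega>: "weak_differential S \<rho> w \<omega>"
    unfolding weak_differential_def
  proof (intro conjI allI impI E)
    fix c W \<sigma> assume L: "lifted_chart S c W \<sigma>"
    note D = lifted_chartD[OF L]
    have "weak_deriv_on W (\<lambda>v. w' (\<sigma> v)) (\<lambda>v e. \<omega>' (\<sigma> v) (dpar S c v e))"
      using wd L unfolding weak_differential_def by blast
    then show "weak_deriv_on W (\<lambda>v. w (\<sigma> v)) (\<lambda>v e. \<omega> (\<sigma> v) (dpar S c v e))"
      by (rule weak_deriv_on_linear[OF _ T]) (simp_all add: w D(6) \<omega>_def)
  qed
  have "Lp_loc_on p W (\<lambda>v. w (\<sigma> v)) \<and> (\<forall>e. Lp_loc_on p W (\<lambda>v. \<omega> (\<sigma> v) (dpar S c v e)))"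
    if L: "lifted_chart S c W \<sigma>" for c W \<sigma>
  proof -
    note D = lifted_chartD[OF L]
    have wdW: "weak_deriv_on W (\<lambda>v. w' (\<sigma> v)) (\<lambda>v e. \<omega>' (\<sigma> v) (dpar S c v e))"
      using wd L unfolding weak_differential_def by blast
    have L1: "Lp_loc_on p W (\<lambda>v. w' (\<sigma> v))" and L2: "Lp_loc_on p W (\<lambda>v. \<omega>' (\<sigma> v) (dpar S c v e))" for e
      using Lp[OF L] by blast+
    have "Lp_loc_on p W (\<lambda>v. w (\<sigma> v))"
      by (rule Lp_loc_on_linear[OF L1 p T w[OF D(6)] weak_deriv_on_integrable(1)[OF wdW]])
    moreover have "Lp_loc_on p W (\<lambda>v. \<omega> (\<sigma> v) (dpar S c v e))" for e
      by (rule Lp_loc_on_linear[OF L2 p T _ weak_deriv_on_integrable(2)[OF wdW]]) (simp add: \<omega>_def)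
    ultimately show ?thesis by blast
  qed
  then show ?thesis
    unfolding W1p_section_def E_section_def using w_deck wd\<omega> by blast
qed

end

theorem theorem3p7:
  fixes S :: "('a::t2_space, 'b::topological_space) surface"
    and \<Gamma> :: "(real ^ ('m::finite option) ^ ('m option)) set"
    and u :: "'a \<Rightarrow> 'm mink set"
    and \<rho> :: "('b \<Rightarrow> 'b) \<Rightarrow> real ^ ('m option) ^ ('m option)"
    and w :: "'b \<Rightarrow> 'm mink"
    and p q :: real
  assumes "closed_oriented_riemannian_surface S"
    and "closed_hyperbolic_group \<Gamma>"
    and "p > 2" and "1 / p + 1 / q = 1"
    and "W1p_map p S \<Gamma> u"
    and "equivariant_lift S \<Gamma> u \<rho> w"
    and "Jp_Euler_Lagrange p S \<rho> w"
  shows "is_arg_min (J_dual q S \<rho> w (Z_form p S \<rho> w))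
           (\<lambda>\<xi>. \<xi> \<in> W1p_tangent_sections p S \<rho> w) (\<lambda>_. 0)
       \<and> weakly_D_closed p S \<rho> w (star S (S_form S w (q - 1) (Z_form p S \<rho> w)))"
proof -
  interpret hyperbolic_lift S \<Gamma> u \<rho> w
    by unfold_locales (rule assms)+
  \<comment> \<open>The assumption on \<open>u\<close> concerns some lift, so its regularity is
    carried over to \<open>w\<close> before the duality argument applies.\<close>
  have "W1p_section p S \<rho> w"
    using assms(3) by (intro W1p_section_lift[OF assms(5)]) simp
  from dual_minimum[OF this assms(3,4)] show ?thesis by blast
qed

end
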